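(* Let $\mathcal{T}$ be a locally well generated triangulated category and $\mathcal{S}\subseteq\mathcal{T}$ be a set of objects. Then $\mathcal{T}/\mathrm{Loc}\,\mathcal{S}$ is a Bousfield localization; that is, there is a localization functor $L:\mathcal{T}\to\mathcal{T}$ such that $\mathrm{Ker}\,L=\mathrm{Loc}\,\mathcal{S}$. In particular, we have $$\mathrm{Im}\,L=\{X\in\mathcal{T}\mid \mathcal{T}(Y,X)=0\text{ for each }Y\in\mathcal{S}\},$$ there is a canonical triangle equivalence between $\mathcal{T}/\mathrm{Loc}\,\mathcal{S}$ and $\mathrm{Im}\,L$ given by the composition $$\mathrm{Im}\,L\xrightarrow{\ \subseteq\ }\mathcal{T}\xrightarrow{\ Q\ }\mathcal{T}/\mathrm{Loc}\,\mathcal{S},$$ and all morphism spaces in $\mathcal{T}/\mathrm{Loc}\,\mathcal{S}$ are sets.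
   Context: Triangulated categories $\mathcal{T}$ here have arbitrary (set-indexed) coproducts; $\mathcal{T}(Y,X)$ denotes the morphisms from $Y$ to $X$ in $\mathcal{T}$. One works in ZFC with the axiom of choice for proper classes. A localizing subcategory of $\mathcal{T}$ is a full triangulated subcategory closed under forming coproducts; for a class $\mathcal{S}$ of objects, $\mathrm{Loc}\,\mathcal{S}$ is the smallest localizing subcategory of $\mathcal{T}$ containing $\mathcal{S}$. For a localizing subcategory $\mathcal{L}\subseteq\mathcal{T}$, the Verdier quotient $\mathcal{T}/\mathcal{L}$ is obtained by formally inverting all morphisms $f$ that fit into a triangle $X\xrightarrow{f}Y\to Z\to X[1]$ in $\mathcal{T}$ with $Z\in\mathcal{L}$, and $Q:\mathcal{T}\to\mathcal{T}/\mathcal{L}$ is the canonical localization functor (here with $\mathcal{L}=\mathrm{Loc}\,\mathcal{S}$); a priori the morphism spaces of $\mathcal{T}/\mathcal{L}$ may be proper classes. A localization functor is an exact endofunctor $L:\mathcal{T}\to\mathcal{T}$ for which there exists a natural transformation $\eta:\mathrm{Id}_{\mathcal{T}}\to L$ such that $L\eta_X=\eta_{LX}$ and $\eta_{LX}:LX\to L^2X$ is an isomorphism for each $X\in\mathcal{T}$. $\mathrm{Ker}\,L$ is the full subcategory $\{X\in\mathcal{T}\mid LX=0\}$, and $\mathrm{Im}\,L$ is the essential image of $L$. For a regular cardinal $\kappa$, an object $Y$ of a category with arbitrary coproducts is $\kappa$-small if every morphism $Y\to\coprod_{i\in I}X_i$ factorizes through a subcoproduct $\coprod_{i\in J}X_i$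 with $|J|<\kappa$. A triangulated category $\mathcal{T}$ with arbitrary coproducts is $\kappa$-well generated if there is a set $\mathcal{G}$ of objects of $\mathcal{T}$ such that: (1) if $X\in\mathcal{T}$ satisfies $\mathcal{T}(Y,X)=0$ for each $Y\in\mathcal{G}$, then $X=0$; (2) each $Y\in\mathcal{G}$ is $\kappa$-small; (3) for any morphism $f:Y\to\coprod_{i\in I}X_i$ in $\mathcal{T}$ with $Y\in\mathcal{G}$ there is a family of morphisms $f_i:Y_i\to X_i$ such that $Y_i\in\mathcal{G}$ for each $i\in I$ and $f$ factorizes as $Y\to\coprod_{i\in I}Y_i\xrightarrow{\coprod f_i}\coprod_{i\in I}X_i$. $\mathcal{T}$ is well generated if it is $\kappa$-well generated for some regular cardinal $\kappa$. A triangulated category $\mathcal{T}$ with arbitrary coproducts is locally well generated if $\mathrm{Loc}\,\mathcal{C}$ is well generated for every set $\mathcal{C}$ of objects of $\mathcal{T}$.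
   Formalization: The description of Im L is corrected to those X with T(Y[n],X)=0 for each Y in S and every integer n; with n=0 only it fails, e.g. T=D(k), S={k}, where Im L=0 but T(k,k[1])=0. If S is closed under shifts, the two descriptions agree. *)

theory Defs
  imports "HOL-Algebra.Group"
begin

unbundle cardinal_syntax

section \<open>Sets versus proper classes\<close>

text \<open>
  HOL has no distinction between sets and proper classes.  We fix a regular uncountable cardinal
  \<open>\<Lambda>\<close>, the size of the universe, and read ``set'' as ``of cardinality less than \<open>\<Lambda>\<close>''.  For
  \<open>\<Lambda>\<close> the cardinality of a Grothendieck universe (an inaccessible cardinal) this is the usual
  notion; that \<open>\<Lambda>\<close> is a strong limit is not required.  Up to bijection every small
  set is a set of elements of the type underlying \<open>\<Lambda>\<close>, so this type provides all the index sets
  of families and all the small cardinals that are needed.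
\<close>

definition regular_cardinal :: "'u rel \<Rightarrow> bool" where
  "regular_cardinal \<kappa> \<longleftrightarrow> Card_order \<kappa> \<and> infinite (Field \<kappa>) \<and> regularCard \<kappa>"

definition universe :: "'u rel \<Rightarrow> bool" where
  "universe \<Lambda> \<longleftrightarrow> regular_cardinal \<Lambda> \<and> natLeq <o \<Lambda>"

definition small :: "'u rel \<Rightarrow> 'a set \<Rightarrow> bool" where
  "small \<Lambda> A \<longleftrightarrow> |A| <o \<Lambda>"


section \<open>Categories and functors\<close>

text \<open>Composition is written in the order of functions: \<open>Cmp C g f\<close> is \<open>g\<close> after \<open>f\<close>.\<close>

record ('o, 'm) cat =
  Obj :: "'o set"
  Arr :: "'m set"
  Dom :: "'m \<Rightarrow> 'o"
  Cod :: "'m \<Rightarrow> 'o"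
  Idn :: "'o \<Rightarrow> 'm"
  Cmp :: "'m \<Rightarrow> 'm \<Rightarrow> 'm"  (infixl \<open>\<cdot>\<index>\<close> 70)

definition Hom :: "('o, 'm, 'z) cat_scheme \<Rightarrow> 'o \<Rightarrow> 'o \<Rightarrow> 'm set" where
  "Hom C X Y = {f \<in> Arr C. Dom C f = X \<and> Cod C f = Y}"

locale category =
  fixes C :: "('o, 'm, 'z) cat_scheme" (structure)
  assumes Dom_in_Obj: "f \<in> Arr C \<Longrightarrow> Dom C f \<in> Obj C"
    and Cod_in_Obj: "f \<in> Arr C \<Longrightarrow> Cod C f \<in> Obj C"
    and Idn_in_Hom: "X \<in> Obj C \<Longrightarrow> Idn C X \<in> Hom C X X"
    and Cmp_in_Hom: "f \<in> Hom C X Y \<Longrightarrow> g \<in> Hom C Y Z \<Longrightarrow> g \<cdot> f \<in> Hom C X Z"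
    and Cmp_Idn: "f \<in> Hom C X Y \<Longrightarrow> f \<cdot> Idn C X = f"
    and Idn_Cmp: "f \<in> Hom C X Y \<Longrightarrow> Idn C Y \<cdot> f = f"
    and Cmp_assoc: "f \<in> Hom C W X \<Longrightarrow> g \<in> Hom C X Y \<Longrightarrow> h \<in> Hom C Y Z \<Longrightarrow>
      (h \<cdot> g) \<cdot> f = h \<cdot> (g \<cdot> f)"

definition locally_small :: "'u rel \<Rightarrow> ('o, 'm, 'z) cat_scheme \<Rightarrow> bool" where
  "locally_small \<Lambda> C \<longleftrightarrow> (\<forall>X\<in>Obj C. \<forall>Y\<in>Obj C. small \<Lambda> (Hom C X Y))"

definition is_iso :: "('o, 'm, 'z) cat_scheme \<Rightarrow> 'o \<Rightarrow> 'o \<Rightarrow> 'm \<Rightarrow> bool" where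
  "is_iso C X Y f \<longleftrightarrow> f \<in> Hom C X Y \<and>
     (\<exists>g\<in>Hom C Y X. Cmp C g f = Idn C X \<and> Cmp C f g = Idn C Y)"

definition isomorphic :: "('o, 'm, 'z) cat_scheme \<Rightarrow> 'o \<Rightarrow> 'o \<Rightarrow> bool" where
  "isomorphic C X Y \<longleftrightarrow> (\<exists>f. is_iso C X Y f)"

definition is_zero :: "('o, 'm, 'z) cat_scheme \<Rightarrow> 'o \<Rightarrow> bool" where
  "is_zero C Z \<longleftrightarrow> Z \<in> Obj C \<and>
     (\<forall>X\<in>Obj C. (\<exists>!f. f \<in> Hom C Z X) \<and> (\<exists>!f. f \<in> Hom C X Z))"

definition is_coproduct ::
  "('o, 'm, 'z) cat_scheme \<Rightarrow> 'i set \<Rightarrow> ('i \<Rightarrow> 'o) \<Rightarrow> 'o \<Rightarrow> ('i \<Rightarrow> 'm) \<Rightarrow> bool" where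
  "is_coproduct C I X P \<iota> \<longleftrightarrow>
     P \<in> Obj C \<and> (\<forall>i\<in>I. X i \<in> Obj C \<and> \<iota> i \<in> Hom C (X i) P) \<and>
     (\<forall>Y\<in>Obj C. \<forall>f. (\<forall>i\<in>I. f i \<in> Hom C (X i) Y) \<longrightarrow>
        (\<exists>!g. g \<in> Hom C P Y \<and> (\<forall>i\<in>I. Cmp C g (\<iota> i) = f i)))"

definition has_small_coproducts :: "'u rel \<Rightarrow> ('o, 'm, 'z) cat_scheme \<Rightarrow> bool" where
  "has_small_coproducts \<Lambda> C \<longleftrightarrow>
     (\<forall>(I :: 'u set) X. small \<Lambda> I \<and> X ` I \<subseteq> Obj C \<longrightarrow> (\<exists>P \<iota>. is_coproduct C I X P \<iota>))"

record ('o, 'm, 'p, 'n) functr =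
  OMap :: "'o \<Rightarrow> 'p"
  AMap :: "'m \<Rightarrow> 'n"

definition is_functor ::
  "('o, 'm, 'y) cat_scheme \<Rightarrow> ('p, 'n, 'z) cat_scheme \<Rightarrow> ('o, 'm, 'p, 'n) functr \<Rightarrow> bool" where
  "is_functor C D F \<longleftrightarrow> category C \<and> category D \<and>
     (\<forall>X\<in>Obj C. OMap F X \<in> Obj D \<and> AMap F (Idn C X) = Idn D (OMap F X)) \<and>
     (\<forall>f\<in>Arr C. AMap F f \<in> Hom D (OMap F (Dom C f)) (OMap F (Cod C f))) \<and>
     (\<forall>f\<in>Arr C. \<forall>g\<in>Arr C. Cod C f = Dom C g \<longrightarrow>
        AMap F (Cmp C g f) = Cmp D (AMap F g) (AMap F f))"

definition id_functor :: "('o, 'm, 'o, 'm) functr" where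
  "id_functor = \<lparr>OMap = (\<lambda>X. X), AMap = (\<lambda>f. f)\<rparr>"

text \<open>The inclusion of a full subcategory acts identically on objects and morphisms.\<close>

abbreviation inclusion_functor :: "('o, 'm, 'o, 'm) functr" where
  "inclusion_functor \<equiv> id_functor"

definition comp_functor ::
  "('p, 'n, 'q, 'k) functr \<Rightarrow> ('o, 'm, 'p, 'n) functr \<Rightarrow> ('o, 'm, 'q, 'k) functr" where
  "comp_functor G F = \<lparr>OMap = OMap G \<circ> OMap F, AMap = AMap G \<circ> AMap F\<rparr>"

definition nat_trans ::
  "('o, 'm, 'y) cat_scheme \<Rightarrow> ('p, 'n, 'z) cat_scheme \<Rightarrow> ('o, 'm, 'p, 'n) functr \<Rightarrow>
   ('o, 'm, 'p, 'n) functr \<Rightarrow> ('o \<Rightarrow> 'n) \<Rightarrow> bool" where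
  "nat_trans C D F G \<eta> \<longleftrightarrow>
     (\<forall>X\<in>Obj C. \<eta> X \<in> Hom D (OMap F X) (OMap G X)) \<and>
     (\<forall>f\<in>Arr C. Cmp D (\<eta> (Cod C f)) (AMap F f) = Cmp D (AMap G f) (\<eta> (Dom C f)))"

definition nat_iso ::
  "('o, 'm, 'y) cat_scheme \<Rightarrow> ('p, 'n, 'z) cat_scheme \<Rightarrow> ('o, 'm, 'p, 'n) functr \<Rightarrow>
   ('o, 'm, 'p, 'n) functr \<Rightarrow> ('o \<Rightarrow> 'n) \<Rightarrow> bool" where
  "nat_iso C D F G \<eta> \<longleftrightarrow> nat_trans C D F G \<eta> \<and>
     (\<forall>X\<in>Obj C. is_iso D (OMap F X) (OMap G X) (\<eta> X))"

definition is_equivalence ::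
  "('o, 'm, 'y) cat_scheme \<Rightarrow> ('p, 'n, 'z) cat_scheme \<Rightarrow> ('o, 'm, 'p, 'n) functr \<Rightarrow> bool" where
  "is_equivalence C D F \<longleftrightarrow> is_functor C D F \<and>
     (\<exists>G. is_functor D C G \<and>
        (\<exists>\<alpha>. nat_iso C C id_functor (comp_functor G F) \<alpha>) \<and>
        (\<exists>\<beta>. nat_iso D D (comp_functor F G) id_functor \<beta>))"

definition essential_image ::
  "('o, 'm, 'y) cat_scheme \<Rightarrow> ('p, 'n, 'z) cat_scheme \<Rightarrow> ('o, 'm, 'p, 'n) functr \<Rightarrow> 'p set" where
  "essential_image C D F = {Y \<in> Obj D. \<exists>X\<in>Obj C. isomorphic D Y (OMap F X)}"


section \<open>Triangulated categories\<close>

text \<open>A triangle is the triple of its three morphisms.\<close>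

record ('o, 'm) tri_cat = "('o, 'm) cat" +
  Zer :: "'o \<Rightarrow> 'o \<Rightarrow> 'm"
  Plus :: "'m \<Rightarrow> 'm \<Rightarrow> 'm"
  Shift :: "('o, 'm, 'o, 'm) functr"
  Tri :: "('m \<times> 'm \<times> 'm) set"

definition hom_group :: "('o, 'm) tri_cat \<Rightarrow> 'o \<Rightarrow> 'o \<Rightarrow> 'm monoid" where
  "hom_group C X Y = \<lparr>carrier = Hom C X Y, mult = Plus C, one = Zer C X Y\<rparr>"

definition neg :: "('o, 'm) tri_cat \<Rightarrow> 'm \<Rightarrow> 'm" where
  "neg C f = inv\<^bsub>hom_group C (Dom C f) (Cod C f)\<^esub> f"

locale additive_category = category C
  for C :: "('o, 'm) tri_cat" (structure) +
  assumes hom_comm_group: "X \<in> Obj C \<Longrightarrow> Y \<in> Obj C \<Longrightarrow> comm_group (hom_group C X Y)"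
    and Cmp_Plus: "f \<in> Hom C X Y \<Longrightarrow> f' \<in> Hom C X Y \<Longrightarrow> g \<in> Hom C Y Z \<Longrightarrow>
      g \<cdot> Plus C f f' = Plus C (g \<cdot> f) (g \<cdot> f')"
    and Plus_Cmp: "f \<in> Hom C X Y \<Longrightarrow> g \<in> Hom C Y Z \<Longrightarrow> g' \<in> Hom C Y Z \<Longrightarrow>
      Plus C g g' \<cdot> f = Plus C (g \<cdot> f) (g' \<cdot> f)"
    and ex_zero: "\<exists>Z. is_zero C Z"
    and ex_binary_coproduct: "range V \<subseteq> Obj C \<Longrightarrow> \<exists>P \<iota>. is_coproduct C (UNIV :: bool set) V P \<iota>"

definition is_additive ::
  "('o, 'm) tri_cat \<Rightarrow> ('p, 'n) tri_cat \<Rightarrow> ('o, 'm, 'p, 'n) functr \<Rightarrow> bool" where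
  "is_additive C D F \<longleftrightarrow> is_functor C D F \<and>
     (\<forall>X\<in>Obj C. \<forall>Y\<in>Obj C. \<forall>f\<in>Hom C X Y. \<forall>g\<in>Hom C X Y.
        AMap F (Plus C f g) = Plus D (AMap F f) (AMap F g))"

definition triangle_shape ::
  "('o, 'm, 'z) cat_scheme \<Rightarrow> ('o, 'm, 'o, 'm) functr \<Rightarrow> 'm \<times> 'm \<times> 'm \<Rightarrow> bool" where
  "triangle_shape C \<Sigma> = (\<lambda>(f, g, h). f \<in> Arr C \<and> g \<in> Arr C \<and> h \<in> Arr C \<and>
     Cod C f = Dom C g \<and> Cod C g = Dom C h \<and> Cod C h = OMap \<Sigma> (Dom C f))"

definition triangle_iso ::
  "('o, 'm, 'z) cat_scheme \<Rightarrow> ('o, 'm, 'o, 'm) functr \<Rightarrow>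
   'm \<times> 'm \<times> 'm \<Rightarrow> 'm \<times> 'm \<times> 'm \<Rightarrow> bool" where
  "triangle_iso C \<Sigma> = (\<lambda>(f, g, h) (f', g', h').
     triangle_shape C \<Sigma> (f, g, h) \<and> triangle_shape C \<Sigma> (f', g', h') \<and>
     (\<exists>a b c. is_iso C (Dom C f) (Dom C f') a \<and> is_iso C (Dom C g) (Dom C g') b \<and>
        is_iso C (Dom C h) (Dom C h') c \<and>
        Cmp C b f = Cmp C f' a \<and> Cmp C c g = Cmp C g' b \<and>
        Cmp C (AMap \<Sigma> a) h = Cmp C h' c))"

text \<open>
  Verdier's axioms.  As in his definition (and Neeman's) the shift is an automorphism, not merely
  an autoequivalence.
\<close>

locale triangulated_category = additive_category C
  for C :: "('o, 'm) tri_cat" (structure) +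
  assumes shift_additive: "is_additive C C (Shift C)"
    and shift_bij_Obj: "bij_betw (OMap (Shift C)) (Obj C) (Obj C)"
    and shift_bij_Arr: "bij_betw (AMap (Shift C)) (Arr C) (Arr C)"
    and Tri_shape: "t \<in> Tri C \<Longrightarrow> triangle_shape C (Shift C) t"
    and Tri_iso: "t \<in> Tri C \<Longrightarrow> triangle_iso C (Shift C) t t' \<Longrightarrow> t' \<in> Tri C"
    and Tri_id: "X \<in> Obj C \<Longrightarrow> is_zero C Z \<Longrightarrow>
      (Idn C X, Zer C X Z, Zer C Z (OMap (Shift C) X)) \<in> Tri C"
    and Tri_complete: "f \<in> Arr C \<Longrightarrow> \<exists>g h. (f, g, h) \<in> Tri C"
    and Tri_rotate: "triangle_shape C (Shift C) (f, g, h) \<Longrightarrow>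
      (f, g, h) \<in> Tri C \<longleftrightarrow> (g, h, neg C (AMap (Shift C) f)) \<in> Tri C"
    and Tri_morphism: "(f, g, h) \<in> Tri C \<Longrightarrow> (f', g', h') \<in> Tri C \<Longrightarrow>
      a \<in> Hom C (Dom C f) (Dom C f') \<Longrightarrow> b \<in> Hom C (Dom C g) (Dom C g') \<Longrightarrow>
      b \<cdot> f = f' \<cdot> a \<Longrightarrow>
      \<exists>c\<in>Hom C (Dom C h) (Dom C h'). c \<cdot> g = g' \<cdot> b \<and> AMap (Shift C) a \<cdot> h = h' \<cdot> c"
    and Tri_octahedral: "Cod C f = Dom C g \<Longrightarrow>
      (f, i, j) \<in> Tri C \<Longrightarrow> (g, k, l) \<in> Tri C \<Longrightarrow> (g \<cdot> f, m, n) \<in> Tri C \<Longrightarrow>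
      \<exists>u v. (u, v, AMap (Shift C) i \<cdot> l) \<in> Tri C \<and>
        u \<in> Hom C (Cod C i) (Cod C m) \<and> v \<in> Hom C (Cod C m) (Cod C k) \<and>
        u \<cdot> i = m \<cdot> g \<and> n \<cdot> u = j \<and> v \<cdot> m = k \<and> l \<cdot> v = AMap (Shift C) f \<cdot> n"

text \<open>
  \<open>shift_power C n X\<close> is \<open>X[n]\<close>.  The objects right orthogonal to \<open>Loc S\<close> are those receiving no nonzero
  morphism from any \<open>Y[n]\<close> with \<open>Y\<close> in \<open>S\<close>; for \<open>S\<close> not closed under shifts, \<open>n = 0\<close> alone does not suffice
  (take \<open>S\<close> to be the field \<open>k\<close> in \<open>D(k)\<close>).
\<close>

definition shift_power :: "('o, 'm) tri_cat \<Rightarrow> int \<Rightarrow> 'o \<Rightarrow> 'o" where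
  "shift_power C n X =
     (if n \<ge> 0 then (OMap (Shift C) ^^ nat n) X
      else (inv_into (Obj C) (OMap (Shift C)) ^^ nat (- n)) X)"

text \<open>
  An exact functor comes with a natural isomorphism \<open>\<phi>\<close> from \<open>F(X[1])\<close> to \<open>(F X)[1]\<close>.
\<close>

definition exact_functor ::
  "('o, 'm) tri_cat \<Rightarrow> ('p, 'n) tri_cat \<Rightarrow> ('o, 'm, 'p, 'n) functr \<Rightarrow> ('o \<Rightarrow> 'n) \<Rightarrow> bool" where
  "exact_functor C D F \<phi> \<longleftrightarrow>
     triangulated_category C \<and> triangulated_category D \<and> is_additive C D F \<and>
     nat_iso C D (comp_functor F (Shift C)) (comp_functor (Shift D) F) \<phi> \<and>
     (\<forall>(f, g, h) \<in> Tri C.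
        (AMap F f, AMap F g, Cmp D (\<phi> (Dom C f)) (AMap F h)) \<in> Tri D)"

definition triangle_equivalence ::
  "('o, 'm) tri_cat \<Rightarrow> ('p, 'n) tri_cat \<Rightarrow> ('o, 'm, 'p, 'n) functr \<Rightarrow> ('o \<Rightarrow> 'n) \<Rightarrow> bool" where
  "triangle_equivalence C D F \<phi> \<longleftrightarrow> exact_functor C D F \<phi> \<and> is_equivalence C D F"

definition full_subcategory :: "('o, 'm) tri_cat \<Rightarrow> 'o set \<Rightarrow> ('o, 'm) tri_cat" where
  "full_subcategory C A = C\<lparr>
     Obj := A,
     Arr := {f \<in> Arr C. Dom C f \<in> A \<and> Cod C f \<in> A},
     Tri := {(f, g, h) \<in> Tri C. Dom C f \<in> A \<and> Dom C g \<in> A \<and> Dom C h \<in> A}\<rparr>"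


section \<open>Localizing subcategories and Verdier quotients\<close>

text \<open>Full subcategories are given by their sets of objects; triangulated ones are replete.\<close>

definition triangulated_subcategory :: "('o, 'm) tri_cat \<Rightarrow> 'o set \<Rightarrow> bool" where
  "triangulated_subcategory C A \<longleftrightarrow> A \<subseteq> Obj C \<and>
     (\<forall>Z. is_zero C Z \<longrightarrow> Z \<in> A) \<and>
     (\<forall>X\<in>A. \<forall>Y. isomorphic C X Y \<longrightarrow> Y \<in> A) \<and>
     OMap (Shift C) ` A = A \<and>
     (\<forall>(f, g, h) \<in> Tri C. Dom C f \<in> A \<and> Dom C g \<in> A \<longrightarrow> Dom C h \<in> A)"

definition localizing :: "'u rel \<Rightarrow> ('o, 'm) tri_cat \<Rightarrow> 'o set \<Rightarrow> bool" where
  "localizing \<Lambda> C A \<longleftrightarrow> triangulated_subcategory C A \<and>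
     (\<forall>(I :: 'u set) X P \<iota>. small \<Lambda> I \<and> X ` I \<subseteq> A \<and> is_coproduct C I X P \<iota> \<longrightarrow> P \<in> A)"

definition Loc :: "'u rel \<Rightarrow> ('o, 'm) tri_cat \<Rightarrow> 'o set \<Rightarrow> 'o set" where
  "Loc \<Lambda> C S = \<Inter> {A. localizing \<Lambda> C A \<and> S \<subseteq> A}"

definition cone_in :: "('o, 'm) tri_cat \<Rightarrow> 'o set \<Rightarrow> 'm set" where
  "cone_in C A = {f. \<exists>g h. (f, g, h) \<in> Tri C \<and> Cod C g \<in> A}"

text \<open>
  The category \<open>C[W\<^sup>-\<^sup>1]\<close> obtained by formally inverting the morphisms in \<open>W\<close> (Gabriel--Zisman):
  morphisms are zigzags modulo the least congruence making \<open>Fwd\<close> functorial and \<open>Bwd s\<close> inverse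
  to \<open>Fwd s\<close> for \<open>s \<in> W\<close>.  Zigzags are read in diagrammatic order, from the source to the
  target.
\<close>

datatype 'm step = Fwd 'm | Bwd 'm

inductive zigzag ::
  "('o, 'm, 'z) cat_scheme \<Rightarrow> 'm set \<Rightarrow> 'o \<Rightarrow> 'm step list \<Rightarrow> 'o \<Rightarrow> bool"
  for C W where
  zigzag_Nil: "X \<in> Obj C \<Longrightarrow> zigzag C W X [] X"
| zigzag_Fwd: "f \<in> Arr C \<Longrightarrow> zigzag C W (Cod C f) p Y \<Longrightarrow> zigzag C W (Dom C f) (Fwd f # p) Y"
| zigzag_Bwd: "s \<in> W \<Longrightarrow> zigzag C W (Dom C s) p Y \<Longrightarrow> zigzag C W (Cod C s) (Bwd s # p) Y"

inductive zigzag_eq ::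
  "('o, 'm, 'z) cat_scheme \<Rightarrow> 'm set \<Rightarrow> 'o \<Rightarrow> 'o \<Rightarrow> 'm step list \<Rightarrow> 'm step list \<Rightarrow> bool"
  for C W where
  zeq_refl: "zigzag C W X p Y \<Longrightarrow> zigzag_eq C W X Y p p"
| zeq_sym: "zigzag_eq C W X Y p q \<Longrightarrow> zigzag_eq C W X Y q p"
| zeq_trans: "zigzag_eq C W X Y p q \<Longrightarrow> zigzag_eq C W X Y q r \<Longrightarrow> zigzag_eq C W X Y p r"
| zeq_context: "zigzag C W X' a X \<Longrightarrow> zigzag_eq C W X Y p q \<Longrightarrow> zigzag C W Y b Y' \<Longrightarrow>
    zigzag_eq C W X' Y' (a @ p @ b) (a @ q @ b)"
| zeq_Idn: "X \<in> Obj C \<Longrightarrow> zigzag_eq C W X X [Fwd (Idn C X)] []"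
| zeq_Cmp: "f \<in> Hom C X Y \<Longrightarrow> g \<in> Hom C Y Z \<Longrightarrow>
    zigzag_eq C W X Z [Fwd f, Fwd g] [Fwd (Cmp C g f)]"
| zeq_Fwd_Bwd: "s \<in> W \<Longrightarrow> zigzag_eq C W (Dom C s) (Dom C s) [Fwd s, Bwd s] []"
| zeq_Bwd_Fwd: "s \<in> W \<Longrightarrow> zigzag_eq C W (Cod C s) (Cod C s) [Bwd s, Fwd s] []"

type_synonym ('o, 'm) frac = "'o \<times> 'o \<times> 'm step list set"

definition frac_class ::
  "('o, 'm, 'z) cat_scheme \<Rightarrow> 'm set \<Rightarrow> 'o \<Rightarrow> 'o \<Rightarrow> 'm step list \<Rightarrow> ('o, 'm) frac" where
  "frac_class C W X Y p = (X, Y, {q. zigzag_eq C W X Y p q})"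

definition localization :: "('o, 'm, 'z) cat_scheme \<Rightarrow> 'm set \<Rightarrow> ('o, ('o, 'm) frac) cat" where
  "localization C W = \<lparr>
     Obj = Obj C,
     Arr = {frac_class C W X Y p | X Y p. zigzag C W X p Y},
     Dom = (\<lambda>(X, Y, A). X),
     Cod = (\<lambda>(X, Y, A). Y),
     Idn = (\<lambda>X. frac_class C W X X []),
     Cmp = (\<lambda>(Y', Z, B) (X, Y, A). (X, Z, {r. \<exists>p\<in>A. \<exists>q\<in>B. zigzag_eq C W X Z (p @ q) r}))\<rparr>"

definition localization_map ::
  "('o, 'm, 'z) cat_scheme \<Rightarrow> 'm set \<Rightarrow> ('o, 'm, 'o, ('o, 'm) frac) functr" where
  "localization_map C W =
     \<lparr>OMap = (\<lambda>X. X), AMap = (\<lambda>f. frac_class C W (Dom C f) (Cod C f) [Fwd f])\<rparr>"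

text \<open>
  The Verdier quotient \<open>C/A\<close>.  Sums of morphisms are formed over a common denominator, \<open>f/s + g/s =
  (f + g)/s\<close>, and the triangles are the triples isomorphic to images of triangles of \<open>C\<close>.
\<close>

definition frac_shift ::
  "('o, 'm) tri_cat \<Rightarrow> 'm set \<Rightarrow> ('o, ('o, 'm) frac, 'o, ('o, 'm) frac) functr" where
  "frac_shift C W = \<lparr>
     OMap = OMap (Shift C),
     AMap = (\<lambda>(X, Y, A). let X' = OMap (Shift C) X; Y' = OMap (Shift C) Y in
       (X', Y', {r. \<exists>p\<in>A. zigzag_eq C W X' Y' (map (map_step (AMap (Shift C))) p) r}))\<rparr>"

definition verdier_quotient ::
  "('o, 'm) tri_cat \<Rightarrow> 'o set \<Rightarrow> ('o, ('o, 'm) frac) tri_cat" where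
  "verdier_quotient C A = (let W = cone_in C A; D = localization C W; Q = localization_map C W in
     \<lparr>Obj = Obj D, Arr = Arr D, Dom = Dom D, Cod = Cod D, Idn = Idn D, Cmp = Cmp D,
      Zer = (\<lambda>X Y. frac_class C W X Y [Fwd (Zer C X Y)]),
      Plus = (\<lambda>(X, Y, M) (X', Y', N). (X, Y, {r. \<exists>s f g.
         [Bwd s, Fwd f] \<in> M \<and> [Bwd s, Fwd g] \<in> N \<and>
         zigzag_eq C W X Y [Bwd s, Fwd (Plus C f g)] r})),
      Shift = frac_shift C W,
      Tri = {t. \<exists>(f, g, h) \<in> Tri C.
         triangle_iso D (frac_shift C W) (AMap Q f, AMap Q g, AMap Q h) t}\<rparr>)"

definition verdier_functor ::
  "('o, 'm) tri_cat \<Rightarrow> 'o set \<Rightarrow> ('o, 'm, 'o, ('o, 'm) frac) functr" where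
  "verdier_functor C A = localization_map C (cone_in C A)"


section \<open>Localization functors\<close>

definition localization_functor :: "('o, 'm) tri_cat \<Rightarrow> ('o, 'm, 'o, 'm) functr \<Rightarrow> bool" where
  "localization_functor C L \<longleftrightarrow> (\<exists>\<phi>. exact_functor C C L \<phi>) \<and>
     (\<exists>\<eta>. nat_trans C C id_functor L \<eta> \<and>
        (\<forall>X\<in>Obj C. AMap L (\<eta> X) = \<eta> (OMap L X) \<and>
           is_iso C (OMap L X) (OMap L (OMap L X)) (\<eta> (OMap L X))))"

definition Ker :: "('o, 'm) tri_cat \<Rightarrow> ('o, 'm, 'o, 'm) functr \<Rightarrow> 'o set" where
  "Ker C L = {X \<in> Obj C. is_zero C (OMap L X)}"

abbreviation Im :: "('o, 'm) tri_cat \<Rightarrow> ('o, 'm, 'o, 'm) functr \<Rightarrow> 'o set" where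
  "Im C L \<equiv> essential_image C C L"


section \<open>Well generated triangulated categories\<close>

definition card_small :: "'u rel \<Rightarrow> 'u rel \<Rightarrow> ('o, 'm, 'z) cat_scheme \<Rightarrow> 'o \<Rightarrow> bool" where
  "card_small \<Lambda> \<kappa> C Y \<longleftrightarrow>
     (\<forall>(I :: 'u set) X P \<iota> f. small \<Lambda> I \<and> is_coproduct C I X P \<iota> \<and> f \<in> Hom C Y P \<longrightarrow>
        (\<exists>J P' \<iota>' g h. J \<subseteq> I \<and> |J| <o \<kappa> \<and> is_coproduct C J X P' \<iota>' \<and>
           h \<in> Hom C P' P \<and> (\<forall>j\<in>J. Cmp C h (\<iota>' j) = \<iota> j) \<and>
           g \<in> Hom C Y P' \<and> f = Cmp C h g))"

text \<open>Morphism sets of \<open>T\<close> are sets, and \<open>T\<close> has coproducts indexed by arbitrary sets.\<close>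

definition coproduct_triangulated :: "'u rel \<Rightarrow> ('o, 'm) tri_cat \<Rightarrow> bool" where
  "coproduct_triangulated \<Lambda> T \<longleftrightarrow>
     triangulated_category T \<and> locally_small \<Lambda> T \<and> has_small_coproducts \<Lambda> T"

definition card_well_generated :: "'u rel \<Rightarrow> 'u rel \<Rightarrow> ('o, 'm) tri_cat \<Rightarrow> bool" where
  "card_well_generated \<Lambda> \<kappa> T \<longleftrightarrow> coproduct_triangulated \<Lambda> T \<and>
     (\<exists>G. small \<Lambda> G \<and> G \<subseteq> Obj T \<and>
        (\<forall>X\<in>Obj T. (\<forall>Y\<in>G. Hom T Y X = {Zer T Y X}) \<longrightarrow> is_zero T X) \<and>
        (\<forall>Y\<in>G. card_small \<Lambda> \<kappa> T Y) \<and>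
        (\<forall>Y\<in>G. \<forall>(I :: 'u set) X P \<iota> f.
           small \<Lambda> I \<and> is_coproduct T I X P \<iota> \<and> f \<in> Hom T Y P \<longrightarrow>
           (\<exists>Y' f' P' \<iota>' g h.
              (\<forall>i\<in>I. Y' i \<in> G \<and> f' i \<in> Hom T (Y' i) (X i)) \<and> is_coproduct T I Y' P' \<iota>' \<and>
              h \<in> Hom T P' P \<and> (\<forall>i\<in>I. Cmp T h (\<iota>' i) = Cmp T (\<iota> i) (f' i)) \<and>
              g \<in> Hom T Y P' \<and> f = Cmp T h g)))"

definition well_generated :: "'u rel \<Rightarrow> ('o, 'm) tri_cat \<Rightarrow> bool" where
  "well_generated \<Lambda> T \<longleftrightarrow>
     (\<exists>\<kappa> :: 'u rel. regular_cardinal \<kappa> \<and> \<kappa> <o \<Lambda> \<and> card_well_generated \<Lambda> \<kappa> T)"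

definition locally_well_generated :: "'u rel \<Rightarrow> ('o, 'm) tri_cat \<Rightarrow> bool" where
  "locally_well_generated \<Lambda> T \<longleftrightarrow> coproduct_triangulated \<Lambda> T \<and>
     (\<forall>S. small \<Lambda> S \<and> S \<subseteq> Obj T \<longrightarrow> well_generated \<Lambda> (full_subcategory T (Loc \<Lambda> T S)))"

end

theory Submission
  imports Defs
begin

text \<open>
  Write \<open>A = Loc S\<close> and let \<open>G\<close> be a set of generators of \<open>A\<close> as in the definition of well generated
  categories, closed under shifts.  For an object \<open>X\<close> one builds, following Krause's proof of Brown
  representability, a tower \<open>\<Gamma>\<^sub>0 \<rightarrow> \<Gamma>\<^sub>1 \<rightarrow> \<dots>\<close> over \<open>X\<close>: \<open>\<Gamma>\<^sub>0\<close> is the coproduct of the sources of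
  all morphisms from \<open>G\<close> to \<open>X\<close>, and \<open>\<Gamma>\<^sub>n\<^sub>+\<^sub>1\<close> is the cone that kills all morphisms from \<open>G\<close> to \<open>\<Gamma>\<^sub>n\<close>
  vanishing in \<open>X\<close>.  Condition (3) of well generation makes countable coproducts of morphisms exact
  enough to show that \<open>G\<close> sees no difference between the homotopy colimit \<open>\<Gamma>\<close> and \<open>X\<close>.  The cone
  of \<open>\<Gamma> \<rightarrow> X\<close> is then right orthogonal to \<open>G\<close>.  Applied to \<open>X\<close> in \<open>A\<close> this gives \<open>Loc G = A\<close>, and for general \<open>X\<close> it gives the triangle \<open>\<Gamma> \<rightarrow> X \<rightarrow> L X \<rightarrow>\<close>
  defining \<open>L\<close>.  In the quotient every object \<open>X\<close> becomes isomorphic to \<open>L X\<close>, so that morphisms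
  \<open>X \<rightarrow> Y\<close> of \<open>T/A\<close> correspond to morphisms \<open>L X \<rightarrow> L Y\<close> of \<open>T\<close>; all of its structure is transported
  along this bijection.
\<close>

section \<open>Categories and coproducts\<close>

text \<open>Condition (3) of well generation concerns families inside \<open>A\<close> only, while
  \<open>X\<close> is arbitrary. The tower gets round this because its stages are built from
  \<open>G\<close> and so stay in \<open>Loc G\<close>; \<open>X\<close> enters only as the target
  of morphisms. The delicate point is that \<open>1 - s\<close>, whose cone is the homotopy colimit,
  must be injective on morphisms from \<open>G\<close>. Since \<open>Hom(Y, -)\<close> need not
  commute with coproducts, condition (3) is used to move the question to a copower of
  \<open>\<Gamma>\<^sub>0\<close>, where \<open>1 - t\<close> has an explicit retraction.

  The quotient is defined by zigzags, so its morphisms, sums and triangles become accessible only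
  once \<open>L\<close> exists: evaluating a zigzag under \<open>L\<close> decides the congruence,
  and the triangulated axioms are inherited through a fully faithful functor. The conclusion speaks
  of every localization functor with kernel \<open>A\<close>; therefore the locale
  \<open>bousfield\<close> uses only functoriality and a unit with local values and cones in
  \<open>A\<close>, and derives exactness from them.\<close>

context category
begin

lemma Hom_iff: "f \<in> Hom C X Y \<longleftrightarrow> f \<in> Arr C \<and> Dom C f = X \<and> Cod C f = Y"
  by (auto simp: Hom_def)

lemma HomD:
  assumes "f \<in> Hom C X Y"
  shows "f \<in> Arr C" "Dom C f = X" "Cod C f = Y" "X \<in> Obj C" "Y \<in> Obj C"
  using assms Dom_in_Obj Cod_in_Obj by (auto simp: Hom_iff)

lemma Cmp_typing [simp]:
  assumes "f \<in> Arr C" "g \<in> Arr C" "Dom C g = Cod C f"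
  shows "g \<cdot> f \<in> Arr C" "Dom C (g \<cdot> f) = Dom C f" "Cod C (g \<cdot> f) = Cod C g"
  using Cmp_in_Hom[of f "Dom C f" "Cod C f" g "Cod C g"] assms by (auto simp: Hom_iff)

lemma Idn_typing [simp]:
  assumes "X \<in> Obj C"
  shows "Idn C X \<in> Arr C" "Dom C (Idn C X) = X" "Cod C (Idn C X) = X"
  using Idn_in_Hom[OF assms] by (auto simp: Hom_iff)

lemma Cmp_Idn_right [simp]: "f \<in> Arr C \<Longrightarrow> Dom C f = X \<Longrightarrow> f \<cdot> Idn C X = f"
  using Cmp_Idn by (auto simp: Hom_iff)

lemma Idn_Cmp_left [simp]: "f \<in> Arr C \<Longrightarrow> Cod C f = X \<Longrightarrow> Idn C X \<cdot> f = f"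
  using Idn_Cmp by (auto simp: Hom_iff)

lemma Cmp_assoc_Arr [simp]:
  "f \<in> Arr C \<Longrightarrow> g \<in> Arr C \<Longrightarrow> h \<in> Arr C \<Longrightarrow> Dom C g = Cod C f \<Longrightarrow> Dom C h = Cod C g \<Longrightarrow>
    (h \<cdot> g) \<cdot> f = h \<cdot> (g \<cdot> f)"
  by (rule Cmp_assoc[of _ "Dom C f" "Cod C f" _ "Cod C g" _ "Cod C h"]) (auto simp: Hom_iff)

text \<open>Turns an equation between composites into a rewrite rule that applies inside right-nested
  composites.\<close>

lemma Cmp_reassoc:
  "h \<cdot> g = k \<Longrightarrow> h \<in> Arr C \<Longrightarrow> g \<in> Arr C \<Longrightarrow> Dom C h = Cod C g \<Longrightarrow>
    f \<in> Arr C \<Longrightarrow> Dom C g = Cod C f \<Longrightarrow> h \<cdot> (g \<cdot> f) = k \<cdot> f"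
  using Cmp_assoc_Arr by metis

lemma Obj_typing [simp]: "f \<in> Arr C \<Longrightarrow> Dom C f \<in> Obj C" "f \<in> Arr C \<Longrightarrow> Cod C f \<in> Obj C"
  by (auto intro: Dom_in_Obj Cod_in_Obj)

lemma is_isoD:
  assumes "is_iso C X Y f"
  obtains g where "g \<in> Hom C Y X" "g \<cdot> f = Idn C X" "f \<cdot> g = Idn C Y"
  using assms by (auto simp: is_iso_def)

lemma is_iso_Hom: "is_iso C X Y f \<Longrightarrow> f \<in> Hom C X Y"
  by (auto simp: is_iso_def)

lemma is_iso_Idn: "X \<in> Obj C \<Longrightarrow> is_iso C X X (Idn C X)"
  unfolding is_iso_def using Idn_in_Hom by (auto intro!: bexI[of _ "Idn C X"])

lemma is_iso_Cmp:
  assumes f: "is_iso C X Y f" and g: "is_iso C Y Z g"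
  shows "is_iso C X Z (g \<cdot> f)"
proof -
  obtain f' where f': "f' \<in> Hom C Y X" "f' \<cdot> f = Idn C X" "f \<cdot> f' = Idn C Y"
    using f by (rule is_isoD)
  obtain g' where g': "g' \<in> Hom C Z Y" "g' \<cdot> g = Idn C Y" "g \<cdot> g' = Idn C Z"
    using g by (rule is_isoD)
  note t = HomD[OF is_iso_Hom[OF f]] HomD[OF is_iso_Hom[OF g]] HomD[OF f'(1)] HomD[OF g'(1)]
  show ?thesis
    unfolding is_iso_def
  proof (intro conjI bexI[of _ "f' \<cdot> g'"])
    show "f' \<cdot> g' \<cdot> (g \<cdot> f) = Idn C X"
      using t f' by (simp add: g' Cmp_reassoc[OF g'(2)])
    show "g \<cdot> f \<cdot> (f' \<cdot> g') = Idn C Z"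
      using t g' by (simp add: f' Cmp_reassoc[OF f'(3)])
  qed (use t in \<open>auto simp: Hom_iff\<close>)
qed

lemma is_iso_inverse:
  "g \<in> Hom C Y X \<Longrightarrow> f \<in> Hom C X Y \<Longrightarrow> g \<cdot> f = Idn C X \<Longrightarrow> f \<cdot> g = Idn C Y \<Longrightarrow> is_iso C Y X g"
  by (auto simp: is_iso_def)

lemma isomorphic_sym: "isomorphic C X Y \<Longrightarrow> isomorphic C Y X"
  by (meson is_isoD is_iso_Hom is_iso_inverse isomorphic_def)

lemma is_coproductD:
  assumes "is_coproduct C I X P \<iota>"
  shows "P \<in> Obj C" "\<And>i. i \<in> I \<Longrightarrow> X i \<in> Obj C" "\<And>i. i \<in> I \<Longrightarrow> \<iota> i \<in> Hom C (X i) P"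
  using assms by (auto simp: is_coproduct_def)

lemma coproduct_ext:
  assumes "is_coproduct C I X P \<iota>" "g \<in> Hom C P Y" "h \<in> Hom C P Y"
    "\<And>i. i \<in> I \<Longrightarrow> g \<cdot> \<iota> i = h \<cdot> \<iota> i"
  shows "g = h"
proof -
  have *: "\<forall>Y\<in>Obj C. \<forall>f. (\<forall>i\<in>I. f i \<in> Hom C (X i) Y) \<longrightarrow>
        (\<exists>!g. g \<in> Hom C P Y \<and> (\<forall>i\<in>I. g \<cdot> \<iota> i = f i))"
    using assms(1) by (auto simp: is_coproduct_def)
  have "\<forall>i\<in>I. h \<cdot> \<iota> i \<in> Hom C (X i) Y"
    using is_coproductD(3)[OF assms(1)] assms(3) Cmp_in_Hom by blast
  then have "\<exists>!g. g \<in> Hom C P Y \<and> (\<forall>i\<in>I. g \<cdot> \<iota> i = h \<cdot> \<iota> i)"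
    using *[THEN bspec, OF HomD(5)[OF assms(3)], THEN spec, of "\<lambda>i. h \<cdot> \<iota> i"] by blast
  with assms show ?thesis by blast
qed

lemma coproduct_copair:
  assumes "is_coproduct C I X P \<iota>" "Y \<in> Obj C" "\<And>i. i \<in> I \<Longrightarrow> f i \<in> Hom C (X i) Y"
  obtains g where "g \<in> Hom C P Y" "\<And>i. i \<in> I \<Longrightarrow> g \<cdot> \<iota> i = f i"
  using assms unfolding is_coproduct_def by metis

lemma is_coproductI:
  assumes "P \<in> Obj C" "\<And>i. i \<in> I \<Longrightarrow> \<iota> i \<in> Hom C (X i) P"
    "\<And>Y f. Y \<in> Obj C \<Longrightarrow> (\<And>i. i \<in> I \<Longrightarrow> f i \<in> Hom C (X i) Y) \<Longrightarrow>
       \<exists>g\<in>Hom C P Y. \<forall>i\<in>I. g \<cdot> \<iota> i = f i"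
    "\<And>Y g h. g \<in> Hom C P Y \<Longrightarrow> h \<in> Hom C P Y \<Longrightarrow> (\<And>i. i \<in> I \<Longrightarrow> g \<cdot> \<iota> i = h \<cdot> \<iota> i) \<Longrightarrow> g = h"
  shows "is_coproduct C I X P \<iota>"
  unfolding is_coproduct_def
proof (intro conjI ballI allI impI)
  fix Y f assume "Y \<in> Obj C" and f: "\<forall>i\<in>I. f i \<in> Hom C (X i) Y"
  then obtain g where "g \<in> Hom C P Y" "\<forall>i\<in>I. g \<cdot> \<iota> i = f i"
    using assms(3)[of Y f] by blast
  then show "\<exists>!g. g \<in> Hom C P Y \<and> (\<forall>i\<in>I. g \<cdot> \<iota> i = f i)"
    using assms(4) by (metis)
qed (use assms(1,2) in \<open>auto dest: HomD(4)\<close>)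

lemma is_coproduct_iso:
  assumes P: "is_coproduct C I X P \<iota>" and u: "is_iso C P P' u"
  shows "is_coproduct C I X P' (\<lambda>i. u \<cdot> \<iota> i)"
proof -
  obtain v where v: "v \<in> Hom C P' P" "v \<cdot> u = Idn C P" "u \<cdot> v = Idn C P'"
    using u by (rule is_isoD)
  note t = HomD[OF v(1)] HomD[OF is_iso_Hom[OF u]]
  note d = is_coproductD[OF P]
  show ?thesis
  proof (rule is_coproductI)
    fix Y f assume Y: "Y \<in> Obj C" "\<And>i. i \<in> I \<Longrightarrow> f i \<in> Hom C (X i) Y"
    obtain g where g: "g \<in> Hom C P Y" "\<And>i. i \<in> I \<Longrightarrow> g \<cdot> \<iota> i = f i"
      using coproduct_copair[OF P Y] by blast
    have "(g \<cdot> v) \<cdot> (u \<cdot> \<iota> i) = f i" if "i \<in> I" for i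
      using g(2)[OF that] HomD[OF g(1)] t HomD[OF d(3)[OF that]] by (simp add: Cmp_reassoc[OF v(2)])
    then show "\<exists>g\<in>Hom C P' Y. \<forall>i\<in>I. g \<cdot> (u \<cdot> \<iota> i) = f i"
      using Cmp_in_Hom[OF v(1) g(1)] by blast
  next
    fix Y g h assume g: "g \<in> Hom C P' Y" and h: "h \<in> Hom C P' Y"
      and e: "\<And>i. i \<in> I \<Longrightarrow> g \<cdot> (u \<cdot> \<iota> i) = h \<cdot> (u \<cdot> \<iota> i)"
    have "g \<cdot> u = h \<cdot> u"
    proof (rule coproduct_ext[OF P])
      show "g \<cdot> u \<cdot> \<iota> i = h \<cdot> u \<cdot> \<iota> i" if "i \<in> I" for i
        using e[OF that] HomD[OF g] HomD[OF h] t HomD[OF d(3)[OF that]] by simp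
    qed (use g h u in \<open>auto intro: Cmp_in_Hom dest: is_iso_Hom\<close>)
    then have "(g \<cdot> u) \<cdot> v = (h \<cdot> u) \<cdot> v" by simp
    then show "g = h" using HomD[OF g] HomD[OF h] t v by simp
  qed (use d(3) is_iso_Hom[OF u] t in \<open>auto intro: Cmp_in_Hom\<close>)
qed

text \<open>The definitions quantify over index sets in the type of \<open>\<Lambda>\<close> only;
  this carries coproducts between those and families over any other small index type, such as the
  natural numbers.\<close>

lemma is_coproduct_reindex:
  assumes P: "is_coproduct C I X P \<iota>" and e: "bij_betw e J I"
  shows "is_coproduct C J (\<lambda>j. X (e j)) P (\<lambda>j. \<iota> (e j))"
proof -
  note d = is_coproductD[OF P]
  have eI: "e j \<in> I" if "j \<in> J" for j using e that by (auto simp: bij_betw_def)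
  \<comment> \<open>Surjectivity of \<open>e\<close>, phrased so that it can be used as a
    rule.\<close>
  have all: "(\<And>j. j \<in> J \<Longrightarrow> R (e j)) \<Longrightarrow> i \<in> I \<Longrightarrow> R i" for R i
    using e by (auto simp: bij_betw_def)
  show ?thesis
  proof (rule is_coproductI)
    fix Y f assume Y: "Y \<in> Obj C" and f: "\<And>j. j \<in> J \<Longrightarrow> f j \<in> Hom C (X (e j)) Y"
    let ?f = "\<lambda>i. f (inv_into J e i)"
    have inv: "inv_into J e (e j) = j" if "j \<in> J" for j
      using e that by (auto simp: bij_betw_def)
    have "?f i \<in> Hom C (X i) Y" if "i \<in> I" for i
      by (rule all[OF _ that]) (simp add: inv f)
    then obtain g where g: "g \<in> Hom C P Y" "\<And>i. i \<in> I \<Longrightarrow> g \<cdot> \<iota> i = ?f i"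
      by (rule coproduct_copair[OF P Y, of ?f]) auto
    have "g \<cdot> \<iota> (e j) = f j" if "j \<in> J" for j
      using g(2)[OF eI[OF that]] inv[OF that] by simp
    then show "\<exists>g\<in>Hom C P Y. \<forall>j\<in>J. g \<cdot> \<iota> (e j) = f j" using g(1) by blast
  next
    fix Y g h assume "g \<in> Hom C P Y" "h \<in> Hom C P Y" "\<And>j. j \<in> J \<Longrightarrow> g \<cdot> \<iota> (e j) = h \<cdot> \<iota> (e j)"
    then show "g = h" using coproduct_ext[OF P] all[of "\<lambda>i. g \<cdot> \<iota> i = h \<cdot> \<iota> i"] by blast
  qed (use d eI in auto)
qed

end

lemma is_functorD:
  assumes "is_functor C D F"
  shows "category C" "category D"
    "\<And>X. X \<in> Obj C \<Longrightarrow> OMap F X \<in> Obj D"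
    "\<And>X. X \<in> Obj C \<Longrightarrow> AMap F (Idn C X) = Idn D (OMap F X)"
    "\<And>f. f \<in> Arr C \<Longrightarrow> AMap F f \<in> Arr D"
    "\<And>f. f \<in> Arr C \<Longrightarrow> Dom D (AMap F f) = OMap F (Dom C f)"
    "\<And>f. f \<in> Arr C \<Longrightarrow> Cod D (AMap F f) = OMap F (Cod C f)"
    "\<And>f g. f \<in> Arr C \<Longrightarrow> g \<in> Arr C \<Longrightarrow> Dom C g = Cod C f \<Longrightarrow>
        AMap F (Cmp C g f) = Cmp D (AMap F g) (AMap F f)"
  using assms unfolding is_functor_def Hom_def by auto

lemma is_functor_Hom:
  assumes "is_functor C D F" "f \<in> Hom C X Y"
  shows "AMap F f \<in> Hom D (OMap F X) (OMap F Y)"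
  using assms unfolding is_functor_def Hom_def by auto

lemma is_functor_iso:
  assumes F: "is_functor C D F" and f: "is_iso C X Y f"
  shows "is_iso D (OMap F X) (OMap F Y) (AMap F f)"
proof -
  interpret C: category C by (rule is_functorD[OF F])
  obtain g where g: "g \<in> Hom C Y X" "Cmp C g f = Idn C X" "Cmp C f g = Idn C Y"
    using f by (rule C.is_isoD)
  note t = C.HomD[OF C.is_iso_Hom[OF f]] C.HomD[OF g(1)]
  show ?thesis
    unfolding is_iso_def
    using is_functor_Hom[OF F g(1)] is_functor_Hom[OF F C.is_iso_Hom[OF f]] g t
      is_functorD(8)[OF F, of f g] is_functorD(8)[OF F, of g f] is_functorD(4)[OF F]
    by (auto intro!: bexI[of _ "AMap F g"])
qed

section \<open>Additive categories\<close>

context additive_category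
begin

lemma Plus_in_Hom: "f \<in> Hom C X Y \<Longrightarrow> g \<in> Hom C X Y \<Longrightarrow> Plus C f g \<in> Hom C X Y"
  using monoid.m_closed[OF group.is_monoid[OF comm_group.axioms(2)[OF hom_comm_group, of X Y]], of f g]
    HomD(4,5)[of f X Y]
  by (simp add: hom_group_def)

lemma Zer_in_Hom: "X \<in> Obj C \<Longrightarrow> Y \<in> Obj C \<Longrightarrow> Zer C X Y \<in> Hom C X Y"
  using group.is_monoid[OF comm_group.axioms(2)[OF hom_comm_group, of X Y]]
    monoid.one_closed[of "hom_group C X Y"]
  by (simp add: hom_group_def)

lemma neg_eq: "f \<in> Hom C X Y \<Longrightarrow> neg C f = inv\<^bsub>hom_group C X Y\<^esub> f"
  by (auto simp: neg_def Hom_iff)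

lemma neg_in_Hom: "f \<in> Hom C X Y \<Longrightarrow> neg C f \<in> Hom C X Y"
  using group.inv_closed[OF comm_group.axioms(2)[OF hom_comm_group, of X Y], of f] HomD(4,5)[of f X Y]
  by (simp add: neg_eq) (simp add: hom_group_def)

lemma Plus_assoc:
  assumes "f \<in> Hom C X Y" "g \<in> Hom C X Y" "h \<in> Hom C X Y"
  shows "Plus C (Plus C f g) h = Plus C f (Plus C g h)"
  using monoid.m_assoc[OF group.is_monoid[OF comm_group.axioms(2)[OF hom_comm_group, of X Y]], of f g h]
    HomD(4,5)[OF assms(1)] assms
  by (simp add: hom_group_def)

lemma Plus_comm:
  assumes "f \<in> Hom C X Y" "g \<in> Hom C X Y"
  shows "Plus C f g = Plus C g f"
  using comm_monoid.m_comm[OF comm_group.axioms(1)[OF hom_comm_group, of X Y], of f g]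
    HomD(4,5)[OF assms(1)] assms
  by (simp add: hom_group_def)

lemma Plus_Zer_left:
  assumes "f \<in> Hom C X Y"
  shows "Plus C (Zer C X Y) f = f"
  using monoid.l_one[OF group.is_monoid[OF comm_group.axioms(2)[OF hom_comm_group, of X Y]], of f]
    HomD(4,5)[OF assms(1)] assms
  by (simp add: hom_group_def)

lemma Plus_Zer_right: "f \<in> Hom C X Y \<Longrightarrow> Plus C f (Zer C X Y) = f"
  using Plus_Zer_left Plus_comm Zer_in_Hom HomD(4,5) by metis

lemma Plus_neg_left:
  assumes "f \<in> Hom C X Y"
  shows "Plus C (neg C f) f = Zer C X Y"
  using group.l_inv[OF comm_group.axioms(2)[OF hom_comm_group, of X Y], of f]
    HomD(4,5)[OF assms(1)] assms neg_eq[OF assms]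
  by (simp add: hom_group_def)

lemma Plus_neg_right: "f \<in> Hom C X Y \<Longrightarrow> Plus C f (neg C f) = Zer C X Y"
  using Plus_neg_left Plus_comm neg_in_Hom by metis

lemma Plus_cancel_left:
  assumes "f \<in> Hom C X Y" "g \<in> Hom C X Y" "h \<in> Hom C X Y" "Plus C f g = Plus C f h"
  shows "g = h"
  using assms Plus_assoc[of "neg C f" X Y f] Plus_neg_left Plus_Zer_left neg_in_Hom by metis

lemma Plus_neg_eq_Zer_iff:
  assumes "f \<in> Hom C X Y" "g \<in> Hom C X Y"
  shows "Plus C f (neg C g) = Zer C X Y \<longleftrightarrow> f = g"
  using assms Plus_neg_right Plus_cancel_left Plus_comm neg_in_Hom by metis

text \<open>Only the neutral element of a group is its own double. Composites with zero and images
  of zero under additive functors are recognised this way.\<close>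

lemma idem_imp_Zer: "f \<in> Hom C X Y \<Longrightarrow> Plus C f f = f \<Longrightarrow> f = Zer C X Y"
  using Plus_cancel_left Plus_Zer_right Zer_in_Hom HomD(4,5) by metis

lemma neg_unique:
  assumes "f \<in> Hom C X Y" "g \<in> Hom C X Y" "Plus C f g = Zer C X Y"
  shows "g = neg C f"
  using assms Plus_neg_right Plus_cancel_left neg_in_Hom by metis

lemma Zer_typing [simp]:
  assumes "X \<in> Obj C" "Y \<in> Obj C"
  shows "Zer C X Y \<in> Arr C" "Dom C (Zer C X Y) = X" "Cod C (Zer C X Y) = Y"
  using Zer_in_Hom[OF assms] by (auto simp: Hom_iff)

lemma neg_typing [simp]:
  assumes "f \<in> Arr C"
  shows "neg C f \<in> Arr C" "Dom C (neg C f) = Dom C f" "Cod C (neg C f) = Cod C f"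
  using neg_in_Hom[of f "Dom C f" "Cod C f"] assms by (auto simp: Hom_iff)

lemma Plus_typing [simp]:
  assumes "f \<in> Arr C" "g \<in> Arr C" "Dom C g = Dom C f" "Cod C g = Cod C f"
  shows "Plus C f g \<in> Arr C" "Dom C (Plus C f g) = Dom C f" "Cod C (Plus C f g) = Cod C f"
  using Plus_in_Hom[of f "Dom C f" "Cod C f" g] assms by (auto simp: Hom_iff)

lemma Cmp_Zer [simp]:
  assumes f: "f \<in> Arr C" "Dom C f = Y" "X \<in> Obj C"
  shows "f \<cdot> Zer C X Y = Zer C X (Cod C f)"
proof (rule idem_imp_Zer)
  have z: "Zer C X Y \<in> Hom C X Y" using assms by (auto intro: Zer_in_Hom)
  have f': "f \<in> Hom C Y (Cod C f)" using assms by (auto simp: Hom_iff)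
  show "f \<cdot> Zer C X Y \<in> Hom C X (Cod C f)" by (rule Cmp_in_Hom[OF z f'])
  show "Plus C (f \<cdot> Zer C X Y) (f \<cdot> Zer C X Y) = f \<cdot> Zer C X Y"
    using Cmp_Plus[OF z z f'] Plus_Zer_left[OF z] by simp
qed

lemma Zer_Cmp [simp]:
  assumes f: "f \<in> Arr C" "Cod C f = X" "Y \<in> Obj C"
  shows "Zer C X Y \<cdot> f = Zer C (Dom C f) Y"
proof (rule idem_imp_Zer)
  have z: "Zer C X Y \<in> Hom C X Y" using assms by (auto intro: Zer_in_Hom)
  have f': "f \<in> Hom C (Dom C f) X" using assms by (auto simp: Hom_iff)
  show "Zer C X Y \<cdot> f \<in> Hom C (Dom C f) Y" by (rule Cmp_in_Hom[OF f' z])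
  show "Plus C (Zer C X Y \<cdot> f) (Zer C X Y \<cdot> f) = Zer C X Y \<cdot> f"
    using Plus_Cmp[OF f' z z] Plus_Zer_left[OF z] by simp
qed

lemma Cmp_Plus_Arr:
  "f \<in> Arr C \<Longrightarrow> f' \<in> Arr C \<Longrightarrow> g \<in> Arr C \<Longrightarrow> Dom C f' = Dom C f \<Longrightarrow> Cod C f' = Cod C f \<Longrightarrow>
    Dom C g = Cod C f \<Longrightarrow> g \<cdot> Plus C f f' = Plus C (g \<cdot> f) (g \<cdot> f')"
  by (rule Cmp_Plus[of _ "Dom C f" "Cod C f" _ _ "Cod C g"]) (auto simp: Hom_iff)

lemma Plus_Cmp_Arr:
  "f \<in> Arr C \<Longrightarrow> g \<in> Arr C \<Longrightarrow> g' \<in> Arr C \<Longrightarrow> Dom C g' = Dom C g \<Longrightarrow> Cod C g' = Cod C g \<Longrightarrow>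
    Dom C g = Cod C f \<Longrightarrow> Plus C g g' \<cdot> f = Plus C (g \<cdot> f) (g' \<cdot> f)"
  by (rule Plus_Cmp[of _ "Dom C f" "Cod C f" _ "Cod C g"]) (auto simp: Hom_iff)

lemma Cmp_neg:
  assumes "f \<in> Arr C" "g \<in> Arr C" "Dom C g = Cod C f"
  shows "g \<cdot> neg C f = neg C (g \<cdot> f)"
proof (rule neg_unique)
  show "Plus C (g \<cdot> f) (g \<cdot> neg C f) = Zer C (Dom C f) (Cod C g)"
    using assms Cmp_Plus_Arr[of f "neg C f" g, symmetric] Plus_neg_right[of f "Dom C f" "Cod C f"]
    by (simp add: Hom_iff)
qed (use assms in \<open>auto simp: Hom_iff\<close>)

lemma neg_Cmp:
  assumes "f \<in> Arr C" "g \<in> Arr C" "Dom C g = Cod C f"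
  shows "neg C g \<cdot> f = neg C (g \<cdot> f)"
proof (rule neg_unique)
  show "Plus C (g \<cdot> f) (neg C g \<cdot> f) = Zer C (Dom C f) (Cod C g)"
    using assms Plus_Cmp_Arr[of f g "neg C g", symmetric] Plus_neg_right[of g "Dom C g" "Cod C g"]
    by (simp add: Hom_iff)
qed (use assms in \<open>auto simp: Hom_iff\<close>)

lemma neg_neg: "f \<in> Arr C \<Longrightarrow> neg C (neg C f) = f"
  using neg_unique[of "neg C f" "Dom C f" "Cod C f" f] Plus_neg_left[of f "Dom C f" "Cod C f"]
  by (simp add: Hom_iff)

lemma neg_inj: "f \<in> Arr C \<Longrightarrow> g \<in> Arr C \<Longrightarrow> neg C f = neg C g \<Longrightarrow> f = g"
  using neg_neg by metis

lemma neg_Zer: "X \<in> Obj C \<Longrightarrow> Y \<in> Obj C \<Longrightarrow> neg C (Zer C X Y) = Zer C X Y"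
  using neg_unique[OF Zer_in_Hom Zer_in_Hom] Plus_Zer_left[OF Zer_in_Hom] by metis

text \<open>Triangles speak about vanishing composites, uniqueness claims about equal ones;
  subtraction passes from one to the other.\<close>

lemma Cmp_eq_iff_diff:
  assumes "k \<in> Hom C Y Z" "k' \<in> Hom C Y Z" "f \<in> Hom C X Y"
  shows "k \<cdot> f = k' \<cdot> f \<longleftrightarrow> Plus C k (neg C k') \<cdot> f = Zer C X Z"
  using assms HomD[OF assms(1)] HomD[OF assms(2)] HomD[OF assms(3)]
  by (simp add: Plus_Cmp_Arr neg_Cmp) (subst Plus_neg_eq_Zer_iff[where X = X and Y = Z], auto simp: Hom_iff)

text \<open>If the identity is zero, every morphism is zero, being its own composite with the
  identity. The equational form is the one that additive functors visibly preserve.\<close>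

lemma is_zero_iff: "is_zero C X \<longleftrightarrow> X \<in> Obj C \<and> Idn C X = Zer C X X"
proof (intro iffI conjI)
  assume "is_zero C X"
  then show "Idn C X = Zer C X X" unfolding is_zero_def
    using Idn_in_Hom[of X] Zer_in_Hom[of X X] by metis
next
  assume *: "X \<in> Obj C \<and> Idn C X = Zer C X X"
  then have l: "f = Zer C X Y" if "f \<in> Hom C X Y" for f Y
    using HomD[OF that] Cmp_Zer[of f X X] Cmp_Idn_right[of f X] by simp
  from * have r: "f = Zer C Y X" if "f \<in> Hom C Y X" for f Y
    using HomD[OF that] Zer_Cmp[of f X X] Idn_Cmp_left[of f X] by simp
  show "is_zero C X" unfolding is_zero_def using * l r Zer_in_Hom by blast
qed (auto simp: is_zero_def)

lemma is_zero_Hom_from: "is_zero C X \<Longrightarrow> f \<in> Hom C X Y \<Longrightarrow> f = Zer C X Y"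
  unfolding is_zero_def using Zer_in_Hom[of X Y] HomD(5)[of f X Y] by metis

lemma is_zero_Hom_to: "is_zero C Y \<Longrightarrow> f \<in> Hom C X Y \<Longrightarrow> f = Zer C X Y"
  unfolding is_zero_def using Zer_in_Hom[of X Y] HomD(4)[of f X Y] by metis

end

lemma is_additiveD:
  assumes "is_additive C D F"
  shows "is_functor C D F"
    "\<And>X Y f g. f \<in> Hom C X Y \<Longrightarrow> g \<in> Hom C X Y \<Longrightarrow> X \<in> Obj C \<Longrightarrow> Y \<in> Obj C \<Longrightarrow>
       AMap F (Plus C f g) = Plus D (AMap F f) (AMap F g)"
  using assms unfolding is_additive_def by auto

lemma is_additive_Zer:
  assumes "additive_category C" "additive_category D" and F: "is_additive C D F"
    and X: "X \<in> Obj C" "Y \<in> Obj C"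
  shows "AMap F (Zer C X Y) = Zer D (OMap F X) (OMap F Y)"
proof -
  interpret C: additive_category C by fact
  interpret D: additive_category D by fact
  have z: "Zer C X Y \<in> Hom C X Y" using C.Zer_in_Hom X by blast
  show ?thesis
    using is_additiveD(2)[OF F z z X] C.Plus_Zer_left[OF z]
      is_functor_Hom[OF is_additiveD(1)[OF F] z] by (metis D.idem_imp_Zer)
qed

lemma is_additive_neg:
  assumes "additive_category C" "additive_category D" and F: "is_additive C D F"
    and f: "f \<in> Arr C"
  shows "AMap F (neg C f) = neg D (AMap F f)"
proof -
  interpret C: additive_category C by fact
  interpret D: additive_category D by fact
  have h: "f \<in> Hom C (Dom C f) (Cod C f)" using f by (auto simp: C.Hom_iff)
  note h' = C.neg_in_Hom[OF h]
  note Fh = is_functor_Hom[OF is_additiveD(1)[OF F]]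
  show ?thesis
    using is_additiveD(2)[OF F h h'] C.Plus_neg_right[OF h] is_additive_Zer[OF assms(1-3)] f
    by (intro D.neg_unique[OF Fh[OF h] Fh[OF h']]) simp
qed

lemma is_additive_zero:
  assumes "additive_category C" "additive_category D" and F: "is_additive C D F"
    and X: "is_zero C X"
  shows "is_zero D (OMap F X)"
proof -
  interpret C: additive_category C by fact
  interpret D: additive_category D by fact
  have "X \<in> Obj C" "Idn C X = Zer C X X" using X by (auto simp: C.is_zero_iff)
  with is_functorD(3,4)[OF is_additiveD(1)[OF F], of X] is_additive_Zer[OF assms(1-3), of X X]
  show ?thesis by (simp add: D.is_zero_iff)
qed

section \<open>Triangulated categories\<close>

context triangulated_category
begin

abbreviation sh :: "'o \<Rightarrow> 'o" where "sh \<equiv> OMap (Shift C)"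
abbreviation shm :: "'m \<Rightarrow> 'm" where "shm \<equiv> AMap (Shift C)"
abbreviation unsh :: "'o \<Rightarrow> 'o" where "unsh \<equiv> inv_into (Obj C) (OMap (Shift C))"

lemma shift_functor: "is_functor C C (Shift C)"
  using shift_additive by (rule is_additiveD)

lemma sh_Obj [simp]: "X \<in> Obj C \<Longrightarrow> sh X \<in> Obj C"
  by (rule is_functorD(3)[OF shift_functor])

lemma shm_typing [simp]:
  assumes "f \<in> Arr C"
  shows "shm f \<in> Arr C" "Dom C (shm f) = sh (Dom C f)" "Cod C (shm f) = sh (Cod C f)"
  using is_functorD[OF shift_functor] assms by auto

lemma shm_Cmp [simp]:
  "f \<in> Arr C \<Longrightarrow> g \<in> Arr C \<Longrightarrow> Dom C g = Cod C f \<Longrightarrow> shm (g \<cdot> f) = shm g \<cdot> shm f"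
  using is_functorD(8)[OF shift_functor] by auto

lemma shm_Idn [simp]: "X \<in> Obj C \<Longrightarrow> shm (Idn C X) = Idn C (sh X)"
  by (rule is_functorD(4)[OF shift_functor])

lemma shm_Zer [simp]: "X \<in> Obj C \<Longrightarrow> Y \<in> Obj C \<Longrightarrow> shm (Zer C X Y) = Zer C (sh X) (sh Y)"
  by (rule is_additive_Zer[OF additive_category_axioms additive_category_axioms shift_additive])

lemma shm_neg [simp]: "f \<in> Arr C \<Longrightarrow> shm (neg C f) = neg C (shm f)"
  by (rule is_additive_neg[OF additive_category_axioms additive_category_axioms shift_additive])

lemma shm_Plus:
  "f \<in> Hom C X Y \<Longrightarrow> g \<in> Hom C X Y \<Longrightarrow> shm (Plus C f g) = Plus C (shm f) (shm g)"
  using is_additiveD(2)[OF shift_additive] HomD(4,5) by metis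

lemma shm_in_Hom: "f \<in> Hom C X Y \<Longrightarrow> shm f \<in> Hom C (sh X) (sh Y)"
  by (rule is_functor_Hom[OF shift_functor])

lemma shm_inj: "f \<in> Arr C \<Longrightarrow> g \<in> Arr C \<Longrightarrow> shm f = shm g \<Longrightarrow> f = g"
  using shift_bij_Arr by (auto simp: bij_betw_def dest: inj_onD)

lemma sh_inj: "X \<in> Obj C \<Longrightarrow> Y \<in> Obj C \<Longrightarrow> sh X = sh Y \<Longrightarrow> X = Y"
  using shift_bij_Obj by (auto simp: bij_betw_def dest: inj_onD)

text \<open>The shift is an automorphism, so morphisms desuspend on the nose. Together with
  \<open>sh (unsh X) = X\<close> this allows arguments to be run after a shift and brought
  back.\<close>

lemma shm_surj:
  assumes "k \<in> Hom C (sh X) (sh Y)" "X \<in> Obj C" "Y \<in> Obj C"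
  obtains d where "d \<in> Hom C X Y" "shm d = k"
proof -
  have "k \<in> shm ` Arr C"
    using bij_betw_imp_surj_on[OF shift_bij_Arr] HomD(1)[OF assms(1)] by simp
  then obtain d where d: "d \<in> Arr C" "k = shm d" by blast
  have "Dom C d = X" "Cod C d = Y"
    using sh_inj[of "Dom C d" X] sh_inj[of "Cod C d" Y] assms(2,3) HomD[OF assms(1)]
      shm_typing[OF d(1)] d by simp_all
  with d show ?thesis using that[of d] by (simp add: Hom_iff)
qed

lemma unsh [simp]:
  assumes "X \<in> Obj C"
  shows "unsh X \<in> Obj C" "sh (unsh X) = X"
  using assms shift_bij_Obj inv_into_into[of X sh "Obj C"] f_inv_into_f[of X sh "Obj C"]
  by (auto simp: bij_betw_def)

lemma unsh_sh [simp]: "X \<in> Obj C \<Longrightarrow> unsh (sh X) = X"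
  using shift_bij_Obj by (auto simp: bij_betw_def)

lemma sh_zero: "is_zero C X \<Longrightarrow> is_zero C (sh X)"
  by (rule is_additive_zero[OF additive_category_axioms additive_category_axioms shift_additive])

section \<open>Exactness of the Hom functors on triangles\<close>

lemma Tri_typing:
  assumes "(f, g, h) \<in> Tri C"
  shows "f \<in> Arr C" "g \<in> Arr C" "h \<in> Arr C" "Dom C g = Cod C f" "Dom C h = Cod C g"
    "Cod C h = sh (Dom C f)"
  using Tri_shape[OF assms] by (auto simp: triangle_shape_def)

lemma rotate: "(f, g, h) \<in> Tri C \<Longrightarrow> (g, h, neg C (shm f)) \<in> Tri C"
  using Tri_rotate[of f g h] Tri_shape[of "(f, g, h)"] by blast

lemma Tri_isoI:
  assumes "(f, g, h) \<in> Tri C" "f' \<in> Arr C" "g' \<in> Arr C" "h' \<in> Arr C"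
    "Dom C g' = Cod C f'" "Dom C h' = Cod C g'" "Cod C h' = sh (Dom C f')"
    "is_iso C (Dom C f) (Dom C f') a" "is_iso C (Cod C f) (Cod C f') b"
    "is_iso C (Cod C g) (Cod C g') c"
    "b \<cdot> f = f' \<cdot> a" "c \<cdot> g = g' \<cdot> b" "shm a \<cdot> h = h' \<cdot> c"
  shows "(f', g', h') \<in> Tri C"
  by (rule Tri_iso[OF assms(1)])
    (use assms Tri_shape[OF assms(1)] Tri_typing[OF assms(1)] in
      \<open>auto simp: triangle_iso_def triangle_shape_def\<close>)

text \<open>\<open>Tri_morphism\<close>, applied to the map from the trivial triangle on the source
  of \<open>f\<close>, factors \<open>g \<cdot> f\<close> through a zero object.\<close>

lemma comp_zero:
  assumes t: "(f, g, h) \<in> Tri C"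
  shows "g \<cdot> f = Zer C (Dom C f) (Cod C g)"
proof -
  obtain Z where Z: "is_zero C Z" using ex_zero by blast
  then have Zo: "Z \<in> Obj C" by (simp add: is_zero_def)
  note tt = Tri_typing[OF t]
  have i: "(Idn C (Dom C f), Zer C (Dom C f) Z, Zer C Z (sh (Dom C f))) \<in> Tri C"
    using tt Z by (intro Tri_id) auto
  obtain c where "c \<in> Hom C Z (Dom C h)" "c \<cdot> Zer C (Dom C f) Z = g \<cdot> f"
    using Tri_morphism[OF i t, of "Idn C (Dom C f)" f] tt Zo by (auto simp: Hom_iff)
  then show ?thesis using tt by (auto simp: Hom_iff)
qed

lemma comp_zero2: "(f, g, h) \<in> Tri C \<Longrightarrow> h \<cdot> g = Zer C (Cod C f) (sh (Dom C f))"
  using comp_zero[OF rotate, of f g h] Tri_typing[of f g h] by simp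

lemma comp_zero3:
  assumes t: "(f, g, h) \<in> Tri C"
  shows "shm f \<cdot> h = Zer C (Cod C g) (sh (Cod C f))"
proof -
  note tt = Tri_typing[OF t]
  have "neg C (shm f) \<cdot> h = Zer C (Cod C g) (sh (Cod C f))"
    using comp_zero[OF rotate[OF rotate[OF t]]] tt by simp
  then have "neg C (shm f \<cdot> h) = Zer C (Cod C g) (sh (Cod C f))"
    using tt by (simp add: neg_Cmp)
  then have "neg C (shm f \<cdot> h) = neg C (Zer C (Cod C g) (sh (Cod C f)))"
    using tt by (simp add: neg_Zer)
  then show ?thesis by (rule neg_inj[rotated 2]) (use tt in auto)
qed

text \<open>Exactness of the covariant Hom functor at the middle term. The axiom
  \<open>Tri_morphism\<close> fills in third arrows only, so the lift is obtained from the rotated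
  triangles, where it appears shifted, and is then desuspended.\<close>

lemma tri_lift:
  assumes t: "(f, g, h) \<in> Tri C" and k: "k \<in> Hom C W (Cod C f)" "g \<cdot> k = Zer C W (Cod C g)"
  obtains k' where "k' \<in> Hom C W (Dom C f)" "f \<cdot> k' = k"
proof -
  obtain Z where Z: "is_zero C Z" using ex_zero by blast
  then have Zo: "Z \<in> Obj C" by (simp add: is_zero_def)
  note tt = Tri_typing[OF t] and kk = HomD[OF k(1)]
  have "(Idn C W, Zer C W Z, Zer C Z (sh W)) \<in> Tri C" using kk Z by (intro Tri_id) auto
  from rotate[OF this] have i: "(Zer C W Z, Zer C Z (sh W), neg C (Idn C (sh W))) \<in> Tri C"
    using kk by simp
  obtain c where c: "c \<in> Hom C (sh W) (sh (Dom C f))"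
      "shm k \<cdot> neg C (Idn C (sh W)) = neg C (shm f) \<cdot> c"
    using Tri_morphism[OF i rotate[OF t], of k "Zer C Z (Dom C h)"] tt kk Zo k
    by (auto simp: Hom_iff)
  have "neg C (shm k) = neg C (shm f \<cdot> c)"
    using c kk tt HomD[OF c(1)] by (simp add: Cmp_neg neg_Cmp)
  then have *: "shm k = shm f \<cdot> c"
    by (rule neg_inj[rotated 2]) (use kk tt HomD[OF c(1)] in auto)
  obtain d where d: "d \<in> Hom C W (Dom C f)" "shm d = c"
    using shm_surj[OF c(1)] kk tt by auto
  have "shm k = shm (f \<cdot> d)" using * d HomD[OF d(1)] tt by simp
  then have "k = f \<cdot> d" by (rule shm_inj[rotated 2]) (use kk tt HomD[OF d(1)] in auto)
  with d that show ?thesis by auto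
qed

lemma tri_lift2:
  assumes t: "(f, g, h) \<in> Tri C" and k: "k \<in> Hom C W (Cod C g)" "h \<cdot> k = Zer C W (sh (Dom C f))"
  obtains k' where "k' \<in> Hom C W (Cod C f)" "g \<cdot> k' = k"
  using tri_lift[OF rotate[OF t] k(1)] k(2) Tri_typing[OF t] by auto

text \<open>Exactness of the contravariant Hom functor at the middle term: the extension is the
  third arrow of a map to the triangle \<open>Z \<rightarrow> W \<rightarrow> W\<close> with
  \<open>Z\<close> zero.\<close>

lemma tri_ext:
  assumes t: "(f, g, h) \<in> Tri C" and k: "k \<in> Hom C (Cod C f) W" "k \<cdot> f = Zer C (Dom C f) W"
  obtains k' where "k' \<in> Hom C (Cod C g) W" "k' \<cdot> g = k"
proof -
  obtain Z where Z: "is_zero C Z" using ex_zero by blast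
  then have Zo: "Z \<in> Obj C" by (simp add: is_zero_def)
  note tt = Tri_typing[OF t] and kk = HomD[OF k(1)]
  \<comment> \<open>The zero object is taken shifted so that the last arrow is minus the shift of a
    morphism \<open>Z \<rightarrow> W\<close>, which is what a backward rotation requires.\<close>
  have "(Idn C W, Zer C W (sh Z), Zer C (sh Z) (sh W)) \<in> Tri C"
    using kk sh_zero[OF Z] by (intro Tri_id) auto
  then have "(Idn C W, Zer C W (sh Z), neg C (shm (Zer C Z W))) \<in> Tri C"
    using kk Zo by (simp add: neg_Zer)
  then have i: "(Zer C Z W, Idn C W, Zer C W (sh Z)) \<in> Tri C"
    by (subst Tri_rotate) (use kk Zo in \<open>auto simp: triangle_shape_def\<close>)
  have "\<exists>c\<in>Hom C (Dom C h) (Dom C (Zer C W (sh Z))). c \<cdot> g = Idn C W \<cdot> k \<and>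
      shm (Zer C (Dom C f) Z) \<cdot> h = Zer C W (sh Z) \<cdot> c"
    by (rule Tri_morphism[OF t i]) (use tt kk Zo k in \<open>auto simp: Hom_iff\<close>)
  then obtain c where c: "c \<in> Hom C (Dom C h) W" "c \<cdot> g = Idn C W \<cdot> k"
    using kk Zo by auto
  then show ?thesis using that kk tt by auto
qed

lemma tri_ext2:
  assumes t: "(f, g, h) \<in> Tri C" and k: "k \<in> Hom C (Cod C g) W" "k \<cdot> g = Zer C (Cod C f) W"
  obtains k' where "k' \<in> Hom C (sh (Dom C f)) W" "k' \<cdot> h = k"
  using tri_ext[OF rotate[OF t] k(1)] k(2) Tri_typing[OF t] by auto

lemma tri_ext3:
  assumes t: "(f, g, h) \<in> Tri C" and k: "k \<in> Hom C (sh (Dom C f)) W" "k \<cdot> h = Zer C (Cod C g) W"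
  obtains k' where "k' \<in> Hom C (sh (Cod C f)) W" "k' \<cdot> shm f = k"
proof -
  note tt = Tri_typing[OF t]
  obtain c where c: "c \<in> Hom C (sh (Cod C f)) W" "c \<cdot> neg C (shm f) = k"
    using tri_ext[OF rotate[OF rotate[OF t]], of k W] k tt by auto
  then have "neg C c \<cdot> shm f = k" using HomD[OF c(1)] tt by (simp add: Cmp_neg neg_Cmp)
  then show ?thesis using that[OF neg_in_Hom[OF c(1)]] by auto
qed

text \<open>With \<open>g\<close> and \<open>h\<close> zero, the identity of the target lifts along
  \<open>f\<close>, and the identity of the shifted source extends along \<open>shm f\<close>. The
  right inverse \<open>s\<close> of \<open>f\<close> is then compared with the left inverse of
  \<open>shm f\<close> after shifting.\<close>

lemma is_iso_if_zero_cone: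
  assumes t: "(f, g, h) \<in> Tri C" and z: "is_zero C (Cod C g)"
  shows "is_iso C (Dom C f) (Cod C f) f"
proof -
  note tt = Tri_typing[OF t]
  have id: "Idn C (Cod C f) \<in> Hom C (Cod C f) (Cod C f)" using tt by (auto simp: Hom_iff)
  have g0: "g = Zer C (Cod C f) (Cod C g)" using z tt by (intro is_zero_Hom_to) (auto simp: Hom_iff)
  have h0: "h = Zer C (Cod C g) (sh (Dom C f))" using z tt by (intro is_zero_Hom_from) (auto simp: Hom_iff)
  obtain s where s: "s \<in> Hom C (Cod C f) (Dom C f)" "f \<cdot> s = Idn C (Cod C f)"
    using tri_lift[OF t id] g0 tt id by auto
  note ss = HomD[OF s(1)]
  have "Idn C (sh (Dom C f)) \<cdot> h = Zer C (Cod C g) (sh (Dom C f))" using h0 tt by simp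
  then obtain r where r: "r \<in> Hom C (sh (Cod C f)) (sh (Dom C f))" "r \<cdot> shm f = Idn C (sh (Dom C f))"
    using tri_ext3[OF t, of "Idn C (sh (Dom C f))" "sh (Dom C f)"] tt by (auto simp: Hom_iff)
  have fsf: "f \<cdot> (s \<cdot> f) = f" using ss tt by (simp add: Cmp_reassoc[OF s(2)])
  have "shm (s \<cdot> f) = r \<cdot> (shm f \<cdot> shm (s \<cdot> f))"
    using ss tt HomD[OF r(1)] by (simp add: Cmp_reassoc[OF r(2)])
  also have "\<dots> = r \<cdot> shm (f \<cdot> (s \<cdot> f))" using ss tt by simp
  also have "\<dots> = shm (Idn C (Dom C f))" unfolding fsf using r tt by simp
  finally have "s \<cdot> f = Idn C (Dom C f)" by (rule shm_inj[rotated 2]) (use ss tt in auto)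
  then show ?thesis using s tt by (auto simp: is_iso_def Hom_iff)
qed

text \<open>Cancelling \<open>f\<close> in \<open>g \<cdot> f = 0\<close> and \<open>shm f\<close>
  in \<open>shm f \<cdot> h = 0\<close> makes \<open>g\<close> and \<open>h\<close> zero. Then the
  identity of the cone lifts along the zero morphism \<open>g\<close>.\<close>

lemma zero_cone_if_is_iso:
  assumes t: "(f, g, h) \<in> Tri C" and i: "is_iso C X Y f"
  shows "is_zero C (Cod C g)"
proof -
  obtain s where s: "s \<in> Hom C Y X" "s \<cdot> f = Idn C X" "f \<cdot> s = Idn C Y"
    using i by (rule is_isoD)
  note tt = Tri_typing[OF t] and ss = HomD[OF s(1)] and ff = HomD[OF is_iso_Hom[OF i]]
  have "g = g \<cdot> (f \<cdot> s)" using s tt ff by simp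
  also have "\<dots> = Zer C (Cod C f) (Cod C g)"
    using comp_zero[OF t] tt ss ff by (simp add: Cmp_reassoc[OF comp_zero[OF t]])
  finally have g0: "g = Zer C (Cod C f) (Cod C g)" .
  have "shm s \<cdot> shm f = Idn C (sh X)" using s ff ss by (metis shm_Cmp shm_Idn)
  then have "h = shm s \<cdot> (shm f \<cdot> h)" using ss ff tt by (simp add: Cmp_reassoc[of "shm s" "shm f"])
  also have "\<dots> = Zer C (Cod C g) (sh (Dom C f))"
    using comp_zero3[OF t] tt ss ff by simp
  finally have h0: "h = Zer C (Cod C g) (sh (Dom C f))" .
  have "h \<cdot> Idn C (Cod C g) = Zer C (Cod C g) (sh (Dom C f))" using tt h0 by simp
  then obtain k where "k \<in> Hom C (Cod C g) (Cod C f)" "g \<cdot> k = Idn C (Cod C g)"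
    using tri_lift2[OF t, of "Idn C (Cod C g)" "Cod C g"] tt by (auto simp: Hom_iff)
  then have "Idn C (Cod C g) = Zer C (Cod C g) (Cod C g)"
    using g0 tt by (metis Hom_iff Obj_typing(1,2) Zer_Cmp)
  then show ?thesis using tt by (simp add: is_zero_iff)
qed

lemma is_iso_neg: "is_iso C X Y f \<Longrightarrow> is_iso C X Y (neg C f)"
proof -
  assume i: "is_iso C X Y f"
  obtain s where s: "s \<in> Hom C Y X" "s \<cdot> f = Idn C X" "f \<cdot> s = Idn C Y"
    using i by (rule is_isoD)
  note ss = HomD[OF s(1)] and ff = HomD[OF is_iso_Hom[OF i]]
  show ?thesis
    unfolding is_iso_def
    by (intro conjI bexI[of _ "neg C s"])
      (use s ss ff in \<open>auto simp: Hom_iff Cmp_neg neg_Cmp neg_neg\<close>)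
qed

text \<open>Three rotations shift a triangle and negate all three arrows. Changing the sign on the
  middle object removes the first two signs and leaves the third.\<close>

lemma shift_Tri:
  assumes t: "(f, g, h) \<in> Tri C"
  shows "(shm f, shm g, neg C (shm h)) \<in> Tri C"
proof -
  note tt = Tri_typing[OF t]
  have "(neg C (shm f), neg C (shm g), neg C (shm h)) \<in> Tri C"
    by (rule rotate[OF rotate[OF rotate[OF t]]])
  then show ?thesis
    by (rule Tri_isoI[where a = "Idn C (sh (Dom C f))" and b = "neg C (Idn C (sh (Cod C f)))"
          and c = "Idn C (sh (Cod C g))"])
      (use tt in \<open>auto simp: is_iso_Idn is_iso_neg Cmp_neg neg_Cmp neg_neg\<close>)
qed

text \<open>Complete \<open>k\<close> to a triangle and rotate backwards: the fiber map is the
  desuspension of minus the third arrow.\<close>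

lemma ex_fiber:
  assumes k: "k \<in> Arr C"
  obtains s h where "(s, k, h) \<in> Tri C"
proof -
  obtain g h where t: "(k, g, h) \<in> Tri C" using Tri_complete[OF k] by blast
  note tt = Tri_typing[OF t]
  obtain s where s: "s \<in> Hom C (unsh (Cod C g)) (Dom C k)" "shm s = neg C h"
    by (rule shm_surj[of "neg C h" "unsh (Cod C g)" "Dom C k"]) (use tt in \<open>auto simp: Hom_iff\<close>)
  have "(s, k, g) \<in> Tri C"
    by (subst Tri_rotate) (use HomD[OF s(1)] tt s(2) t in \<open>auto simp: triangle_shape_def neg_neg\<close>)
  then show ?thesis by (rule that)
qed

subsection \<open>Triangulated subcategories and their right orthogonals\<close>

text \<open>The right orthogonal of \<open>A\<close>. For a triangulated subcategory its members are
  the local objects. Closure of \<open>A\<close> under shifts is not built in.\<close>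

definition orth :: "'o set \<Rightarrow> 'o set" where
  "orth A = {X \<in> Obj C. \<forall>Y\<in>A. Hom C Y X = {Zer C Y X}}"

lemma orthD: "X \<in> orth A \<Longrightarrow> Y \<in> A \<Longrightarrow> f \<in> Hom C Y X \<Longrightarrow> f = Zer C Y X"
  by (auto simp: orth_def)

lemma orth_Obj: "X \<in> orth A \<Longrightarrow> X \<in> Obj C"
  by (auto simp: orth_def)

lemma orthI:
  assumes "A \<subseteq> Obj C" "X \<in> Obj C" "\<And>Y f. Y \<in> A \<Longrightarrow> f \<in> Hom C Y X \<Longrightarrow> f = Zer C Y X"
  shows "X \<in> orth A"
  using assms Zer_in_Hom[of _ X] unfolding orth_def by blast

lemma orth_zero: "A \<subseteq> Obj C \<Longrightarrow> is_zero C X \<Longrightarrow> X \<in> orth A"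
  by (rule orthI) (auto simp: is_zero_Hom_to is_zero_def)

lemma orth_iso:
  assumes "A \<subseteq> Obj C" "X \<in> orth A" "isomorphic C X Y"
  shows "Y \<in> orth A"
proof -
  obtain f where f: "is_iso C X Y f" using assms(3) by (auto simp: isomorphic_def)
  obtain g where g: "g \<in> Hom C Y X" "g \<cdot> f = Idn C X" "f \<cdot> g = Idn C Y"
    using f by (rule is_isoD)
  note tt = HomD[OF is_iso_Hom[OF f]] HomD[OF g(1)]
  show ?thesis
  proof (rule orthI[OF assms(1)])
    fix W k assume W: "W \<in> A" and k: "k \<in> Hom C W Y"
    have "g \<cdot> k = Zer C W X" by (rule orthD[OF assms(2) W Cmp_in_Hom[OF k g(1)]])
    then have "f \<cdot> (g \<cdot> k) = Zer C W Y" using tt HomD[OF k] by simp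
    then show "k = Zer C W Y" using tt HomD[OF k] by (simp add: Cmp_reassoc[OF g(3)])
  qed (use tt in auto)
qed

text \<open>A morphism into the cone has zero composite with \<open>h\<close>, hence comes from
  \<open>Cod C f\<close>, where it vanishes. The shift in the hypothesis is the target of
  \<open>h\<close>.\<close>

lemma orth_cone:
  assumes A: "A \<subseteq> Obj C" and t: "(f, g, h) \<in> Tri C"
    and "Cod C f \<in> orth A" "sh (Dom C f) \<in> orth A"
  shows "Cod C g \<in> orth A"
proof (rule orthI[OF A])
  note tt = Tri_typing[OF t]
  fix W k assume W: "W \<in> A" and k: "k \<in> Hom C W (Cod C g)"
  have "h \<cdot> k = Zer C W (sh (Dom C f))"
    by (rule orthD[OF assms(4) W]) (use tt HomD[OF k] in \<open>auto simp: Hom_iff\<close>)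
  then obtain k' where k': "k' \<in> Hom C W (Cod C f)" "g \<cdot> k' = k" using tri_lift2[OF t k] by blast
  have "k' = Zer C W (Cod C f)" by (rule orthD[OF assms(3) W k'(1)])
  then show "k = Zer C W (Cod C g)" using k' tt HomD[OF k] by auto
qed (use Tri_typing[OF t] in auto)

lemma orth_sh:
  assumes A: "A \<subseteq> Obj C" and s: "\<And>Y. Y \<in> A \<Longrightarrow> unsh Y \<in> A" and X: "X \<in> orth A"
  shows "sh X \<in> orth A"
proof (rule orthI[OF A])
  fix W k assume W: "W \<in> A" and k: "k \<in> Hom C W (sh X)"
  obtain d where d: "d \<in> Hom C (unsh W) X" "shm d = k"
    by (rule shm_surj[of k "unsh W" X]) (use W A k orth_Obj[OF X] in auto)
  have "d = Zer C (unsh W) X" by (rule orthD[OF X s[OF W] d(1)])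
  then show "k = Zer C W (sh X)" using d(2) W A orth_Obj[OF X] by auto
qed (use orth_Obj[OF X] in auto)

lemma orth_unsh:
  assumes A: "A \<subseteq> Obj C" and s: "\<And>Y. Y \<in> A \<Longrightarrow> sh Y \<in> A" and X: "X \<in> orth A"
  shows "unsh X \<in> orth A"
proof (rule orthI[OF A])
  fix W k assume W: "W \<in> A" and k: "k \<in> Hom C W (unsh X)"
  have "shm k = Zer C (sh W) X"
    by (rule orthD[OF X s[OF W]]) (use shm_in_Hom[OF k] orth_Obj[OF X] in auto)
  also have "\<dots> = shm (Zer C W (unsh X))" using orth_Obj[OF X] W A by auto
  finally show "k = Zer C W (unsh X)"
    by (rule shm_inj[rotated 2]) (use HomD[OF k] orth_Obj[OF X] in auto)
qed (use orth_Obj[OF X] in auto)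

lemma tri_subD:
  assumes "triangulated_subcategory C A"
  shows "A \<subseteq> Obj C" "\<And>Z. is_zero C Z \<Longrightarrow> Z \<in> A"
    "\<And>X Y. X \<in> A \<Longrightarrow> isomorphic C X Y \<Longrightarrow> Y \<in> A"
    "\<And>X. X \<in> A \<Longrightarrow> sh X \<in> A"
    "\<And>X. X \<in> Obj C \<Longrightarrow> sh X \<in> A \<Longrightarrow> X \<in> A"
    "\<And>X. X \<in> A \<Longrightarrow> unsh X \<in> A"
    "\<And>f g h. (f, g, h) \<in> Tri C \<Longrightarrow> Dom C f \<in> A \<Longrightarrow> Cod C f \<in> A \<Longrightarrow> Cod C g \<in> A"
proof -
  note a = assms[unfolded triangulated_subcategory_def]
  show A: "A \<subseteq> Obj C" "\<And>Z. is_zero C Z \<Longrightarrow> Z \<in> A"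
    "\<And>X Y. X \<in> A \<Longrightarrow> isomorphic C X Y \<Longrightarrow> Y \<in> A" using a by auto
  show sA: "sh X \<in> A" if "X \<in> A" for X using that a by blast
  show uA: "X \<in> A" if "X \<in> Obj C" "sh X \<in> A" for X
  proof -
    from that(2) a have "sh X \<in> sh ` A" by auto
    then obtain X' where "X' \<in> A" "sh X = sh X'" by blast
    then show ?thesis using sh_inj[of X X'] that A(1) by auto
  qed
  show "unsh X \<in> A" if "X \<in> A" for X
  proof -
    have "X \<in> Obj C" using that A(1) by blast
    then show ?thesis using that uA[of "unsh X"] by simp
  qed
  show "Cod C g \<in> A" if t: "(f, g, h) \<in> Tri C" "Dom C f \<in> A" "Cod C f \<in> A" for f g h
  proof -
    have "Dom C f \<in> A \<and> Dom C g \<in> A \<longrightarrow> Dom C h \<in> A" using a t(1) by blast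
    then show ?thesis using t Tri_typing[OF t(1)] by simp
  qed
qed

lemma tri_sub_fiber:
  assumes A: "triangulated_subcategory C A" and t: "(f, g, h) \<in> Tri C"
    "Cod C f \<in> A" "Cod C g \<in> A"
  shows "Dom C f \<in> A"
  using tri_subD(7)[OF A rotate[OF t(1)]] t tri_subD(5)[OF A, of "Dom C f"] Tri_typing[OF t(1)] by simp

text \<open>The transport of the structure asks for a cone that is literally of the form
  \<open>r Z\<close>, not merely isomorphic to such an object.\<close>

lemma Tri_replace_cone:
  assumes t: "(f, g, h) \<in> Tri C" and i: "is_iso C (Cod C g) Z u"
  obtains g' h' where "(f, g', h') \<in> Tri C" "Cod C g' = Z"
proof -
  obtain v where v: "v \<in> Hom C Z (Cod C g)" "v \<cdot> u = Idn C (Cod C g)" "u \<cdot> v = Idn C Z"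
    using i by (rule is_isoD)
  note tt = Tri_typing[OF t] HomD[OF v(1)] HomD[OF is_iso_Hom[OF i]]
  have "(f, u \<cdot> g, h \<cdot> v) \<in> Tri C"
    by (rule Tri_isoI[OF t, where a = "Idn C (Dom C f)" and b = "Idn C (Cod C f)" and c = u])
      (use tt v(2) i in \<open>auto simp: is_iso_Idn\<close>)
  then show ?thesis using that tt by auto
qed

end

section \<open>Bousfield localization\<close>

context triangulated_category
begin

section \<open>Morphisms with cone in \<open>A\<close>, as seen by local objects\<close>

lemma cone_inE:
  assumes "s \<in> cone_in C A"
  obtains g h where "(s, g, h) \<in> Tri C" "Cod C g \<in> A"
  using assms by (auto simp: cone_in_def)

lemma cone_in_Arr: "s \<in> cone_in C A \<Longrightarrow> s \<in> Arr C"
  by (auto elim!: cone_inE dest: Tri_typing)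

text \<open>The difference of two extensions vanishes on \<open>s\<close>, so it factors through the
  cone of \<open>s\<close>, which lies in \<open>A\<close> and has only zero morphisms to
  \<open>W\<close>.\<close>

lemma cone_ext_unique:
  assumes s: "s \<in> cone_in C A" and W: "W \<in> orth A"
    and k: "k \<in> Hom C (Cod C s) W" "k' \<in> Hom C (Cod C s) W" "k \<cdot> s = k' \<cdot> s"
  shows "k = k'"
proof -
  obtain g h where t: "(s, g, h) \<in> Tri C" and g: "Cod C g \<in> A" using s by (rule cone_inE)
  note tt = Tri_typing[OF t]
  have d: "Plus C k (neg C k') \<in> Hom C (Cod C s) W" using k by (intro Plus_in_Hom neg_in_Hom)
  have "Plus C k (neg C k') \<cdot> s = Zer C (Dom C s) W"
    using Cmp_eq_iff_diff[OF k(1,2), of s "Dom C s"] k(3) tt by (simp add: Hom_iff)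
  then obtain m where m: "m \<in> Hom C (Cod C g) W" "m \<cdot> g = Plus C k (neg C k')"
    using tri_ext[OF t d] by blast
  have "m = Zer C (Cod C g) W" by (rule orthD[OF W g m(1)])
  then have "Plus C k (neg C k') = Zer C (Cod C s) W" using m tt orth_Obj[OF W] by simp
  then show ?thesis using Plus_neg_eq_Zer_iff[OF k(1,2)] by simp
qed

text \<open>The obstruction to extending \<open>f\<close> is \<open>shm f \<cdot> h\<close>, a
  morphism from the cone to \<open>sh W\<close>. It vanishes because \<open>A\<close> is stable
  under \<open>unsh\<close>, so that \<open>sh W\<close> is local along with
  \<open>W\<close>.\<close>

lemma cone_ext:
  assumes A: "triangulated_subcategory C A"
    and s: "s \<in> cone_in C A" and W: "W \<in> orth A" and f: "f \<in> Hom C (Dom C s) W"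
  obtains k where "k \<in> Hom C (Cod C s) W" "k \<cdot> s = f"
proof -
  obtain g h where t: "(s, g, h) \<in> Tri C" and g: "Cod C g \<in> A" using s by (rule cone_inE)
  note tt = Tri_typing[OF t] and ff = HomD[OF f]
  have shW: "sh W \<in> orth A" by (rule orth_sh[OF tri_subD(1)[OF A] tri_subD(6)[OF A] W])
  have "shm f \<cdot> h = Zer C (Cod C g) (sh W)"
    by (rule orthD[OF shW g]) (use tt ff in \<open>auto simp: Hom_iff\<close>)
  then obtain k' where k': "k' \<in> Hom C (sh (Cod C s)) (sh W)" "k' \<cdot> shm s = shm f"
    using tri_ext3[OF t shm_in_Hom[OF f]] by blast
  obtain d where d: "d \<in> Hom C (Cod C s) W" "shm d = k'"
    by (rule shm_surj[OF k'(1)]) (use tt ff in auto)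
  have "shm (d \<cdot> s) = shm f" using k'(2) d(2) HomD[OF d(1)] tt by simp
  then have "d \<cdot> s = f" by (rule shm_inj[rotated 2]) (use HomD[OF d(1)] tt ff in auto)
  with d that show ?thesis by blast
qed

lemma cone_in_sh:
  assumes A: "triangulated_subcategory C A" and s: "s \<in> cone_in C A"
  shows "shm s \<in> cone_in C A"
proof -
  obtain g h where t: "(s, g, h) \<in> Tri C" and g: "Cod C g \<in> A" using s by (rule cone_inE)
  show ?thesis
    using shift_Tri[OF t] tri_subD(4)[OF A g] Tri_typing[OF t] unfolding cone_in_def by fastforce
qed

end

text \<open>Of \<open>L\<close> only functoriality is asked. Additivity, exactness,
  \<open>LA (\<eta> X) = \<eta> (LO X)\<close> and the description of kernel and image all follow
  from the universal property that \<open>L_orth\<close> and \<open>eta_cone\<close> give to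
  \<open>\<eta>\<close>.\<close>

locale bousfield = triangulated_category C
  for C :: "('o, 'm) tri_cat" (structure) +
  fixes A :: "'o set" and L :: "('o, 'm, 'o, 'm) functr" and \<eta> :: "'o \<Rightarrow> 'm"
  assumes tri_sub: "triangulated_subcategory C A"
    and L_functor: "is_functor C C L"
    and eta_nat: "nat_trans C C id_functor L \<eta>"
    and L_orth: "X \<in> Obj C \<Longrightarrow> OMap L X \<in> orth A"
    and eta_cone: "X \<in> Obj C \<Longrightarrow> \<eta> X \<in> cone_in C A"
begin

abbreviation LO :: "'o \<Rightarrow> 'o" where "LO \<equiv> OMap L"
abbreviation LA :: "'m \<Rightarrow> 'm" where "LA \<equiv> AMap L"

section \<open>Consequences of the universal property of the unit\<close>

lemmas A_Obj = tri_subD(1)[OF tri_sub]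

lemma L_typing [simp]:
  "X \<in> Obj C \<Longrightarrow> LO X \<in> Obj C"
  "X \<in> Obj C \<Longrightarrow> LA (Idn C X) = Idn C (LO X)"
  "f \<in> Arr C \<Longrightarrow> LA f \<in> Arr C"
  "f \<in> Arr C \<Longrightarrow> Dom C (LA f) = LO (Dom C f)"
  "f \<in> Arr C \<Longrightarrow> Cod C (LA f) = LO (Cod C f)"
  "f \<in> Arr C \<Longrightarrow> g \<in> Arr C \<Longrightarrow> Dom C g = Cod C f \<Longrightarrow> LA (g \<cdot> f) = LA g \<cdot> LA f"
  using is_functorD[OF L_functor] by auto

lemma eta_Hom: "X \<in> Obj C \<Longrightarrow> \<eta> X \<in> Hom C X (LO X)"
  using eta_nat by (auto simp: nat_trans_def id_functor_def)

lemma eta_typing [simp]: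
  assumes "X \<in> Obj C"
  shows "\<eta> X \<in> Arr C" "Dom C (\<eta> X) = X" "Cod C (\<eta> X) = LO X"
  using eta_Hom[OF assms] by (auto simp: Hom_iff)

lemma eta_natural: "f \<in> Arr C \<Longrightarrow> LA f \<cdot> \<eta> (Dom C f) = \<eta> (Cod C f) \<cdot> f"
  using eta_nat by (auto simp: nat_trans_def id_functor_def)

lemma eta_epi:
  assumes "X \<in> Obj C" "W \<in> orth A" "k \<in> Hom C (LO X) W" "k' \<in> Hom C (LO X) W"
    "k \<cdot> \<eta> X = k' \<cdot> \<eta> X"
  shows "k = k'"
  using cone_ext_unique[OF eta_cone[OF assms(1)] assms(2), of k k'] assms by simp

lemma eta_ext:
  assumes "X \<in> Obj C" "W \<in> orth A" "f \<in> Hom C X W"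
  obtains k where "k \<in> Hom C (LO X) W" "k \<cdot> \<eta> X = f"
  using cone_ext[OF tri_sub eta_cone[OF assms(1)] assms(2), of f] assms by auto

lemma LA_unique:
  assumes "f \<in> Hom C X Y" "k \<in> Hom C (LO X) (LO Y)" "k \<cdot> \<eta> X = \<eta> Y \<cdot> f"
  shows "LA f = k"
proof (rule eta_epi[of X "LO Y"])
  show "LA f \<cdot> \<eta> X = k \<cdot> \<eta> X" using eta_natural[of f] HomD[OF assms(1)] assms(3) by simp
qed (use HomD[OF assms(1)] assms(2) in \<open>auto simp: Hom_iff L_orth\<close>)

lemma LA_in_Hom: "f \<in> Hom C X Y \<Longrightarrow> LA f \<in> Hom C (LO X) (LO Y)"
  by (rule is_functor_Hom[OF L_functor])

text \<open>The inverse of \<open>LA s\<close> is \<open>\<eta> (Dom C s)\<close>, extended first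
  along \<open>s\<close> and then along \<open>\<eta> (Cod C s)\<close>; both extensions exist
  because \<open>LO (Dom C s)\<close> is local.\<close>

lemma L_inverts:
  assumes s: "s \<in> cone_in C A"
  shows "is_iso C (LO (Dom C s)) (LO (Cod C s)) (LA s)"
proof -
  let ?X = "Dom C s" and ?Y = "Cod C s"
  have sA: "s \<in> Arr C" using s by (rule cone_in_Arr)
  then have X: "?X \<in> Obj C" and Y: "?Y \<in> Obj C" by auto
  obtain m where m: "m \<in> Hom C ?Y (LO ?X)" "m \<cdot> s = \<eta> ?X"
    using cone_ext[OF tri_sub s L_orth[OF X] eta_Hom[OF X]] by blast
  obtain m' where m': "m' \<in> Hom C (LO ?Y) (LO ?X)" "m' \<cdot> \<eta> ?Y = m"
    using eta_ext[OF Y L_orth[OF X] m(1)] by blast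
  note tt = sA HomD[OF m(1)] HomD[OF m'(1)]
  have 1: "m' \<cdot> LA s = Idn C (LO ?X)"
  proof (rule eta_epi[OF X L_orth[OF X]])
    show "(m' \<cdot> LA s) \<cdot> \<eta> ?X = Idn C (LO ?X) \<cdot> \<eta> ?X"
      using tt m(2) by (simp add: eta_natural Cmp_reassoc[OF m'(2)])
  qed (use tt in \<open>auto simp: Hom_iff\<close>)
  have 2: "LA s \<cdot> m = \<eta> ?Y"
    by (rule cone_ext_unique[OF s L_orth[OF Y]])
      (use tt in \<open>auto simp: Hom_iff m(2) eta_natural\<close>)
  have 3: "LA s \<cdot> m' = Idn C (LO ?Y)"
  proof (rule eta_epi[OF Y L_orth[OF Y]])
    show "(LA s \<cdot> m') \<cdot> \<eta> ?Y = Idn C (LO ?Y) \<cdot> \<eta> ?Y" using tt by (simp add: m'(2) 2)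
  qed (use tt in \<open>auto simp: Hom_iff\<close>)
  show ?thesis using 1 3 m'(1) tt by (auto simp: is_iso_def Hom_iff)
qed

text \<open>The sum of \<open>LA f\<close> and \<open>LA g\<close> fits into the naturality square
  of \<open>Plus C f g\<close>, and the morphism that does so is unique.\<close>

lemma L_additive: "is_additive C C L"
  unfolding is_additive_def
proof (intro conjI ballI)
  fix X Y f g assume f: "f \<in> Hom C X Y" and g: "g \<in> Hom C X Y"
  note tt = HomD[OF f] HomD[OF g]
  show "LA (Plus C f g) = Plus C (LA f) (LA g)"
    by (rule LA_unique[OF Plus_in_Hom[OF f g]])
      (use tt eta_natural[of f] eta_natural[of g] in \<open>auto simp: Hom_iff Plus_Cmp_Arr Cmp_Plus_Arr\<close>)
qed (rule L_functor)

lemma LA_Zer [simp]: "X \<in> Obj C \<Longrightarrow> Y \<in> Obj C \<Longrightarrow> LA (Zer C X Y) = Zer C (LO X) (LO Y)"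
  by (rule is_additive_Zer[OF additive_category_axioms additive_category_axioms L_additive])

lemma eta_iso_if_orth:
  assumes X: "X \<in> orth A"
  shows "is_iso C X (LO X) (\<eta> X)"
proof -
  have Xo: "X \<in> Obj C" by (rule orth_Obj[OF X])
  obtain r where r: "r \<in> Hom C (LO X) X" "r \<cdot> \<eta> X = Idn C X"
    using eta_ext[OF Xo X Idn_in_Hom[OF Xo]] by blast
  note tt = Xo HomD[OF r(1)]
  have "\<eta> X \<cdot> r = Idn C (LO X)"
  proof (rule eta_epi[OF Xo L_orth[OF Xo]])
    show "(\<eta> X \<cdot> r) \<cdot> \<eta> X = Idn C (LO X) \<cdot> \<eta> X" using tt r(2) by simp
  qed (use tt in \<open>auto simp: Hom_iff\<close>)
  then show ?thesis using r tt by (auto simp: is_iso_def Hom_iff)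
qed

lemma LA_eta: "X \<in> Obj C \<Longrightarrow> LA (\<eta> X) = \<eta> (LO X)"
  by (rule LA_unique[of _ X]) (auto simp: Hom_iff)

lemma Im_eq: "Im C L = orth A"
proof
  show "Im C L \<subseteq> orth A"
    using orth_iso[OF A_Obj L_orth] isomorphic_sym by (auto simp: essential_image_def)
  show "orth A \<subseteq> Im C L"
    using eta_iso_if_orth orth_Obj by (auto simp: essential_image_def isomorphic_def)
qed

lemma orth_sh': "X \<in> orth A \<Longrightarrow> sh X \<in> orth A"
  by (rule orth_sh[OF A_Obj tri_subD(6)[OF tri_sub]])

lemma orth_unsh': "X \<in> orth A \<Longrightarrow> unsh X \<in> orth A"
  by (rule orth_unsh[OF A_Obj tri_subD(4)[OF tri_sub]])

text \<open>For \<open>X\<close> in \<open>A\<close> the unit is zero, so the identity and the zero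
  of \<open>LO X\<close> agree after it. Conversely, if \<open>LO X\<close> vanishes, then the
  target and the cone of \<open>\<eta> X\<close> both lie in \<open>A\<close>, hence so does its
  source \<open>X\<close>.\<close>

lemma Ker_eq: "Ker C L = A"
proof
  show "A \<subseteq> Ker C L"
  proof
    fix X assume X: "X \<in> A"
    then have Xo: "X \<in> Obj C" using A_Obj by blast
    have e0: "\<eta> X = Zer C X (LO X)" by (rule orthD[OF L_orth[OF Xo] X eta_Hom[OF Xo]])
    have "Idn C (LO X) = Zer C (LO X) (LO X)"
      by (rule eta_epi[OF Xo L_orth[OF Xo]]) (use Xo e0 in \<open>auto simp: Hom_iff\<close>)
    then show "X \<in> Ker C L" using Xo by (simp add: Ker_def is_zero_iff)
  qed
  show "Ker C L \<subseteq> A"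
  proof
    fix X assume X: "X \<in> Ker C L"
    then have Xo: "X \<in> Obj C" and z: "is_zero C (LO X)" by (auto simp: Ker_def)
    obtain g h where t: "(\<eta> X, g, h) \<in> Tri C" and g: "Cod C g \<in> A"
      using eta_cone[OF Xo] by (rule cone_inE)
    have "Cod C (\<eta> X) \<in> A" using tri_subD(2)[OF tri_sub z] Xo by simp
    then have "Dom C (\<eta> X) \<in> A" by (rule tri_sub_fiber[OF tri_sub t _ g])
    then show "X \<in> A" using Xo by simp
  qed
qed

text \<open>A natural isomorphism \<open>\<phi>\<close> exhibiting \<open>L\<close> as an exact functor need not be compatible with \<open>\<eta>\<close>.
  The following one is, by construction, and it also makes \<open>L\<close> exact.\<close>

definition psi :: "'o \<Rightarrow> 'm" where
  "psi X = (SOME k. k \<in> Hom C (LO (sh X)) (sh (LO X)) \<and> k \<cdot> \<eta> (sh X) = shm (\<eta> X))"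

lemma psi:
  assumes X: "X \<in> Obj C"
  shows "psi X \<in> Hom C (LO (sh X)) (sh (LO X))" "psi X \<cdot> \<eta> (sh X) = shm (\<eta> X)"
proof -
  obtain k where "k \<in> Hom C (LO (sh X)) (sh (LO X))" "k \<cdot> \<eta> (sh X) = shm (\<eta> X)"
    using eta_ext[of "sh X" "sh (LO X)" "shm (\<eta> X)"] orth_sh'[OF L_orth[OF X]] X
    by (auto simp: Hom_iff)
  then have "\<exists>k. k \<in> Hom C (LO (sh X)) (sh (LO X)) \<and> k \<cdot> \<eta> (sh X) = shm (\<eta> X)" by blast
  from someI_ex[OF this] show "psi X \<in> Hom C (LO (sh X)) (sh (LO X))"
    "psi X \<cdot> \<eta> (sh X) = shm (\<eta> X)" by (simp_all add: psi_def)
qed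

lemma psi_typing [simp]:
  assumes "X \<in> Obj C"
  shows "psi X \<in> Arr C" "Dom C (psi X) = LO (sh X)" "Cod C (psi X) = sh (LO X)"
  using psi(1)[OF assms] by (auto simp: Hom_iff)

text \<open>Both \<open>\<eta> (sh X)\<close> and \<open>shm (\<eta> X)\<close> are reflections of
  \<open>sh X\<close>: each has its cone in \<open>A\<close> and a local target.\<close>

lemma psi_iso:
  assumes X: "X \<in> Obj C"
  shows "is_iso C (LO (sh X)) (sh (LO X)) (psi X)"
proof -
  have s: "shm (\<eta> X) \<in> cone_in C A" by (rule cone_in_sh[OF tri_sub eta_cone[OF X]])
  have "\<eta> (sh X) \<in> Hom C (Dom C (shm (\<eta> X))) (LO (sh X))" using X by (auto simp: Hom_iff)
  then obtain k where k: "k \<in> Hom C (Cod C (shm (\<eta> X))) (LO (sh X))" "k \<cdot> shm (\<eta> X) = \<eta> (sh X)"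
    using cone_ext[OF tri_sub s L_orth[OF sh_Obj[OF X]]] X by auto
  note tt = X HomD[OF k(1)]
  have 1: "k \<cdot> psi X = Idn C (LO (sh X))"
  proof (rule eta_epi[of "sh X" "LO (sh X)"])
    show "(k \<cdot> psi X) \<cdot> \<eta> (sh X) = Idn C (LO (sh X)) \<cdot> \<eta> (sh X)"
      using tt k(2) by (simp add: psi)
  qed (use tt in \<open>auto simp: Hom_iff L_orth\<close>)
  have 2: "psi X \<cdot> k = Idn C (sh (LO X))"
  proof (rule cone_ext_unique[OF s, of "sh (LO X)"])
    show "(psi X \<cdot> k) \<cdot> shm (\<eta> X) = Idn C (sh (LO X)) \<cdot> shm (\<eta> X)"
      using tt k(2) by (simp add: psi)
  qed (use tt in \<open>auto simp: Hom_iff L_orth orth_sh'\<close>)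
  show ?thesis using 1 2 tt k by (auto simp: is_iso_def Hom_iff)
qed

lemma psi_natural:
  assumes f: "f \<in> Arr C"
  shows "shm (LA f) \<cdot> psi (Dom C f) = psi (Cod C f) \<cdot> LA (shm f)"
proof (rule eta_epi[of "sh (Dom C f)" "sh (LO (Cod C f))"])
  have "(shm (LA f) \<cdot> psi (Dom C f)) \<cdot> \<eta> (sh (Dom C f)) = shm (LA f \<cdot> \<eta> (Dom C f))"
    using f by (simp add: psi)
  also have "\<dots> = shm (\<eta> (Cod C f)) \<cdot> shm f" using f by (simp add: eta_natural)
  also have "\<dots> = (psi (Cod C f) \<cdot> LA (shm f)) \<cdot> \<eta> (sh (Dom C f))"
    using f eta_natural[of "shm f"] by (simp add: Cmp_reassoc[OF psi(2)])
  finally show "(shm (LA f) \<cdot> psi (Dom C f)) \<cdot> \<eta> (sh (Dom C f)) =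
    (psi (Cod C f) \<cdot> LA (shm f)) \<cdot> \<eta> (sh (Dom C f))" .
qed (use f in \<open>auto simp: Hom_iff orth_sh' L_orth\<close>)

lemma psi_nat_iso: "nat_iso C C (comp_functor L (Shift C)) (comp_functor (Shift C) L) psi"
  unfolding nat_iso_def nat_trans_def comp_functor_def
  using psi(1) psi_iso psi_natural by auto

lemma orth_cone':
  "(f, g, h) \<in> Tri C \<Longrightarrow> Dom C f \<in> orth A \<Longrightarrow> Cod C f \<in> orth A \<Longrightarrow> Cod C g \<in> orth A"
  using orth_cone[OF A_Obj] orth_sh' by blast

text \<open>Exactness is a five lemma argument, carried out on morphisms into local objects.\<close>

lemma L_triangle:
  assumes t: "(f, g, h) \<in> Tri C"
  shows "(LA f, LA g, psi (Dom C f) \<cdot> LA h) \<in> Tri C"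
proof -
  note tt = Tri_typing[OF t]
  define X Y Z where "X = Dom C f" and "Y = Cod C f" and "Z = Cod C g"
  have o: "X \<in> Obj C" "Y \<in> Obj C" "Z \<in> Obj C" using tt by (auto simp: X_def Y_def Z_def)
  have ty [simp]: "f \<in> Arr C" "Dom C f = X" "Cod C f = Y" "g \<in> Arr C" "Dom C g = Y" "Cod C g = Z"
    "h \<in> Arr C" "Dom C h = Z" "Cod C h = sh X"
    using tt by (auto simp: X_def Y_def Z_def)
  note [simp] = o
  obtain g' h' where t': "(LA f, g', h') \<in> Tri C" using Tri_complete[of "LA f"] by auto
  define Z' where "Z' = Cod C g'"
  have ty' [simp]: "g' \<in> Arr C" "Dom C g' = LO Y" "Cod C g' = Z'" "h' \<in> Arr C" "Dom C h' = Z'"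
    "Cod C h' = sh (LO X)"
    using Tri_typing[OF t'] by (auto simp: Z'_def)
  then have Z'o [simp]: "Z' \<in> Obj C" using Obj_typing(2)[of g'] by simp
  have Z': "Z' \<in> orth A" using orth_cone'[OF t'] by (simp add: L_orth)
  \<comment> \<open>\<open>Tri_morphism\<close> gives \<open>c\<close>, which extends along
    \<open>\<eta> Z\<close> because \<open>Z'\<close> is local. The extension \<open>u\<close> is to
    be an isomorphism from \<open>LO Z\<close> to the cone of \<open>LA f\<close>; its inverse
    \<open>w\<close> is built by hand.\<close>
  obtain c where c: "c \<in> Hom C Z Z'" "c \<cdot> g = g' \<cdot> \<eta> Y" "shm (\<eta> X) \<cdot> h = h' \<cdot> c"
    using Tri_morphism[OF t t', of "\<eta> X" "\<eta> Y"] eta_natural[of f] by (auto simp: Hom_iff)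
  obtain u where u: "u \<in> Hom C (LO Z) Z'" "u \<cdot> \<eta> Z = c"
    using eta_ext[OF _ Z' c(1)] by auto
  have [simp]: "c \<in> Arr C" "Dom C c = Z" "Cod C c = Z'" "u \<in> Arr C" "Dom C u = LO Z" "Cod C u = Z'"
    using c(1) u(1) by (auto simp: Hom_iff)
  have hom: "k \<in> Hom C U V" if "k \<in> Arr C" "Dom C k = U" "Cod C k = V" for k U V
    using that by (simp add: Hom_iff)
  have sX: "shm (\<eta> X) \<in> cone_in C A" and sY: "shm (\<eta> Y) \<in> cone_in C A"
    using cone_in_sh[OF tri_sub eta_cone] by auto
  have "LA (g \<cdot> f) = LA (Zer C X Z)" using comp_zero[OF t] by simp
  then have "LA g \<cdot> LA f = Zer C (LO X) (LO Z)" by simp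
  then obtain v where v: "v \<in> Hom C Z' (LO Z)" "v \<cdot> g' = LA g"
    using tri_ext[OF t' hom, of "LA g" "LO Z"] by auto
  have [simp]: "v \<in> Arr C" "Dom C v = Z'" "Cod C v = LO Z" using v(1) by (auto simp: Hom_iff)
  have vcg: "v \<cdot> (c \<cdot> g) = \<eta> Z \<cdot> g"
    using eta_natural[of g] by (simp add: c(2) Cmp_reassoc[OF v(2)])
  \<comment> \<open>\<open>v \<cdot> c\<close> need not be \<open>\<eta> Z\<close>. The defect
    \<open>e\<close> vanishes on \<open>g\<close>, hence factors through \<open>h\<close>, and then
    extends to a morphism \<open>m'\<close> on \<open>sh (LO X)\<close>. Subtracting
    \<open>m' \<cdot> h'\<close> from \<open>v\<close> removes the defect and does not change
    \<open>v \<cdot> g'\<close>.\<close>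
  define e where "e = Plus C (v \<cdot> c) (neg C (\<eta> Z))"
  have [simp]: "e \<in> Arr C" "Dom C e = Z" "Cod C e = LO Z" by (simp_all add: e_def)
  have "e \<cdot> g = Zer C Y (LO Z)" unfolding e_def
    using Cmp_eq_iff_diff[OF hom hom hom, of "v \<cdot> c" Z "LO Z" "\<eta> Z" g Y] vcg by simp
  then obtain m where m: "m \<in> Hom C (sh X) (LO Z)" "m \<cdot> h = e"
    using tri_ext2[OF t hom, of e "LO Z"] by auto
  obtain m' where m': "m' \<in> Hom C (sh (LO X)) (LO Z)" "m' \<cdot> shm (\<eta> X) = m"
    using cone_ext[OF tri_sub sX L_orth[of Z], of m] m(1) by auto
  have [simp]: "m' \<in> Arr C" "Dom C m' = sh (LO X)" "Cod C m' = LO Z" "m \<in> Arr C" "Dom C m = sh X"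
     "Cod C m = LO Z" using m m' by (auto simp: Hom_iff)
  have m'hc: "m' \<cdot> (h' \<cdot> c) = e"
    using m(2) by (simp add: c(3)[symmetric] Cmp_reassoc[OF m'(2)])
  define w where "w = Plus C v (neg C (m' \<cdot> h'))"
  have [simp]: "w \<in> Arr C" "Dom C w = Z'" "Cod C w = LO Z" by (simp_all add: w_def)
  have wc: "w \<cdot> c = \<eta> Z"
  proof -
    have vc: "v \<cdot> c \<in> Hom C Z (LO Z)" and ez: "neg C (\<eta> Z) \<in> Hom C Z (LO Z)"
      by (auto simp: Hom_iff)
    have eh: "e \<in> Hom C Z (LO Z)" by (auto simp: Hom_iff)
    have "Plus C e (\<eta> Z) = Plus C (v \<cdot> c) (Plus C (neg C (\<eta> Z)) (\<eta> Z))"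
      unfolding e_def by (rule Plus_assoc[OF vc ez eta_Hom]) simp
    also have "\<dots> = v \<cdot> c" using Plus_neg_left[OF eta_Hom[of Z]] Plus_Zer_right[OF vc] by simp
    finally have e1: "v \<cdot> c = Plus C (\<eta> Z) e" using Plus_comm[OF eh eta_Hom] by simp
    have "w \<cdot> c = Plus C (v \<cdot> c) (neg C e)"
      unfolding w_def by (simp add: Plus_Cmp_Arr neg_Cmp m'hc)
    also have "\<dots> = Plus C (\<eta> Z) (Plus C e (neg C e))"
      unfolding e1 by (rule Plus_assoc[OF eta_Hom eh neg_in_Hom[OF eh]]) simp
    also have "\<dots> = \<eta> Z" using Plus_neg_right[OF eh] Plus_Zer_right[OF eta_Hom[of Z]] by simp
    finally show ?thesis .
  qed
  have wg: "w \<cdot> g' = LA g"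
    using comp_zero2[OF t'] Plus_Zer_right[of "LA g" "LO Y" "LO Z"]
    unfolding w_def by (simp add: Plus_Cmp_Arr neg_Cmp v(2) neg_Zer Hom_iff)
  have ug: "u \<cdot> LA g = g'"
  proof (rule eta_epi[of Y Z'])
    show "(u \<cdot> LA g) \<cdot> \<eta> Y = g' \<cdot> \<eta> Y"
      using eta_natural[of g] by (simp add: Cmp_reassoc[OF u(2)] c(2))
  qed (auto simp: Hom_iff Z')
  have hu: "h' \<cdot> u = psi X \<cdot> LA h"
  proof (rule eta_epi[of Z "sh (LO X)"])
    show "(h' \<cdot> u) \<cdot> \<eta> Z = (psi X \<cdot> LA h) \<cdot> \<eta> Z"
      using eta_natural[of h] by (simp add: u(2) c(3)[symmetric] Cmp_reassoc[OF psi(2)])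
  qed (auto simp: Hom_iff orth_sh' L_orth)
  have wu: "w \<cdot> u = Idn C (LO Z)"
  proof (rule eta_epi[of Z "LO Z"])
    show "(w \<cdot> u) \<cdot> \<eta> Z = Idn C (LO Z) \<cdot> \<eta> Z" by (simp add: u(2) wc)
  qed (auto simp: Hom_iff L_orth)
  have uw: "u \<cdot> w = Idn C Z'"
  proof -
    \<comment> \<open>\<open>d\<close> vanishes on both \<open>g'\<close> and \<open>c\<close>. The
      first gives \<open>d = n \<cdot> h'\<close>; the second shows that \<open>n\<close> factors
      through \<open>shm (LA f)\<close>, whose composite with \<open>h'\<close> is zero.\<close>
    define d where "d = Plus C (u \<cdot> w) (neg C (Idn C Z'))"
    have [simp]: "d \<in> Arr C" "Dom C d = Z'" "Cod C d = Z'" by (simp_all add: d_def)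
    have dg: "d \<cdot> g' = Zer C (LO Y) Z'" unfolding d_def
      using Cmp_eq_iff_diff[OF hom hom hom, of "u \<cdot> w" Z' Z' "Idn C Z'" g' "LO Y"] by (simp add: wg ug)
    have dc: "d \<cdot> c = Zer C Z Z'" unfolding d_def
      using Cmp_eq_iff_diff[OF hom hom hom, of "u \<cdot> w" Z' Z' "Idn C Z'" c Z] by (simp add: wc u(2))
    obtain n where n: "n \<in> Hom C (sh (LO X)) Z'" "n \<cdot> h' = d"
      using tri_ext2[OF t' hom, of d Z'] dg by auto
    have [simp]: "n \<in> Arr C" "Dom C n = sh (LO X)" "Cod C n = Z'" using n(1) by (auto simp: Hom_iff)
    have "(n \<cdot> shm (\<eta> X)) \<cdot> h = Zer C Z Z'"
      using dc by (simp add: c(3) Cmp_reassoc[OF n(2)])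
    then obtain p where p: "p \<in> Hom C (sh Y) Z'" "p \<cdot> shm f = n \<cdot> shm (\<eta> X)"
      using tri_ext3[OF t hom, of "n \<cdot> shm (\<eta> X)" Z'] by auto
    obtain q where q: "q \<in> Hom C (sh (LO Y)) Z'" "q \<cdot> shm (\<eta> Y) = p"
      using cone_ext[OF tri_sub sY Z', of p] p(1) by auto
    have [simp]: "q \<in> Arr C" "Dom C q = sh (LO Y)" "Cod C q = Z'" "p \<in> Arr C" "Dom C p = sh Y"
      using p q by (auto simp: Hom_iff)
    have "q \<cdot> shm (LA f \<cdot> \<eta> X) = n \<cdot> shm (\<eta> X)"
      using eta_natural[of f] by (simp add: p(2) Cmp_reassoc[OF q(2)])
    then have qn: "q \<cdot> shm (LA f) = n"
      by - (rule cone_ext_unique[OF sX Z'], auto simp: Hom_iff)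
    have "d = q \<cdot> (shm (LA f) \<cdot> h')" by (simp add: n(2) Cmp_reassoc[OF qn])
    also have "\<dots> = Zer C Z' Z'" using comp_zero3[OF t'] by simp
    finally show ?thesis unfolding d_def
      using Plus_neg_eq_Zer_iff[OF hom hom, of "u \<cdot> w" Z' Z' "Idn C Z'"] by simp
  qed
  have iw: "is_iso C Z' (LO Z) w"
    using wu uw by (auto simp: is_iso_def Hom_iff)
  show ?thesis
  proof (rule Tri_isoI[OF t', where a = "Idn C (LO X)" and b = "Idn C (LO Y)" and c = w])
    have "h' = h' \<cdot> (u \<cdot> w)" by (simp add: uw)
    also have "\<dots> = (psi X \<cdot> LA h) \<cdot> w" by (simp add: Cmp_reassoc[OF hu])
    finally show "shm (Idn C (LO X)) \<cdot> h' = (psi (Dom C f) \<cdot> LA h) \<cdot> w" by simp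
  qed (use iw in \<open>auto simp: is_iso_Idn wg\<close>)
qed

lemma L_exact: "exact_functor C C L psi"
  unfolding exact_functor_def
  using triangulated_category_axioms L_additive psi_nat_iso L_triangle by auto

lemma L_localization_functor: "localization_functor C L"
  unfolding localization_functor_def
proof (intro conjI exI)
  show "\<forall>X\<in>Obj C. LA (\<eta> X) = \<eta> (LO X) \<and> is_iso C (LO X) (LO (LO X)) (\<eta> (LO X))"
    using LA_eta eta_iso_if_orth[OF L_orth] by auto
qed (rule L_exact eta_nat)+

text \<open>If \<open>LA s\<close> is invertible, exactness of \<open>L\<close> makes
  \<open>L\<close> vanish on the cone of \<open>s\<close>, which therefore lies in the kernel
  \<open>A\<close>. Thus \<open>cone_in C A\<close> is saturated, and its closure under composition
  reduces to that of isomorphisms.\<close>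

lemma cone_in_iff: "s \<in> cone_in C A \<longleftrightarrow> s \<in> Arr C \<and> is_iso C (LO (Dom C s)) (LO (Cod C s)) (LA s)"
proof (intro iffI conjI)
  assume s: "s \<in> Arr C \<and> is_iso C (LO (Dom C s)) (LO (Cod C s)) (LA s)"
  then obtain g h where t: "(s, g, h) \<in> Tri C" using Tri_complete by blast
  have "is_zero C (Cod C (LA g))"
    by (rule zero_cone_if_is_iso[OF L_triangle[OF t]]) (use s in blast)
  then have "Cod C g \<in> A" using Tri_typing[OF t] by (simp add: Ker_eq[symmetric] Ker_def)
  then show "s \<in> cone_in C A" using t by (auto simp: cone_in_def)
qed (auto intro: L_inverts cone_in_Arr)

end

text \<open>As \<open>AMap L (\<eta> X)\<close> equals the isomorphism
  \<open>\<eta> (OMap L X)\<close>, exactness makes \<open>L\<close> kill the cone of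
  \<open>\<eta> X\<close>. A morphism from the kernel to \<open>OMap L X\<close>, followed by
  \<open>\<eta> (OMap L X)\<close>, factors by naturality through a zero object, so it is zero.
  Hence an arbitrary localization functor whose kernel is a triangulated subcategory can be treated
  like a constructed one.\<close>

lemma (in triangulated_category) localization_functor_bousfield:
  assumes L: "localization_functor C L" and A: "triangulated_subcategory C (Ker C L)"
  shows "\<exists>\<eta>. bousfield C (Ker C L) L \<eta>"
proof -
  obtain \<phi> where ex: "exact_functor C C L \<phi>" using L by (auto simp: localization_functor_def)
  then have add: "is_additive C C L"
    and nat: "nat_iso C C (comp_functor L (Shift C)) (comp_functor (Shift C) L) \<phi>"
    and tri: "\<And>f g h. (f, g, h) \<in> Tri C \<Longrightarrow> (AMap L f, AMap L g, \<phi> (Dom C f) \<cdot> AMap L h) \<in> Tri C"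
    by (auto simp: exact_functor_def)
  obtain \<eta> where \<eta>: "nat_trans C C id_functor L \<eta>"
    and \<eta>L: "\<And>X. X \<in> Obj C \<Longrightarrow> AMap L (\<eta> X) = \<eta> (OMap L X)"
    and \<eta>i: "\<And>X. X \<in> Obj C \<Longrightarrow> is_iso C (OMap L X) (OMap L (OMap L X)) (\<eta> (OMap L X))"
    using L by (auto simp: localization_functor_def)
  note F = is_additiveD(1)[OF add] and Fd = is_functorD[OF is_additiveD(1)[OF add]]
  have \<eta>H: "\<eta> X \<in> Hom C X (OMap L X)" if "X \<in> Obj C" for X
    using \<eta> that by (auto simp: nat_trans_def id_functor_def)
  have \<eta>n: "AMap L f \<cdot> \<eta> (Dom C f) = \<eta> (Cod C f) \<cdot> f" if "f \<in> Arr C" for f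
    using \<eta> that by (auto simp: nat_trans_def id_functor_def)
  have "bousfield C (Ker C L) L \<eta>"
  proof (unfold_locales)
    fix X assume X: "X \<in> Obj C"
    obtain g h where t: "(\<eta> X, g, h) \<in> Tri C" using Tri_complete[OF HomD(1)[OF \<eta>H[OF X]]] by blast
    have "is_zero C (Cod C (AMap L g))"
      by (rule zero_cone_if_is_iso[OF tri[OF t]]) (use \<eta>L[OF X] \<eta>i[OF X] in simp)
    then show "\<eta> X \<in> cone_in C (Ker C L)"
      using t Tri_typing[OF t] Fd by (auto simp: cone_in_def Ker_def)
    show "OMap L X \<in> orth (Ker C L)"
    proof (rule orthI)
      fix Y f assume Y: "Y \<in> Ker C L" and f: "f \<in> Hom C Y (OMap L X)"
      then have z: "is_zero C (OMap L Y)" and Yo: "Y \<in> Obj C" by (auto simp: Ker_def)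
      note LX = Fd(3)[OF X]
      note tt = HomD[OF f] X LX HomD[OF \<eta>H[OF LX]] HomD[OF \<eta>H[OF Yo]]
      have "AMap L f = Zer C (OMap L Y) (OMap L (OMap L X))"
        by (rule is_zero_Hom_from[OF z is_functor_Hom[OF F f]])
      then have "\<eta> (OMap L X) \<cdot> f = Zer C Y (OMap L (OMap L X))"
        using \<eta>n[of f] tt by simp
      moreover obtain r where r: "r \<in> Hom C (OMap L (OMap L X)) (OMap L X)"
          "r \<cdot> \<eta> (OMap L X) = Idn C (OMap L X)" "\<eta> (OMap L X) \<cdot> r = Idn C (OMap L (OMap L X))"
        using \<eta>i[OF X] by (rule is_isoD)
      moreover have "f = r \<cdot> (\<eta> (OMap L X) \<cdot> f)"
        using tt HomD[OF r(1)] by (simp add: Cmp_reassoc[OF r(2)])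
      ultimately show "f = Zer C Y (OMap L X)" using HomD[OF r(1)] Yo by simp
    qed (use X Fd in \<open>auto simp: Ker_def\<close>)
  qed (use A F \<eta> in auto)
  then show ?thesis by blast
qed

section \<open>Transport of a triangulated structure along a fully faithful functor\<close>

text \<open>\<open>D\<close> is only assumed to be a category; its operations merely correspond to
  those of \<open>C\<close> under the fully faithful \<open>\<rho>\<close>. As \<open>r\<close> need
  not be surjective, \<open>r_zero\<close>, \<open>r_coproduct\<close> and \<open>r_cone\<close> ask
  that the objects formed in \<open>C\<close> can be found in its image. The locale serves both the
  quotient and the local objects.\<close>

locale triangulated_transport = triangulated_category C + D: category D
  for C :: "('o, 'm) tri_cat" (structure) and D :: "('p, 'n) tri_cat" (structure) +
  fixes r :: "'p \<Rightarrow> 'o" and \<rho> :: "'n \<Rightarrow> 'm" and \<phi> :: "'p \<Rightarrow> 'm"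
  assumes r_Obj [simp]: "X \<in> Obj D \<Longrightarrow> r X \<in> Obj C"
    and rho_bij: "X \<in> Obj D \<Longrightarrow> Y \<in> Obj D \<Longrightarrow> bij_betw \<rho> (Hom D X Y) (Hom C (r X) (r Y))"
    and rho_Idn [simp]: "X \<in> Obj D \<Longrightarrow> \<rho> (Idn D X) = Idn C (r X)"
    and rho_Cmp [simp]: "f \<in> Arr D \<Longrightarrow> g \<in> Arr D \<Longrightarrow> Dom D g = Cod D f \<Longrightarrow>
      \<rho> (g \<cdot>\<^bsub>D\<^esub> f) = \<rho> g \<cdot> \<rho> f"
    and Plus_Hom: "f \<in> Hom D X Y \<Longrightarrow> g \<in> Hom D X Y \<Longrightarrow> Plus D f g \<in> Hom D X Y"
    and rho_Plus: "f \<in> Hom D X Y \<Longrightarrow> g \<in> Hom D X Y \<Longrightarrow> \<rho> (Plus D f g) = Plus C (\<rho> f) (\<rho> g)"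
    and Zer_Hom: "X \<in> Obj D \<Longrightarrow> Y \<in> Obj D \<Longrightarrow> Zer D X Y \<in> Hom D X Y"
    and rho_Zer: "X \<in> Obj D \<Longrightarrow> Y \<in> Obj D \<Longrightarrow> \<rho> (Zer D X Y) = Zer C (r X) (r Y)"
    and r_zero: "\<exists>Z\<in>Obj D. is_zero C (r Z)"
    and r_coproduct: "range V \<subseteq> Obj D \<Longrightarrow>
      \<exists>P\<in>Obj D. \<exists>\<iota>. is_coproduct C (UNIV :: bool set) (\<lambda>i. r (V i)) (r P) \<iota>"
    and D_shift: "is_functor D D (Shift D)"
    and D_shift_Obj: "bij_betw (OMap (Shift D)) (Obj D) (Obj D)"
    and D_shift_Arr: "bij_betw (AMap (Shift D)) (Arr D) (Arr D)"
    and phi_iso: "X \<in> Obj D \<Longrightarrow> is_iso C (r (OMap (Shift D) X)) (sh (r X)) (\<phi> X)"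
    and phi_natural: "f \<in> Arr D \<Longrightarrow>
      shm (\<rho> f) \<cdot> \<phi> (Dom D f) = \<phi> (Cod D f) \<cdot> \<rho> (AMap (Shift D) f)"
    and D_Tri_shape: "t \<in> Tri D \<Longrightarrow> triangle_shape D (Shift D) t"
    and D_Tri_iff: "triangle_shape D (Shift D) (f, g, h) \<Longrightarrow>
      (f, g, h) \<in> Tri D \<longleftrightarrow> (\<rho> f, \<rho> g, \<phi> (Dom D f) \<cdot> \<rho> h) \<in> Tri C"
    and r_cone: "f \<in> Arr D \<Longrightarrow> \<exists>Z\<in>Obj D. \<exists>g h. (\<rho> f, g, h) \<in> Tri C \<and> Cod C g = r Z"
begin

abbreviation dsh :: "'p \<Rightarrow> 'p" where "dsh \<equiv> OMap (Shift D)"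
abbreviation dshm :: "'n \<Rightarrow> 'n" where "dshm \<equiv> AMap (Shift D)"

lemma rho_Hom: "f \<in> Hom D X Y \<Longrightarrow> \<rho> f \<in> Hom C (r X) (r Y)"
  using rho_bij[of X Y] D.HomD[of f X Y] by (auto simp: bij_betw_def)

lemma rho_typing [simp]:
  assumes "f \<in> Arr D"
  shows "\<rho> f \<in> Arr C" "Dom C (\<rho> f) = r (Dom D f)" "Cod C (\<rho> f) = r (Cod D f)"
  using rho_Hom[of f "Dom D f" "Cod D f"] assms by (auto simp: D.Hom_iff Hom_iff)

lemma rho_inj: "f \<in> Hom D X Y \<Longrightarrow> g \<in> Hom D X Y \<Longrightarrow> \<rho> f = \<rho> g \<Longrightarrow> f = g"
  using rho_bij[of X Y] D.HomD[of f X Y] by (auto simp: bij_betw_def dest: inj_onD)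

lemma rho_surj:
  assumes "k \<in> Hom C (r X) (r Y)" "X \<in> Obj D" "Y \<in> Obj D"
  obtains d where "d \<in> Hom D X Y" "\<rho> d = k"
proof -
  have "k \<in> \<rho> ` Hom D X Y" using bij_betw_imp_surj_on[OF rho_bij[OF assms(2,3)]] assms(1) by simp
  then show ?thesis using that by blast
qed

lemma D_shift_typing [simp]:
  "X \<in> Obj D \<Longrightarrow> dsh X \<in> Obj D"
  "f \<in> Arr D \<Longrightarrow> dshm f \<in> Arr D"
  "f \<in> Arr D \<Longrightarrow> Dom D (dshm f) = dsh (Dom D f)"
  "f \<in> Arr D \<Longrightarrow> Cod D (dshm f) = dsh (Cod D f)"
  using is_functorD[OF D_shift] by auto

lemma phi_typing [simp]:
  assumes "X \<in> Obj D"
  shows "\<phi> X \<in> Arr C" "Dom C (\<phi> X) = r (dsh X)" "Cod C (\<phi> X) = sh (r X)"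
  using is_iso_Hom[OF phi_iso[OF assms]] by (auto simp: Hom_iff)

lemma phi_cancel:
  assumes "\<phi> X \<cdot> a = \<phi> X \<cdot> b" "X \<in> Obj D" "a \<in> Arr C" "b \<in> Arr C" "Cod C a = r (dsh X)"
    "Cod C b = r (dsh X)"
  shows "a = b"
proof -
  obtain g where g: "g \<in> Hom C (sh (r X)) (r (dsh X))" "g \<cdot> \<phi> X = Idn C (r (dsh X))"
    using phi_iso[OF assms(2)] by (rule is_isoD)
  have "g \<cdot> (\<phi> X \<cdot> a) = g \<cdot> (\<phi> X \<cdot> b)" using assms(1) by simp
  then show ?thesis using assms(2-) HomD[OF g(1)] by (simp add: Cmp_reassoc[OF g(2)])
qed

section \<open>The additive structure of \<open>D\<close>\<close>

lemma D_hom_comm_group: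
  assumes X: "X \<in> Obj D" "Y \<in> Obj D"
  shows "comm_group (hom_group D X Y)"
proof (rule comm_groupI, unfold hom_group_def partial_object.simps monoid.simps)
  fix f g assume f: "f \<in> Hom D X Y" and g: "g \<in> Hom D X Y"
  show "Plus D f g \<in> Hom D X Y" by (rule Plus_Hom[OF f g])
  show "Plus D f g = Plus D g f"
    by (rule rho_inj[OF Plus_Hom[OF f g] Plus_Hom[OF g f]])
      (simp add: rho_Plus[OF f g] rho_Plus[OF g f] Plus_comm[OF rho_Hom[OF f] rho_Hom[OF g]])
next
  fix f g h assume f: "f \<in> Hom D X Y" and g: "g \<in> Hom D X Y" and h: "h \<in> Hom D X Y"
  show "Plus D (Plus D f g) h = Plus D f (Plus D g h)"
    by (rule rho_inj[OF Plus_Hom[OF Plus_Hom[OF f g] h] Plus_Hom[OF f Plus_Hom[OF g h]]])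
      (simp add: rho_Plus[OF f g] rho_Plus[OF g h] rho_Plus[OF f Plus_Hom[OF g h]]
        rho_Plus[OF Plus_Hom[OF f g] h] Plus_assoc[OF rho_Hom[OF f] rho_Hom[OF g] rho_Hom[OF h]])
next
  fix f assume f: "f \<in> Hom D X Y"
  show "Plus D (Zer D X Y) f = f"
    by (rule rho_inj[OF Plus_Hom[OF Zer_Hom[OF X] f] f])
      (simp add: rho_Plus[OF Zer_Hom[OF X] f] rho_Zer[OF X] Plus_Zer_left[OF rho_Hom[OF f]])
  obtain g where g: "g \<in> Hom D X Y" "\<rho> g = neg C (\<rho> f)"
    using rho_surj[OF neg_in_Hom[OF rho_Hom[OF f]] X] by blast
  have "Plus D g f = Zer D X Y"
    by (rule rho_inj[OF Plus_Hom[OF g(1) f] Zer_Hom[OF X]])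
      (simp add: rho_Plus[OF g(1) f] rho_Zer[OF X] g(2) Plus_neg_left[OF rho_Hom[OF f]])
  then show "\<exists>g\<in>Hom D X Y. Plus D g f = Zer D X Y" using g(1) by blast
qed (rule Zer_Hom[OF X])

text \<open>A fully faithful functor reflects coproducts: both the injections and the induced
  morphisms have unique preimages under \<open>\<rho>\<close>.\<close>

lemma D_coproduct:
  assumes P: "is_coproduct C I (\<lambda>i. r (V i)) (r P) \<iota>" and Po: "P \<in> Obj D"
    and V: "\<And>i. i \<in> I \<Longrightarrow> V i \<in> Obj D"
  shows "\<exists>\<iota>'. is_coproduct D I V P \<iota>'"
proof -
  have "\<exists>d. d \<in> Hom D (V i) P \<and> \<rho> d = \<iota> i" if "i \<in> I" for i
    using rho_surj[OF is_coproductD(3)[OF P that] V[OF that] Po] by blast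
  then obtain \<iota>' where \<iota>': "\<And>i. i \<in> I \<Longrightarrow> \<iota>' i \<in> Hom D (V i) P" "\<And>i. i \<in> I \<Longrightarrow> \<rho> (\<iota>' i) = \<iota> i"
    by metis
  have "is_coproduct D I V P \<iota>'"
  proof (rule D.is_coproductI)
    fix Y f assume Y: "Y \<in> Obj D" and f: "\<And>i. i \<in> I \<Longrightarrow> f i \<in> Hom D (V i) Y"
    obtain g where g: "g \<in> Hom C (r P) (r Y)" "\<And>i. i \<in> I \<Longrightarrow> g \<cdot> \<iota> i = \<rho> (f i)"
      by (rule coproduct_copair[OF P, of "r Y" "\<lambda>i. \<rho> (f i)"]) (use Y f rho_Hom in auto)
    obtain d where d: "d \<in> Hom D P Y" "\<rho> d = g" using rho_surj[OF g(1) Po Y] by blast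
    have "d \<cdot>\<^bsub>D\<^esub> \<iota>' i = f i" if i: "i \<in> I" for i
      by (rule rho_inj[OF D.Cmp_in_Hom[OF \<iota>'(1)[OF i] d(1)] f[OF i]])
        (use D.HomD[OF \<iota>'(1)[OF i]] D.HomD[OF d(1)] \<iota>'(2)[OF i] d(2) g(2)[OF i] in simp)
    then show "\<exists>g\<in>Hom D P Y. \<forall>i\<in>I. g \<cdot>\<^bsub>D\<^esub> \<iota>' i = f i" using d(1) by blast
  next
    fix Y g h assume g: "g \<in> Hom D P Y" and h: "h \<in> Hom D P Y"
      and e: "\<And>i. i \<in> I \<Longrightarrow> g \<cdot>\<^bsub>D\<^esub> \<iota>' i = h \<cdot>\<^bsub>D\<^esub> \<iota>' i"
    have "\<rho> g = \<rho> h"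
    proof (rule coproduct_ext[OF P rho_Hom[OF g] rho_Hom[OF h]])
      fix i assume i: "i \<in> I"
      have "\<rho> (g \<cdot>\<^bsub>D\<^esub> \<iota>' i) = \<rho> (h \<cdot>\<^bsub>D\<^esub> \<iota>' i)" using e[OF i] by simp
      then show "\<rho> g \<cdot> \<iota> i = \<rho> h \<cdot> \<iota> i"
        using D.HomD[OF \<iota>'(1)[OF i]] D.HomD[OF g] D.HomD[OF h] \<iota>'(2)[OF i] by simp
    qed
    then show "g = h" by (rule rho_inj[OF g h])
  qed (use \<iota>' Po in auto)
  then show ?thesis by blast
qed

lemma D_additive_category: "additive_category D"
proof (intro additive_category.intro additive_category_axioms.intro D.category_axioms)
  fix f f' g X Y Z assume f: "f \<in> Hom D X Y" and f': "f' \<in> Hom D X Y" and g: "g \<in> Hom D Y Z"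
  note tt = D.HomD[OF f] D.HomD[OF f'] D.HomD[OF g] D.HomD[OF Plus_Hom[OF f f']]
  note 1 = D.Cmp_in_Hom[OF f g] and 2 = D.Cmp_in_Hom[OF f' g]
  show "g \<cdot>\<^bsub>D\<^esub> Plus D f f' = Plus D (g \<cdot>\<^bsub>D\<^esub> f) (g \<cdot>\<^bsub>D\<^esub> f')"
    by (rule rho_inj[OF D.Cmp_in_Hom[OF Plus_Hom[OF f f'] g] Plus_Hom[OF 1 2]])
      (use tt in \<open>simp add: rho_Plus[OF 1 2] rho_Plus[OF f f'] Cmp_Plus_Arr\<close>)
next
  fix f g g' X Y Z assume f: "f \<in> Hom D X Y" and g: "g \<in> Hom D Y Z" and g': "g' \<in> Hom D Y Z"
  note tt = D.HomD[OF f] D.HomD[OF g'] D.HomD[OF g] D.HomD[OF Plus_Hom[OF g g']]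
  note 1 = D.Cmp_in_Hom[OF f g] and 2 = D.Cmp_in_Hom[OF f g']
  show "Plus D g g' \<cdot>\<^bsub>D\<^esub> f = Plus D (g \<cdot>\<^bsub>D\<^esub> f) (g' \<cdot>\<^bsub>D\<^esub> f)"
    by (rule rho_inj[OF D.Cmp_in_Hom[OF f Plus_Hom[OF g g']] Plus_Hom[OF 1 2]])
      (use tt in \<open>simp add: rho_Plus[OF 1 2] rho_Plus[OF g g'] Plus_Cmp_Arr\<close>)
next
  obtain Z where Z: "Z \<in> Obj D" "is_zero C (r Z)" using r_zero by blast
  have from1: "f = Zer D Z X" if f: "f \<in> Hom D Z X" for f X
    by (rule rho_inj[OF f Zer_Hom[OF D.HomD(4,5)[OF f]]])
      (use is_zero_Hom_from[OF Z(2) rho_Hom[OF f]] rho_Zer[OF D.HomD(4,5)[OF f]] in simp)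
  have to: "f = Zer D X Z" if f: "f \<in> Hom D X Z" for f X
    by (rule rho_inj[OF f Zer_Hom[OF D.HomD(4,5)[OF f]]])
      (use is_zero_Hom_to[OF Z(2) rho_Hom[OF f]] rho_Zer[OF D.HomD(4,5)[OF f]] in simp)
  have "is_zero D Z"
    unfolding is_zero_def using Z(1) Zer_Hom from1 to by metis
  then show "\<exists>Z. is_zero D Z" by blast
next
  fix V :: "bool \<Rightarrow> 'p" assume V: "range V \<subseteq> Obj D"
  obtain P \<iota> where P: "P \<in> Obj D" "is_coproduct C (UNIV :: bool set) (\<lambda>i. r (V i)) (r P) \<iota>"
    using r_coproduct[OF V] by blast
  then obtain \<iota>' where "is_coproduct D (UNIV :: bool set) V P \<iota>'"
    using D_coproduct[OF P(2,1)] V by blast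
  then show "\<exists>P \<iota>. is_coproduct D (UNIV :: bool set) V P \<iota>" by blast
qed (rule D_hom_comm_group)

sublocale D: additive_category D
  by (rule D_additive_category)

lemma R_additive: "is_additive D C \<lparr>OMap = r, AMap = \<rho>\<rparr>"
  unfolding is_additive_def is_functor_def
  using D.category_axioms category_axioms rho_Plus by (auto simp: Hom_iff)

lemma rho_neg: "f \<in> Arr D \<Longrightarrow> \<rho> (neg D f) = neg C (\<rho> f)"
  using is_additive_neg[OF D.additive_category_axioms additive_category_axioms R_additive] by simp

lemma r_is_zero: "is_zero D X \<Longrightarrow> is_zero C (r X)"
  using is_additive_zero[OF D.additive_category_axioms additive_category_axioms R_additive] by simp

lemma rho_iso: "is_iso D X Y f \<Longrightarrow> is_iso C (r X) (r Y) (\<rho> f)"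
  using is_functor_iso[OF is_additiveD(1)[OF R_additive]] by simp

section \<open>Verdier's axioms for \<open>D\<close>\<close>

lemma D_TriD:
  assumes "(f, g, h) \<in> Tri D"
  shows "f \<in> Arr D" "g \<in> Arr D" "h \<in> Arr D" "Dom D g = Cod D f" "Dom D h = Cod D g"
    "Cod D h = dsh (Dom D f)" "(\<rho> f, \<rho> g, \<phi> (Dom D f) \<cdot> \<rho> h) \<in> Tri C"
  using D_Tri_shape[OF assms] D_Tri_iff[of f g h] assms by (auto simp: triangle_shape_def)

lemma D_TriI:
  assumes "f \<in> Arr D" "g \<in> Arr D" "h \<in> Arr D" "Dom D g = Cod D f" "Dom D h = Cod D g"
    "Cod D h = dsh (Dom D f)" "(\<rho> f, \<rho> g, \<phi> (Dom D f) \<cdot> \<rho> h) \<in> Tri C"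
  shows "(f, g, h) \<in> Tri D"
  using assms D_Tri_iff[of f g h] by (simp add: triangle_shape_def)

lemma D_Tri_iso:
  assumes t: "(f, g, h) \<in> Tri D" and i: "triangle_iso D (Shift D) (f, g, h) (f', g', h')"
  shows "(f', g', h') \<in> Tri D"
proof -
  obtain a b c where i': "is_iso D (Dom D f) (Dom D f') a" "is_iso D (Dom D g) (Dom D g') b"
      "is_iso D (Dom D h) (Dom D h') c" and
      e: "b \<cdot>\<^bsub>D\<^esub> f = f' \<cdot>\<^bsub>D\<^esub> a" "c \<cdot>\<^bsub>D\<^esub> g = g' \<cdot>\<^bsub>D\<^esub> b" "dshm a \<cdot>\<^bsub>D\<^esub> h = h' \<cdot>\<^bsub>D\<^esub> c"
    using i unfolding triangle_iso_def by blast
  have ty: "f' \<in> Arr D" "g' \<in> Arr D" "h' \<in> Arr D" "Dom D g' = Cod D f'" "Dom D h' = Cod D g'"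
    "Cod D h' = dsh (Dom D f')"
    using i by (simp_all add: triangle_iso_def triangle_shape_def)
  note tt = D_TriD[OF t] D.HomD[OF D.is_iso_Hom[OF i'(1)]] D.HomD[OF D.is_iso_Hom[OF i'(2)]]
    D.HomD[OF D.is_iso_Hom[OF i'(3)]]
  have e': "\<rho> b \<cdot> \<rho> f = \<rho> f' \<cdot> \<rho> a" "\<rho> c \<cdot> \<rho> g = \<rho> g' \<cdot> \<rho> b" "\<rho> (dshm a) \<cdot> \<rho> h = \<rho> h' \<cdot> \<rho> c"
    using arg_cong[OF e(1), of \<rho>] arg_cong[OF e(2), of \<rho>] arg_cong[OF e(3), of \<rho>] tt(1-6,8-) ty
    by simp_all
  have n: "shm (\<rho> a) \<cdot> \<phi> (Dom D f) = \<phi> (Dom D f') \<cdot> \<rho> (dshm a)"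
    using phi_natural[of a] tt(8-) by simp
  show ?thesis
  proof (rule D_TriI)
    show "(\<rho> f', \<rho> g', \<phi> (Dom D f') \<cdot> \<rho> h') \<in> Tri C"
    proof (rule Tri_isoI[OF tt(7), where a = "\<rho> a" and b = "\<rho> b" and c = "\<rho> c"])
      show "shm (\<rho> a) \<cdot> (\<phi> (Dom D f) \<cdot> \<rho> h) = \<phi> (Dom D f') \<cdot> \<rho> h' \<cdot> \<rho> c"
        using tt(1-6,8-) ty e'(3) by (simp add: Cmp_reassoc[OF n])
    qed (use tt(1-6,8-) ty e' rho_iso[OF i'(1)] rho_iso[OF i'(2)] rho_iso[OF i'(3)] in auto)
  qed (use ty in auto)
qed

text \<open>Rotation in \<open>C\<close> ends at \<open>sh (r ?X)\<close>, rotation in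
  \<open>D\<close> at \<open>r (dsh ?X)\<close>. The two resulting triangles of \<open>C\<close> are
  isomorphic through \<open>\<phi> ?X\<close> and its inverse.\<close>

lemma D_Tri_rotate:
  assumes "triangle_shape D (Shift D) (f, g, h)"
  shows "(f, g, h) \<in> Tri D \<longleftrightarrow> (g, h, neg D (dshm f)) \<in> Tri D"
proof -
  have ty: "f \<in> Arr D" "g \<in> Arr D" "h \<in> Arr D" "Dom D g = Cod D f" "Dom D h = Cod D g"
    "Cod D h = dsh (Dom D f)"
    using assms by (auto simp: triangle_shape_def)
  let ?X = "Dom D f" and ?Y = "Cod D f"
  obtain \<chi> where \<chi>: "\<chi> \<in> Hom C (sh (r ?X)) (r (dsh ?X))" "\<chi> \<cdot> \<phi> ?X = Idn C (r (dsh ?X))"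
      "\<phi> ?X \<cdot> \<chi> = Idn C (sh (r ?X))"
    using phi_iso[of ?X] ty by (auto elim: is_isoD)
  note xx = HomD[OF \<chi>(1)]
  have \<chi>i: "is_iso C (sh (r ?X)) (r (dsh ?X)) \<chi>"
    using \<chi> is_iso_Hom[OF phi_iso[of ?X]] ty by (auto simp: is_iso_def)
  have n: "\<phi> ?Y \<cdot> \<rho> (neg D (dshm f)) = neg C (shm (\<rho> f)) \<cdot> \<phi> ?X"
    using ty phi_natural[of f] by (simp add: rho_neg Cmp_neg neg_Cmp)
  have n': "neg C (shm (\<rho> f)) = \<phi> ?Y \<cdot> \<rho> (neg D (dshm f)) \<cdot> \<chi>"
    using ty xx \<chi>(3) by (simp add: n)
  have "(f, g, h) \<in> Tri D \<longleftrightarrow> (\<rho> f, \<rho> g, \<phi> ?X \<cdot> \<rho> h) \<in> Tri C"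
    by (rule D_Tri_iff[OF assms])
  also have "\<dots> \<longleftrightarrow> (\<rho> g, \<phi> ?X \<cdot> \<rho> h, neg C (shm (\<rho> f))) \<in> Tri C"
    by (rule Tri_rotate) (use ty in \<open>auto simp: triangle_shape_def\<close>)
  also have "\<dots> \<longleftrightarrow> (\<rho> g, \<rho> h, \<phi> ?Y \<cdot> \<rho> (neg D (dshm f))) \<in> Tri C"
  proof
    assume t: "(\<rho> g, \<phi> ?X \<cdot> \<rho> h, neg C (shm (\<rho> f))) \<in> Tri C"
    show "(\<rho> g, \<rho> h, \<phi> ?Y \<cdot> \<rho> (neg D (dshm f))) \<in> Tri C"
      by (rule Tri_isoI[OF t, where a = "Idn C (r ?Y)" and b = "Idn C (r (Cod D g))" and c = \<chi>])
        (use ty xx \<chi>(2) \<chi>i n' in \<open>auto simp: is_iso_Idn Cmp_reassoc[OF \<chi>(2)]\<close>)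
  next
    assume t: "(\<rho> g, \<rho> h, \<phi> ?Y \<cdot> \<rho> (neg D (dshm f))) \<in> Tri C"
    show "(\<rho> g, \<phi> ?X \<cdot> \<rho> h, neg C (shm (\<rho> f))) \<in> Tri C"
      by (rule Tri_isoI[OF t, where a = "Idn C (r ?Y)" and b = "Idn C (r (Cod D g))" and c = "\<phi> ?X"])
        (use ty n phi_iso[of ?X] in \<open>auto simp: is_iso_Idn\<close>)
  qed
  also have "\<dots> \<longleftrightarrow> (g, h, neg D (dshm f)) \<in> Tri D"
    using D_Tri_iff[of g h "neg D (dshm f)"] ty by (simp add: triangle_shape_def)
  finally show ?thesis .
qed

lemma D_Tri_morphism:
  assumes t: "(f, g, h) \<in> Tri D" and t': "(f', g', h') \<in> Tri D"
    and a: "a \<in> Hom D (Dom D f) (Dom D f')" and b: "b \<in> Hom D (Dom D g) (Dom D g')"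
    and e: "b \<cdot>\<^bsub>D\<^esub> f = f' \<cdot>\<^bsub>D\<^esub> a"
  shows "\<exists>c\<in>Hom D (Dom D h) (Dom D h'). c \<cdot>\<^bsub>D\<^esub> g = g' \<cdot>\<^bsub>D\<^esub> b \<and> dshm a \<cdot>\<^bsub>D\<^esub> h = h' \<cdot>\<^bsub>D\<^esub> c"
proof -
  note tt = D_TriD(1-6)[OF t] D_TriD(1-6)[OF t'] D.HomD[OF a] D.HomD[OF b]
  have e': "\<rho> b \<cdot> \<rho> f = \<rho> f' \<cdot> \<rho> a" using arg_cong[OF e, of \<rho>] tt by simp
  have "\<exists>c\<in>Hom C (Dom C (\<phi> (Dom D f) \<cdot> \<rho> h)) (Dom C (\<phi> (Dom D f') \<cdot> \<rho> h')).
      c \<cdot> \<rho> g = \<rho> g' \<cdot> \<rho> b \<and>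
      shm (\<rho> a) \<cdot> (\<phi> (Dom D f) \<cdot> \<rho> h) = (\<phi> (Dom D f') \<cdot> \<rho> h') \<cdot> c"
    by (rule Tri_morphism[OF D_TriD(7)[OF t] D_TriD(7)[OF t']])
      (use tt e' rho_Hom[OF a] rho_Hom[OF b] in auto)
  then obtain c where c: "c \<in> Hom C (r (Dom D h)) (r (Dom D h'))" "c \<cdot> \<rho> g = \<rho> g' \<cdot> \<rho> b"
      "shm (\<rho> a) \<cdot> (\<phi> (Dom D f) \<cdot> \<rho> h) = (\<phi> (Dom D f') \<cdot> \<rho> h') \<cdot> c"
    using tt by auto
  obtain d where d: "d \<in> Hom D (Dom D h) (Dom D h')" "\<rho> d = c"
    using rho_surj[OF c(1)] tt by auto
  note dd = D.HomD[OF d(1)]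
  have n: "shm (\<rho> a) \<cdot> \<phi> (Dom D f) = \<phi> (Dom D f') \<cdot> \<rho> (dshm a)"
    using phi_natural[of a] tt by simp
  have 1: "d \<cdot>\<^bsub>D\<^esub> g = g' \<cdot>\<^bsub>D\<^esub> b"
    by (rule rho_inj[of _ "Dom D g" "Cod D g'"]) (use tt dd d(2) c(2) in \<open>auto simp: D.Hom_iff\<close>)
  have "\<phi> (Dom D f') \<cdot> (\<rho> (dshm a) \<cdot> \<rho> h) = shm (\<rho> a) \<cdot> (\<phi> (Dom D f) \<cdot> \<rho> h)"
    using tt by (simp add: Cmp_reassoc[OF n])
  also have "\<dots> = \<phi> (Dom D f') \<cdot> (\<rho> h' \<cdot> \<rho> d)" using c(3) d(2) tt dd HomD[OF c(1)] by simp
  finally have "\<rho> (dshm a) \<cdot> \<rho> h = \<rho> h' \<cdot> \<rho> d"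
    by (rule phi_cancel) (use tt dd in auto)
  then have "dshm a \<cdot>\<^bsub>D\<^esub> h = h' \<cdot>\<^bsub>D\<^esub> d"
    by - (rule rho_inj[of _ "Dom D h" "Cod D h'"], use tt dd in \<open>auto simp: D.Hom_iff\<close>)
  with 1 d(1) show ?thesis by blast
qed

text \<open>Every equation is checked after \<open>\<rho>\<close>. Where a third arrow occurs,
  naturality of \<open>\<phi>\<close> moves \<open>\<phi>\<close> to the left, and
  \<open>phi_cancel\<close> removes it.\<close>

lemma D_Tri_octahedral:
  assumes fg: "Cod D f = Dom D g" and t1: "(f, i, j) \<in> Tri D" and t2: "(g, k, l) \<in> Tri D"
    and t3: "(g \<cdot>\<^bsub>D\<^esub> f, m, n) \<in> Tri D"
  shows "\<exists>u v. (u, v, dshm i \<cdot>\<^bsub>D\<^esub> l) \<in> Tri D \<and>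
        u \<in> Hom D (Cod D i) (Cod D m) \<and> v \<in> Hom D (Cod D m) (Cod D k) \<and>
        u \<cdot>\<^bsub>D\<^esub> i = m \<cdot>\<^bsub>D\<^esub> g \<and> n \<cdot>\<^bsub>D\<^esub> u = j \<and> v \<cdot>\<^bsub>D\<^esub> m = k \<and> l \<cdot>\<^bsub>D\<^esub> v = dshm f \<cdot>\<^bsub>D\<^esub> n"
proof -
  let ?X = "Dom D f" and ?Y = "Dom D g"
  have ty: "f \<in> Arr D" "i \<in> Arr D" "j \<in> Arr D" "g \<in> Arr D" "k \<in> Arr D" "l \<in> Arr D"
    "m \<in> Arr D" "n \<in> Arr D" "Cod D f = ?Y" "Dom D i = ?Y" "Dom D j = Cod D i" "Cod D j = dsh ?X"
    "Dom D k = Cod D g" "Dom D l = Cod D k" "Cod D l = dsh ?Y" "Dom D m = Cod D g"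
    "Dom D n = Cod D m" "Cod D n = dsh ?X"
    using D_TriD(1-6)[OF t1] D_TriD(1-6)[OF t2] D_TriD(1-6)[OF t3] fg by auto
  have t3': "(\<rho> g \<cdot> \<rho> f, \<rho> m, \<phi> ?X \<cdot> \<rho> n) \<in> Tri C" using D_TriD(7)[OF t3] ty by simp
  have "Cod C (\<rho> f) = Dom C (\<rho> g)" using ty by simp
  from Tri_octahedral[OF this D_TriD(7)[OF t1] D_TriD(7)[OF t2] t3']
  obtain u v where uv: "(u, v, shm (\<rho> i) \<cdot> (\<phi> ?Y \<cdot> \<rho> l)) \<in> Tri C"
      "u \<in> Hom C (Cod C (\<rho> i)) (Cod C (\<rho> m))" "v \<in> Hom C (Cod C (\<rho> m)) (Cod C (\<rho> k))"
      "u \<cdot> \<rho> i = \<rho> m \<cdot> \<rho> g" "(\<phi> ?X \<cdot> \<rho> n) \<cdot> u = \<phi> ?X \<cdot> \<rho> j" "v \<cdot> \<rho> m = \<rho> k"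
      "(\<phi> ?Y \<cdot> \<rho> l) \<cdot> v = shm (\<rho> f) \<cdot> (\<phi> ?X \<cdot> \<rho> n)" by blast
  obtain u' where u': "u' \<in> Hom D (Cod D i) (Cod D m)" "\<rho> u' = u"
    by (rule rho_surj[of u "Cod D i" "Cod D m"]) (use uv(2) ty in auto)
  obtain v' where v': "v' \<in> Hom D (Cod D m) (Cod D k)" "\<rho> v' = v"
    by (rule rho_surj[of v "Cod D m" "Cod D k"]) (use uv(3) ty in auto)
  note uu = D.HomD[OF u'(1)] D.HomD[OF v'(1)]
  have ni: "shm (\<rho> i) \<cdot> \<phi> ?Y = \<phi> (Cod D i) \<cdot> \<rho> (dshm i)"
    using phi_natural[of i] ty by simp
  have nf: "shm (\<rho> f) \<cdot> \<phi> ?X = \<phi> ?Y \<cdot> \<rho> (dshm f)"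
    using phi_natural[of f] ty by simp
  have 1: "(u', v', dshm i \<cdot>\<^bsub>D\<^esub> l) \<in> Tri D"
  proof (rule D_TriI)
    have "\<phi> (Dom D u') \<cdot> \<rho> (dshm i \<cdot>\<^bsub>D\<^esub> l) = shm (\<rho> i) \<cdot> (\<phi> ?Y \<cdot> \<rho> l)"
      using ty uu by (simp add: Cmp_reassoc[OF ni])
    then show "(\<rho> u', \<rho> v', \<phi> (Dom D u') \<cdot> \<rho> (dshm i \<cdot>\<^bsub>D\<^esub> l)) \<in> Tri C"
      using uv(1) u'(2) v'(2) by simp
  qed (use ty uu in auto)
  have 2: "u' \<cdot>\<^bsub>D\<^esub> i = m \<cdot>\<^bsub>D\<^esub> g"
    by (rule rho_inj[of _ ?Y "Cod D m"]) (use ty uu uv(4) u'(2) in \<open>auto simp: D.Hom_iff\<close>)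
  have "\<phi> ?X \<cdot> (\<rho> n \<cdot> \<rho> u') = \<phi> ?X \<cdot> \<rho> j" using uv(5) u'(2) HomD[OF uv(2)] ty by simp
  then have "\<rho> n \<cdot> \<rho> u' = \<rho> j" by (rule phi_cancel) (use ty uu in auto)
  then have 3: "n \<cdot>\<^bsub>D\<^esub> u' = j"
    by - (rule rho_inj[of _ "Cod D i" "dsh ?X"], use ty uu in \<open>auto simp: D.Hom_iff\<close>)
  have 4: "v' \<cdot>\<^bsub>D\<^esub> m = k"
    by (rule rho_inj[of _ "Cod D g" "Cod D k"]) (use ty uu uv(6) v'(2) in \<open>auto simp: D.Hom_iff\<close>)
  have "\<phi> ?Y \<cdot> (\<rho> l \<cdot> \<rho> v') = shm (\<rho> f) \<cdot> (\<phi> ?X \<cdot> \<rho> n)"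
    using uv(7) v'(2) HomD[OF uv(3)] ty by simp
  also have "\<dots> = \<phi> ?Y \<cdot> (\<rho> (dshm f) \<cdot> \<rho> n)" using ty by (simp add: Cmp_reassoc[OF nf])
  finally have "\<rho> l \<cdot> \<rho> v' = \<rho> (dshm f) \<cdot> \<rho> n" by (rule phi_cancel) (use ty uu in auto)
  then have 5: "l \<cdot>\<^bsub>D\<^esub> v' = dshm f \<cdot>\<^bsub>D\<^esub> n"
    by - (rule rho_inj[of _ "Cod D m" "dsh ?Y"], use ty uu in \<open>auto simp: D.Hom_iff\<close>)
  show ?thesis using 1 2 3 4 5 u'(1) v'(1) by blast
qed

lemma D_triangulated: "triangulated_category D"
proof (intro triangulated_category.intro triangulated_category_axioms.intro D.additive_category_axioms)
  show "is_additive D D (Shift D)"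
    unfolding is_additive_def
  proof (intro conjI ballI)
    fix X Y f g assume X: "X \<in> Obj D" and Y: "Y \<in> Obj D" and f: "f \<in> Hom D X Y" and g: "g \<in> Hom D X Y"
    note fg = Plus_Hom[OF f g]
    note sf = is_functor_Hom[OF D_shift f] and sg = is_functor_Hom[OF D_shift g]
    note tt = X Y D.HomD[OF f] D.HomD[OF g] D.HomD[OF fg] D.HomD[OF sf] D.HomD[OF sg]
    have "\<phi> Y \<cdot> \<rho> (dshm (Plus D f g)) = shm (\<rho> (Plus D f g)) \<cdot> \<phi> X"
      using phi_natural[of "Plus D f g"] tt by simp
    also have "\<dots> = Plus C (shm (\<rho> f) \<cdot> \<phi> X) (shm (\<rho> g) \<cdot> \<phi> X)"
      using tt by (simp add: rho_Plus[OF f g] shm_Plus[OF rho_Hom[OF f] rho_Hom[OF g]] Plus_Cmp_Arr)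
    also have "\<dots> = \<phi> Y \<cdot> Plus C (\<rho> (dshm f)) (\<rho> (dshm g))"
      using phi_natural[of f] phi_natural[of g] tt by (simp add: Cmp_Plus_Arr)
    finally have "\<rho> (dshm (Plus D f g)) = Plus C (\<rho> (dshm f)) (\<rho> (dshm g))"
      by (rule phi_cancel) (use tt in auto)
    then show "dshm (Plus D f g) = Plus D (dshm f) (dshm g)"
      by - (rule rho_inj[OF is_functor_Hom[OF D_shift fg] Plus_Hom[OF sf sg]],
          simp add: rho_Plus[OF sf sg])
  qed (rule D_shift)
next
  fix t t' assume "t \<in> Tri D" "triangle_iso D (Shift D) t t'"
  then show "t' \<in> Tri D" using D_Tri_iso by (cases t, cases t') blast
next
  fix X Z assume X: "X \<in> Obj D" and Z: "is_zero D Z"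
  have Zo: "Z \<in> Obj D" using Z by (simp add: is_zero_def)
  show "(Idn D X, Zer D X Z, Zer D Z (dsh X)) \<in> Tri D"
    by (rule D_TriI)
      (use X Zo D.HomD[OF Zer_Hom[of X Z]] D.HomD[OF Zer_Hom[of Z "dsh X"]]
        Tri_id[of "r X" "r Z"] r_is_zero[OF Z] in \<open>auto simp: rho_Zer\<close>)
next
  fix f assume f: "f \<in> Arr D"
  obtain Z g h where Z: "Z \<in> Obj D" and t: "(\<rho> f, g, h) \<in> Tri C" "Cod C g = r Z"
    using r_cone[OF f] by blast
  note tt = Tri_typing[OF t(1)] f
  let ?X = "Dom D f"
  obtain g' where g': "g' \<in> Hom D (Cod D f) Z" "\<rho> g' = g"
    by (rule rho_surj[of g "Cod D f" Z]) (use tt Z t(2) in \<open>auto simp: Hom_iff\<close>)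
  obtain \<chi> where \<chi>: "\<chi> \<in> Hom C (sh (r ?X)) (r (dsh ?X))" "\<chi> \<cdot> \<phi> ?X = Idn C (r (dsh ?X))"
      "\<phi> ?X \<cdot> \<chi> = Idn C (sh (r ?X))"
    using phi_iso[of ?X] f by (auto elim: is_isoD)
  note xx = HomD[OF \<chi>(1)]
  \<comment> \<open>Correcting \<open>h\<close> by the inverse of \<open>\<phi> ?X\<close> makes
    \<open>\<phi> ?X \<cdot> \<rho> h'\<close> equal to \<open>h\<close> again.\<close>
  obtain h' where h': "h' \<in> Hom D Z (dsh ?X)" "\<rho> h' = \<chi> \<cdot> h"
    by (rule rho_surj[of "\<chi> \<cdot> h" Z "dsh ?X"]) (use tt Z t(2) xx in \<open>auto simp: Hom_iff\<close>)
  have "(f, g', h') \<in> Tri D"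
    by (rule D_TriI)
      (use tt t D.HomD[OF g'(1)] D.HomD[OF h'(1)] g'(2) h'(2) xx in \<open>auto simp: Cmp_reassoc[OF \<chi>(3)]\<close>)
  then show "\<exists>g h. (f, g, h) \<in> Tri D" by blast
qed (fact D_shift_Obj D_shift_Arr D_Tri_shape D_Tri_rotate D_Tri_morphism D_Tri_octahedral)+

end

section \<open>The Verdier quotient\<close>

context bousfield
begin

abbreviation W :: "'m set" where "W \<equiv> cone_in C A"
abbreviation V :: "('o, ('o, 'm) frac) tri_cat" where "V \<equiv> verdier_quotient C A"

section \<open>Zigzags evaluated under \<open>L\<close>\<close>

definition linv :: "'m \<Rightarrow> 'm" where
  "linv s = (SOME g. g \<in> Hom C (LO (Cod C s)) (LO (Dom C s)) \<and>
     g \<cdot> LA s = Idn C (LO (Dom C s)) \<and> LA s \<cdot> g = Idn C (LO (Cod C s)))"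

lemma linv:
  assumes "s \<in> W"
  shows "linv s \<in> Hom C (LO (Cod C s)) (LO (Dom C s))"
    "linv s \<cdot> LA s = Idn C (LO (Dom C s))" "LA s \<cdot> linv s = Idn C (LO (Cod C s))"
proof -
  have "\<exists>g. g \<in> Hom C (LO (Cod C s)) (LO (Dom C s)) \<and>
     g \<cdot> LA s = Idn C (LO (Dom C s)) \<and> LA s \<cdot> g = Idn C (LO (Cod C s))"
    using L_inverts[OF assms] by (auto simp: is_iso_def)
  from someI_ex[OF this] show "linv s \<in> Hom C (LO (Cod C s)) (LO (Dom C s))"
    "linv s \<cdot> LA s = Idn C (LO (Dom C s))" "LA s \<cdot> linv s = Idn C (LO (Cod C s))"
    by (auto simp: linv_def)
qed

lemma linv_eta:
  assumes "X \<in> Obj C"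
  shows "linv (\<eta> X) \<in> Hom C (LO (LO X)) (LO X)" "linv (\<eta> X) \<cdot> \<eta> (LO X) = Idn C (LO X)"
    "\<eta> (LO X) \<cdot> linv (\<eta> X) = Idn C (LO (LO X))"
  using linv[OF eta_cone[OF assms]] assms by (auto simp: LA_eta)

lemma linv_eta_typing:
  assumes "X \<in> Obj C"
  shows "linv (\<eta> X) \<in> Arr C" "Dom C (linv (\<eta> X)) = LO (LO X)" "Cod C (linv (\<eta> X)) = LO X"
  using linv_eta(1)[OF assms] by (auto simp: Hom_iff)

lemma linv_eta_iso: "X \<in> Obj C \<Longrightarrow> is_iso C (LO (LO X)) (LO X) (linv (\<eta> X))"
  using linv_eta[of X] eta_Hom[of "LO X"] by (auto simp: is_iso_def)

lemma linv_eta_natural: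
  assumes X: "X \<in> Obj C" "Y \<in> Obj C" and k: "k \<in> Hom C (LO X) (LO Y)"
  shows "linv (\<eta> Y) \<cdot> LA k = k \<cdot> linv (\<eta> X)"
proof (rule eta_epi[of "LO X" "LO Y"])
  show "(linv (\<eta> Y) \<cdot> LA k) \<cdot> \<eta> (LO X) = (k \<cdot> linv (\<eta> X)) \<cdot> \<eta> (LO X)"
    using X HomD[OF k] eta_natural[of k] linv_eta(2)[OF X(1)] linv_eta_typing[OF X(1)]
      linv_eta_typing[OF X(2)]
    by (simp add: Cmp_reassoc[OF linv_eta(2)[OF X(2)]])
qed (use X HomD[OF k] linv_eta_typing L_orth in \<open>auto simp: Hom_iff\<close>)

lemma W_typing: "s \<in> W \<Longrightarrow> s \<in> Arr C" "s \<in> W \<Longrightarrow> Dom C s \<in> Obj C" "s \<in> W \<Longrightarrow> Cod C s \<in> Obj C"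
  using cone_in_Arr by auto

lemma linv_typing:
  assumes "s \<in> W"
  shows "linv s \<in> Arr C" "Dom C (linv s) = LO (Cod C s)" "Cod C (linv s) = LO (Dom C s)"
  using linv(1)[OF assms] by (auto simp: Hom_iff)

text \<open>The extension of \<open>L\<close> to zigzags.  It is a complete invariant: naturality of \<open>\<eta>\<close> moves every
  zigzag into the form \<open>X \<rightarrow> L X \<rightarrow> L Y \<leftarrow> Y\<close>.\<close>

primrec ev :: "'m step list \<Rightarrow> 'o \<Rightarrow> 'm" where
  "ev [] = (\<lambda>X. Idn C (LO X))"
| "ev (a # p) = (\<lambda>X. case a of Fwd f \<Rightarrow> ev p (Cod C f) \<cdot> LA f | Bwd s \<Rightarrow> ev p (Dom C s) \<cdot> linv s)"

lemma zigzag_Obj: "zigzag C W X p Y \<Longrightarrow> X \<in> Obj C \<and> Y \<in> Obj C"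
  by (induction rule: zigzag.induct) (auto simp: W_typing)

lemma ev_Hom: "zigzag C W X p Y \<Longrightarrow> ev p X \<in> Hom C (LO X) (LO Y)"
proof (induction rule: zigzag.induct)
  case (zigzag_Nil X)
  then show ?case by (auto simp: Hom_iff)
next
  case (zigzag_Fwd f p Y)
  then show ?case by (auto simp: Hom_iff)
next
  case (zigzag_Bwd s p Y)
  then show ?case using linv_typing[of s] by (auto simp: Hom_iff)
qed

lemma zigzag_append: "zigzag C W X p Y \<Longrightarrow> zigzag C W Y q Z \<Longrightarrow> zigzag C W X (p @ q) Z"
  by (induction rule: zigzag.induct) (auto intro: zigzag.intros)

lemma ev_append: "zigzag C W X p Y \<Longrightarrow> zigzag C W Y q Z \<Longrightarrow> ev (p @ q) X = ev q Y \<cdot> ev p X"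
proof (induction rule: zigzag.induct)
  case (zigzag_Nil X)
  then show ?case using ev_Hom[of X q Z] by (auto simp: Hom_iff)
next
  case (zigzag_Fwd f p Y)
  then show ?case using ev_Hom[of "Cod C f" p Y] ev_Hom[of Y q Z] by (auto simp: Hom_iff)
next
  case (zigzag_Bwd s p Y)
  then show ?case
    using ev_Hom[of "Dom C s" p Y] ev_Hom[of Y q Z] linv_typing[of s] by (auto simp: Hom_iff)
qed

lemma zigzag_Fwd1: "f \<in> Hom C X Y \<Longrightarrow> zigzag C W X [Fwd f] Y"
  using zigzag_Fwd[of f C W "[]" Y] zigzag_Nil[of Y C W] HomD[of f X Y] by auto

lemma zigzag_Bwd1: "s \<in> W \<Longrightarrow> zigzag C W (Cod C s) [Bwd s] (Dom C s)"
  using zigzag_Bwd[of s W C "[]" "Dom C s"] zigzag_Nil[of "Dom C s" C W] W_typing by auto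

text \<open>Every generating relation becomes an identity because \<open>LA\<close> is functorial
  and inverts \<open>W\<close>; the congruence rules hold because \<open>ev\<close> turns
  concatenation into composition.\<close>

lemma zigzag_eq_sound:
  "zigzag_eq C W X Y p q \<Longrightarrow> zigzag C W X p Y \<and> zigzag C W X q Y \<and> ev p X = ev q X"
proof (induction rule: zigzag_eq.induct)
  case (zeq_context X' a X Y p q b Y')
  then show ?case
    using zigzag_append[of X' a X] zigzag_append[of X _ Y b Y'] ev_append[of X' a X "p @ b" Y']
      ev_append[of X' a X "q @ b" Y'] ev_append[of X p Y b Y'] ev_append[of X q Y b Y'] by auto
next
  case (zeq_Idn X)
  then show ?case using zigzag_Fwd1[OF Idn_in_Hom] by (auto intro: zigzag.intros)
next
  case (zeq_Cmp f X Y g Z)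
  note tt = HomD[OF zeq_Cmp(1)] HomD[OF zeq_Cmp(2)]
  have "zigzag C W X ([Fwd f] @ [Fwd g]) Z"
    by (rule zigzag_append[OF zigzag_Fwd1[OF zeq_Cmp(1)] zigzag_Fwd1[OF zeq_Cmp(2)]])
  then show ?case using zigzag_Fwd1[OF Cmp_in_Hom[OF zeq_Cmp]] tt by simp
next
  case (zeq_Fwd_Bwd s)
  have "zigzag C W (Dom C s) ([Fwd s] @ [Bwd s]) (Dom C s)"
    by (rule zigzag_append[OF zigzag_Fwd1 zigzag_Bwd1]) (use zeq_Fwd_Bwd W_typing in \<open>auto simp: Hom_iff\<close>)
  then show ?case using zeq_Fwd_Bwd W_typing[of s] linv[of s] linv_typing[of s]
    by (auto intro: zigzag.intros)
next
  case (zeq_Bwd_Fwd s)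
  have "zigzag C W (Cod C s) ([Bwd s] @ [Fwd s]) (Cod C s)"
    by (rule zigzag_append[OF zigzag_Bwd1 zigzag_Fwd1]) (use zeq_Bwd_Fwd W_typing in \<open>auto simp: Hom_iff\<close>)
  then show ?case using zeq_Bwd_Fwd W_typing[of s] linv[of s] linv_typing[of s]
    by (auto intro: zigzag.intros)
qed auto

lemma zigzag_eq_append:
  assumes p: "zigzag_eq C W X Y p p'" and q: "zigzag_eq C W Y Z q q'"
  shows "zigzag_eq C W X Z (p @ q) (p' @ q')"
proof -
  note pz = zigzag_eq_sound[OF p] and qz = zigzag_eq_sound[OF q]
  have "zigzag_eq C W X Z ([] @ p @ q) ([] @ p' @ q)"
    by (rule zeq_context[OF _ p]) (use zigzag_Obj pz qz in \<open>auto intro: zigzag.intros\<close>)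
  moreover have "zigzag_eq C W X Z (p' @ q @ []) (p' @ q' @ [])"
    by (rule zeq_context[OF _ q]) (use zigzag_Obj pz qz in \<open>auto intro: zigzag.intros\<close>)
  ultimately show ?thesis by (auto intro: zeq_trans)
qed

lemma zigzag_eq_Cmp:
  "f \<in> Hom C X Y \<Longrightarrow> g \<in> Hom C Y Z \<Longrightarrow> h = g \<cdot> f \<Longrightarrow> zigzag_eq C W X Z [Fwd h] [Fwd f, Fwd g]"
  using zeq_sym[OF zeq_Cmp, of f C X Y g Z W] by simp

lemma zigzag_eq_normal_form:
  "zigzag C W X p Y \<Longrightarrow> zigzag_eq C W X Y p [Fwd (\<eta> X), Fwd (ev p X), Bwd (\<eta> Y)]"
proof (induction rule: zigzag.induct)
  case (zigzag_Nil X)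
  have 1: "zigzag_eq C W X X [Fwd (\<eta> X), Bwd (\<eta> X)] []"
    using zeq_Fwd_Bwd[OF eta_cone[OF zigzag_Nil], of C] zigzag_Nil by simp
  have "zigzag_eq C W X X ([Fwd (\<eta> X)] @ [Fwd (Idn C (LO X))] @ [Bwd (\<eta> X)]) ([Fwd (\<eta> X)] @ [] @ [Bwd (\<eta> X)])"
    by (rule zeq_context[OF zigzag_Fwd1[OF eta_Hom] zeq_Idn])
      (use zigzag_Nil zigzag_Bwd1[OF eta_cone[OF zigzag_Nil]] in auto)
  with 1 show ?case by (auto intro: zeq_trans zeq_sym)
next
  case (zigzag_Fwd f p Y)
  let ?X = "Dom C f" and ?X' = "Cod C f"
  note f = zigzag_Fwd(1)
  have Y: "Y \<in> Obj C" using zigzag_Obj[OF zigzag_Fwd(2)] by simp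
  have fH: "f \<in> Hom C ?X ?X'" using f by (simp add: Hom_iff)
  note e = ev_Hom[OF zigzag_Fwd(2)]
  note \<eta>1 = eta_Hom[of ?X] and \<eta>2 = eta_Hom[of ?X']
  have B: "zigzag_eq C W (LO Y) Y [Bwd (\<eta> Y)] [Bwd (\<eta> Y)]"
    using zeq_refl[OF zigzag_Bwd1[OF eta_cone[OF Y]]] Y by simp
  have E: "zigzag_eq C W (LO ?X') (LO Y) [Fwd (ev p ?X')] [Fwd (ev p ?X')]"
    by (rule zeq_refl[OF zigzag_Fwd1[OF e]])
  have "zigzag_eq C W ?X Y ([Fwd f] @ p) ([Fwd f] @ [Fwd (\<eta> ?X'), Fwd (ev p ?X'), Bwd (\<eta> Y)])"
    by (rule zigzag_eq_append[OF zeq_refl[OF zigzag_Fwd1[OF fH]] zigzag_Fwd(3)])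
  moreover have "zigzag_eq C W ?X (LO ?X') [Fwd f, Fwd (\<eta> ?X')] [Fwd (\<eta> ?X' \<cdot> f)]"
    by (rule zeq_Cmp[OF fH]) (use f \<eta>2 in auto)
  \<comment> \<open>Naturality of \<open>\<eta>\<close> moves the leading step behind the unit,
    where it can be merged with \<open>ev p ?X'\<close>.\<close>
  moreover have "zigzag_eq C W ?X (LO ?X') [Fwd (\<eta> ?X' \<cdot> f)] [Fwd (\<eta> ?X), Fwd (LA f)]"
    by (rule zigzag_eq_Cmp) (use f \<eta>1 eta_natural[OF f] LA_in_Hom[OF fH] in auto)
  ultimately have 1: "zigzag_eq C W ?X Y (Fwd f # p) ([Fwd (\<eta> ?X), Fwd (LA f)] @ [Fwd (ev p ?X')] @ [Bwd (\<eta> Y)])"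
    using zigzag_eq_append[OF _ zigzag_eq_append[OF E B], of ?X "[Fwd f, Fwd (\<eta> ?X')]" "[Fwd (\<eta> ?X), Fwd (LA f)]"]
    by (auto intro: zeq_trans)
  have "zigzag_eq C W ?X Y ([Fwd (\<eta> ?X)] @ [Fwd (LA f), Fwd (ev p ?X')] @ [Bwd (\<eta> Y)])
      ([Fwd (\<eta> ?X)] @ [Fwd (ev p ?X' \<cdot> LA f)] @ [Bwd (\<eta> Y)])"
    by (rule zeq_context[OF zigzag_Fwd1 zeq_Cmp[OF LA_in_Hom[OF fH] e]])
      (use f \<eta>1 zigzag_Bwd1[OF eta_cone[OF Y]] Y in auto)
  with 1 show ?case by (auto intro: zeq_trans)
next
  case (zigzag_Bwd s p Y)
  let ?X = "Cod C s" and ?X' = "Dom C s"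
  note s = W_typing[OF zigzag_Bwd(1)] and l = linv[OF zigzag_Bwd(1)] and lt = linv_typing[OF zigzag_Bwd(1)]
  have Y: "Y \<in> Obj C" using zigzag_Obj[OF zigzag_Bwd(2)] by simp
  have sH: "s \<in> Hom C ?X' ?X" using s by (simp add: Hom_iff)
  note e = ev_Hom[OF zigzag_Bwd(2)]
  note \<eta>1 = eta_Hom[OF s(3)] and \<eta>2 = eta_Hom[OF s(2)]
  have B: "zigzag_eq C W (LO Y) Y [Bwd (\<eta> Y)] [Bwd (\<eta> Y)]"
    using zeq_refl[OF zigzag_Bwd1[OF eta_cone[OF Y]]] Y by simp
  have E: "zigzag_eq C W (LO ?X') (LO Y) [Fwd (ev p ?X')] [Fwd (ev p ?X')]"
    by (rule zeq_refl[OF zigzag_Fwd1[OF e]])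
  have S: "zigzag_eq C W ?X ?X' [Bwd s] [Bwd s]"
    by (rule zeq_refl[OF zigzag_Bwd1[OF zigzag_Bwd(1)]])
  have 0: "zigzag_eq C W ?X Y (Bwd s # p) ([Bwd s] @ [Fwd (\<eta> ?X')] @ [Fwd (ev p ?X'), Bwd (\<eta> Y)])"
    using zigzag_eq_append[OF S zigzag_Bwd(3)] by simp
  \<comment> \<open>For a backward step the unit of the far end is rewritten so that it begins with
    \<open>s\<close>, which then cancels against \<open>Bwd s\<close>; what remains is
    \<open>\<eta> ?X\<close> followed by \<open>linv s\<close>.\<close>
  have \<eta>eq: "\<eta> ?X' = linv s \<cdot> (\<eta> ?X \<cdot> s)"
    using s lt by (simp add: eta_natural[OF s(1), symmetric] Cmp_reassoc[OF l(2)])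
  have "zigzag_eq C W ?X' (LO ?X') [Fwd (\<eta> ?X')] [Fwd (\<eta> ?X \<cdot> s), Fwd (linv s)]"
    by (rule zigzag_eq_Cmp[OF _ l(1) \<eta>eq]) (rule Cmp_in_Hom[OF sH \<eta>1])
  moreover have "zigzag_eq C W ?X' (LO ?X) [Fwd (\<eta> ?X \<cdot> s)] [Fwd s, Fwd (\<eta> ?X)]"
    by (rule zigzag_eq_Cmp[OF sH \<eta>1]) simp
  ultimately have "zigzag_eq C W ?X' (LO ?X') [Fwd (\<eta> ?X')] ([Fwd s, Fwd (\<eta> ?X)] @ [Fwd (linv s)])"
    using zigzag_eq_append[OF _ zeq_refl[OF zigzag_Fwd1[OF l(1)]], of ?X' "[Fwd (\<eta> ?X \<cdot> s)]" "[Fwd s, Fwd (\<eta> ?X)]"]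
    by (auto intro: zeq_trans)
  then have "zigzag_eq C W ?X (LO ?X') ([Bwd s] @ [Fwd (\<eta> ?X')]) ([Bwd s] @ [Fwd s, Fwd (\<eta> ?X), Fwd (linv s)])"
    using zigzag_eq_append[OF S] by fastforce
  moreover have "zigzag_eq C W ?X (LO ?X') ([Bwd s, Fwd s] @ [Fwd (\<eta> ?X), Fwd (linv s)]) ([] @ [Fwd (\<eta> ?X), Fwd (linv s)])"
    using zigzag_eq_append[OF zeq_Bwd_Fwd[OF zigzag_Bwd(1)]
       zeq_refl[OF zigzag_append[OF zigzag_Fwd1[OF \<eta>1] zigzag_Fwd1[OF l(1)]]]] by simp
  ultimately have "zigzag_eq C W ?X (LO ?X') ([Bwd s] @ [Fwd (\<eta> ?X')]) [Fwd (\<eta> ?X), Fwd (linv s)]"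
    by (auto intro: zeq_trans)
  from zigzag_eq_append[OF this zigzag_eq_append[OF E B]]
  have 1: "zigzag_eq C W ?X Y (Bwd s # p) ([Fwd (\<eta> ?X)] @ [Fwd (linv s), Fwd (ev p ?X')] @ [Bwd (\<eta> Y)])"
    using 0 by (auto intro: zeq_trans)
  have "zigzag_eq C W ?X Y ([Fwd (\<eta> ?X)] @ [Fwd (linv s), Fwd (ev p ?X')] @ [Bwd (\<eta> Y)])
      ([Fwd (\<eta> ?X)] @ [Fwd (ev p ?X' \<cdot> linv s)] @ [Bwd (\<eta> Y)])"
    by (rule zeq_context[OF zigzag_Fwd1[OF \<eta>1] zeq_Cmp[OF l(1) e]])
      (use zigzag_Bwd1[OF eta_cone[OF Y]] Y in auto)
  with 1 show ?case by (auto intro: zeq_trans)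
qed

text \<open>Zigzags with the same endpoints and the same value have the same normal form. This
  replaces a calculus of fractions: morphisms of the quotient are from here on handled through their
  values.\<close>

lemma zigzag_eq_iff:
  "zigzag_eq C W X Y p q \<longleftrightarrow> zigzag C W X p Y \<and> zigzag C W X q Y \<and> ev p X = ev q X"
  using zigzag_eq_sound[of X Y p q] zigzag_eq_normal_form[of X p Y] zigzag_eq_normal_form[of X q Y]
    zeq_trans zeq_sym by metis

text \<open>\<open>fr X Y a\<close> is the morphism \<open>X \<rightarrow> Y\<close> of the quotient that corresponds to \<open>a: L X \<rightarrow> L Y\<close>.\<close>

definition fr :: "'o \<Rightarrow> 'o \<Rightarrow> 'm \<Rightarrow> ('o, 'm) frac" where
  "fr X Y a = (X, Y, {q. zigzag C W X q Y \<and> ev q X = a})"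

lemma frac_class_eq: "zigzag C W X p Y \<Longrightarrow> frac_class C W X Y p = fr X Y (ev p X)"
  by (auto simp: frac_class_def fr_def zigzag_eq_iff)

lemma ex_zigzag:
  assumes X: "X \<in> Obj C" "Y \<in> Obj C" and a: "a \<in> Hom C (LO X) (LO Y)"
  shows "\<exists>p. zigzag C W X p Y \<and> ev p X = a"
proof (intro exI conjI)
  let ?p = "[Fwd (\<eta> X)] @ [Fwd a] @ [Bwd (\<eta> Y)]"
  show "zigzag C W X ?p Y"
    by (rule zigzag_append[OF zigzag_Fwd1[OF eta_Hom[OF X(1)]] zigzag_append[OF zigzag_Fwd1[OF a]]])
      (use zigzag_Bwd1[OF eta_cone[OF X(2)]] X in auto)
  note l = linv[OF eta_cone[OF X(2)]] linv_typing[OF eta_cone[OF X(2)]] and tt = X HomD[OF a]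
  \<comment> \<open>Naturality of \<open>\<eta>\<close> at \<open>a\<close>, rewritten with
    \<open>LA (\<eta> X) = \<eta> (LO X)\<close>; it lets the inverse of
    \<open>LA (\<eta> Y)\<close> cancel and leaves \<open>a\<close>.\<close>
  have "LA a \<cdot> LA (\<eta> X) = LA (\<eta> Y) \<cdot> a"
    using eta_natural[of a] tt by (simp add: LA_eta)
  then show "ev ?p X = a" using l tt by (simp add: Cmp_reassoc[OF l(2)])
qed

lemma fr_inj:
  assumes "fr X Y a = fr X Y b" "X \<in> Obj C" "Y \<in> Obj C" "a \<in> Hom C (LO X) (LO Y)"
  shows "a = b"
  using ex_zigzag[OF assms(2-4)] assms(1) by (auto simp: fr_def)

section \<open>The quotient as a category\<close>

lemma loc_simps:
  "Obj V = Obj C" "Dom V (fr X Y a) = X" "Cod V (fr X Y a) = Y"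
  by (auto simp: verdier_quotient_def localization_def fr_def Let_def)

lemma V_Arr: "Arr V = {fr X Y a | X Y a. X \<in> Obj C \<and> Y \<in> Obj C \<and> a \<in> Hom C (LO X) (LO Y)}"
proof -
  have "Arr V = {frac_class C W X Y p | X Y p. zigzag C W X p Y}"
    by (simp add: verdier_quotient_def localization_def Let_def)
  also have "\<dots> = {fr X Y (ev p X) | X Y p. zigzag C W X p Y}"
    using frac_class_eq by (metis (no_types, lifting))
  also have "\<dots> = {fr X Y a | X Y a. X \<in> Obj C \<and> Y \<in> Obj C \<and> a \<in> Hom C (LO X) (LO Y)}"
    using ev_Hom zigzag_Obj ex_zigzag by blast
  finally show ?thesis .
qed

lemma V_HomI: "X \<in> Obj C \<Longrightarrow> Y \<in> Obj C \<Longrightarrow> a \<in> Hom C (LO X) (LO Y) \<Longrightarrow> fr X Y a \<in> Hom V X Y"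
  unfolding Hom_def[of V] using V_Arr loc_simps by auto

lemma V_HomE:
  assumes "\<alpha> \<in> Hom V X Y"
  obtains a where "X \<in> Obj C" "Y \<in> Obj C" "a \<in> Hom C (LO X) (LO Y)" "\<alpha> = fr X Y a"
  using assms unfolding Hom_def[of V] V_Arr by (auto simp: loc_simps)

lemma V_ArrI: "X \<in> Obj C \<Longrightarrow> Y \<in> Obj C \<Longrightarrow> a \<in> Hom C (LO X) (LO Y) \<Longrightarrow> fr X Y a \<in> Arr V"
  unfolding V_Arr by blast

lemma V_ArrE:
  assumes "\<alpha> \<in> Arr V"
  obtains X Y a where "X \<in> Obj C" "Y \<in> Obj C" "a \<in> Hom C (LO X) (LO Y)" "\<alpha> = fr X Y a"
  using assms unfolding V_Arr by auto

lemma V_Idn: "X \<in> Obj C \<Longrightarrow> Idn V X = fr X X (Idn C (LO X))"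
  using frac_class_eq[OF zigzag_Nil, of X]
  by (simp add: verdier_quotient_def localization_def Let_def)

lemma V_Cmp:
  assumes "X \<in> Obj C" "Y \<in> Obj C" "Z \<in> Obj C" "a \<in> Hom C (LO X) (LO Y)" "b \<in> Hom C (LO Y) (LO Z)"
  shows "fr Y Z b \<cdot>\<^bsub>V\<^esub> fr X Y a = fr X Z (b \<cdot> a)"
proof -
  obtain p q where p: "zigzag C W X p Y" "ev p X = a" and q: "zigzag C W Y q Z" "ev q Y = b"
    using ex_zigzag[OF assms(1,2,4)] ex_zigzag[OF assms(2,3,5)] by blast
  have "fr Y Z b \<cdot>\<^bsub>V\<^esub> fr X Y a = (X, Z, {r. \<exists>p q. zigzag C W X p Y \<and> ev p X = a \<and>
      zigzag C W Y q Z \<and> ev q Y = b \<and> zigzag_eq C W X Z (p @ q) r})"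
    by (auto simp: verdier_quotient_def localization_def Let_def fr_def)
  also have "\<dots> = fr X Z (b \<cdot> a)"
    unfolding fr_def zigzag_eq_iff using ev_append zigzag_append p q by (auto, metis+)
  finally show ?thesis .
qed

lemma V_category: "category V"
proof
  fix \<alpha> assume "\<alpha> \<in> Arr V"
  then show "Dom V \<alpha> \<in> Obj V" "Cod V \<alpha> \<in> Obj V" by (auto elim!: V_ArrE simp: loc_simps)
next
  fix X assume X: "X \<in> Obj V"
  then show "Idn V X \<in> Hom V X X" by (auto simp: loc_simps V_Idn intro!: V_HomI Idn_in_Hom)
next
  fix f g X Y Z assume "f \<in> Hom V X Y" "g \<in> Hom V Y Z"
  then show "g \<cdot>\<^bsub>V\<^esub> f \<in> Hom V X Z"
    by (auto elim!: V_HomE simp: V_Cmp intro!: V_HomI intro: Cmp_in_Hom)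
next
  fix f X Y assume "f \<in> Hom V X Y"
  then show "f \<cdot>\<^bsub>V\<^esub> Idn V X = f" "Idn V Y \<cdot>\<^bsub>V\<^esub> f = f"
    by (auto elim!: V_HomE simp: V_Cmp V_Idn Idn_in_Hom Hom_iff)
next
  fix f g h X' X Y Z assume "f \<in> Hom V X' X" "g \<in> Hom V X Y" "h \<in> Hom V Y Z"
  then obtain a b c where o: "X' \<in> Obj C" "X \<in> Obj C" "Y \<in> Obj C" "Z \<in> Obj C"
    and a: "a \<in> Hom C (LO X') (LO X)" "b \<in> Hom C (LO X) (LO Y)" "c \<in> Hom C (LO Y) (LO Z)"
    and e: "f = fr X' X a" "g = fr X Y b" "h = fr Y Z c" by (metis V_HomE)
  show "(h \<cdot>\<^bsub>V\<^esub> g) \<cdot>\<^bsub>V\<^esub> f = h \<cdot>\<^bsub>V\<^esub> (g \<cdot>\<^bsub>V\<^esub> f)"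
    unfolding e using o a Cmp_in_Hom[OF a(1,2)] Cmp_in_Hom[OF a(2,3)] Cmp_assoc[OF a]
    by (simp add: V_Cmp)
qed

section \<open>The additive structure of the quotient\<close>

lemma V_Zer: "X \<in> Obj C \<Longrightarrow> Y \<in> Obj C \<Longrightarrow> Zer V X Y = fr X Y (Zer C (LO X) (LO Y))"
  using frac_class_eq[OF zigzag_Fwd1[OF Zer_in_Hom], of X Y]
  by (simp add: verdier_quotient_def Let_def)

text \<open>The obstruction to factoring \<open>a \<cdot> \<eta> X\<close> through
  \<open>\<eta> Y\<close> is its composite \<open>k\<close> with the map from \<open>LO Y\<close> to
  the cone of \<open>\<eta> Y\<close>. Passing to the fiber \<open>s\<close> of \<open>k\<close>
  removes it, and \<open>s\<close> is in \<open>W\<close> because its cone is the target of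
  \<open>k\<close>, which lies in \<open>A\<close>.\<close>

lemma common_denominator1:
  assumes X: "X \<in> Obj C" and Y: "Y \<in> Obj C" and a: "a \<in> Hom C (LO X) (LO Y)"
  obtains s f where "s \<in> W" "Cod C s = X" "f \<in> Hom C (Dom C s) Y" "LA f = a \<cdot> LA s"
proof -
  obtain g h where t: "(\<eta> Y, g, h) \<in> Tri C" and g: "Cod C g \<in> A" using eta_cone[OF Y] by (rule cone_inE)
  note tt = Tri_typing[OF t] X Y HomD[OF a]
  define k where "k = g \<cdot> (a \<cdot> \<eta> X)"
  have k: "k \<in> Arr C" "Dom C k = X" "Cod C k = Cod C g" using tt by (auto simp: k_def)
  obtain s k2 where t3: "(s, k, k2) \<in> Tri C" using ex_fiber[OF k(1)] by blast
  have st: "s \<in> Arr C" "Dom C s \<in> Obj C" "Cod C s = X" using Tri_typing[OF t3] k by auto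
  have sW: "s \<in> W" using t3 g k(3) by (auto simp: cone_in_def)
  have "g \<cdot> (a \<cdot> \<eta> X \<cdot> s) = Zer C (Dom C s) (Cod C g)"
    using comp_zero[OF t3] st tt k by (simp add: k_def)
  then obtain f where f: "f \<in> Hom C (Dom C s) Y" "\<eta> Y \<cdot> f = a \<cdot> \<eta> X \<cdot> s"
    using tri_lift[OF t, of "a \<cdot> \<eta> X \<cdot> s" "Dom C s"] st tt by (auto simp: Hom_iff)
  have "LA f = a \<cdot> LA s"
    by (rule LA_unique[OF f(1)]) (use st tt f(2) eta_natural[of s] in \<open>auto simp: Hom_iff\<close>)
  with that sW st f(1) show ?thesis by blast
qed

text \<open>A denominator for \<open>a\<close> is found first; then \<open>b\<close> is pulled back
  along it and given a further denominator, so that the composite of the two serves for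
  both.\<close>

lemma common_denominator:
  assumes X: "X \<in> Obj C" and Y: "Y \<in> Obj C"
    and a: "a \<in> Hom C (LO X) (LO Y)" and b: "b \<in> Hom C (LO X) (LO Y)"
  obtains s f g where "s \<in> W" "Cod C s = X" "f \<in> Hom C (Dom C s) Y" "g \<in> Hom C (Dom C s) Y"
    "LA f = a \<cdot> LA s" "LA g = b \<cdot> LA s"
proof -
  obtain s1 f1 where 1: "s1 \<in> W" "Cod C s1 = X" "f1 \<in> Hom C (Dom C s1) Y" "LA f1 = a \<cdot> LA s1"
    by (rule common_denominator1[OF X Y a])
  note t1 = W_typing[OF 1(1)] HomD[OF 1(3)] HomD[OF a] HomD[OF b]
  have "b \<cdot> LA s1 \<in> Hom C (LO (Dom C s1)) (LO Y)" using t1 1(2) by (auto simp: Hom_iff)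
  then obtain s2 g where 2: "s2 \<in> W" "Cod C s2 = Dom C s1" "g \<in> Hom C (Dom C s2) Y"
      "LA g = (b \<cdot> LA s1) \<cdot> LA s2"
    by (rule common_denominator1[OF t1(2) Y])
  note t2 = W_typing[OF 2(1)]
  show ?thesis
  proof (rule that[of "s1 \<cdot> s2" "f1 \<cdot> s2" g])
    show "s1 \<cdot> s2 \<in> W" using 1 2 t1 t2 is_iso_Cmp[of "LO (Dom C s2)" "LO (Dom C s1)" "LA s2"]
      by (simp add: cone_in_iff)
  qed (use 1 2 t1 t2 in \<open>auto simp: Hom_iff\<close>)
qed

lemma ev_roof:
  "s \<in> W \<Longrightarrow> f \<in> Hom C (Dom C s) Y \<Longrightarrow> ev [Bwd s, Fwd f] X = LA f \<cdot> linv s"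
  using HomD[of f "Dom C s" Y] by simp

lemma zigzag_roof:
  "zigzag C W X [Bwd s, Fwd f] Y \<longleftrightarrow> s \<in> W \<and> Cod C s = X \<and> f \<in> Hom C (Dom C s) Y"
proof
  assume z: "zigzag C W X [Bwd s, Fwd f] Y"
  from z have sW: "s \<in> W" "X = Cod C s" and z': "zigzag C W (Dom C s) [Fwd f] Y"
    by (auto elim: zigzag.cases)
  from z' have "f \<in> Arr C" "Dom C s = Dom C f" and z'': "zigzag C W (Cod C f) [] Y"
    by (auto elim: zigzag.cases)
  moreover from z'' have "Cod C f = Y" by (auto elim: zigzag.cases)
  ultimately show "s \<in> W \<and> Cod C s = X \<and> f \<in> Hom C (Dom C s) Y" using sW by (simp add: Hom_iff)
next
  assume "s \<in> W \<and> Cod C s = X \<and> f \<in> Hom C (Dom C s) Y"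
  then show "zigzag C W X [Bwd s, Fwd f] Y"
    using zigzag_append[OF zigzag_Bwd1 zigzag_Fwd1] by fastforce
qed

lemma roof_eq_iff:
  assumes s: "s \<in> W" and f: "f \<in> Hom C (Dom C s) Y" and a: "a \<in> Hom C (LO (Cod C s)) (LO Y)"
  shows "LA f \<cdot> linv s = a \<longleftrightarrow> LA f = a \<cdot> LA s"
  using W_typing[OF s] linv_typing[OF s] linv[OF s] HomD[OF f] HomD[OF a] by auto

text \<open>The defining set ranges over all common denominators at once. Additivity of
  \<open>L\<close> gives each of them the same value \<open>Plus C a b\<close>, so the sum is
  independent of the choice; \<open>common_denominator\<close> ensures that there is at least
  one.\<close>

lemma V_Plus:
  assumes X: "X \<in> Obj C" and Y: "Y \<in> Obj C"
    and a: "a \<in> Hom C (LO X) (LO Y)" and b: "b \<in> Hom C (LO X) (LO Y)"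
  shows "Plus V (fr X Y a) (fr X Y b) = fr X Y (Plus C a b)"
proof -
  have ab: "Plus C a b \<in> Hom C (LO X) (LO Y)" by (rule Plus_in_Hom[OF a b])
  have ev_sum: "ev [Bwd s, Fwd (Plus C f g)] X = Plus C a b"
    if s: "s \<in> W" "Cod C s = X" and f: "f \<in> Hom C (Dom C s) Y" and g: "g \<in> Hom C (Dom C s) Y"
      and e: "LA f = a \<cdot> LA s" "LA g = b \<cdot> LA s" for s f g
  proof -
    have "LA (Plus C f g) = Plus C a b \<cdot> LA s"
      using is_additiveD(2)[OF L_additive f g] W_typing[OF s(1)] Y e s HomD[OF a] HomD[OF b]
      by (simp add: Plus_Cmp_Arr)
    then show ?thesis
      using roof_eq_iff[OF s(1) Plus_in_Hom[OF f g], of "Plus C a b"] ab s(2)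
        ev_roof[OF s(1) Plus_in_Hom[OF f g]] by simp
  qed
  have roof: "[Bwd s, Fwd f] \<in> {q. zigzag C W X q Y \<and> ev q X = a} \<longleftrightarrow>
      s \<in> W \<and> Cod C s = X \<and> f \<in> Hom C (Dom C s) Y \<and> LA f = a \<cdot> LA s"
    if a: "a \<in> Hom C (LO X) (LO Y)" for s f a
    using roof_eq_iff[of s f Y a] ev_roof[of s f Y X] a by (auto simp: zigzag_roof)
  have "Plus V (fr X Y a) (fr X Y b) = (X, Y, {r. \<exists>s f g.
      (s \<in> W \<and> Cod C s = X \<and> f \<in> Hom C (Dom C s) Y \<and> LA f = a \<cdot> LA s) \<and>
      (s \<in> W \<and> Cod C s = X \<and> g \<in> Hom C (Dom C s) Y \<and> LA g = b \<cdot> LA s) \<and>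
      zigzag_eq C W X Y [Bwd s, Fwd (Plus C f g)] r})"
    unfolding roof[OF a, symmetric] roof[OF b, symmetric]
    by (simp add: verdier_quotient_def localization_def Let_def fr_def)
  also have "\<dots> = fr X Y (Plus C a b)"
  proof -
    have "(\<exists>s f g. (s \<in> W \<and> Cod C s = X \<and> f \<in> Hom C (Dom C s) Y \<and> LA f = a \<cdot> LA s) \<and>
      (s \<in> W \<and> Cod C s = X \<and> g \<in> Hom C (Dom C s) Y \<and> LA g = b \<cdot> LA s) \<and>
      zigzag_eq C W X Y [Bwd s, Fwd (Plus C f g)] r) \<longleftrightarrow> zigzag C W X r Y \<and> ev r X = Plus C a b" (is "?l \<longleftrightarrow> ?r")
      for r
    proof
      assume ?l
      then show ?r using ev_sum unfolding zigzag_eq_iff by metis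
    next
      assume r: ?r
      obtain s f g where s: "s \<in> W" "Cod C s = X" "f \<in> Hom C (Dom C s) Y" "g \<in> Hom C (Dom C s) Y"
          "LA f = a \<cdot> LA s" "LA g = b \<cdot> LA s"
        by (rule common_denominator[OF X Y a b])
      have "zigzag_eq C W X Y [Bwd s, Fwd (Plus C f g)] r"
        unfolding zigzag_eq_iff using r s ev_sum[OF s] Plus_in_Hom[OF s(3,4)]
        by (simp add: zigzag_roof)
      then show ?l using s by blast
    qed
    then show ?thesis by (simp add: fr_def)
  qed
  finally show ?thesis .
qed

end

section \<open>Binary coproducts of local objects\<close>

context triangulated_category
begin

text \<open>A binary coproduct in an additive category is a product as well: the identity of
  \<open>P\<close> is the sum of the two composites \<open>\<iota> j \<cdot> p j\<close>, so a
  morphism into \<open>P\<close> vanishes when its components do.\<close>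

lemma orth_coproduct:
  assumes A: "A \<subseteq> Obj C" and P: "is_coproduct C (UNIV :: bool set) X P \<iota>"
    and X: "\<And>i. X i \<in> orth A"
  shows "P \<in> orth A"
proof -
  note d = is_coproductD[OF P]
  have o: "X i \<in> Obj C" for i using X orth_Obj by blast
  have "\<exists>p. p \<in> Hom C P (X j) \<and> (\<forall>i. p \<cdot> \<iota> i = (if i = j then Idn C (X j) else Zer C (X i) (X j)))" for j
  proof -
    obtain p where "p \<in> Hom C P (X j)"
        "\<And>i. i \<in> UNIV \<Longrightarrow> p \<cdot> \<iota> i = (if i = j then Idn C (X j) else Zer C (X i) (X j))"
      by (rule coproduct_copair[OF P o, of "\<lambda>i. if i = j then Idn C (X j) else Zer C (X i) (X j)" j])
        (auto simp: o Idn_in_Hom Zer_in_Hom)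
    then show ?thesis by blast
  qed
  then obtain p where p: "\<And>j. p j \<in> Hom C P (X j)"
      "\<And>i j. p j \<cdot> \<iota> i = (if i = j then Idn C (X j) else Zer C (X i) (X j))" by metis
  have \<iota>: "\<iota> i \<in> Hom C (X i) P" for i using d(3) by simp
  have ty: "p j \<in> Arr C" "Dom C (p j) = P" "Cod C (p j) = X j" "\<iota> j \<in> Arr C"
    "Dom C (\<iota> j) = X j" "Cod C (\<iota> j) = P" for j
    using HomD[OF p(1)[of j]] HomD[OF \<iota>[of j]] by auto
  let ?e = "\<lambda>j. \<iota> j \<cdot> p j"
  have e: "?e j \<in> Hom C P P" for j by (auto simp: Hom_iff ty)
  have 1: "Plus C (?e True) (?e False) = Idn C P"
  proof (rule coproduct_ext[OF P])
    fix i :: bool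
    show "Plus C (?e True) (?e False) \<cdot> \<iota> i = Idn C P \<cdot> \<iota> i"
      using Plus_Zer_right[OF \<iota>] Plus_Zer_left[OF \<iota>]
      by (cases i) (simp_all add: ty d(1) o Plus_Cmp_Arr p(2))
  qed (use e d(1) in \<open>auto intro: Plus_in_Hom Idn_in_Hom\<close>)
  show ?thesis
  proof (rule orthI[OF A d(1)])
    fix Y k assume Y: "Y \<in> A" and k: "k \<in> Hom C Y P"
    note kt = HomD[OF k]
    have "p j \<cdot> k = Zer C Y (X j)" for j
      by (rule orthD[OF X Y]) (simp add: Hom_iff ty kt)
    then have "?e j \<cdot> k = Zer C Y P" for j using kt by (simp add: ty o)
    then have "Plus C (?e True) (?e False) \<cdot> k = Zer C Y P"
      using kt Plus_Zer_left[OF Zer_in_Hom[of Y P]] by (simp add: Plus_Cmp_Arr ty)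
    then show "k = Zer C Y P" unfolding 1 using kt by simp
  qed
qed

end

context bousfield
begin

section \<open>The shift of the quotient\<close>

lemma psi_cancel:
  assumes "psi X \<cdot> a = psi X \<cdot> b" "X \<in> Obj C" "a \<in> Arr C" "b \<in> Arr C" "Cod C a = LO (sh X)"
    "Cod C b = LO (sh X)"
  shows "a = b"
proof -
  obtain g where g: "g \<in> Hom C (sh (LO X)) (LO (sh X))" "g \<cdot> psi X = Idn C (LO (sh X))"
    using psi_iso[OF assms(2)] by (rule is_isoD)
  have "g \<cdot> (psi X \<cdot> a) = g \<cdot> (psi X \<cdot> b)" using assms(1) by simp
  then show ?thesis using assms(2-) HomD[OF g(1)] by (simp add: Cmp_reassoc[OF g(2)])
qed

text \<open>Shifting a zigzag step by step changes its value into the conjugate of the shifted value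
  by \<open>psi\<close>. Forward steps are naturality of \<open>psi\<close>; backward steps need the
  same square for the inverses.\<close>

lemma zigzag_shift:
  "zigzag C W X p Y \<Longrightarrow> zigzag C W (sh X) (map (map_step shm) p) (sh Y) \<and>
     psi Y \<cdot> ev (map (map_step shm) p) (sh X) = shm (ev p X) \<cdot> psi X"
proof (induction rule: zigzag.induct)
  case (zigzag_Nil X)
  then show ?case by (auto intro: zigzag.intros)
next
  case (zigzag_Fwd f p Y)
  note f = zigzag_Fwd(1) and Y = zigzag_Obj[OF zigzag_Fwd(2)]
  let ?p = "map (map_step shm) p"
  have z: "zigzag C W (sh (Cod C f)) ?p (sh Y)"
    and IH: "psi Y \<cdot> ev ?p (sh (Cod C f)) = shm (ev p (Cod C f)) \<cdot> psi (Cod C f)"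
    using zigzag_Fwd(3) by auto
  note e = HomD[OF ev_Hom[OF z]] HomD[OF ev_Hom[OF zigzag_Fwd(2)]]
  have "psi Y \<cdot> (ev ?p (sh (Cod C f)) \<cdot> LA (shm f)) = shm (ev p (Cod C f)) \<cdot> (psi (Cod C f) \<cdot> LA (shm f))"
    using f Y e by (simp add: Cmp_reassoc[OF IH])
  also have "\<dots> = shm (ev p (Cod C f) \<cdot> LA f) \<cdot> psi (Dom C f)"
    using f Y e by (simp add: psi_natural[symmetric])
  finally show ?case using zigzag.zigzag_Fwd[of "shm f" C W ?p "sh Y"] z f by simp
next
  case (zigzag_Bwd s p Y)
  note s = W_typing[OF zigzag_Bwd(1)] and Y = zigzag_Obj[OF zigzag_Bwd(2)]
  let ?p = "map (map_step shm) p"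
  have z: "zigzag C W (sh (Dom C s)) ?p (sh Y)"
    and IH: "psi Y \<cdot> ev ?p (sh (Dom C s)) = shm (ev p (Dom C s)) \<cdot> psi (Dom C s)"
    using zigzag_Bwd(3) by auto
  have sW: "shm s \<in> W" by (rule cone_in_sh[OF tri_sub zigzag_Bwd(1)])
  note e = HomD[OF ev_Hom[OF z]] HomD[OF ev_Hom[OF zigzag_Bwd(2)]]
  note l = linv[OF zigzag_Bwd(1)] and lt = linv_typing[OF zigzag_Bwd(1)]
  note l' = linv[OF sW] and lt' = linv_typing[OF sW]
  have ll: "shm (linv s) \<cdot> shm (LA s) = Idn C (sh (LO (Dom C s)))"
    using arg_cong[OF l(2), of shm] s lt by simp
  have "psi (Dom C s) = shm (linv s) \<cdot> (shm (LA s) \<cdot> psi (Dom C s))"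
    using s lt by (simp add: Cmp_reassoc[OF ll])
  also have "\<dots> = shm (linv s) \<cdot> (psi (Cod C s) \<cdot> LA (shm s))" using s by (simp add: psi_natural)
  finally have "psi (Dom C s) \<cdot> linv (shm s) = shm (linv s) \<cdot> (psi (Cod C s) \<cdot> LA (shm s)) \<cdot> linv (shm s)"
    by simp
  also have "\<dots> = shm (linv s) \<cdot> psi (Cod C s)" using s lt lt' l'(3) by simp
  \<comment> \<open>The naturality square of \<open>psi\<close> at \<open>s\<close>, with both
    vertical arrows inverted.\<close>
  finally have n: "psi (Dom C s) \<cdot> linv (shm s) = shm (linv s) \<cdot> psi (Cod C s)" .
  have "psi Y \<cdot> (ev ?p (sh (Dom C s)) \<cdot> linv (shm s)) = shm (ev p (Dom C s)) \<cdot> (psi (Dom C s) \<cdot> linv (shm s))"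
    using s Y e lt' by (simp add: Cmp_reassoc[OF IH])
  also have "\<dots> = shm (ev p (Dom C s) \<cdot> linv s) \<cdot> psi (Cod C s)" unfolding n using s e lt by simp
  finally show ?case using zigzag.zigzag_Bwd[OF sW, of C ?p "sh Y"] z s by simp
qed

lemma Shift_V: "Shift V = frac_shift C W"
  by (simp add: verdier_quotient_def Let_def)

lemma V_shift_Obj: "OMap (Shift V) X = sh X"
  by (simp add: Shift_V frac_shift_def)

text \<open>The value \<open>a'\<close> is the conjugate of \<open>shm a\<close> by
  \<open>psi\<close>. Characterising it by an equation keeps the chosen inverses of
  \<open>psi\<close> out of the later computations.\<close>

lemma V_shift:
  assumes X: "X \<in> Obj C" and Y: "Y \<in> Obj C" and a: "a \<in> Hom C (LO X) (LO Y)"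
    and a': "a' \<in> Hom C (LO (sh X)) (LO (sh Y))" "psi Y \<cdot> a' = shm a \<cdot> psi X"
  shows "AMap (Shift V) (fr X Y a) = fr (sh X) (sh Y) a'"
proof -
  have *: "ev (map (map_step shm) p) (sh X) = a'" if "zigzag C W X p Y" "ev p X = a" for p
    by (rule psi_cancel[of Y])
      (use zigzag_shift[OF that(1)] that(2) a' HomD[OF a'(1)] Y
         HomD[OF ev_Hom, of "sh X" "map (map_step shm) p" "sh Y"] in auto)
  obtain p where p: "zigzag C W X p Y" "ev p X = a" using ex_zigzag[OF X Y a] by blast
  have "(\<exists>p. (zigzag C W X p Y \<and> ev p X = a) \<and> zigzag_eq C W (sh X) (sh Y) (map (map_step shm) p) r) \<longleftrightarrow>
     zigzag C W (sh X) r (sh Y) \<and> ev r (sh X) = a'" for r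
    unfolding zigzag_eq_iff using * zigzag_shift p by metis
  then show ?thesis
    by (simp add: Shift_V frac_shift_def fr_def Let_def)
qed

lemma ex_shift:
  assumes X: "X \<in> Obj C" and Y: "Y \<in> Obj C" and a: "a \<in> Hom C (LO X) (LO Y)"
  obtains a' where "a' \<in> Hom C (LO (sh X)) (LO (sh Y))" "psi Y \<cdot> a' = shm a \<cdot> psi X"
proof -
  obtain g where g: "g \<in> Hom C (sh (LO Y)) (LO (sh Y))" "psi Y \<cdot> g = Idn C (sh (LO Y))"
    using psi_iso[OF Y] by (rule is_isoD)
  show ?thesis
    by (rule that[of "g \<cdot> (shm a \<cdot> psi X)"])
      (use X Y HomD[OF a] HomD[OF g(1)] in \<open>auto simp: Hom_iff Cmp_reassoc[OF g(2)]\<close>)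
qed

lemma ex_unshift:
  assumes X: "X \<in> Obj C" and Y: "Y \<in> Obj C" and a': "a' \<in> Hom C (LO (sh X)) (LO (sh Y))"
  obtains a where "a \<in> Hom C (LO X) (LO Y)" "psi Y \<cdot> a' = shm a \<cdot> psi X"
proof -
  obtain g where g: "g \<in> Hom C (sh (LO X)) (LO (sh X))" "g \<cdot> psi X = Idn C (LO (sh X))"
    using psi_iso[OF X] by (rule is_isoD)
  have "psi Y \<cdot> a' \<cdot> g \<in> Hom C (sh (LO X)) (sh (LO Y))"
    using X Y HomD[OF a'] HomD[OF g(1)] by (auto simp: Hom_iff)
  then obtain a where a: "a \<in> Hom C (LO X) (LO Y)" "shm a = psi Y \<cdot> a' \<cdot> g"
    using shm_surj X Y by (metis L_typing(1))
  show ?thesis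
    by (rule that[OF a(1)]) (use X Y HomD[OF a'] HomD[OF g(1)] a(2) g(2) in simp)
qed

lemma shift_psi_inj:
  assumes X: "X \<in> Obj C" and Y: "Y \<in> Obj C" and a: "a \<in> Hom C (LO X) (LO Y)" "b \<in> Hom C (LO X) (LO Y)"
    and e: "shm a \<cdot> psi X = shm b \<cdot> psi X"
  shows "a = b"
proof -
  obtain g where g: "g \<in> Hom C (sh (LO X)) (LO (sh X))" "psi X \<cdot> g = Idn C (sh (LO X))"
    using psi_iso[OF X] by (rule is_isoD)
  have "(shm a \<cdot> psi X) \<cdot> g = (shm b \<cdot> psi X) \<cdot> g" using e by simp
  then have "shm a = shm b" using X HomD[OF g(1)] g(2) HomD[OF a(1)] HomD[OF a(2)] by simp
  then show ?thesis by (rule shm_inj[rotated 2]) (use HomD[OF a(1)] HomD[OF a(2)] in auto)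
qed

lemma V_shift_functor: "is_functor V V (Shift V)"
  unfolding is_functor_def
proof (intro conjI ballI impI V_category)
  fix X assume "X \<in> Obj V"
  then have X: "X \<in> Obj C" by (simp add: loc_simps)
  then show "OMap (Shift V) X \<in> Obj V" by (simp add: V_shift_Obj loc_simps)
  show "AMap (Shift V) (Idn V X) = Idn V (OMap (Shift V) X)"
    unfolding V_shift_Obj V_Idn[OF X] V_Idn[OF sh_Obj[OF X]]
    by (rule V_shift) (use X in \<open>auto simp: Hom_iff\<close>)
next
  fix \<alpha> assume "\<alpha> \<in> Arr V"
  then obtain X Y a where *: "X \<in> Obj C" "Y \<in> Obj C" "a \<in> Hom C (LO X) (LO Y)" "\<alpha> = fr X Y a"
    by (rule V_ArrE)
  obtain a' where a': "a' \<in> Hom C (LO (sh X)) (LO (sh Y))" "psi Y \<cdot> a' = shm a \<cdot> psi X"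
    by (rule ex_shift[OF *(1-3)])
  show "AMap (Shift V) \<alpha> \<in> Hom V (OMap (Shift V) (Dom V \<alpha>)) (OMap (Shift V) (Cod V \<alpha>))"
    using V_shift[OF *(1-3) a'] V_HomI[OF _ _ a'(1)] * by (simp add: loc_simps V_shift_Obj)
next
  fix \<alpha> \<beta> assume "\<alpha> \<in> Arr V" and "\<beta> \<in> Arr V" and e: "Cod V \<alpha> = Dom V \<beta>"
  then obtain X Y a Z b where *: "X \<in> Obj C" "Y \<in> Obj C" "a \<in> Hom C (LO X) (LO Y)" "\<alpha> = fr X Y a"
      "Z \<in> Obj C" "b \<in> Hom C (LO Y) (LO Z)" "\<beta> = fr Y Z b"
    by (metis V_ArrE loc_simps(2,3))
  obtain a' where a': "a' \<in> Hom C (LO (sh X)) (LO (sh Y))" "psi Y \<cdot> a' = shm a \<cdot> psi X"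
    by (rule ex_shift[OF *(1-3)])
  obtain b' where b': "b' \<in> Hom C (LO (sh Y)) (LO (sh Z))" "psi Z \<cdot> b' = shm b \<cdot> psi Y"
    by (rule ex_shift[OF *(2,5,6)])
  note tt = HomD[OF a'(1)] HomD[OF b'(1)] HomD[OF *(3)] HomD[OF *(6)]
  have "AMap (Shift V) (fr X Z (b \<cdot> a)) = fr (sh X) (sh Z) (b' \<cdot> a')"
  proof (rule V_shift[OF *(1,5)])
    have "psi Z \<cdot> (b' \<cdot> a') = shm b \<cdot> (psi Y \<cdot> a')" using tt * by (simp add: Cmp_reassoc[OF b'(2)])
    then show "psi Z \<cdot> (b' \<cdot> a') = shm (b \<cdot> a) \<cdot> psi X" unfolding a'(2) using tt * by simp
  qed (use * a' b' in \<open>auto intro: Cmp_in_Hom\<close>)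
  then show "AMap (Shift V) (\<beta> \<cdot>\<^bsub>V\<^esub> \<alpha>) = AMap (Shift V) \<beta> \<cdot>\<^bsub>V\<^esub> AMap (Shift V) \<alpha>"
    using V_Cmp[OF *(1,2,5,3,6)] V_shift[OF *(1-3) a'] V_shift[OF *(2,5,6) b']
      V_Cmp[OF _ _ _ a'(1) b'(1)] * by simp
qed

text \<open>The shift of \<open>C\<close> and conjugation by \<open>psi\<close> are both bijective
  on morphisms. A fraction records its source and target, so equal shifted fractions have equal
  endpoints.\<close>

lemma V_shift_bij_Arr: "bij_betw (AMap (Shift V)) (Arr V) (Arr V)"
proof (rule bij_betw_imageI)
  show "inj_on (AMap (Shift V)) (Arr V)"
  proof (rule inj_onI)
    fix \<alpha> \<beta> assume "\<alpha> \<in> Arr V" "\<beta> \<in> Arr V" and e: "AMap (Shift V) \<alpha> = AMap (Shift V) \<beta>"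
    then obtain X Y a X' Y' b where *: "X \<in> Obj C" "Y \<in> Obj C" "a \<in> Hom C (LO X) (LO Y)" "\<alpha> = fr X Y a"
      and **: "X' \<in> Obj C" "Y' \<in> Obj C" "b \<in> Hom C (LO X') (LO Y')" "\<beta> = fr X' Y' b"
      by (metis V_ArrE)
    obtain a' where a': "a' \<in> Hom C (LO (sh X)) (LO (sh Y))" "psi Y \<cdot> a' = shm a \<cdot> psi X"
      by (rule ex_shift[OF *(1-3)])
    obtain b' where b': "b' \<in> Hom C (LO (sh X')) (LO (sh Y'))" "psi Y' \<cdot> b' = shm b \<cdot> psi X'"
      by (rule ex_shift[OF **(1-3)])
    have e': "fr (sh X) (sh Y) a' = fr (sh X') (sh Y') b'"
      using e V_shift[OF *(1-3) a'] V_shift[OF **(1-3) b'] * ** by simp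
    then have "sh X = sh X'" "sh Y = sh Y'" by (auto simp: fr_def)
    then have XY: "X = X'" "Y = Y'" using sh_inj * ** by blast+
    have "a' = b'" by (rule fr_inj[OF e'[folded XY]]) (use * a' in auto)
    then have "a = b"
      using shift_psi_inj[OF *(1-3), of b] a'(2) b'(2) ** XY by simp
    then show "\<alpha> = \<beta>" using * ** XY by simp
  qed
  have "\<beta> \<in> AMap (Shift V) ` Arr V" if "\<beta> \<in> Arr V" for \<beta>
  proof -
    from that
    obtain X Y b where *: "X \<in> Obj C" "Y \<in> Obj C" "b \<in> Hom C (LO X) (LO Y)" "\<beta> = fr X Y b"
      by (rule V_ArrE)
    have o: "unsh X \<in> Obj C" "unsh Y \<in> Obj C" "sh (unsh X) = X" "sh (unsh Y) = Y" using * by auto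
    obtain a where a: "a \<in> Hom C (LO (unsh X)) (LO (unsh Y))" "psi (unsh Y) \<cdot> b = shm a \<cdot> psi (unsh X)"
      by (rule ex_unshift[OF o(1,2), of b]) (use * o in auto)
    have "AMap (Shift V) (fr (unsh X) (unsh Y) a) = fr X Y b"
      using V_shift[OF o(1,2) a(1) _ a(2)] * o by simp
    then show "\<beta> \<in> AMap (Shift V) ` Arr V"
      using *(4) V_ArrI[OF o(1,2) a(1)] by (auto intro!: image_eqI[of _ _ "fr (unsh X) (unsh Y) a"])
  qed
  then show "AMap (Shift V) ` Arr V = Arr V" using is_functorD(5)[OF V_shift_functor] by blast
qed

text \<open>The inverse of \<open>fr X Y\<close>: any representative may be evaluated, as
  \<open>ev\<close> is constant on the classes.\<close>

definition rho :: "('o, 'm) frac \<Rightarrow> 'm" where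
  "rho \<alpha> = (case \<alpha> of (X, Y, M) \<Rightarrow> ev (SOME p. p \<in> M) X)"

lemma rho_fr:
  assumes "X \<in> Obj C" "Y \<in> Obj C" "a \<in> Hom C (LO X) (LO Y)"
  shows "rho (fr X Y a) = a"
proof -
  let ?M = "{q. zigzag C W X q Y \<and> ev q X = a}"
  have "\<exists>p. p \<in> ?M" using ex_zigzag[OF assms] by simp
  from someI_ex[OF this] have "ev (SOME p. p \<in> ?M) X = a" by simp
  then show ?thesis by (simp add: rho_def fr_def)
qed

lemma rho_V_functor: "is_functor V C \<lparr>OMap = LO, AMap = rho\<rparr>"
  unfolding is_functor_def
proof (intro conjI ballI impI V_category category_axioms, unfold functr.simps)
  fix X assume "X \<in> Obj V"
  then have X: "X \<in> Obj C" by (simp add: loc_simps)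
  then show "LO X \<in> Obj C" by simp
  show "rho (Idn V X) = Idn C (LO X)" using X by (simp add: V_Idn rho_fr Idn_in_Hom)
next
  fix \<alpha> assume "\<alpha> \<in> Arr V"
  then show "rho \<alpha> \<in> Hom C (LO (Dom V \<alpha>)) (LO (Cod V \<alpha>))"
    by (auto elim!: V_ArrE simp: rho_fr loc_simps)
next
  fix \<alpha> \<beta> assume "\<alpha> \<in> Arr V" and "\<beta> \<in> Arr V" and e: "Cod V \<alpha> = Dom V \<beta>"
  then obtain X Y a Z b where *: "X \<in> Obj C" "Y \<in> Obj C" "a \<in> Hom C (LO X) (LO Y)" "\<alpha> = fr X Y a"
      "Z \<in> Obj C" "b \<in> Hom C (LO Y) (LO Z)" "\<beta> = fr Y Z b"
    by (metis V_ArrE loc_simps(2,3))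
  show "rho (\<beta> \<cdot>\<^bsub>V\<^esub> \<alpha>) = rho \<beta> \<cdot> rho \<alpha>"
    using V_Cmp[OF *(1,2,5,3,6)] rho_fr[OF *(1,5) Cmp_in_Hom[OF *(3,6)]] rho_fr[OF *(1-3)]
      rho_fr[OF *(2,5,6)] * by simp
qed

lemma rho_V_iso: "is_iso V X Y \<alpha> \<Longrightarrow> is_iso C (LO X) (LO Y) (rho \<alpha>)"
  using is_functor_iso[OF rho_V_functor] by simp

lemma V_isoI:
  assumes X: "X \<in> Obj C" "Y \<in> Obj C" and u: "is_iso C (LO X) (LO Y) u"
  shows "is_iso V X Y (fr X Y u)"
proof -
  obtain v where v: "v \<in> Hom C (LO Y) (LO X)" "v \<cdot> u = Idn C (LO X)" "u \<cdot> v = Idn C (LO Y)"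
    using u by (rule is_isoD)
  note uH = is_iso_Hom[OF u]
  show ?thesis
    unfolding is_iso_def
    by (intro conjI bexI[of _ "fr Y X v"] V_HomI)
      (use X v uH in \<open>auto simp: V_Cmp V_Idn\<close>)
qed

section \<open>Triangles of the quotient\<close>

lemma V_Q:
  assumes "f \<in> Arr C"
  shows "frac_class C W (Dom C f) (Cod C f) [Fwd f] = fr (Dom C f) (Cod C f) (LA f)"
  using frac_class_eq[OF zigzag_Fwd1[of f "Dom C f" "Cod C f"]] assms by (simp add: Hom_iff)

text \<open>The triangles of the quotient are defined by isomorphism in the plain localization,
  before the additive structure is attached; both have the same underlying category.\<close>

lemma triangle_iso_V: "triangle_iso (localization C W) S = triangle_iso V S"
  by (intro ext) (simp add: triangle_iso_def triangle_shape_def is_iso_def Hom_def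
      verdier_quotient_def Let_def split_beta)

lemma V_Tri_iff: "t \<in> Tri V \<longleftrightarrow> (\<exists>f g h. (f, g, h) \<in> Tri C \<and> triangle_iso V (Shift V)
    (fr (Dom C f) (Cod C f) (LA f), fr (Dom C g) (Cod C g) (LA g), fr (Dom C h) (Cod C h) (LA h)) t)"
proof -
  have "Tri V = {t. \<exists>(f, g, h) \<in> Tri C. triangle_iso V (Shift V)
      (frac_class C W (Dom C f) (Cod C f) [Fwd f], frac_class C W (Dom C g) (Cod C g) [Fwd g],
       frac_class C W (Dom C h) (Cod C h) [Fwd h]) t}"
    unfolding triangle_iso_V[symmetric] Shift_V
    by (simp add: verdier_quotient_def Let_def localization_map_def)
  then have "t \<in> Tri V \<longleftrightarrow> (\<exists>f g h. (f, g, h) \<in> Tri C \<and> triangle_iso V (Shift V)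
      (frac_class C W (Dom C f) (Cod C f) [Fwd f], frac_class C W (Dom C g) (Cod C g) [Fwd g],
       frac_class C W (Dom C h) (Cod C h) [Fwd h]) t)"
    by auto
  also have "\<dots> \<longleftrightarrow> (\<exists>f g h. (f, g, h) \<in> Tri C \<and> triangle_iso V (Shift V)
    (fr (Dom C f) (Cod C f) (LA f), fr (Dom C g) (Cod C g) (LA g), fr (Dom C h) (Cod C h) (LA h)) t)"
  proof (intro iff_exI conj_cong refl)
    fix f g h assume t: "(f, g, h) \<in> Tri C"
    show "triangle_iso V (Shift V)
      (frac_class C W (Dom C f) (Cod C f) [Fwd f], frac_class C W (Dom C g) (Cod C g) [Fwd g],
       frac_class C W (Dom C h) (Cod C h) [Fwd h]) t \<longleftrightarrow> triangle_iso V (Shift V)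
      (fr (Dom C f) (Cod C f) (LA f), fr (Dom C g) (Cod C g) (LA g), fr (Dom C h) (Cod C h) (LA h)) t"
      by (simp only: V_Q[OF Tri_typing(1)[OF t]] V_Q[OF Tri_typing(2)[OF t]] V_Q[OF Tri_typing(3)[OF t]])
  qed
  finally show ?thesis .
qed

lemma V_shapeE:
  assumes "triangle_shape V (Shift V) (\<alpha>, \<beta>, \<gamma>)"
  obtains X Y Z a b c where "X \<in> Obj C" "Y \<in> Obj C" "Z \<in> Obj C"
    "a \<in> Hom C (LO X) (LO Y)" "b \<in> Hom C (LO Y) (LO Z)" "c \<in> Hom C (LO Z) (LO (sh X))"
    "\<alpha> = fr X Y a" "\<beta> = fr Y Z b" "\<gamma> = fr Z (sh X) c"
proof -
  have a: "\<alpha> \<in> Arr V" "\<beta> \<in> Arr V" "\<gamma> \<in> Arr V" "Cod V \<alpha> = Dom V \<beta>" "Cod V \<beta> = Dom V \<gamma>"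
    "Cod V \<gamma> = sh (Dom V \<alpha>)"
    using assms by (simp_all add: triangle_shape_def V_shift_Obj)
  obtain X Y a' where 1: "X \<in> Obj C" "Y \<in> Obj C" "a' \<in> Hom C (LO X) (LO Y)" "\<alpha> = fr X Y a'"
    using a(1) by (rule V_ArrE)
  obtain Y' Z b where 2: "Y' \<in> Obj C" "Z \<in> Obj C" "b \<in> Hom C (LO Y') (LO Z)" "\<beta> = fr Y' Z b"
    using a(2) by (rule V_ArrE)
  obtain Z' X' c where 3: "Z' \<in> Obj C" "X' \<in> Obj C" "c \<in> Hom C (LO Z') (LO X')" "\<gamma> = fr Z' X' c"
    using a(3) by (rule V_ArrE)
  have "Y' = Y" "Z' = Z" "X' = sh X" using a(4-6) 1 2 3 by (simp_all add: loc_simps)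
  then show ?thesis using that 1 2 3 by blast
qed

lemma V_Tri_shape: "t \<in> Tri V \<Longrightarrow> triangle_shape V (Shift V) t"
  unfolding V_Tri_iff by (auto simp: triangle_iso_def)

text \<open>Triangles of the quotient are images of triangles up to isomorphism, and
  \<open>L\<close> is exact; this gives one direction. Conversely, a triangle on
  \<open>LO X\<close>, \<open>LO Y\<close>, \<open>LO Z\<close> is sent by the quotient functor to
  the given triple, up to the isomorphisms coming from \<open>linv (\<eta> X)\<close>,
  \<open>linv (\<eta> Y)\<close>, \<open>linv (\<eta> Z)\<close>.\<close>

lemma V_Tri_rho:
  assumes s: "triangle_shape V (Shift V) (\<alpha>, \<beta>, \<gamma>)"
  shows "(\<alpha>, \<beta>, \<gamma>) \<in> Tri V \<longleftrightarrow> (rho \<alpha>, rho \<beta>, psi (Dom V \<alpha>) \<cdot> rho \<gamma>) \<in> Tri C"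
proof -
  obtain X Y Z a b c where o: "X \<in> Obj C" "Y \<in> Obj C" "Z \<in> Obj C"
    and a: "a \<in> Hom C (LO X) (LO Y)" "b \<in> Hom C (LO Y) (LO Z)" "c \<in> Hom C (LO Z) (LO (sh X))"
    and e: "\<alpha> = fr X Y a" "\<beta> = fr Y Z b" "\<gamma> = fr Z (sh X) c"
    using s by (rule V_shapeE)
  note tt = o HomD[OF a(1)] HomD[OF a(2)] HomD[OF a(3)]
  have r: "rho \<alpha> = a" "rho \<beta> = b" "rho \<gamma> = c" "Dom V \<alpha> = X"
    unfolding e using o a by (auto simp: rho_fr loc_simps)
  show ?thesis
  proof
    assume "(\<alpha>, \<beta>, \<gamma>) \<in> Tri V"
    then obtain f g h where t: "(f, g, h) \<in> Tri C" and i: "triangle_iso V (Shift V)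
        (fr (Dom C f) (Cod C f) (LA f), fr (Dom C g) (Cod C g) (LA g), fr (Dom C h) (Cod C h) (LA h)) (\<alpha>, \<beta>, \<gamma>)"
      unfolding V_Tri_iff by blast
    note ft = Tri_typing[OF t]
    obtain u v w where i': "is_iso V (Dom C f) X u" "is_iso V (Cod C f) Y v" "is_iso V (Cod C g) Z w"
      and q: "v \<cdot>\<^bsub>V\<^esub> fr (Dom C f) (Cod C f) (LA f) = fr X Y a \<cdot>\<^bsub>V\<^esub> u"
        "w \<cdot>\<^bsub>V\<^esub> fr (Cod C f) (Cod C g) (LA g) = fr Y Z b \<cdot>\<^bsub>V\<^esub> v"
        "AMap (Shift V) u \<cdot>\<^bsub>V\<^esub> fr (Cod C g) (sh (Dom C f)) (LA h) = fr Z (sh X) c \<cdot>\<^bsub>V\<^esub> w"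
      using i ft unfolding triangle_iso_def e by (auto simp: loc_simps)
    interpret VC: category V by (rule V_category)
    obtain u0 where u0: "u0 \<in> Hom C (LO (Dom C f)) (LO X)" "u = fr (Dom C f) X u0"
      using VC.is_iso_Hom[OF i'(1)] by (rule V_HomE)
    obtain v0 where v0: "v0 \<in> Hom C (LO (Cod C f)) (LO Y)" "v = fr (Cod C f) Y v0"
      using VC.is_iso_Hom[OF i'(2)] by (rule V_HomE)
    obtain w0 where w0: "w0 \<in> Hom C (LO (Cod C g)) (LO Z)" "w = fr (Cod C g) Z w0"
      using VC.is_iso_Hom[OF i'(3)] by (rule V_HomE)
    have fo: "Dom C f \<in> Obj C" "Cod C f \<in> Obj C" "Cod C g \<in> Obj C" using ft by auto
    have fH: "LA f \<in> Hom C (LO (Dom C f)) (LO (Cod C f))" "LA g \<in> Hom C (LO (Cod C f)) (LO (Cod C g))"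
      "LA h \<in> Hom C (LO (Cod C g)) (LO (sh (Dom C f)))"
      using ft by (auto simp: Hom_iff)
    obtain u' where u': "u' \<in> Hom C (LO (sh (Dom C f))) (LO (sh X))" "psi X \<cdot> u' = shm u0 \<cdot> psi (Dom C f)"
      by (rule ex_shift[OF fo(1) o(1) u0(1)])
    have iso0: "is_iso C (LO (Dom C f)) (LO X) u0" "is_iso C (LO (Cod C f)) (LO Y) v0"
      "is_iso C (LO (Cod C g)) (LO Z) w0"
      using rho_V_iso[OF i'(1)] rho_V_iso[OF i'(2)] rho_V_iso[OF i'(3)] u0 v0 w0 fo o
      by (simp_all add: rho_fr)
    have "fr (Dom C f) Y (v0 \<cdot> LA f) = fr (Dom C f) Y (a \<cdot> u0)"
      using q(1) fo o fH a u0 v0 by (simp add: V_Cmp)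
    then have q1: "v0 \<cdot> LA f = a \<cdot> u0"
      by (rule fr_inj) (use fo o Cmp_in_Hom[OF fH(1) v0(1)] in auto)
    have "fr (Cod C f) Z (w0 \<cdot> LA g) = fr (Cod C f) Z (b \<cdot> v0)"
      using q(2) fo o fH a v0 w0 by (simp add: V_Cmp)
    then have q2: "w0 \<cdot> LA g = b \<cdot> v0"
      by (rule fr_inj) (use fo o Cmp_in_Hom[OF fH(2) w0(1)] in auto)
    have "AMap (Shift V) u = fr (sh (Dom C f)) (sh X) u'"
      unfolding u0(2) by (rule V_shift[OF fo(1) o(1) u0(1) u'])
    then have "fr (Cod C g) (sh X) (u' \<cdot> LA h) = fr (Cod C g) (sh X) (c \<cdot> w0)"
      using q(3) fo o fH a w0 u'(1) by (simp add: V_Cmp)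
    then have q3: "u' \<cdot> LA h = c \<cdot> w0"
      by (rule fr_inj) (use fo o Cmp_in_Hom[OF fH(3) u'(1)] in auto)
    note ut = HomD[OF u0(1)] HomD[OF v0(1)] HomD[OF w0(1)] HomD[OF u'(1)]
    have "(a, b, psi X \<cdot> c) \<in> Tri C"
    proof (rule Tri_isoI[OF L_triangle[OF t], where a = u0 and b = v0 and c = w0])
      show "shm u0 \<cdot> (psi (Dom C f) \<cdot> LA h) = psi X \<cdot> c \<cdot> w0"
        using ft fo tt ut by (simp add: Cmp_reassoc[OF u'(2)[symmetric]] q3)
    qed (use tt ft ut iso0 q1 q2 in auto)
    then show "(rho \<alpha>, rho \<beta>, psi (Dom V \<alpha>) \<cdot> rho \<gamma>) \<in> Tri C" by (simp add: r)
  next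
    assume "(rho \<alpha>, rho \<beta>, psi (Dom V \<alpha>) \<cdot> rho \<gamma>) \<in> Tri C"
    then have t: "(a, b, psi X \<cdot> c) \<in> Tri C" by (simp add: r)
    let ?e = "\<lambda>X. linv (\<eta> X)"
    note e' = linv_eta and et = linv_eta_typing
    \<comment> \<open>The value of the shift of \<open>fr (LO X) X (?e X)\<close>; it is needed for
      the square at the third arrow, where the shift of the first isomorphism occurs.\<close>
    obtain e1 where e1: "e1 \<in> Hom C (LO (sh (LO X))) (LO (sh X))" "psi X \<cdot> e1 = shm (?e X) \<cdot> psi (LO X)"
      by (rule ex_shift[of "LO X" X "?e X"]) (use o e' in auto)
    note e1t = HomD[OF e1(1)]
    have c3: "e1 \<cdot> LA (psi X \<cdot> c) = c \<cdot> ?e Z"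
    proof (rule eta_epi[of "LO Z" "LO (sh X)"])
      have ee: "shm (?e X) \<cdot> shm (\<eta> (LO X)) = Idn C (sh (LO X))"
        using arg_cong[OF e'(2)[OF o(1)], of shm] et[OF o(1)] o(1) by simp
      have "e1 \<cdot> LA (psi X \<cdot> c) \<cdot> \<eta> (LO Z) = e1 \<cdot> (\<eta> (sh (LO X)) \<cdot> (psi X \<cdot> c))"
        using eta_natural[of "psi X \<cdot> c"] tt e1t by simp
      also have "\<dots> = c"
      proof (rule psi_cancel[of X])
        have "psi X \<cdot> (e1 \<cdot> (\<eta> (sh (LO X)) \<cdot> (psi X \<cdot> c))) =
            shm (?e X) \<cdot> (psi (LO X) \<cdot> (\<eta> (sh (LO X)) \<cdot> (psi X \<cdot> c)))"
          using tt e1t et[OF o(1)] by (simp add: Cmp_reassoc[OF e1(2)])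
        also have "\<dots> = shm (?e X) \<cdot> (shm (\<eta> (LO X)) \<cdot> (psi X \<cdot> c))"
          using tt by (simp add: Cmp_reassoc[OF psi(2)])
        also have "\<dots> = psi X \<cdot> c" using tt et[OF o(1)] by (simp add: Cmp_reassoc[OF ee])
        finally show "psi X \<cdot> (e1 \<cdot> (\<eta> (sh (LO X)) \<cdot> (psi X \<cdot> c))) = psi X \<cdot> c" .
      qed (use tt e1t in auto)
      finally show "e1 \<cdot> LA (psi X \<cdot> c) \<cdot> \<eta> (LO Z) = c \<cdot> ?e Z \<cdot> \<eta> (LO Z)"
        using tt et[OF o(3)] e'(2)[OF o(3)] by simp
    qed (use tt e1t et[OF o(3)] L_orth in \<open>auto simp: Hom_iff\<close>)
    have LO: "LO X \<in> Obj C" "LO Y \<in> Obj C" "LO Z \<in> Obj C" using o by auto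
    have LH: "LA a \<in> Hom C (LO (LO X)) (LO (LO Y))" "LA b \<in> Hom C (LO (LO Y)) (LO (LO Z))"
      "LA (psi X \<cdot> c) \<in> Hom C (LO (LO Z)) (LO (sh (LO X)))"
      using tt by (auto simp: Hom_iff)
    have sh_e: "AMap (Shift V) (fr (LO X) X (?e X)) = fr (sh (LO X)) (sh X) e1"
      by (rule V_shift[OF LO(1) o(1) e'(1)[OF o(1)] e1])
    have "triangle_iso V (Shift V) (fr (LO X) (LO Y) (LA a), fr (LO Y) (LO Z) (LA b),
        fr (LO Z) (sh (LO X)) (LA (psi X \<cdot> c))) (\<alpha>, \<beta>, \<gamma>)"
      unfolding triangle_iso_def prod.case
    proof (intro conjI exI)
      show "triangle_shape V (Shift V) (fr (LO X) (LO Y) (LA a), fr (LO Y) (LO Z) (LA b),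
        fr (LO Z) (sh (LO X)) (LA (psi X \<cdot> c)))"
        using V_ArrI[OF LO(1,2) LH(1)] V_ArrI[OF LO(2,3) LH(2)] V_ArrI[OF LO(3) sh_Obj[OF LO(1)] LH(3)]
        by (simp add: triangle_shape_def loc_simps V_shift_Obj)
      show "is_iso V (Dom V (fr (LO X) (LO Y) (LA a))) (Dom V \<alpha>) (fr (LO X) X (?e X))"
        unfolding e loc_simps by (rule V_isoI[OF LO(1) o(1) linv_eta_iso[OF o(1)]])
      show "is_iso V (Dom V (fr (LO Y) (LO Z) (LA b))) (Dom V \<beta>) (fr (LO Y) Y (?e Y))"
        unfolding e loc_simps by (rule V_isoI[OF LO(2) o(2) linv_eta_iso[OF o(2)]])
      show "is_iso V (Dom V (fr (LO Z) (sh (LO X)) (LA (psi X \<cdot> c)))) (Dom V \<gamma>) (fr (LO Z) Z (?e Z))"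
        unfolding e loc_simps by (rule V_isoI[OF LO(3) o(3) linv_eta_iso[OF o(3)]])
      show "fr (LO Y) Y (?e Y) \<cdot>\<^bsub>V\<^esub> fr (LO X) (LO Y) (LA a) = \<alpha> \<cdot>\<^bsub>V\<^esub> fr (LO X) X (?e X)"
        unfolding e using o LO LH a e'(1) linv_eta_natural[OF o(1,2) a(1)] by (simp add: V_Cmp)
      show "fr (LO Z) Z (?e Z) \<cdot>\<^bsub>V\<^esub> fr (LO Y) (LO Z) (LA b) = \<beta> \<cdot>\<^bsub>V\<^esub> fr (LO Y) Y (?e Y)"
        unfolding e using o LO LH a e'(1) linv_eta_natural[OF o(2,3) a(2)] by (simp add: V_Cmp)
      show "AMap (Shift V) (fr (LO X) X (?e X)) \<cdot>\<^bsub>V\<^esub> fr (LO Z) (sh (LO X)) (LA (psi X \<cdot> c)) =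
          \<gamma> \<cdot>\<^bsub>V\<^esub> fr (LO Z) Z (?e Z)"
        unfolding e sh_e V_Cmp[OF LO(3) sh_Obj[OF LO(1)] sh_Obj[OF o(1)] LH(3) e1(1)]
          V_Cmp[OF LO(3) o(3) sh_Obj[OF o(1)] e'(1)[OF o(3)] a(3)] c3 by (rule refl)
    qed (rule s)
    then show "(\<alpha>, \<beta>, \<gamma>) \<in> Tri V"
      unfolding V_Tri_iff using t tt by (intro exI[of _ a] exI[of _ b] exI[of _ "psi X \<cdot> c"]) simp
  qed
qed

lemma V_transport: "triangulated_transport C V LO rho psi"
proof (intro triangulated_transport.intro triangulated_transport_axioms.intro
    triangulated_category_axioms V_category)
  show "LO X \<in> Obj C" if "X \<in> Obj V" for X using that by (simp add: loc_simps)
  show "bij_betw rho (Hom V X Y) (Hom C (LO X) (LO Y))" if "X \<in> Obj V" "Y \<in> Obj V" for X Y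
    by (rule bij_betw_byWitness[where f' = "fr X Y"])
      (use that in \<open>auto simp: loc_simps rho_fr elim!: V_HomE intro: V_HomI\<close>)
  show "rho (Idn V X) = Idn C (LO X)" if "X \<in> Obj V" for X
    using is_functorD(4)[OF rho_V_functor that] by simp
  show "rho (\<beta> \<cdot>\<^bsub>V\<^esub> \<alpha>) = rho \<beta> \<cdot> rho \<alpha>"
    if "\<alpha> \<in> Arr V" "\<beta> \<in> Arr V" "Dom V \<beta> = Cod V \<alpha>" for \<alpha> \<beta>
    using is_functorD(8)[OF rho_V_functor that] by simp
  show "Plus V \<alpha> \<beta> \<in> Hom V X Y" "rho (Plus V \<alpha> \<beta>) = Plus C (rho \<alpha>) (rho \<beta>)"
    if \<alpha>: "\<alpha> \<in> Hom V X Y" and \<beta>: "\<beta> \<in> Hom V X Y" for \<alpha> \<beta> X Y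
  proof -
    obtain a where a: "X \<in> Obj C" "Y \<in> Obj C" "a \<in> Hom C (LO X) (LO Y)" "\<alpha> = fr X Y a"
      using \<alpha> by (rule V_HomE)
    obtain b where b: "b \<in> Hom C (LO X) (LO Y)" "\<beta> = fr X Y b"
      using \<beta> by (rule V_HomE)
    show "Plus V \<alpha> \<beta> \<in> Hom V X Y" "rho (Plus V \<alpha> \<beta>) = Plus C (rho \<alpha>) (rho \<beta>)"
      using a b Plus_in_Hom[OF a(3) b(1)] by (simp_all add: V_Plus rho_fr V_HomI)
  qed
  show "Zer V X Y \<in> Hom V X Y" "rho (Zer V X Y) = Zer C (LO X) (LO Y)"
    if "X \<in> Obj V" "Y \<in> Obj V" for X Y
    using that by (simp_all add: loc_simps V_Zer rho_fr V_HomI Zer_in_Hom)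
  obtain Z where Z: "is_zero C Z" using ex_zero by blast
  then have "Z \<in> Ker C L" using tri_subD(2)[OF tri_sub] by (simp add: Ker_eq)
  then show "\<exists>Z\<in>Obj V. is_zero C (LO Z)" by (auto simp: Ker_def loc_simps)
  show "\<exists>P\<in>Obj V. \<exists>\<iota>. is_coproduct C (UNIV :: bool set) (\<lambda>i. LO (U i)) (LO P) \<iota>"
    if "range U \<subseteq> Obj V" for U
  proof -
    have U: "U i \<in> Obj C" for i using that by (auto simp: loc_simps)
    then have "range (\<lambda>i. LO (U i)) \<subseteq> Obj C" by auto
    then obtain P \<iota> where P: "is_coproduct C (UNIV :: bool set) (\<lambda>i. LO (U i)) P \<iota>"
      using ex_binary_coproduct[of "\<lambda>i. LO (U i)"] by blast
    \<comment> \<open>Being local, \<open>P\<close> can be exchanged for the isomorphic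
      \<open>LO P\<close>, which has the literal form that the transport asks for.\<close>
    have "P \<in> orth A" by (rule orth_coproduct[OF A_Obj P]) (rule L_orth[OF U])
    from is_coproduct_iso[OF P eta_iso_if_orth[OF this]] show ?thesis
      using is_coproductD(1)[OF P] by (auto simp: loc_simps)
  qed
  show "bij_betw (OMap (Shift V)) (Obj V) (Obj V)"
    using shift_bij_Obj by (simp add: loc_simps V_shift_Obj[abs_def])
  show "is_iso C (LO (OMap (Shift V) X)) (sh (LO X)) (psi X)" if "X \<in> Obj V" for X
    using psi_iso that by (simp add: loc_simps V_shift_Obj)
  show "shm (rho \<alpha>) \<cdot> psi (Dom V \<alpha>) = psi (Cod V \<alpha>) \<cdot> rho (AMap (Shift V) \<alpha>)" if \<alpha>: "\<alpha> \<in> Arr V" for \<alpha>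
  proof -
    obtain X Y a where *: "X \<in> Obj C" "Y \<in> Obj C" "a \<in> Hom C (LO X) (LO Y)" "\<alpha> = fr X Y a"
      using \<alpha> by (rule V_ArrE)
    obtain a' where a': "a' \<in> Hom C (LO (sh X)) (LO (sh Y))" "psi Y \<cdot> a' = shm a \<cdot> psi X"
      by (rule ex_shift[OF *(1-3)])
    show ?thesis using * a' V_shift[OF *(1-3) a'] by (simp add: rho_fr loc_simps)
  qed
  show "\<exists>Z\<in>Obj V. \<exists>g h. (rho \<alpha>, g, h) \<in> Tri C \<and> Cod C g = LO Z" if \<alpha>: "\<alpha> \<in> Arr V" for \<alpha>
  proof -
    obtain X Y a where *: "X \<in> Obj C" "Y \<in> Obj C" "a \<in> Hom C (LO X) (LO Y)" "\<alpha> = fr X Y a"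
      using \<alpha> by (rule V_ArrE)
    note at = HomD[OF *(3)]
    obtain g h where t: "(a, g, h) \<in> Tri C" using Tri_complete[OF at(1)] by blast
    have Z: "Cod C g \<in> orth A" using orth_cone'[OF t] at * L_orth by simp
    obtain g' h' where "(a, g', h') \<in> Tri C" "Cod C g' = LO (Cod C g)"
      by (rule Tri_replace_cone[OF t eta_iso_if_orth[OF Z]])
    then show ?thesis using * orth_Obj[OF Z] by (auto simp: loc_simps rho_fr)
  qed
qed (fact V_shift_functor V_shift_bij_Arr V_Tri_shape V_Tri_rho)+

lemma V_triangulated: "triangulated_category V"
  by (rule triangulated_transport.D_triangulated[OF V_transport])

text \<open>The zigzags between two objects may be very many, but their classes are parametrised by
  morphisms of \<open>C\<close> through \<open>fr X Y\<close>.\<close>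

lemma V_locally_small: "locally_small \<Lambda> C \<Longrightarrow> locally_small \<Lambda> V"
  unfolding locally_small_def small_def
proof (intro ballI)
  fix X Y assume ls: "\<forall>X\<in>Obj C. \<forall>Y\<in>Obj C. |Hom C X Y| <o \<Lambda>" and "X \<in> Obj V" "Y \<in> Obj V"
  then have o: "X \<in> Obj C" "Y \<in> Obj C" by (simp_all add: loc_simps)
  have "Hom V X Y \<subseteq> fr X Y ` Hom C (LO X) (LO Y)" by (auto elim: V_HomE)
  then have "|Hom V X Y| \<le>o |fr X Y ` Hom C (LO X) (LO Y)|" by (rule card_of_mono1)
  also have "|fr X Y ` Hom C (LO X) (LO Y)| \<le>o |Hom C (LO X) (LO Y)|" by (rule card_of_image)
  also have "|Hom C (LO X) (LO Y)| <o \<Lambda>" using ls o by simp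
  finally show "|Hom V X Y| <o \<Lambda>" .
qed

end

section \<open>The equivalence with the local objects\<close>

lemma full_subcategory_simps:
  "Obj (full_subcategory C A) = A" "Dom (full_subcategory C A) = Dom C"
  "Cod (full_subcategory C A) = Cod C" "Idn (full_subcategory C A) = Idn C"
  "Cmp (full_subcategory C A) = Cmp C" "Zer (full_subcategory C A) = Zer C"
  "Plus (full_subcategory C A) = Plus C" "Shift (full_subcategory C A) = Shift C"
  by (simp_all add: full_subcategory_def)

lemma full_subcategory_Hom: "X \<in> A \<Longrightarrow> Y \<in> A \<Longrightarrow> Hom (full_subcategory C A) X Y = Hom C X Y"
  by (auto simp: Hom_def full_subcategory_def)

lemma comp_functor_apply:
  "OMap (comp_functor G H) X = OMap G (OMap H X)" "AMap (comp_functor G H) f = AMap G (AMap H f)"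
  by (simp_all add: comp_functor_def)

lemma id_functor_apply: "OMap id_functor X = X" "AMap id_functor f = f"
  by (simp_all add: id_functor_def)

context bousfield
begin

section \<open>The local objects as a triangulated category\<close>

abbreviation E :: "('o, 'm) tri_cat" where "E \<equiv> full_subcategory C (orth A)"

lemmas E_simps = full_subcategory_simps[of C "orth A"]
lemmas E_Hom = full_subcategory_Hom[of _ "orth A" _ C]

lemma E_Arr: "f \<in> Arr E \<longleftrightarrow> f \<in> Arr C \<and> Dom C f \<in> orth A \<and> Cod C f \<in> orth A"
  by (simp add: full_subcategory_def)

lemma E_HomD: "f \<in> Hom E X Y \<Longrightarrow> X \<in> orth A \<and> Y \<in> orth A \<and> f \<in> Hom C X Y"
  by (auto simp: Hom_def E_Arr E_simps)

lemma E_Tri: "(f, g, h) \<in> Tri E \<longleftrightarrow> (f, g, h) \<in> Tri C \<and> Dom C f \<in> orth A \<and> Dom C g \<in> orth A \<and> Dom C h \<in> orth A"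
  by (simp add: full_subcategory_def)

lemma E_category: "category E"
proof
  fix f assume "f \<in> Arr E"
  then show "Dom E f \<in> Obj E" "Cod E f \<in> Obj E" by (simp_all add: E_Arr E_simps)
next
  fix X assume "X \<in> Obj E"
  then show "Idn E X \<in> Hom E X X" using Idn_in_Hom orth_Obj by (simp add: E_simps E_Hom)
next
  fix f g X Y Z assume f: "f \<in> Hom E X Y" and g: "g \<in> Hom E Y Z"
  show "g \<cdot>\<^bsub>E\<^esub> f \<in> Hom E X Z"
    using E_HomD[OF f] E_HomD[OF g] Cmp_in_Hom[of f X Y g Z] by (simp add: E_simps E_Hom)
next
  fix f X Y assume f: "f \<in> Hom E X Y"
  show "f \<cdot>\<^bsub>E\<^esub> Idn E X = f" "Idn E Y \<cdot>\<^bsub>E\<^esub> f = f"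
    using E_HomD[OF f] Cmp_Idn[of f X Y] Idn_Cmp[of f X Y] by (simp_all add: E_simps)
next
  fix f g h X' X Y Z assume f: "f \<in> Hom E X' X" and g: "g \<in> Hom E X Y" and h: "h \<in> Hom E Y Z"
  show "(h \<cdot>\<^bsub>E\<^esub> g) \<cdot>\<^bsub>E\<^esub> f = h \<cdot>\<^bsub>E\<^esub> (g \<cdot>\<^bsub>E\<^esub> f)"
    using E_HomD[OF f] E_HomD[OF g] E_HomD[OF h] Cmp_assoc[of f X' X g Y h Z]
    by (simp add: E_simps)
qed

lemma E_shift_Obj: "bij_betw sh (orth A) (orth A)"
  by (rule bij_betw_byWitness[where f' = unsh])
    (use orth_Obj orth_sh' orth_unsh' in auto)

lemma E_shift_Arr: "bij_betw shm (Arr E) (Arr E)"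
proof (rule bij_betw_imageI)
  show "inj_on shm (Arr E)" by (rule inj_onI) (auto simp: E_Arr intro: shm_inj)
  have "k \<in> shm ` Arr E" if k: "k \<in> Arr E" for k
  proof -
    have o: "Dom C k \<in> Obj C" "Cod C k \<in> Obj C" using k by (auto simp: E_Arr)
    obtain d where d: "d \<in> Hom C (unsh (Dom C k)) (unsh (Cod C k))" "shm d = k"
      by (rule shm_surj[of k "unsh (Dom C k)" "unsh (Cod C k)"]) (use k o in \<open>auto simp: E_Arr Hom_iff\<close>)
    have "d \<in> Arr E"
      using HomD[OF d(1)] k orth_unsh' by (auto simp: E_Arr)
    then show ?thesis using d(2) by blast
  qed
  then show "shm ` Arr E = Arr E" using orth_sh' by (auto simp: E_Arr)
qed

lemma E_shift_functor: "is_functor E E (Shift C)"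
  unfolding is_functor_def
proof (intro conjI ballI impI E_category)
  fix f assume "f \<in> Arr E"
  then show "shm f \<in> Hom E (sh (Dom E f)) (sh (Cod E f))"
    using orth_sh' shm_in_Hom[of f "Dom C f" "Cod C f"] by (auto simp: E_Arr E_simps E_Hom Hom_iff)
next
  fix f g assume "f \<in> Arr E" "g \<in> Arr E" "Cod E f = Dom E g"
  then show "shm (g \<cdot>\<^bsub>E\<^esub> f) = shm g \<cdot>\<^bsub>E\<^esub> shm f" by (auto simp: E_Arr E_simps)
qed (use orth_sh' orth_Obj in \<open>auto simp: E_simps\<close>)

lemma E_shape: "triangle_shape E (Shift C) (f, g, h) \<longleftrightarrow> triangle_shape C (Shift C) (f, g, h) \<and>
    Dom C f \<in> orth A \<and> Dom C g \<in> orth A \<and> Dom C h \<in> orth A"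
  using orth_sh'[of "Dom C f"] by (simp add: triangle_shape_def E_Arr E_simps) metis

text \<open>Local objects are closed under zero objects, binary coproducts, shifts in both
  directions and cones. The inclusion commutes strictly with the shift, hence the identities as
  comparison.\<close>

lemma E_transport: "triangulated_transport C E (\<lambda>X. X) (\<lambda>f. f) (\<lambda>X. Idn C (sh X))"
proof (intro triangulated_transport.intro triangulated_transport_axioms.intro
    triangulated_category_axioms E_category, unfold E_simps)
  show "bij_betw (\<lambda>f. f) (Hom E X Y) (Hom C X Y)" if "X \<in> orth A" "Y \<in> orth A" for X Y
    using that by (simp add: E_Hom bij_betw_def)
  show "Plus C f g \<in> Hom E X Y" if "f \<in> Hom E X Y" "g \<in> Hom E X Y" for f g X Y
    using E_HomD[OF that(1)] E_HomD[OF that(2)] by (auto simp: E_Hom Plus_in_Hom)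
  show "Zer C X Y \<in> Hom E X Y" if "X \<in> orth A" "Y \<in> orth A" for X Y
    using that orth_Obj by (auto simp: E_Hom Zer_in_Hom)
  show "\<exists>Z\<in>orth A. is_zero C Z" using ex_zero orth_zero[OF A_Obj] by blast
  show "\<exists>P\<in>orth A. \<exists>\<iota>. is_coproduct C (UNIV :: bool set) (\<lambda>i. U i) P \<iota>"
    if U: "range U \<subseteq> orth A" for U
  proof -
    have "range U \<subseteq> Obj C" using U orth_Obj by blast
    then obtain P \<iota> where P: "is_coproduct C (UNIV :: bool set) U P \<iota>"
      using ex_binary_coproduct by blast
    have "P \<in> orth A" by (rule orth_coproduct[OF A_Obj P]) (use U in auto)
    with P show ?thesis by auto
  qed
  show "triangle_shape E (Shift C) t" if "t \<in> Tri E" for t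
    using that Tri_shape by (cases t) (auto simp: E_Tri E_shape)
  show "(f, g, h) \<in> Tri E \<longleftrightarrow> (f, g, Idn C (sh (Dom C f)) \<cdot> h) \<in> Tri C"
    if "triangle_shape E (Shift C) (f, g, h)" for f g h
  proof -
    have s: "triangle_shape C (Shift C) (f, g, h)" "Dom C f \<in> orth A" "Dom C g \<in> orth A" "Dom C h \<in> orth A"
      using that unfolding E_shape by blast+
    then have "Idn C (sh (Dom C f)) \<cdot> h = h" by (simp add: triangle_shape_def)
    then show ?thesis using s by (simp add: E_Tri)
  qed
  show "\<exists>Z\<in>orth A. \<exists>g h. (f, g, h) \<in> Tri C \<and> Cod C g = Z" if "f \<in> Arr E" for f
  proof -
    have f: "f \<in> Arr C" "Dom C f \<in> orth A" "Cod C f \<in> orth A" using that by (auto simp: E_Arr)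
    obtain g h where t: "(f, g, h) \<in> Tri C" using Tri_complete[OF f(1)] by blast
    with orth_cone'[OF t f(2,3)] show ?thesis by blast
  qed
qed (use orth_Obj E_shift_functor E_shift_Obj E_shift_Arr is_iso_Idn in \<open>auto simp: E_Arr\<close>)

lemma E_triangulated: "triangulated_category E"
  by (rule triangulated_transport.D_triangulated[OF E_transport])

section \<open>The quotient functor restricted to local objects\<close>

abbreviation F :: "('o, 'm, 'o, ('o, 'm) frac) functr" where
  "F \<equiv> comp_functor (verdier_functor C A) inclusion_functor"

lemma F_simps: "OMap F X = X" "f \<in> Arr C \<Longrightarrow> AMap F f = fr (Dom C f) (Cod C f) (LA f)"
  by (simp_all add: comp_functor_def id_functor_apply verdier_functor_def localization_map_def V_Q)

lemma F_functor: "is_functor E V F"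
  unfolding is_functor_def
proof (intro conjI ballI impI E_category V_category)
  fix X assume "X \<in> Obj E"
  then have X: "X \<in> Obj C" using orth_Obj by (auto simp: E_simps)
  then show "OMap F X \<in> Obj V" by (simp add: F_simps loc_simps)
  show "AMap F (Idn E X) = Idn V (OMap F X)" using X by (simp add: F_simps E_simps V_Idn)
next
  fix f assume "f \<in> Arr E"
  then show "AMap F f \<in> Hom V (OMap F (Dom E f)) (OMap F (Cod E f))"
    by (auto simp: E_Arr E_simps F_simps intro!: V_HomI LA_in_Hom) (simp add: Hom_iff)
next
  fix f g assume "f \<in> Arr E" "g \<in> Arr E" "Cod E f = Dom E g"
  then have t: "f \<in> Arr C" "g \<in> Arr C" "Dom C g = Cod C f" by (auto simp: E_Arr E_simps)
  have "LA f \<in> Hom C (LO (Dom C f)) (LO (Cod C f))" "LA g \<in> Hom C (LO (Cod C f)) (LO (Cod C g))"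
    using t by (auto simp: Hom_iff)
  then show "AMap F (g \<cdot>\<^bsub>E\<^esub> f) = AMap F g \<cdot>\<^bsub>V\<^esub> AMap F f"
    using t by (simp add: E_simps F_simps V_Cmp)
qed

lemma F_additive: "is_additive E V F"
  unfolding is_additive_def
proof (intro conjI ballI)
  fix X Y f g assume "f \<in> Hom E X Y" "g \<in> Hom E X Y"
  then have f: "f \<in> Hom C X Y" and g: "g \<in> Hom C X Y" using E_HomD by blast+
  note tt = HomD[OF f] HomD[OF g] HomD[OF Plus_in_Hom[OF f g]]
  show "AMap F (Plus E f g) = Plus V (AMap F f) (AMap F g)"
    using tt V_Plus[OF tt(4,5) LA_in_Hom[OF f] LA_in_Hom[OF g]] is_additiveD(2)[OF L_additive f g]
    by (simp add: E_simps F_simps)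
qed (rule F_functor)

text \<open>Naturality of \<open>psi\<close> says that \<open>LA (shm f)\<close> is precisely the
  conjugate of \<open>shm (LA f)\<close> that describes the shift in the quotient. The functor
  therefore commutes strictly with shifts, and identities can serve as comparison in
  \<open>F_exact\<close>.\<close>

lemma F_shift:
  assumes "f \<in> Arr C"
  shows "AMap F (shm f) = AMap (Shift V) (AMap F f)"
  using V_shift[of "Dom C f" "Cod C f" "LA f" "LA (shm f)"] psi_natural[OF assms] assms
  by (simp add: F_simps Hom_iff)

lemma F_exact: "exact_functor E V F (\<lambda>X. Idn V (sh X))"
proof -
  interpret VC: category V by (rule V_category)
  have so: "sh X \<in> Obj V" "X \<in> Obj V" if "X \<in> orth A" for X
    using that orth_Obj by (auto simp: loc_simps)
  have F_arr: "AMap F f \<in> Hom V (Dom C f) (Cod C f)" if "f \<in> Arr C" for f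
    using that by (auto simp: F_simps Hom_iff intro!: V_HomI)
  show ?thesis
    unfolding exact_functor_def
  proof (intro conjI E_triangulated V_triangulated F_additive)
    show "nat_iso E V (comp_functor F (Shift E)) (comp_functor (Shift V) F) (\<lambda>X. Idn V (sh X))"
      unfolding nat_iso_def nat_trans_def
    proof (intro conjI ballI)
      fix X assume "X \<in> Obj E"
      then have X: "X \<in> orth A" by (simp add: E_simps)
      show "Idn V (sh X) \<in> Hom V (OMap (comp_functor F (Shift E)) X) (OMap (comp_functor (Shift V) F) X)"
        using VC.Idn_in_Hom[OF so(1)[OF X]]
        by (simp add: comp_functor_apply[of F "Shift C"] comp_functor_apply[of "Shift V" F] F_simps E_simps V_shift_Obj)
      show "is_iso V (OMap (comp_functor F (Shift E)) X) (OMap (comp_functor (Shift V) F) X) (Idn V (sh X))"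
        using VC.is_iso_Idn[OF so(1)[OF X]]
        by (simp add: comp_functor_apply[of F "Shift C"] comp_functor_apply[of "Shift V" F] F_simps E_simps V_shift_Obj)
    next
      fix f assume "f \<in> Arr E"
      then have f: "f \<in> Arr C" by (simp add: E_Arr)
      have sf: "AMap F (shm f) \<in> Hom V (sh (Dom C f)) (sh (Cod C f))" using F_arr[of "shm f"] f by simp
      show "Idn V (sh (Cod E f)) \<cdot>\<^bsub>V\<^esub> AMap (comp_functor F (Shift E)) f =
          AMap (comp_functor (Shift V) F) f \<cdot>\<^bsub>V\<^esub> Idn V (sh (Dom E f))"
        using VC.Cmp_Idn[OF sf] VC.Idn_Cmp[OF sf] F_shift[OF f]
        by (simp add: comp_functor_apply[of F "Shift C"] comp_functor_apply[of "Shift V" F] E_simps)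
    qed
    have "(AMap F f, AMap F g, Idn V (sh (Dom E f)) \<cdot>\<^bsub>V\<^esub> AMap F h) \<in> Tri V" if "(f, g, h) \<in> Tri E" for f g h
    proof -
      have t: "(f, g, h) \<in> Tri C" using that by (simp add: E_Tri)
      note tt = Tri_typing[OF t]
      note FH = F_arr[OF tt(1)] F_arr[OF tt(2)] F_arr[OF tt(3)]
      have LH: "LA f \<in> Hom C (LO (Dom C f)) (LO (Cod C f))" "LA g \<in> Hom C (LO (Cod C f)) (LO (Cod C g))"
        "LA h \<in> Hom C (LO (Cod C g)) (LO (sh (Dom C f)))"
        using tt by (auto simp: Hom_iff)
      have 1: "Idn V (sh (Dom E f)) \<cdot>\<^bsub>V\<^esub> AMap F h = AMap F h"
        using VC.Idn_Cmp[OF FH(3)] tt by (simp add: E_simps)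
      have r: "rho (AMap F f) = LA f" "rho (AMap F g) = LA g" "rho (AMap F h) = LA h"
        using tt LH by (simp_all add: F_simps rho_fr)
      show ?thesis unfolding 1
        using VC.HomD[OF FH(1)] VC.HomD[OF FH(2)] VC.HomD[OF FH(3)] tt r L_triangle[OF t]
        by (intro triangulated_transport.D_TriI[OF V_transport]) (auto simp: V_shift_Obj)
    qed
    then show "\<forall>(f, g, h)\<in>Tri E. (AMap F f, AMap F g, Idn V (sh (Dom E f)) \<cdot>\<^bsub>V\<^esub> AMap F h) \<in> Tri V"
      by blast
  qed
qed

text \<open>The quasi-inverse is \<open>LO\<close> with \<open>rho\<close>. Its unit is
  \<open>\<eta>\<close>, which is invertible on local objects; its counit at \<open>X\<close> is the
  fraction with value \<open>linv (\<eta> X)\<close>.\<close>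

lemma F_equivalence: "is_equivalence E V F"
  unfolding is_equivalence_def
proof (intro conjI exI)
  let ?G = "\<lparr>OMap = LO, AMap = rho\<rparr>"
  interpret VC: category V by (rule V_category)
  note Gd = is_functorD[OF rho_V_functor, unfolded functr.simps]
  show "is_functor V E ?G"
    unfolding is_functor_def
  proof (intro conjI ballI impI E_category V_category, unfold functr.simps)
    fix f assume f: "f \<in> Arr V"
    then show "rho f \<in> Hom E (LO (Dom V f)) (LO (Cod V f))"
      using VC.Dom_in_Obj[OF f] VC.Cod_in_Obj[OF f] Gd(5-7)[OF f] L_orth
      by (simp add: E_Hom loc_simps Hom_iff)
  qed (use Gd L_orth in \<open>auto simp: E_simps loc_simps\<close>)
  show "nat_iso E E id_functor (comp_functor ?G F) \<eta>"
    unfolding nat_iso_def nat_trans_def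
  proof (intro conjI ballI)
    fix X assume "X \<in> Obj E"
    then have X: "X \<in> orth A" "X \<in> Obj C" using orth_Obj by (auto simp: E_simps)
    have o: "OMap (comp_functor ?G F) X = LO X" by (simp add: comp_functor_apply[of ?G F] F_simps)
    show "\<eta> X \<in> Hom E (OMap id_functor X) (OMap (comp_functor ?G F) X)"
      using X L_orth eta_Hom by (simp add: o id_functor_apply E_Hom)
    show "is_iso E (OMap id_functor X) (OMap (comp_functor ?G F) X) (\<eta> X)"
      using eta_iso_if_orth[OF X(1)] X L_orth
      by (simp add: o id_functor_apply is_iso_def E_Hom E_simps)
  next
    fix f assume f: "f \<in> Arr E"
    then have fC: "f \<in> Arr C" by (simp add: E_Arr)
    have "rho (fr (Dom C f) (Cod C f) (LA f)) = LA f" using fC by (intro rho_fr) (auto simp: Hom_iff)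
    then show "\<eta> (Cod E f) \<cdot>\<^bsub>E\<^esub> AMap id_functor f = AMap (comp_functor ?G F) f \<cdot>\<^bsub>E\<^esub> \<eta> (Dom E f)"
      using fC eta_natural[OF fC] by (simp add: E_simps id_functor_apply comp_functor_apply[of ?G F] F_simps)
  qed
  let ?e = "\<lambda>X. linv (\<eta> X)"
  show "nat_iso V V (comp_functor F ?G) id_functor (\<lambda>X. fr (LO X) X (?e X))"
    unfolding nat_iso_def nat_trans_def
  proof (intro conjI ballI)
    fix X assume "X \<in> Obj V"
    then have X: "X \<in> Obj C" by (simp add: loc_simps)
    have o: "OMap (comp_functor F ?G) X = LO X" "OMap id_functor X = X"
      by (simp_all add: comp_functor_apply[of F ?G] F_simps id_functor_apply)
    show "fr (LO X) X (?e X) \<in> Hom V (OMap (comp_functor F ?G) X) (OMap id_functor X)"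
      unfolding o using X linv_eta(1) by (intro V_HomI) auto
    show "is_iso V (OMap (comp_functor F ?G) X) (OMap id_functor X) (fr (LO X) X (?e X))"
      unfolding o using X linv_eta_iso by (intro V_isoI) auto
  next
    fix \<alpha> assume "\<alpha> \<in> Arr V"
    then obtain X Y a where *: "X \<in> Obj C" "Y \<in> Obj C" "a \<in> Hom C (LO X) (LO Y)" "\<alpha> = fr X Y a"
      by (rule V_ArrE)
    note n = linv_eta_natural[OF *(1-3)] and at = HomD[OF *(3)]
    have "AMap (comp_functor F ?G) \<alpha> = fr (LO X) (LO Y) (LA a)"
      using * at by (simp add: comp_functor_apply[of F ?G] F_simps rho_fr)
    moreover have "LA a \<in> Hom C (LO (LO X)) (LO (LO Y))" using LA_in_Hom[OF *(3)] .
    ultimately show "fr (LO (Cod V \<alpha>)) (Cod V \<alpha>) (?e (Cod V \<alpha>)) \<cdot>\<^bsub>V\<^esub> AMap (comp_functor F ?G) \<alpha> =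
        AMap id_functor \<alpha> \<cdot>\<^bsub>V\<^esub> fr (LO (Dom V \<alpha>)) (Dom V \<alpha>) (?e (Dom V \<alpha>))"
      using * linv_eta n by (simp add: loc_simps id_functor_apply V_Cmp)
  qed
qed (rule F_functor)

lemma F_triangle_equivalence: "triangle_equivalence E V F (\<lambda>X. Idn V (sh X))"
  unfolding triangle_equivalence_def using F_exact F_equivalence by blast

end

section \<open>Small sets and coproducts\<close>

lemma (in category) is_coproduct_cong:
  assumes "is_coproduct C I X P \<iota>" "\<And>i. i \<in> I \<Longrightarrow> X i = X' i" "\<And>i. i \<in> I \<Longrightarrow> \<iota> i = \<iota>' i"
  shows "is_coproduct C I X' P \<iota>'"
  using assms by (auto simp: is_coproduct_def cong: ball_cong)

lemma small_subset: "small \<Lambda> B \<Longrightarrow> A \<subseteq> B \<Longrightarrow> small \<Lambda> A"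
  unfolding small_def using card_of_mono1 ordLeq_ordLess_trans by blast

lemma small_image: "small \<Lambda> A \<Longrightarrow> small \<Lambda> (f ` A)"
  unfolding small_def using card_of_image ordLeq_ordLess_trans by blast

lemma small_UNION:
  assumes "universe \<Lambda>" "small \<Lambda> I" "\<And>i. i \<in> I \<Longrightarrow> small \<Lambda> (A i)"
  shows "small \<Lambda> (\<Union>i\<in>I. A i)"
proof -
  have "Cinfinite \<Lambda>" "regularCard \<Lambda>"
    using assms(1) by (auto simp: universe_def regular_cardinal_def cinfinite_def)
  then show ?thesis
    using card_of_UNION_ordLess_infinite_Field_regularCard[of \<Lambda> I A] assms(2,3) by (auto simp: small_def)
qed

lemma small_Sigma:
  assumes "universe \<Lambda>" "small \<Lambda> I" "\<And>i. i \<in> I \<Longrightarrow> small \<Lambda> (A i)"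
  shows "small \<Lambda> (Sigma I A)"
proof -
  have "Sigma I A = (\<Union>i\<in>I. Pair i ` A i)" by auto
  then show ?thesis using small_UNION[OF assms(1,2), of "\<lambda>i. Pair i ` A i"] assms(3) small_image by metis
qed

text \<open>Uncountability of \<open>\<Lambda>\<close> makes coproducts of sequences available, and
  with them homotopy colimits.\<close>

lemma small_nat:
  assumes "universe \<Lambda>"
  shows "small \<Lambda> (UNIV :: nat set)"
proof -
  have "|UNIV :: nat set| =o natLeq" by (rule card_of_nat)
  also have "natLeq <o \<Lambda>" using assms by (simp add: universe_def)
  finally show ?thesis by (simp add: small_def)
qed

lemma small_embedding:
  fixes \<Lambda> :: "'u rel" and I :: "'i set"
  assumes "universe \<Lambda>" "small \<Lambda> I"
  obtains e :: "'i \<Rightarrow> 'u" where "inj_on e I"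
proof -
  have "|I| \<le>o \<Lambda>" using assms(2) by (simp add: small_def ordLess_imp_ordLeq)
  also have "\<Lambda> =o |Field \<Lambda>|"
    using assms(1) card_of_Field_ordIso ordIso_symmetric
    by (auto simp: universe_def regular_cardinal_def)
  finally have "|I| \<le>o |Field \<Lambda>|" .
  then show ?thesis using that card_of_ordLeq[of I "Field \<Lambda>"] by blast
qed

context triangulated_category
begin

lemma one_minus_Cmp:
  assumes s: "s \<in> Hom C P P" and a: "a \<in> Hom C Z P"
  shows "Plus C (Idn C P) (neg C s) \<cdot> a = Zer C Z P \<longleftrightarrow> s \<cdot> a = a"
  using Cmp_eq_iff_diff[OF Idn_in_Hom s a] HomD[OF s] HomD[OF a] by auto

lemma Cmp_one_minus:
  assumes s: "s \<in> Hom C P P" and a: "a \<in> Hom C P Z"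
  shows "a \<cdot> Plus C (Idn C P) (neg C s) = Zer C P Z \<longleftrightarrow> a \<cdot> s = a"
proof -
  note tt = HomD[OF s] HomD[OF a]
  have "a \<cdot> Plus C (Idn C P) (neg C s) = Plus C a (neg C (a \<cdot> s))"
    using tt by (simp add: Cmp_Plus_Arr Cmp_neg)
  then show ?thesis using Plus_neg_eq_Zer_iff[OF a Cmp_in_Hom[OF s a]] by auto
qed

section \<open>Coproducts under the shift automorphism\<close>

lemma coproduct_sh:
  assumes P: "is_coproduct C I X P \<iota>"
  shows "is_coproduct C I (\<lambda>i. sh (X i)) (sh P) (\<lambda>i. shm (\<iota> i))"
proof -
  note d = is_coproductD[OF P]
  show ?thesis
  proof (rule is_coproductI)
    fix Y f assume Y: "Y \<in> Obj C" and f: "\<And>i. i \<in> I \<Longrightarrow> f i \<in> Hom C (sh (X i)) Y"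
    have "\<exists>f'. f' \<in> Hom C (X i) (unsh Y) \<and> shm f' = f i" if i: "i \<in> I" for i
      by (rule shm_surj[of "f i" "X i" "unsh Y"]) (use f[OF i] d(2)[OF i] Y in auto)
    then obtain f' where f': "\<And>i. i \<in> I \<Longrightarrow> f' i \<in> Hom C (X i) (unsh Y)" "\<And>i. i \<in> I \<Longrightarrow> shm (f' i) = f i"
      by metis
    obtain g where g: "g \<in> Hom C P (unsh Y)" "\<And>i. i \<in> I \<Longrightarrow> g \<cdot> \<iota> i = f' i"
      by (rule coproduct_copair[OF P, of "unsh Y" f']) (use Y f' in auto)
    have "shm g \<cdot> shm (\<iota> i) = f i" if i: "i \<in> I" for i
    proof -
      have "shm (g \<cdot> \<iota> i) = f i" using g(2)[OF i] f'(2)[OF i] by simp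
      then show ?thesis using HomD[OF g(1)] HomD[OF d(3)[OF i]] by simp
    qed
    then show "\<exists>g\<in>Hom C (sh P) Y. \<forall>i\<in>I. g \<cdot> shm (\<iota> i) = f i" using shm_in_Hom[OF g(1)] Y by auto
  next
    fix Y g h assume g: "g \<in> Hom C (sh P) Y" and h: "h \<in> Hom C (sh P) Y"
      and e: "\<And>i. i \<in> I \<Longrightarrow> g \<cdot> shm (\<iota> i) = h \<cdot> shm (\<iota> i)"
    have Y: "Y \<in> Obj C" using HomD[OF g] by simp
    obtain g' where g': "g' \<in> Hom C P (unsh Y)" "shm g' = g"
      by (rule shm_surj[of g P "unsh Y"]) (use g Y d(1) in auto)
    obtain h' where h': "h' \<in> Hom C P (unsh Y)" "shm h' = h"
      by (rule shm_surj[of h P "unsh Y"]) (use h Y d(1) in auto)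
    have "g' = h'"
    proof (rule coproduct_ext[OF P g'(1) h'(1)])
      fix i assume i: "i \<in> I"
      note tt = HomD[OF g'(1)] HomD[OF h'(1)] HomD[OF d(3)[OF i]]
      have "shm (g' \<cdot> \<iota> i) = shm (h' \<cdot> \<iota> i)" using e[OF i] g'(2) h'(2) tt by simp
      then show "g' \<cdot> \<iota> i = h' \<cdot> \<iota> i" by (rule shm_inj[rotated 2]) (use tt in auto)
    qed
    then show "g = h" using g'(2) h'(2) by simp
  qed (use d in \<open>auto intro: shm_in_Hom\<close>)
qed

lemma coproduct_unsh:
  assumes P: "is_coproduct C I X P \<iota>"
  obtains \<kappa> where "is_coproduct C I (\<lambda>i. unsh (X i)) (unsh P) \<kappa>" "\<And>i. i \<in> I \<Longrightarrow> shm (\<kappa> i) = \<iota> i"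
proof -
  note d = is_coproductD[OF P]
  have "\<exists>k. k \<in> Hom C (unsh (X i)) (unsh P) \<and> shm k = \<iota> i" if i: "i \<in> I" for i
    by (rule shm_surj[of "\<iota> i" "unsh (X i)" "unsh P"]) (use d(1) d(2)[OF i] d(3)[OF i] in auto)
  then obtain \<kappa> where \<kappa>: "\<And>i. i \<in> I \<Longrightarrow> \<kappa> i \<in> Hom C (unsh (X i)) (unsh P)" "\<And>i. i \<in> I \<Longrightarrow> shm (\<kappa> i) = \<iota> i"
    by metis
  have "is_coproduct C I (\<lambda>i. unsh (X i)) (unsh P) \<kappa>"
  proof (rule is_coproductI)
    fix Y f assume Y: "Y \<in> Obj C" and f: "\<And>i. i \<in> I \<Longrightarrow> f i \<in> Hom C (unsh (X i)) Y"
    have f': "shm (f i) \<in> Hom C (X i) (sh Y)" if "i \<in> I" for i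
      using shm_in_Hom[OF f[OF that]] d(2)[OF that] by simp
    obtain g where g: "g \<in> Hom C P (sh Y)" "\<And>i. i \<in> I \<Longrightarrow> g \<cdot> \<iota> i = shm (f i)"
      by (rule coproduct_copair[OF P, of "sh Y" "\<lambda>i. shm (f i)"]) (use Y f' in auto)
    obtain g' where g': "g' \<in> Hom C (unsh P) Y" "shm g' = g"
      by (rule shm_surj[of g "unsh P" Y]) (use g Y d(1) in auto)
    have "g' \<cdot> \<kappa> i = f i" if i: "i \<in> I" for i
      by (rule shm_inj)
        (use HomD[OF g'(1)] HomD[OF \<kappa>(1)[OF i]] HomD[OF f[OF i]] g(2)[OF i] g'(2) \<kappa>(2)[OF i] in auto)
    then show "\<exists>g\<in>Hom C (unsh P) Y. \<forall>i\<in>I. g \<cdot> \<kappa> i = f i" using g'(1) by blast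
  next
    fix Y g h assume g: "g \<in> Hom C (unsh P) Y" and h: "h \<in> Hom C (unsh P) Y"
      and e: "\<And>i. i \<in> I \<Longrightarrow> g \<cdot> \<kappa> i = h \<cdot> \<kappa> i"
    have "shm g = shm h"
    proof (rule coproduct_ext[OF P])
      fix i assume i: "i \<in> I"
      have "shm (g \<cdot> \<kappa> i) = shm (h \<cdot> \<kappa> i)" using e[OF i] by simp
      then show "shm g \<cdot> \<iota> i = shm h \<cdot> \<iota> i"
        using HomD[OF g] HomD[OF h] HomD[OF \<kappa>(1)[OF i]] \<kappa>(2)[OF i] by simp
    qed (use shm_in_Hom[OF g] shm_in_Hom[OF h] d(1) in auto)
    then show "g = h" by (rule shm_inj[rotated 2]) (use HomD[OF g] HomD[OF h] in auto)
  qed (use \<kappa> d in auto)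
  then show ?thesis using that \<kappa>(2) by blast
qed

section \<open>Closing a set of objects under shifts\<close>

lemma shift_power_Obj: "Y \<in> Obj C \<Longrightarrow> shift_power C n Y \<in> Obj C"
proof -
  assume Y: "Y \<in> Obj C"
  have "(sh ^^ m) Y \<in> Obj C" "(unsh ^^ m) Y \<in> Obj C" for m by (induction m) (use Y in auto)
  then show ?thesis by (simp add: shift_power_def)
qed

lemma sh_shift_power:
  assumes Y: "Y \<in> Obj C"
  shows "sh (shift_power C n Y) = shift_power C (n + 1) Y"
proof (cases "n \<ge> 0")
  case True
  then have "nat (n + 1) = Suc (nat n)" by simp
  then show ?thesis using True by (simp add: shift_power_def)
next
  case False
  then obtain m where m: "n = - int (Suc m)" by (metis int_cases linorder_not_le of_nat_0_le_iff)
  have "(unsh ^^ m) Y \<in> Obj C" by (induction m) (use Y in auto)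
  moreover have neg: "shift_power C (- int k) Y = (unsh ^^ k) Y" for k by (simp add: shift_power_def)
  moreover have n1: "n + 1 = - int m" by (simp add: m)
  ultimately show ?thesis using neg[of "Suc m"] neg[of m] unfolding n1 m by simp
qed

lemma unsh_shift_power:
  assumes Y: "Y \<in> Obj C"
  shows "unsh (shift_power C n Y) = shift_power C (n - 1) Y"
  using sh_shift_power[OF Y, of "n - 1"] unsh_sh[OF shift_power_Obj[OF Y, of "n - 1"]] by simp

lemma shift_power_0: "shift_power C 0 Y = Y"
  by (simp add: shift_power_def)

definition shifts :: "'o set \<Rightarrow> 'o set" where
  "shifts G = {shift_power C n Y | n Y. Y \<in> G}"

lemma shifts_closed:
  assumes "G \<subseteq> Obj C"
  shows "shifts G \<subseteq> Obj C" "G \<subseteq> shifts G" "\<And>Y. Y \<in> shifts G \<Longrightarrow> sh Y \<in> shifts G"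
    "\<And>Y. Y \<in> shifts G \<Longrightarrow> unsh Y \<in> shifts G"
proof -
  show "shifts G \<subseteq> Obj C" using assms shift_power_Obj by (auto simp: shifts_def)
  show "G \<subseteq> shifts G" using shift_power_0 unfolding shifts_def by (smt (verit) mem_Collect_eq subsetI)
  show "sh Y \<in> shifts G" if "Y \<in> shifts G" for Y
    using that assms sh_shift_power unfolding shifts_def by blast
  show "unsh Y \<in> shifts G" if "Y \<in> shifts G" for Y
    using that assms unsh_shift_power unfolding shifts_def by blast
qed

lemma shifts_induct:
  assumes "Z \<in> shifts G" "G \<subseteq> Obj C" "\<And>Y. Y \<in> G \<Longrightarrow> Q Y"
    "\<And>Y. Y \<in> Obj C \<Longrightarrow> Q Y \<Longrightarrow> Q (sh Y)" "\<And>Y. Y \<in> Obj C \<Longrightarrow> Q Y \<Longrightarrow> Q (unsh Y)"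
  shows "Q Z"
proof -
  obtain n Y where Y: "Z = shift_power C n Y" "Y \<in> G" using assms(1) by (auto simp: shifts_def)
  have Yo: "Y \<in> Obj C" using Y(2) assms(2) by blast
  have "Q (shift_power C n Y)"
  proof (induction n rule: int_induct[where k = 0])
    case base
    then show ?case using assms(3)[OF Y(2)] by (simp add: shift_power_0)
  next
    case (step1 i)
    then show ?case using assms(4)[OF shift_power_Obj[OF Yo]] sh_shift_power[OF Yo] by metis
  next
    case (step2 i)
    then show ?case using assms(5)[OF shift_power_Obj[OF Yo]] unsh_shift_power[OF Yo] by metis
  qed
  then show ?thesis using Y by simp
qed

lemma shifts_subset: "triangulated_subcategory C A \<Longrightarrow> G \<subseteq> A \<Longrightarrow> shifts G \<subseteq> A"
proof
  fix Z assume A: "triangulated_subcategory C A" "G \<subseteq> A" and Z: "Z \<in> shifts G"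
  have "G \<subseteq> Obj C" using A tri_subD(1) by blast
  with Z show "Z \<in> A"
    by (rule shifts_induct) (use A tri_subD(4,6)[OF A(1)] in auto)
qed

end

section \<open>Localizing subcategories\<close>

locale coproduct_triangulated_category = triangulated_category C
  for C :: "('o, 'm) tri_cat" (structure) +
  fixes \<Lambda> :: "'u rel"
  assumes universe: "universe \<Lambda>"
    and locally_small: "locally_small \<Lambda> C"
    and small_coproducts: "has_small_coproducts \<Lambda> C"
begin

lemma ex_coproduct:
  fixes I :: "'i set"
  assumes I: "small \<Lambda> I" and X: "\<And>i. i \<in> I \<Longrightarrow> X i \<in> Obj C"
  obtains P \<iota> where "is_coproduct C I X P \<iota>"
proof -
  obtain e :: "'i \<Rightarrow> 'u" where e: "inj_on e I" by (rule small_embedding[OF universe I])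
  have "(X \<circ> inv_into I e) ` (e ` I) \<subseteq> Obj C" using X e by auto
  then obtain P \<iota> where P: "is_coproduct C (e ` I) (X \<circ> inv_into I e) P \<iota>"
    using small_coproducts small_image[OF I, of e] unfolding has_small_coproducts_def by blast
  from is_coproduct_reindex[OF P, of e I] e
  have "is_coproduct C I X P (\<lambda>i. \<iota> (e i))"
    by (auto simp: bij_betw_def intro: is_coproduct_cong)
  then show ?thesis by (rule that)
qed

lemma localizingD:
  assumes "localizing \<Lambda> C A"
  shows "triangulated_subcategory C A"
  using assms by (simp add: localizing_def)

lemma localizing_coproduct:
  fixes I :: "'i set"
  assumes A: "localizing \<Lambda> C A" and I: "small \<Lambda> I" and X: "\<And>i. i \<in> I \<Longrightarrow> X i \<in> A"
    and P: "is_coproduct C I X P \<iota>"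
  shows "P \<in> A"
proof -
  obtain e :: "'i \<Rightarrow> 'u" where e: "inj_on e I" by (rule small_embedding[OF universe I])
  have "is_coproduct C (e ` I) (\<lambda>j. X (inv_into I e j)) P (\<lambda>j. \<iota> (inv_into I e j))"
    by (rule is_coproduct_reindex[OF P]) (simp add: bij_betw_inv_into e inj_on_imp_bij_betw)
  moreover have "(\<lambda>j. X (inv_into I e j)) ` (e ` I) \<subseteq> A" using X e by auto
  ultimately show ?thesis
    using A small_image[OF I, of e] unfolding localizing_def by blast
qed

lemma localizing_Obj: "localizing \<Lambda> C (Obj C)"
  unfolding localizing_def triangulated_subcategory_def
proof (intro conjI allI impI ballI)
  show "sh ` Obj C = Obj C" by (rule bij_betw_imp_surj_on[OF shift_bij_Obj])
  show "case t of (f, g, h) \<Rightarrow> Dom C f \<in> Obj C \<and> Dom C g \<in> Obj C \<longrightarrow> Dom C h \<in> Obj C" if "t \<in> Tri C" for t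
    using that Tri_typing(3) by (cases t) auto
qed (auto simp: is_zero_def isomorphic_def is_coproduct_def dest!: is_iso_Hom HomD(5))

lemma Loc_least: "localizing \<Lambda> C A \<Longrightarrow> S \<subseteq> A \<Longrightarrow> Loc \<Lambda> C S \<subseteq> A"
  by (auto simp: Loc_def)

lemma Loc_superset: "S \<subseteq> Loc \<Lambda> C S"
  by (auto simp: Loc_def)

lemma Loc_localizing:
  assumes S: "S \<subseteq> Obj C"
  shows "localizing \<Lambda> C (Loc \<Lambda> C S)"
proof -
  have sub: "Loc \<Lambda> C S \<subseteq> Obj C" by (rule Loc_least[OF localizing_Obj S])
  have I: "X \<in> Loc \<Lambda> C S" if "\<And>A. localizing \<Lambda> C A \<Longrightarrow> S \<subseteq> A \<Longrightarrow> X \<in> A" for X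
    using that by (auto simp: Loc_def)
  have D: "X \<in> A" if "X \<in> Loc \<Lambda> C S" "localizing \<Lambda> C A" "S \<subseteq> A" for X A
    using that by (auto simp: Loc_def)
  show ?thesis
    unfolding localizing_def triangulated_subcategory_def
  proof (intro conjI allI impI ballI sub)
    show "Z \<in> Loc \<Lambda> C S" if "is_zero C Z" for Z
      by (rule I) (use tri_subD(2)[OF localizingD] that in blast)
    show "Y \<in> Loc \<Lambda> C S" if "X \<in> Loc \<Lambda> C S" "isomorphic C X Y" for X Y
      by (rule I) (use tri_subD(3)[OF localizingD] D that in blast)
    show "sh ` Loc \<Lambda> C S = Loc \<Lambda> C S"
    proof
      show "sh ` Loc \<Lambda> C S \<subseteq> Loc \<Lambda> C S"
        by (intro image_subsetI I) (use tri_subD(4)[OF localizingD] D in blast)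
      show "Loc \<Lambda> C S \<subseteq> sh ` Loc \<Lambda> C S"
      proof
        fix X assume X: "X \<in> Loc \<Lambda> C S"
        then have "unsh X \<in> Loc \<Lambda> C S" by (intro I) (use tri_subD(6)[OF localizingD] D in blast)
        moreover have "X = sh (unsh X)" using X sub by auto
        ultimately show "X \<in> sh ` Loc \<Lambda> C S" by blast
      qed
    qed
    show "case t of (f, g, h) \<Rightarrow> Dom C f \<in> Loc \<Lambda> C S \<and> Dom C g \<in> Loc \<Lambda> C S \<longrightarrow> Dom C h \<in> Loc \<Lambda> C S"
      if t: "t \<in> Tri C" for t
    proof -
      obtain f g h where tt: "t = (f, g, h)" by (cases t)
      note ty = Tri_typing[OF t[unfolded tt]]
      have "Dom C h \<in> Loc \<Lambda> C S" if f: "Dom C f \<in> Loc \<Lambda> C S" and g: "Dom C g \<in> Loc \<Lambda> C S"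
      proof (rule I)
        fix A assume A: "localizing \<Lambda> C A" "S \<subseteq> A"
        show "Dom C h \<in> A"
          using tri_subD(7)[OF localizingD[OF A(1)] t[unfolded tt]] D[OF f A] D[OF g A] ty by simp
      qed
      then show ?thesis by (simp add: tt)
    qed
    show "P \<in> Loc \<Lambda> C S"
      if "small \<Lambda> I \<and> X ` I \<subseteq> Loc \<Lambda> C S \<and> is_coproduct C I X P \<iota>" for I :: "'u set" and X P \<iota>
    proof (rule I)
      fix A assume A: "localizing \<Lambda> C A" "S \<subseteq> A"
      show "P \<in> A"
        by (rule localizing_coproduct[OF A(1), of I X P \<iota>]) (use that D[OF _ A] in auto)
    qed
  qed
qed

text \<open>Morphisms out of cones and coproducts are controlled by their restrictions, so vanishing
  towards a shift-stable class passes to the whole localizing subcategory. This is the test class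
  against which \<open>Loc_least\<close> is applied.\<close>

lemma localizing_left_orth:
  assumes B: "B \<subseteq> Obj C" "\<And>X. X \<in> B \<Longrightarrow> sh X \<in> B" "\<And>X. X \<in> B \<Longrightarrow> unsh X \<in> B"
  shows "localizing \<Lambda> C {Y \<in> Obj C. \<forall>X\<in>B. \<forall>f\<in>Hom C Y X. f = Zer C Y X}" (is "localizing \<Lambda> C ?A")
proof -
  have shA: "sh Y \<in> ?A" if Y: "Y \<in> ?A" for Y
  proof -
    have "f = Zer C (sh Y) X" if X: "X \<in> B" and f: "f \<in> Hom C (sh Y) X" for X f
    proof -
      have Xo: "X \<in> Obj C" using X B(1) by blast
      obtain d where d: "d \<in> Hom C Y (unsh X)" "shm d = f"
        by (rule shm_surj[of f Y "unsh X"]) (use f Y Xo in auto)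
      have "d = Zer C Y (unsh X)" using Y d(1) B(3)[OF X] by blast
      then show ?thesis using d(2) Y Xo by auto
    qed
    then show ?thesis using Y by auto
  qed
  have unshA: "unsh Y \<in> ?A" if Y: "Y \<in> ?A" for Y
  proof -
    have "f = Zer C (unsh Y) X" if X: "X \<in> B" and f: "f \<in> Hom C (unsh Y) X" for X f
    proof -
      have "shm f \<in> Hom C Y (sh X)" using shm_in_Hom[OF f] Y by simp
      then have "shm f = Zer C Y (sh X)" using Y B(2)[OF X] by blast
      also have "\<dots> = shm (Zer C (unsh Y) X)" using Y HomD[OF f] by simp
      finally show ?thesis by (rule shm_inj[rotated 2]) (use HomD[OF f] in auto)
    qed
    then show ?thesis using Y by auto
  qed
  show ?thesis
    unfolding localizing_def triangulated_subcategory_def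
  proof (intro conjI allI impI ballI)
    show "?A \<subseteq> Obj C" by blast
    show "Z \<in> ?A" if "is_zero C Z" for Z
      using that is_zero_Hom_from by (auto simp: is_zero_def)
    show "Y \<in> ?A" if X: "X \<in> ?A" and i: "isomorphic C X Y" for X Y
    proof -
      obtain u where u: "is_iso C X Y u" using i by (auto simp: isomorphic_def)
      obtain v where v: "v \<in> Hom C Y X" "v \<cdot> u = Idn C X" "u \<cdot> v = Idn C Y"
        using u by (rule is_isoD)
      note tt = HomD[OF v(1)] HomD[OF is_iso_Hom[OF u]]
      have "f = Zer C Y Z" if Z: "Z \<in> B" and f: "f \<in> Hom C Y Z" for Z f
      proof -
        have "f \<cdot> u = Zer C X Z" using X Z Cmp_in_Hom[OF is_iso_Hom[OF u] f] by blast
        then have "(f \<cdot> u) \<cdot> v = Zer C Y Z" using tt HomD[OF f] by simp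
        then show ?thesis using tt HomD[OF f] v(3) by simp
      qed
      then show ?thesis using tt by auto
    qed
    show "sh ` ?A = ?A"
    proof
      show "sh ` ?A \<subseteq> ?A" using shA by blast
      show "?A \<subseteq> sh ` ?A"
      proof
        fix X assume X: "X \<in> ?A"
        then have "X = sh (unsh X)" by simp
        then show "X \<in> sh ` ?A" using unshA[OF X] by blast
      qed
    qed
    show "case t of (f, g, h) \<Rightarrow> Dom C f \<in> ?A \<and> Dom C g \<in> ?A \<longrightarrow> Dom C h \<in> ?A" if t: "t \<in> Tri C" for t
    proof -
      obtain f g h where tt: "t = (f, g, h)" by (cases t)
      note t = t[unfolded tt]
      note ty = Tri_typing[OF t]
      have "Dom C h \<in> ?A" if f: "Dom C f \<in> ?A" and g: "Dom C g \<in> ?A"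
      proof -
        have "k = Zer C (Dom C h) X" if X: "X \<in> B" and k: "k \<in> Hom C (Dom C h) X" for X k
        proof -
          have k': "k \<in> Hom C (Cod C g) X" using k ty by simp
          note kt = HomD[OF k']
          have "k \<cdot> g \<in> Hom C (Dom C g) X" using kt ty by (simp add: Hom_iff)
          then have "k \<cdot> g = Zer C (Cod C f) X" using g X ty by auto
          then obtain m where m: "m \<in> Hom C (sh (Dom C f)) X" "m \<cdot> h = k"
            using tri_ext2[OF t k'] by blast
          have "m = Zer C (sh (Dom C f)) X" using shA[OF f] m(1) X by blast
          then show ?thesis using m(2) ty kt by auto
        qed
        then show ?thesis using ty by auto
      qed
      then show ?thesis by (simp add: tt)
    qed
    show "P \<in> ?A" if "small \<Lambda> I \<and> X ` I \<subseteq> ?A \<and> is_coproduct C I X P \<iota>" for I :: "'u set" and X P \<iota>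
    proof -
      have P: "is_coproduct C I X P \<iota>" and X: "\<And>i. i \<in> I \<Longrightarrow> X i \<in> ?A" using that by auto
      note d = is_coproductD[OF P]
      have "f = Zer C P Z" if Z: "Z \<in> B" and f: "f \<in> Hom C P Z" for Z f
      proof (rule coproduct_ext[OF P f])
        fix i assume i: "i \<in> I"
        have "f \<cdot> \<iota> i = Zer C (X i) Z" using X[OF i] Z Cmp_in_Hom[OF d(3)[OF i] f] by blast
        then show "f \<cdot> \<iota> i = Zer C P Z \<cdot> \<iota> i" using HomD[OF f] HomD[OF d(3)[OF i]] by simp
      qed (use HomD[OF f] in \<open>auto intro: Zer_in_Hom\<close>)
      then show ?thesis using d(1) by auto
    qed
  qed
qed

text \<open>The left orthogonal of \<open>orth (shifts S)\<close> is localizing and contains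
  \<open>S\<close>, hence contains \<open>Loc \<Lambda> C S\<close>. The other inclusion holds
  because a localizing subcategory contains all shifts of its members.\<close>

lemma orth_Loc:
  assumes S: "S \<subseteq> Obj C"
  shows "orth (Loc \<Lambda> C S) = orth (shifts S)"
proof
  note sc = shifts_closed[OF S]
  have "shifts S \<subseteq> Loc \<Lambda> C S"
    by (rule shifts_subset[OF localizingD[OF Loc_localizing[OF S]] Loc_superset])
  then show "orth (Loc \<Lambda> C S) \<subseteq> orth (shifts S)" by (auto simp: orth_def)
  let ?A = "{Y \<in> Obj C. \<forall>X\<in>orth (shifts S). \<forall>f\<in>Hom C Y X. f = Zer C Y X}"
  have "localizing \<Lambda> C ?A"
    by (rule localizing_left_orth)
      (auto intro: orth_Obj orth_sh[OF sc(1) sc(4)] orth_unsh[OF sc(1) sc(3)])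
  moreover have "S \<subseteq> ?A" using S sc(2) orthD by blast
  ultimately have L: "Loc \<Lambda> C S \<subseteq> ?A" by (rule Loc_least)
  show "orth (shifts S) \<subseteq> orth (Loc \<Lambda> C S)"
  proof
    fix X assume X: "X \<in> orth (shifts S)"
    show "X \<in> orth (Loc \<Lambda> C S)"
      by (rule orthI) (use L X orth_Obj in blast)+
  qed
qed

end

section \<open>Perfect generation and approximation by a localizing subcategory\<close>

context triangulated_category
begin

text \<open>Condition (3) for countable families only, with the given family in \<open>M\<close> but
  all coproducts formed in \<open>C\<close>. The parameter \<open>M\<close> allows \<open>C\<close>
  to be larger than the well generated part.\<close>

definition perfect_for :: "'o set \<Rightarrow> 'o set \<Rightarrow> 'o \<Rightarrow> bool" where
  "perfect_for M G Y \<longleftrightarrow> (\<forall>(X :: nat \<Rightarrow> 'o) P \<iota> f.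
     range X \<subseteq> M \<and> is_coproduct C UNIV X P \<iota> \<and> f \<in> Hom C Y P \<longrightarrow>
     (\<exists>Y' f' P' \<iota>' g h. (\<forall>i. Y' i \<in> G \<and> f' i \<in> Hom C (Y' i) (X i)) \<and>
        is_coproduct C UNIV Y' P' \<iota>' \<and> h \<in> Hom C P' P \<and> (\<forall>i. h \<cdot> \<iota>' i = \<iota> i \<cdot> f' i) \<and>
        g \<in> Hom C Y P' \<and> f = h \<cdot> g))"

lemma perfect_forE:
  fixes X :: "nat \<Rightarrow> 'o"
  assumes "perfect_for M G Y" "range X \<subseteq> M" "is_coproduct C UNIV X P \<iota>" "f \<in> Hom C Y P"
  obtains Y' f' P' \<iota>' g h where "\<And>i. Y' i \<in> G" "\<And>i. f' i \<in> Hom C (Y' i) (X i)"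
    "is_coproduct C UNIV Y' P' \<iota>'" "h \<in> Hom C P' P" "\<And>i. h \<cdot> \<iota>' i = \<iota> i \<cdot> f' i"
    "g \<in> Hom C Y P'" "f = h \<cdot> g"
proof -
  have "\<exists>Y' f' P' \<iota>' g h. (\<forall>i. Y' i \<in> G \<and> f' i \<in> Hom C (Y' i) (X i)) \<and>
        is_coproduct C UNIV Y' P' \<iota>' \<and> h \<in> Hom C P' P \<and> (\<forall>i. h \<cdot> \<iota>' i = \<iota> i \<cdot> f' i) \<and>
        g \<in> Hom C Y P' \<and> f = h \<cdot> g"
    by (rule assms(1)[unfolded perfect_for_def, THEN spec, THEN spec, THEN spec, THEN spec, THEN mp])
      (intro conjI assms(2-4))
  then obtain Y' f' P' \<iota>' g h where "(\<forall>i. Y' i \<in> G \<and> f' i \<in> Hom C (Y' i) (X i)) \<and>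
        is_coproduct C UNIV Y' P' \<iota>' \<and> h \<in> Hom C P' P \<and> (\<forall>i. h \<cdot> \<iota>' i = \<iota> i \<cdot> f' i) \<and>
        g \<in> Hom C Y P' \<and> f = h \<cdot> g"
    by (elim exE)
  then show ?thesis by (intro that[of Y' f' P' \<iota>' h g]) simp_all
qed

lemma perfect_for_mono: "perfect_for M G Y \<Longrightarrow> G \<subseteq> G' \<Longrightarrow> perfect_for M G' Y"
  unfolding perfect_for_def by (meson subsetD)

lemma perfect_for_sh:
  assumes M: "M \<subseteq> Obj C" "\<And>X. X \<in> M \<Longrightarrow> unsh X \<in> M" and G: "G \<subseteq> Obj C" "\<And>Y. Y \<in> G \<Longrightarrow> sh Y \<in> G"
    and Z: "Z \<in> Obj C" and p: "perfect_for M G Z"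
  shows "perfect_for M G (sh Z)"
  unfolding perfect_for_def
proof (intro allI impI)
  fix X :: "nat \<Rightarrow> 'o" and P \<iota> f
  assume "range X \<subseteq> M \<and> is_coproduct C UNIV X P \<iota> \<and> f \<in> Hom C (sh Z) P"
  then have X: "range X \<subseteq> M" and P: "is_coproduct C UNIV X P \<iota>" and f: "f \<in> Hom C (sh Z) P" by auto
  note d = is_coproductD[OF P]
  obtain \<kappa> where \<kappa>: "is_coproduct C UNIV (\<lambda>i. unsh (X i)) (unsh P) \<kappa>" "\<And>i. shm (\<kappa> i) = \<iota> i"
    using coproduct_unsh[OF P] by auto
  obtain f0 where f0: "f0 \<in> Hom C Z (unsh P)" "shm f0 = f"
    by (rule shm_surj[of f Z "unsh P"]) (use f d(1) Z in auto)
  have "range (\<lambda>i. unsh (X i)) \<subseteq> M" using X M(2) by auto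
  from perfect_forE[OF p this \<kappa>(1) f0(1)] obtain Y' f' P' \<iota>' g h where *: "\<And>i. Y' i \<in> G"
    "\<And>i. f' i \<in> Hom C (Y' i) (unsh (X i))" "is_coproduct C UNIV Y' P' \<iota>'" "h \<in> Hom C P' (unsh P)"
    "\<And>i. h \<cdot> \<iota>' i = \<kappa> i \<cdot> f' i" "g \<in> Hom C Z P'" "f0 = h \<cdot> g" by metis
  note d' = is_coproductD[OF *(3)] is_coproductD[OF \<kappa>(1)]
  show "\<exists>Y' f' P' \<iota>' g h. (\<forall>i. Y' i \<in> G \<and> f' i \<in> Hom C (Y' i) (X i)) \<and>
        is_coproduct C UNIV Y' P' \<iota>' \<and> h \<in> Hom C P' P \<and> (\<forall>i. h \<cdot> \<iota>' i = \<iota> i \<cdot> f' i) \<and>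
        g \<in> Hom C (sh Z) P' \<and> f = h \<cdot> g"
  proof (intro exI conjI allI)
    show "is_coproduct C UNIV (\<lambda>i. sh (Y' i)) (sh P') (\<lambda>i. shm (\<iota>' i))" by (rule coproduct_sh[OF *(3)])
    show "sh (Y' i) \<in> G" for i by (rule G(2)[OF *(1)])
    show "shm (f' i) \<in> Hom C (sh (Y' i)) (X i)" for i using shm_in_Hom[OF *(2)[of i]] d(2)[of i] by simp
    show "shm h \<in> Hom C (sh P') P" using shm_in_Hom[OF *(4)] d(1) by simp
    show "shm g \<in> Hom C (sh Z) (sh P')" by (rule shm_in_Hom[OF *(6)])
    show "f = shm h \<cdot> shm g" using f0(2) *(7) HomD[OF *(4)] HomD[OF *(6)] by auto
    show "shm h \<cdot> shm (\<iota>' i) = \<iota> i \<cdot> shm (f' i)" for i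
    proof -
      have "shm (h \<cdot> \<iota>' i) = shm (\<kappa> i \<cdot> f' i)" using *(5) by simp
      then show ?thesis using HomD[OF *(4)] HomD[OF d'(3)[of i]] HomD[OF d'(6)[of i]] HomD[OF *(2)[of i]] \<kappa>(2)
        by simp
    qed
  qed
qed

lemma perfect_for_unsh:
  assumes M: "M \<subseteq> Obj C" "\<And>X. X \<in> M \<Longrightarrow> sh X \<in> M" and G: "G \<subseteq> Obj C" "\<And>Y. Y \<in> G \<Longrightarrow> unsh Y \<in> G"
    and Z: "Z \<in> Obj C" and p: "perfect_for M G Z"
  shows "perfect_for M G (unsh Z)"
  unfolding perfect_for_def
proof (intro allI impI)
  fix X :: "nat \<Rightarrow> 'o" and P \<iota> f
  assume "range X \<subseteq> M \<and> is_coproduct C UNIV X P \<iota> \<and> f \<in> Hom C (unsh Z) P"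
  then have X: "range X \<subseteq> M" and P: "is_coproduct C UNIV X P \<iota>" and f: "f \<in> Hom C (unsh Z) P" by auto
  note d = is_coproductD[OF P]
  have f0: "shm f \<in> Hom C Z (sh P)" using shm_in_Hom[OF f] Z by simp
  have "range (\<lambda>i. sh (X i)) \<subseteq> M" using X M(2) by auto
  from perfect_forE[OF p this coproduct_sh[OF P] f0] obtain Y' f' P' \<iota>' g h where *: "\<And>i. Y' i \<in> G"
    "\<And>i. f' i \<in> Hom C (Y' i) (sh (X i))" "is_coproduct C UNIV Y' P' \<iota>'" "h \<in> Hom C P' (sh P)"
    "\<And>i. h \<cdot> \<iota>' i = shm (\<iota> i) \<cdot> f' i" "g \<in> Hom C Z P'" "shm f = h \<cdot> g" by metis
  note d' = is_coproductD[OF *(3)]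
  obtain \<kappa> where \<kappa>: "is_coproduct C UNIV (\<lambda>i. unsh (Y' i)) (unsh P') \<kappa>" "\<And>i. shm (\<kappa> i) = \<iota>' i"
    using coproduct_unsh[OF *(3)] by auto
  note dk = is_coproductD[OF \<kappa>(1)]
  have "\<exists>k. k \<in> Hom C (unsh (Y' i)) (X i) \<and> shm k = f' i" for i
    by (rule shm_surj[of "f' i" "unsh (Y' i)" "X i"]) (use *(2)[of i] d(2)[of i] d'(2)[of i] in auto)
  then obtain f'' where f'': "\<And>i. f'' i \<in> Hom C (unsh (Y' i)) (X i)" "\<And>i. shm (f'' i) = f' i" by metis
  obtain h' where h': "h' \<in> Hom C (unsh P') P" "shm h' = h"
    by (rule shm_surj[of h "unsh P'" P]) (use *(4) d(1) d'(1) in auto)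
  obtain g' where g': "g' \<in> Hom C (unsh Z) (unsh P')" "shm g' = g"
    by (rule shm_surj[of g "unsh Z" "unsh P'"]) (use *(6) Z d'(1) in auto)
  show "\<exists>Y' f' P' \<iota>' g h. (\<forall>i. Y' i \<in> G \<and> f' i \<in> Hom C (Y' i) (X i)) \<and>
        is_coproduct C UNIV Y' P' \<iota>' \<and> h \<in> Hom C P' P \<and> (\<forall>i. h \<cdot> \<iota>' i = \<iota> i \<cdot> f' i) \<and>
        g \<in> Hom C (unsh Z) P' \<and> f = h \<cdot> g"
  proof (intro exI conjI allI)
    show "unsh (Y' i) \<in> G" for i by (rule G(2)[OF *(1)])
    show "f = h' \<cdot> g'"
      by (rule shm_inj) (use HomD[OF f] HomD[OF h'(1)] HomD[OF g'(1)] *(7) h'(2) g'(2) in auto)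
    show "h' \<cdot> \<kappa> i = \<iota> i \<cdot> f'' i" for i
      by (rule shm_inj) (use HomD[OF h'(1)] HomD[OF dk(3)[of i]] HomD[OF d(3)[of i]] HomD[OF f''(1)[of i]]
        *(5)[of i] h'(2) \<kappa>(2)[of i] f''(2)[of i] in auto)
  qed (fact \<kappa>(1) f''(1) h'(1) g'(1))+
qed

text \<open>A morphism from a shifted object is desuspended or suspended, factored there and moved
  back; the shift preserves coproducts because it is an automorphism.\<close>

lemma perfect_for_shifts:
  assumes M: "triangulated_subcategory C M" and G: "G \<subseteq> Obj C" and p: "\<And>Y. Y \<in> G \<Longrightarrow> perfect_for M G Y"
    and Z: "Z \<in> shifts G"
  shows "perfect_for M (shifts G) Z"
  using Z G
proof (rule shifts_induct)
  note Md = tri_subD[OF M] and Gd = shifts_closed[OF G]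
  show "perfect_for M (shifts G) Y" if "Y \<in> G" for Y by (rule perfect_for_mono[OF p[OF that] Gd(2)])
  show "perfect_for M (shifts G) (sh Y)" if "Y \<in> Obj C" "perfect_for M (shifts G) Y" for Y
    by (rule perfect_for_sh[OF Md(1,6) Gd(1,3) that])
  show "perfect_for M (shifts G) (unsh Y)" if "Y \<in> Obj C" "perfect_for M (shifts G) Y" for Y
    by (rule perfect_for_unsh[OF Md(1,4) Gd(1,4) that])
qed

end

context coproduct_triangulated_category
begin

text \<open>Exactness of coproducts, in the weak form that the cone of a coproduct of fibers receives a
  map from the coproduct of the targets.\<close>

lemma perfect_for_weak_kernel:
  fixes U U' :: "nat \<Rightarrow> 'o"
  assumes M: "triangulated_subcategory C M" and Y: "perfect_for M G Y"
    and U: "range U \<subseteq> M" "range U' \<subseteq> M" and u: "\<And>i. u i \<in> Hom C (U i) (U' i)"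
    and Q: "is_coproduct C UNIV U Q \<kappa>" and P: "is_coproduct C UNIV U' P \<iota>"
    and Phi: "\<Phi> \<in> Hom C Q P" "\<And>i. \<Phi> \<cdot> \<kappa> i = \<iota> i \<cdot> u i"
    and e: "e \<in> Hom C Y Q" "\<Phi> \<cdot> e = Zer C Y P"
  obtains W w R \<mu> m e' where "\<And>i. W i \<in> G" "\<And>i. w i \<in> Hom C (W i) (U i)"
    "\<And>i. u i \<cdot> w i = Zer C (W i) (U' i)" "is_coproduct C UNIV W R \<mu>" "m \<in> Hom C R Q"
    "\<And>i. m \<cdot> \<mu> i = \<kappa> i \<cdot> w i" "e' \<in> Hom C Y R" "e = m \<cdot> e'"
proof -
  note Qd = is_coproductD[OF Q] and Pd = is_coproductD[OF P]
  have "\<exists>a h. (a, u i, h) \<in> Tri C" for i using ex_fiber[OF HomD(1)[OF u]] by metis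
  then obtain a b where t: "\<And>i. (a i, u i, b i) \<in> Tri C" by metis
  let ?K = "\<lambda>i. Dom C (a i)"
  have UM: "U i \<in> M" "U' i \<in> M" for i using U by auto
  have KM: "?K i \<in> M" for i
    by (rule tri_sub_fiber[OF M t[of i]]) (use UM[of i] Tri_typing[OF t[of i]] HomD[OF u[of i]] in auto)
  have K: "?K i \<in> Obj C" "a i \<in> Hom C (?K i) (U i)" for i
    using Tri_typing[OF t[of i]] HomD[OF u[of i]] by (auto simp: Hom_iff)
  obtain R0 \<mu>0 where R0: "is_coproduct C (UNIV :: nat set) ?K R0 \<mu>0"
    by (rule ex_coproduct[OF small_nat[OF universe], of ?K]) (use K in auto)
  note R0d = is_coproductD[OF R0]
  obtain m0 where m0: "m0 \<in> Hom C R0 Q" "\<And>i. m0 \<cdot> \<mu>0 i = \<kappa> i \<cdot> a i"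
    using coproduct_copair[OF R0 Qd(1), of "\<lambda>i. \<kappa> i \<cdot> a i"] Qd(3) K Cmp_in_Hom by (metis UNIV_I)
  obtain c d where t0: "(m0, c, d) \<in> Tri C" using Tri_complete[OF HomD(1)[OF m0(1)]] by blast
  note ct = Tri_typing[OF t0]
  let ?Z = "Cod C c"
  have c: "c \<in> Hom C Q ?Z" using ct HomD[OF m0(1)] by (simp add: Hom_iff)
  \<comment> \<open>On each component \<open>c\<close> kills the fiber of \<open>u i\<close> and so
    factors over \<open>u i\<close>. Assembled over \<open>i\<close>, this factors \<open>c\<close>
    through \<open>\<Phi>\<close>, so whatever \<open>\<Phi>\<close> kills is killed by
    \<open>c\<close>.\<close>
  have "\<exists>\<theta>. \<theta> \<in> Hom C (U' i) ?Z \<and> \<theta> \<cdot> u i = c \<cdot> \<kappa> i" for i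
  proof -
    note tt = HomD[OF K(2)[of i]] HomD[OF Qd(3)[of i]] HomD[OF c] HomD[OF R0d(3)[of i]] HomD[OF m0(1)]
    have "(c \<cdot> \<kappa> i) \<cdot> a i = (c \<cdot> m0) \<cdot> \<mu>0 i" using tt m0(2)[of i] by simp
    also have "\<dots> = Zer C (?K i) ?Z" using comp_zero[OF t0] tt by simp
    finally have "(c \<cdot> \<kappa> i) \<cdot> a i = Zer C (?K i) ?Z" .
    moreover have "c \<cdot> \<kappa> i \<in> Hom C (Cod C (a i)) ?Z" using tt by (simp add: Hom_iff)
    ultimately obtain k where "k \<in> Hom C (Cod C (u i)) ?Z" "k \<cdot> u i = c \<cdot> \<kappa> i"
      using tri_ext[OF t[of i]] by metis
    then show ?thesis using HomD[OF u[of i]] by auto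
  qed
  then obtain \<theta> where \<theta>: "\<And>i. \<theta> i \<in> Hom C (U' i) ?Z" "\<And>i. \<theta> i \<cdot> u i = c \<cdot> \<kappa> i" by metis
  obtain \<Theta> where \<Theta>: "\<Theta> \<in> Hom C P ?Z" "\<And>i. \<Theta> \<cdot> \<iota> i = \<theta> i"
    using coproduct_copair[OF P, of ?Z \<theta>] \<theta>(1) HomD(5)[OF c] by auto
  have Tc: "\<Theta> \<cdot> \<Phi> = c"
  proof (rule coproduct_ext[OF Q Cmp_in_Hom[OF Phi(1) \<Theta>(1)] c])
    fix i :: nat
    note tt = HomD[OF \<Theta>(1)] HomD[OF Phi(1)] HomD[OF Qd(3)[of i]] HomD[OF Pd(3)[of i]] HomD[OF u[of i]]
    show "\<Theta> \<cdot> \<Phi> \<cdot> \<kappa> i = c \<cdot> \<kappa> i"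
      using tt by (simp add: Phi(2) Cmp_reassoc[OF \<Theta>(2)] \<theta>(2))
  qed
  have "c \<cdot> e = Zer C Y ?Z"
    using HomD[OF \<Theta>(1)] HomD[OF Phi(1)] HomD[OF e(1)] e(2) by (simp add: Tc[symmetric])
  then obtain e0 where e0: "e0 \<in> Hom C Y R0" "m0 \<cdot> e0 = e"
    using tri_lift[OF t0, of e Y] e(1) HomD[OF m0(1)] by auto
  have "range ?K \<subseteq> M" using KM by auto
  \<comment> \<open>The lift \<open>e0\<close> lands in a coproduct of fibers, which belong to
    \<open>M\<close> but not to \<open>G\<close>. Perfectness of \<open>Y\<close> replaces them by
    objects of \<open>G\<close>.\<close>
  from perfect_forE[OF Y this R0 e0(1)] obtain W f' R \<mu> g h where *: "\<And>i. W i \<in> G"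
    "\<And>i. f' i \<in> Hom C (W i) (?K i)" "is_coproduct C UNIV W R \<mu>" "h \<in> Hom C R R0"
    "\<And>i. h \<cdot> \<mu> i = \<mu>0 i \<cdot> f' i" "g \<in> Hom C Y R" "e0 = h \<cdot> g" by metis
  note Rd = is_coproductD[OF *(3)]
  show ?thesis
  proof (rule that[of W "\<lambda>i. a i \<cdot> f' i" R \<mu> "m0 \<cdot> h" g])
    fix i
    note tt = HomD[OF K(2)[of i]] HomD[OF *(2)[of i]] HomD[OF u[of i]] HomD[OF m0(1)] HomD[OF *(4)]
      HomD[OF Rd(3)[of i]] HomD[OF R0d(3)[of i]] HomD[OF Qd(3)[of i]]
    show "W i \<in> G" by (rule *(1))
    show "a i \<cdot> f' i \<in> Hom C (W i) (U i)" by (rule Cmp_in_Hom[OF *(2) K(2)])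
    show "u i \<cdot> (a i \<cdot> f' i) = Zer C (W i) (U' i)"
      using comp_zero[OF t[of i]] tt by (simp add: Cmp_reassoc[OF comp_zero[OF t[of i]]])
    show "(m0 \<cdot> h) \<cdot> \<mu> i = \<kappa> i \<cdot> (a i \<cdot> f' i)"
      using tt by (simp add: *(5) Cmp_reassoc[OF m0(2)])
  next
    show "e = (m0 \<cdot> h) \<cdot> g" using e0(2) *(7) HomD[OF m0(1)] HomD[OF *(4)] HomD[OF *(6)] by auto
  qed (fact *(3) *(6) Cmp_in_Hom[OF *(4) m0(1)])+
qed

end

text \<open>A tower \<open>\<Gamma>\<^sub>0 \<rightarrow> \<Gamma>\<^sub>1 \<rightarrow> \<dots>\<close> over \<open>X\<close>, each step of which kills the morphisms from \<open>G\<close> that vanish in \<open>X\<close>;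
  its homotopy colimit represents the functor represented by \<open>X\<close> on \<open>G\<close>.\<close>

locale tower = coproduct_triangulated_category C \<Lambda>
  for C :: "('o, 'm) tri_cat" (structure) and \<Lambda> :: "'u rel" +
  fixes M G :: "'o set" and X :: 'o and \<Gamma> :: "nat \<Rightarrow> 'o" and \<pi> \<phi> :: "nat \<Rightarrow> 'm"
    and P :: 'o and \<iota> :: "nat \<Rightarrow> 'm"
  assumes M: "localizing \<Lambda> C M"
    and G_M: "G \<subseteq> M" and G_sh: "Y \<in> G \<Longrightarrow> sh Y \<in> G" and G_unsh: "Y \<in> G \<Longrightarrow> unsh Y \<in> G"
    and G_perfect: "Y \<in> G \<Longrightarrow> perfect_for M G Y"
    and Gam_M: "\<Gamma> i \<in> M"
    and pi_Hom: "\<pi> i \<in> Hom C (\<Gamma> i) X" and phi_Hom: "\<phi> i \<in> Hom C (\<Gamma> i) (\<Gamma> (Suc i))"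
    and pi_phi: "\<pi> (Suc i) \<cdot> \<phi> i = \<pi> i"
    and epi: "Y \<in> G \<Longrightarrow> f \<in> Hom C Y X \<Longrightarrow> \<exists>f'\<in>Hom C Y (\<Gamma> 0). \<pi> 0 \<cdot> f' = f"
    and kill: "Y \<in> G \<Longrightarrow> f \<in> Hom C Y (\<Gamma> i) \<Longrightarrow> \<pi> i \<cdot> f = Zer C Y X \<Longrightarrow>
      \<phi> i \<cdot> f = Zer C Y (\<Gamma> (Suc i))"
    and P: "is_coproduct C UNIV \<Gamma> P \<iota>"
begin

lemma M_Obj: "M \<subseteq> Obj C" by (rule tri_subD(1)[OF localizingD[OF M]])
lemma G_Obj: "Y \<in> G \<Longrightarrow> Y \<in> Obj C" using G_M M_Obj by blast

lemma tower_typing [simp]: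
  "\<Gamma> i \<in> Obj C" "X \<in> Obj C" "P \<in> Obj C"
  "\<pi> i \<in> Arr C" "Dom C (\<pi> i) = \<Gamma> i" "Cod C (\<pi> i) = X"
  "\<phi> i \<in> Arr C" "Dom C (\<phi> i) = \<Gamma> i" "Cod C (\<phi> i) = \<Gamma> (Suc i)"
  "\<iota> i \<in> Arr C" "Dom C (\<iota> i) = \<Gamma> i" "Cod C (\<iota> i) = P"
  using HomD[OF pi_Hom[of i]] HomD[OF phi_Hom[of i]] HomD[OF is_coproductD(3)[OF P, of i]]
  by auto

lemma iota_Hom: "\<iota> i \<in> Hom C (\<Gamma> i) P"
  by (simp add: Hom_iff)

primrec phi0 :: "nat \<Rightarrow> 'm" where
  "phi0 0 = Idn C (\<Gamma> 0)"
| "phi0 (Suc i) = \<phi> i \<cdot> phi0 i"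

lemma phi0_typing [simp]: "phi0 i \<in> Arr C" "Dom C (phi0 i) = \<Gamma> 0" "Cod C (phi0 i) = \<Gamma> i"
  by (induction i) auto

lemma phi0_Hom: "phi0 i \<in> Hom C (\<Gamma> 0) (\<Gamma> i)"
  by (simp add: Hom_iff)

lemma pi_phi0: "\<pi> i \<cdot> phi0 i = \<pi> 0"
  by (induction i) (simp_all add: Cmp_reassoc[OF pi_phi])

text \<open>The shift map of the telescope; the cone of \<open>1 - s\<close> is the homotopy
  colimit.\<close>

definition s :: 'm where
  "s = (SOME k. k \<in> Hom C P P \<and> (\<forall>i. k \<cdot> \<iota> i = \<iota> (Suc i) \<cdot> \<phi> i))"

lemma s: "s \<in> Hom C P P" "s \<cdot> \<iota> i = \<iota> (Suc i) \<cdot> \<phi> i"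
proof -
  obtain k where "k \<in> Hom C P P" "\<And>i. k \<cdot> \<iota> i = \<iota> (Suc i) \<cdot> \<phi> i"
    using coproduct_copair[OF P, of P "\<lambda>i. \<iota> (Suc i) \<cdot> \<phi> i"] Cmp_in_Hom[OF phi_Hom iota_Hom] by auto
  then have "\<exists>k. k \<in> Hom C P P \<and> (\<forall>i. k \<cdot> \<iota> i = \<iota> (Suc i) \<cdot> \<phi> i)" by blast
  from someI_ex[OF this] show "s \<in> Hom C P P" "s \<cdot> \<iota> i = \<iota> (Suc i) \<cdot> \<phi> i" by (simp_all add: s_def)
qed

lemma s_typing [simp]: "s \<in> Arr C" "Dom C s = P" "Cod C s = P"
  using HomD[OF s(1)] by auto

text \<open>Every morphism from \<open>G\<close> to \<open>X\<close> already lifts to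
  \<open>\<Gamma> 0\<close>, so a copower of \<open>\<Gamma> 0\<close> captures morphisms from
  \<open>G\<close> to \<open>P\<close> up to one application of \<open>s\<close>. Its shift
  \<open>t\<close> involves no transition maps, which makes \<open>1 - t\<close> computable.\<close>

lemma ex_copower:
  obtains Q \<kappa> t \<Phi> where "is_coproduct C (UNIV :: nat set) (\<lambda>_. \<Gamma> 0) Q \<kappa>"
    "t \<in> Hom C Q Q" "\<And>i. t \<cdot> \<kappa> i = \<kappa> (Suc i)" "\<Phi> \<in> Hom C Q P" "\<And>i. \<Phi> \<cdot> \<kappa> i = \<iota> i \<cdot> phi0 i"
    "s \<cdot> \<Phi> = \<Phi> \<cdot> t"
proof -
  obtain Q \<kappa> where Q: "is_coproduct C (UNIV :: nat set) (\<lambda>_. \<Gamma> 0) Q \<kappa>"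
    by (rule ex_coproduct[OF small_nat[OF universe], of "\<lambda>_. \<Gamma> 0"]) auto
  note Qd = is_coproductD[OF Q]
  obtain t where t: "t \<in> Hom C Q Q" "\<And>i. t \<cdot> \<kappa> i = \<kappa> (Suc i)"
    using coproduct_copair[OF Q Qd(1), of "\<lambda>i. \<kappa> (Suc i)"] Qd(3) by auto
  obtain \<Phi> where \<Phi>: "\<Phi> \<in> Hom C Q P" "\<And>i. \<Phi> \<cdot> \<kappa> i = \<iota> i \<cdot> phi0 i"
    using coproduct_copair[OF Q, of P "\<lambda>i. \<iota> i \<cdot> phi0 i"] Cmp_in_Hom[OF phi0_Hom iota_Hom] by auto
  have "s \<cdot> \<Phi> = \<Phi> \<cdot> t"
  proof (rule coproduct_ext[OF Q Cmp_in_Hom[OF \<Phi>(1) s(1)] Cmp_in_Hom[OF t(1) \<Phi>(1)]])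
    fix i :: nat
    note tt = HomD[OF t(1)] HomD[OF \<Phi>(1)] HomD[OF Qd(3)[of i]]
    show "s \<cdot> \<Phi> \<cdot> \<kappa> i = \<Phi> \<cdot> t \<cdot> \<kappa> i"
      using tt by (simp add: \<Phi>(2) t(2) Cmp_reassoc[OF s(2)])
  qed
  then show ?thesis using that Q t \<Phi> by blast
qed

text \<open>Perfectness splits \<open>g\<close> into components \<open>g' i\<close> from
  \<open>G\<close> to the stages. Each has the same image in \<open>X\<close> as some
  \<open>k i\<close> into \<open>\<Gamma> 0\<close>, and it may be replaced by
  \<open>phi0 i \<cdot> k i\<close> once \<open>s\<close> has been applied.\<close>

lemma factor_copower:
  assumes Q: "is_coproduct C (UNIV :: nat set) (\<lambda>_. \<Gamma> 0) Q \<kappa>"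
    and t: "t \<in> Hom C Q Q" "\<And>i. t \<cdot> \<kappa> i = \<kappa> (Suc i)"
    and \<Phi>: "\<Phi> \<in> Hom C Q P" "\<And>i. \<Phi> \<cdot> \<kappa> i = \<iota> i \<cdot> phi0 i"
    and Y: "Y \<in> G" and g: "g \<in> Hom C Y P"
  obtains b where "b \<in> Hom C Y Q" "s \<cdot> g = \<Phi> \<cdot> (t \<cdot> b)"
proof -
  note Qd = is_coproductD[OF Q]
  have "range \<Gamma> \<subseteq> M" using Gam_M by auto
  from perfect_forE[OF G_perfect[OF Y] this P g] obtain Y' g' R \<mu> a h where *: "\<And>i. Y' i \<in> G"
    "\<And>i. g' i \<in> Hom C (Y' i) (\<Gamma> i)" "is_coproduct C UNIV Y' R \<mu>" "h \<in> Hom C R P"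
    "\<And>i. h \<cdot> \<mu> i = \<iota> i \<cdot> g' i" "a \<in> Hom C Y R" "g = h \<cdot> a" by metis
  note Rd = is_coproductD[OF *(3)]
  have "\<exists>k. k \<in> Hom C (Y' i) (\<Gamma> 0) \<and> \<pi> 0 \<cdot> k = \<pi> i \<cdot> g' i" for i
    using epi[OF *(1)[of i] Cmp_in_Hom[OF *(2) pi_Hom]] by blast
  then obtain k where k: "\<And>i. k i \<in> Hom C (Y' i) (\<Gamma> 0)" "\<And>i. \<pi> 0 \<cdot> k i = \<pi> i \<cdot> g' i" by metis
  \<comment> \<open>The difference of the two morphisms vanishes in \<open>X\<close>, so the next
    transition kills it. This is why the factorization is one of \<open>s \<cdot> g\<close> and not
    of \<open>g\<close>.\<close>
  have eq: "\<phi> i \<cdot> (phi0 i \<cdot> k i) = \<phi> i \<cdot> g' i" for i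
  proof -
    note tt = HomD[OF k(1)[of i]] HomD[OF *(2)[of i]]
    have H: "phi0 i \<cdot> k i \<in> Hom C (Y' i) (\<Gamma> i)" by (rule Cmp_in_Hom[OF k(1) phi0_Hom])
    define d where "d = Plus C (phi0 i \<cdot> k i) (neg C (g' i))"
    have dH: "d \<in> Hom C (Y' i) (\<Gamma> i)" unfolding d_def by (intro Plus_in_Hom neg_in_Hom H *(2))
    have "\<pi> i \<cdot> d = Plus C (\<pi> i \<cdot> (phi0 i \<cdot> k i)) (neg C (\<pi> i \<cdot> g' i))"
      unfolding d_def using tt by (simp add: Cmp_Plus_Arr Cmp_neg)
    also have "\<pi> i \<cdot> (phi0 i \<cdot> k i) = \<pi> i \<cdot> g' i" using tt by (simp add: Cmp_reassoc[OF pi_phi0] k(2))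
    finally have "\<pi> i \<cdot> d = Zer C (Y' i) X" using Plus_neg_right[OF Cmp_in_Hom[OF *(2) pi_Hom]] by simp
    then have "\<phi> i \<cdot> d = Zer C (Y' i) (\<Gamma> (Suc i))" by (rule kill[OF *(1) dH])
    moreover have "\<phi> i \<cdot> d = Plus C (\<phi> i \<cdot> (phi0 i \<cdot> k i)) (neg C (\<phi> i \<cdot> g' i))"
      unfolding d_def using tt by (simp add: Cmp_Plus_Arr Cmp_neg)
    ultimately show ?thesis
      using Plus_neg_eq_Zer_iff[OF Cmp_in_Hom[OF H phi_Hom] Cmp_in_Hom[OF *(2) phi_Hom]] by simp
  qed
  obtain l where l: "l \<in> Hom C R Q" "\<And>i. l \<cdot> \<mu> i = \<kappa> i \<cdot> k i"
    using coproduct_copair[OF *(3) Qd(1), of "\<lambda>i. \<kappa> i \<cdot> k i"] Cmp_in_Hom[OF k(1) Qd(3)] by auto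
  have lt: "s \<cdot> h = \<Phi> \<cdot> (t \<cdot> l)"
  proof (rule coproduct_ext[OF *(3) Cmp_in_Hom[OF *(4) s(1)] Cmp_in_Hom[OF Cmp_in_Hom[OF l(1) t(1)] \<Phi>(1)]])
    fix i :: nat
    note tt = HomD[OF t(1)] HomD[OF \<Phi>(1)] HomD[OF Qd(3)[of i]] HomD[OF Qd(3)[of "Suc i"]] HomD[OF l(1)]
      HomD[OF *(4)] HomD[OF Rd(3)[of i]] HomD[OF k(1)[of i]] HomD[OF *(2)[of i]]
    have "(s \<cdot> h) \<cdot> \<mu> i = \<iota> (Suc i) \<cdot> (\<phi> i \<cdot> g' i)"
      using tt by (simp add: *(5) Cmp_reassoc[OF s(2)])
    also have "\<dots> = (\<Phi> \<cdot> (t \<cdot> l)) \<cdot> \<mu> i"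
      unfolding eq[symmetric] using tt by (simp add: l(2) Cmp_reassoc[OF t(2)] Cmp_reassoc[OF \<Phi>(2)])
    finally show "(s \<cdot> h) \<cdot> \<mu> i = (\<Phi> \<cdot> (t \<cdot> l)) \<cdot> \<mu> i" .
  qed
  have "s \<cdot> g = \<Phi> \<cdot> (t \<cdot> (l \<cdot> a))"
    using HomD[OF *(4)] HomD[OF *(6)] HomD[OF l(1)] HomD[OF t(1)] HomD[OF \<Phi>(1)]
    by (simp add: *(7) Cmp_reassoc[OF lt])
  with that Cmp_in_Hom[OF *(6) l(1)] show ?thesis by blast
qed

lemma phi0_kill:
  assumes "w \<in> Hom C Z (\<Gamma> 0)" "\<phi> 0 \<cdot> w = Zer C Z (\<Gamma> 1)"
  shows "phi0 (Suc i) \<cdot> w = Zer C Z (\<Gamma> (Suc i))"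
  using HomD[OF assms(1)] assms(2) by (induction i) simp_all

text \<open>The copower of \<open>\<Gamma>\<^sub>0\<close> carries the shift \<open>t\<close>, and \<open>1 - t\<close> has the
  retraction \<open>r\<close> with \<open>r \<kappa>\<^sub>n = - (\<kappa>\<^sub>0 + \<dots> + \<kappa>\<^sub>n\<^sub>-\<^sub>1)\<close>.\<close>

lemma fixed_by_s:
  assumes Y: "Y \<in> G" and g: "g \<in> Hom C Y P" and sg: "s \<cdot> g = g"
  shows "g = Zer C Y P"
proof -
  obtain Q \<kappa> t \<Phi> where Q: "is_coproduct C (UNIV :: nat set) (\<lambda>_. \<Gamma> 0) Q \<kappa>"
    and t: "t \<in> Hom C Q Q" "\<And>i. t \<cdot> \<kappa> i = \<kappa> (Suc i)"
    and \<Phi>: "\<Phi> \<in> Hom C Q P" "\<And>i. \<Phi> \<cdot> \<kappa> i = \<iota> i \<cdot> phi0 i" and s\<Phi>: "s \<cdot> \<Phi> = \<Phi> \<cdot> t"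
    using ex_copower by blast
  note Qd = is_coproductD[OF Q]
  have \<kappa>: "\<kappa> i \<in> Hom C (\<Gamma> 0) Q" for i using Qd(3) by simp
  have ty [simp]: "Q \<in> Obj C" "t \<in> Arr C" "Dom C t = Q" "Cod C t = Q" "\<Phi> \<in> Arr C" "Dom C \<Phi> = Q" "Cod C \<Phi> = P"
    "\<kappa> i \<in> Arr C" "Dom C (\<kappa> i) = \<Gamma> 0" "Cod C (\<kappa> i) = Q" for i
    using HomD[OF t(1)] HomD[OF \<Phi>(1)] HomD[OF \<kappa>[of i]] by auto
  obtain b where b: "b \<in> Hom C Y Q" "s \<cdot> g = \<Phi> \<cdot> (t \<cdot> b)"
    by (rule factor_copower[OF Q t \<Phi> Y g])
  \<comment> \<open>As \<open>s\<close> fixes \<open>g\<close>, the factorization of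
    \<open>s \<cdot> g\<close> is one of \<open>g\<close> itself, and
    \<open>s \<cdot> \<Phi> = \<Phi> \<cdot> t\<close> turns the fixed point equation into
    \<open>\<Phi> \<cdot> (T \<cdot> c) = 0\<close> with \<open>T = 1 - t\<close>.\<close>
  define c where "c = t \<cdot> b"
  have c: "c \<in> Hom C Y Q" unfolding c_def by (rule Cmp_in_Hom[OF b(1) t(1)])
  have gc: "g = \<Phi> \<cdot> c" using sg b(2) by (simp add: c_def)
  note ct = HomD[OF c]
  define T where "T = Plus C (Idn C Q) (neg C t)"
  have T: "T \<in> Hom C Q Q" unfolding T_def by (intro Plus_in_Hom neg_in_Hom t(1) Idn_in_Hom) simp
  note Tt = HomD[OF T]
  have Tc: "T \<cdot> c = Plus C c (neg C (t \<cdot> c))"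
    using ct by (simp add: T_def Plus_Cmp_Arr neg_Cmp)
  have "\<Phi> \<cdot> (T \<cdot> c) = Plus C (\<Phi> \<cdot> c) (neg C (\<Phi> \<cdot> (t \<cdot> c)))"
    unfolding Tc using ct by (simp add: Cmp_Plus_Arr Cmp_neg)
  also have "\<Phi> \<cdot> (t \<cdot> c) = s \<cdot> g" using ct by (simp add: gc Cmp_reassoc[OF s\<Phi>])
  finally have "\<Phi> \<cdot> (T \<cdot> c) = Zer C Y P" using Plus_neg_right[OF g] sg gc by simp
  from perfect_for_weak_kernel[OF localizingD[OF M] G_perfect[OF Y] _ _ phi0_Hom Q P \<Phi> Cmp_in_Hom[OF c T] this] Gam_M
  obtain W w R \<mu> m e' where W: "\<And>i. W i \<in> G" "\<And>i. w i \<in> Hom C (W i) (\<Gamma> 0)"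
    "\<And>i. phi0 i \<cdot> w i = Zer C (W i) (\<Gamma> i)" "is_coproduct C UNIV W R \<mu>" "m \<in> Hom C R Q"
    "\<And>i. m \<cdot> \<mu> i = \<kappa> i \<cdot> w i" "e' \<in> Hom C Y R" "T \<cdot> c = m \<cdot> e'"
    by (metis (no_types, lifting) image_subsetI)
  note Rd = is_coproductD[OF W(4)] and mt = HomD[OF W(5)] and et = HomD[OF W(7)]
  have Wo: "W i \<in> Obj C" for i using G_Obj W(1) by blast
  have wt: "w i \<in> Arr C" "Dom C (w i) = W i" "Cod C (w i) = \<Gamma> 0" "\<mu> i \<in> Arr C" "Dom C (\<mu> i) = W i" "Cod C (\<mu> i) = R" for i
    using HomD[OF W(2)[of i]] HomD[OF Rd(3)[of i]] by auto
  \<comment> \<open>From \<open>phi0 i \<cdot> w i = 0\<close> it follows that \<open>w i\<close>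
    vanishes in \<open>X\<close>, so it dies at the very first transition, whatever \<open>i\<close>
    is.\<close>
  have kw: "\<phi> 0 \<cdot> w i = Zer C (W i) (\<Gamma> 1)" for i
  proof -
    have "\<pi> 0 \<cdot> w i = \<pi> i \<cdot> (phi0 i \<cdot> w i)" using wt by (simp add: Cmp_reassoc[OF pi_phi0])
    also have "\<dots> = Zer C (W i) X" using W(3) Wo by simp
    finally show ?thesis using kill[OF W(1,2)] by simp
  qed
  define \<rho> where "\<rho> = rec_nat (Zer C (\<Gamma> 0) Q) (\<lambda>n r. Plus C r (neg C (\<kappa> n)))"
  have \<rho>s: "\<rho> 0 = Zer C (\<Gamma> 0) Q" "\<rho> (Suc n) = Plus C (\<rho> n) (neg C (\<kappa> n))" for n
    by (simp_all add: \<rho>_def)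
  have \<rho>: "\<rho> n \<in> Hom C (\<Gamma> 0) Q" for n
  proof (induction n)
    case 0 show ?case unfolding \<rho>s by (rule Zer_in_Hom) auto
  next
    case (Suc n) show ?case unfolding \<rho>s by (intro Plus_in_Hom neg_in_Hom Suc \<kappa>)
  qed
  have \<rho>t: "\<rho> n \<in> Arr C" "Dom C (\<rho> n) = \<Gamma> 0" "Cod C (\<rho> n) = Q" for n using HomD[OF \<rho>[of n]] by auto
  obtain r where r: "r \<in> Hom C Q Q" "\<And>i. r \<cdot> \<kappa> i = \<rho> i"
    using coproduct_copair[OF Q Qd(1), of \<rho>] \<rho> by auto
  note rt = HomD[OF r(1)]
  have rT: "r \<cdot> T = Idn C Q"
  proof (rule coproduct_ext[OF Q Cmp_in_Hom[OF T r(1)] Idn_in_Hom[OF Qd(1)]])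
    fix n :: nat
    have nr: "neg C (\<rho> n) \<in> Hom C (\<Gamma> 0) Q" by (rule neg_in_Hom[OF \<rho>])
    have "T \<cdot> \<kappa> n = Plus C (\<kappa> n) (neg C (\<kappa> (Suc n)))"
      by (simp add: T_def Plus_Cmp_Arr neg_Cmp t(2))
    then have "r \<cdot> T \<cdot> \<kappa> n = Plus C (\<rho> n) (neg C (\<rho> (Suc n)))"
      using rt Tt by (simp add: Cmp_Plus_Arr Cmp_neg r(2))
    moreover have "Plus C (\<rho> (Suc n)) (\<kappa> n) = \<rho> n"
      unfolding \<rho>s using Plus_assoc[OF \<rho> neg_in_Hom[OF \<kappa>] \<kappa>] Plus_neg_left[OF \<kappa>] Plus_Zer_right[OF \<rho>] by metis
    moreover have "Plus C (Plus C (\<kappa> n) (\<rho> (Suc n))) (neg C (\<rho> (Suc n))) = \<kappa> n"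
      using Plus_assoc[OF \<kappa> \<rho> neg_in_Hom[OF \<rho>]] Plus_neg_right[OF \<rho>] Plus_Zer_right[OF \<kappa>] by metis
    ultimately have "r \<cdot> T \<cdot> \<kappa> n = \<kappa> n" using Plus_comm[OF \<kappa> \<rho>] by metis
    then show "r \<cdot> T \<cdot> \<kappa> n = Idn C Q \<cdot> \<kappa> n" by simp
  qed
  have cr: "c = r \<cdot> (m \<cdot> e')"
    using rt Tt ct W(8) by (metis Cmp_reassoc[OF rT] Idn_Cmp_left)
  \<comment> \<open>\<open>\<Phi> \<cdot> (\<rho> n \<cdot> w i)\<close> is minus the sum of
    \<open>\<iota> m \<cdot> (phi0 m \<cdot> w i)\<close> over \<open>m < n\<close>. The terms with
    \<open>m > 0\<close> vanish, so only component \<open>0\<close> survives: \<open>v\<close> is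
    zero for \<open>n = 0\<close> and minus \<open>w i\<close> otherwise.\<close>
  have exv: "\<exists>v. v \<in> Hom C (W i) (\<Gamma> 0) \<and> \<phi> 0 \<cdot> v = Zer C (W i) (\<Gamma> 1) \<and> \<Phi> \<cdot> (\<rho> n \<cdot> w i) = \<iota> 0 \<cdot> v" for n i
  proof (induction n)
    case 0
    show ?case unfolding \<rho>s
      by (rule exI[of _ "Zer C (W i) (\<Gamma> 0)"]) (use wt[of i] Wo[of i] in \<open>auto intro: Zer_in_Hom\<close>)
  next
    case (Suc n)
    then obtain v where v: "v \<in> Hom C (W i) (\<Gamma> 0)" "\<phi> 0 \<cdot> v = Zer C (W i) (\<Gamma> 1)"
      "\<Phi> \<cdot> (\<rho> n \<cdot> w i) = \<iota> 0 \<cdot> v" by blast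
    note vt = HomD[OF v(1)]
    have "\<Phi> \<cdot> (\<rho> (Suc n) \<cdot> w i) = Plus C (\<Phi> \<cdot> (\<rho> n \<cdot> w i)) (neg C (\<Phi> \<cdot> (\<kappa> n \<cdot> w i)))"
      using wt \<rho>t by (simp add: \<rho>s Plus_Cmp_Arr Cmp_Plus_Arr neg_Cmp Cmp_neg)
    also have "\<dots> = Plus C (\<iota> 0 \<cdot> v) (neg C (\<iota> n \<cdot> (phi0 n \<cdot> w i)))"
      using wt by (simp add: v(3) Cmp_reassoc[OF \<Phi>(2)])
    finally have e: "\<Phi> \<cdot> (\<rho> (Suc n) \<cdot> w i) = Plus C (\<iota> 0 \<cdot> v) (neg C (\<iota> n \<cdot> (phi0 n \<cdot> w i)))" .
    show ?case
    proof (cases n)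
      case 0
      have "\<Phi> \<cdot> (\<rho> (Suc n) \<cdot> w i) = \<iota> 0 \<cdot> Plus C v (neg C (w i))"
        unfolding e using 0 wt vt by (simp add: Cmp_Plus_Arr Cmp_neg)
      moreover have "\<phi> 0 \<cdot> Plus C v (neg C (w i)) = Zer C (W i) (\<Gamma> 1)"
        using wt vt v(2) kw[of i] Plus_neg_right[OF Zer_in_Hom, of "W i" "\<Gamma> 1"]
        by (simp add: Cmp_Plus_Arr Cmp_neg)
      moreover have "Plus C v (neg C (w i)) \<in> Hom C (W i) (\<Gamma> 0)" by (intro Plus_in_Hom neg_in_Hom v(1) W(2))
      ultimately show ?thesis by blast
    next
      case (Suc k)
      have "phi0 (Suc k) \<cdot> w i = Zer C (W i) (\<Gamma> (Suc k))" by (rule phi0_kill[OF W(2) kw])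
      then have "\<iota> n \<cdot> (phi0 n \<cdot> w i) = Zer C (W i) P"
        unfolding Suc using Wo[of i] by (simp del: phi0.simps)
      then have "\<Phi> \<cdot> (\<rho> (Suc n) \<cdot> w i) = \<iota> 0 \<cdot> v"
        unfolding e using Plus_Zer_right[OF Cmp_in_Hom[OF v(1) iota_Hom]] Wo[of i] by (simp add: neg_Zer)
      then show ?thesis using v by blast
    qed
  qed
  have "\<exists>v. \<forall>i. v i \<in> Hom C (W i) (\<Gamma> 0) \<and> \<phi> 0 \<cdot> v i = Zer C (W i) (\<Gamma> 1) \<and> \<Phi> \<cdot> (\<rho> i \<cdot> w i) = \<iota> 0 \<cdot> v i"
    by (rule choice) (use exv in blast)
  then obtain v where v: "\<And>i. v i \<in> Hom C (W i) (\<Gamma> 0)" "\<And>i. \<phi> 0 \<cdot> v i = Zer C (W i) (\<Gamma> 1)"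
    "\<And>i. \<Phi> \<cdot> (\<rho> i \<cdot> w i) = \<iota> 0 \<cdot> v i" by blast
  obtain y where y: "y \<in> Hom C R (\<Gamma> 0)" "\<And>i. y \<cdot> \<mu> i = v i"
    using coproduct_copair[OF W(4), of "\<Gamma> 0" v] v(1) by auto
  note yt = HomD[OF y(1)]
  have 1: "\<Phi> \<cdot> (r \<cdot> m) = \<iota> 0 \<cdot> y"
  proof (rule coproduct_ext[OF W(4) Cmp_in_Hom[OF Cmp_in_Hom[OF W(5) r(1)] \<Phi>(1)] Cmp_in_Hom[OF y(1) iota_Hom]])
    fix i :: nat
    show "\<Phi> \<cdot> (r \<cdot> m) \<cdot> \<mu> i = \<iota> 0 \<cdot> y \<cdot> \<mu> i"
      using rt mt wt \<rho>t yt by (simp add: W(6) Cmp_reassoc[OF r(2)] v(3) y(2))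
  qed
  have 2: "\<phi> 0 \<cdot> y = Zer C R (\<Gamma> 1)"
  proof (rule coproduct_ext[OF W(4) Cmp_in_Hom[OF y(1) phi_Hom]])
    fix i :: nat
    show "\<phi> 0 \<cdot> y \<cdot> \<mu> i = Zer C R (\<Gamma> 1) \<cdot> \<mu> i" using yt wt v(2) by (simp add: y(2))
  qed (use yt in \<open>auto intro: Zer_in_Hom\<close>)
  have gy: "g = \<iota> 0 \<cdot> (y \<cdot> e')"
  proof -
    have "g = (\<Phi> \<cdot> (r \<cdot> m)) \<cdot> e'" unfolding gc cr using rt mt et by simp
    also have "\<dots> = \<iota> 0 \<cdot> (y \<cdot> e')" unfolding 1 using yt et by simp
    finally show ?thesis .
  qed
  \<comment> \<open>All of \<open>g\<close> now sits in component \<open>0\<close>; \<open>s\<close>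
    moves it to component \<open>1\<close> through \<open>\<phi> 0\<close>, which kills it.\<close>
  have "s \<cdot> g = \<iota> 1 \<cdot> (\<phi> 0 \<cdot> (y \<cdot> e'))"
    unfolding gy using yt et by (simp add: Cmp_reassoc[OF s(2)])
  also have "\<dots> = Zer C Y P" using yt et by (simp add: Cmp_reassoc[OF 2])
  finally show ?thesis using sg by simp
qed

text \<open>\<open>H\<close> is the cone of \<open>1 - s\<close>. By \<open>fixed_by_s\<close> the
  boundary of a morphism from \<open>G\<close> to \<open>H\<close> is zero, so the morphism comes
  from \<open>P\<close>; modulo \<open>1 - s\<close> it can be moved into \<open>\<Gamma> 0\<close>,
  and if it vanishes in \<open>X\<close> it dies in \<open>\<Gamma> 1\<close>.\<close>

lemma hocolim:
  obtains H \<pi>' where "\<pi>' \<in> Hom C H X" "\<And>A. localizing \<Lambda> C A \<Longrightarrow> range \<Gamma> \<subseteq> A \<Longrightarrow> H \<in> A"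
    "\<And>Y f. Y \<in> G \<Longrightarrow> f \<in> Hom C Y X \<Longrightarrow> \<exists>f'\<in>Hom C Y H. \<pi>' \<cdot> f' = f"
    "\<And>Y f. Y \<in> G \<Longrightarrow> f \<in> Hom C Y H \<Longrightarrow> \<pi>' \<cdot> f = Zer C Y X \<Longrightarrow> f = Zer C Y H"
proof -
  define D where "D = Plus C (Idn C P) (neg C s)"
  have D: "D \<in> Hom C P P" unfolding D_def by (intro Plus_in_Hom neg_in_Hom s(1) Idn_in_Hom) simp
  note Dt = HomD[OF D]
  obtain q \<delta> where t: "(D, q, \<delta>) \<in> Tri C" using Tri_complete[OF Dt(1)] by blast
  let ?H = "Cod C q"
  have q: "q \<in> Hom C P ?H" and \<delta>: "\<delta> \<in> Hom C ?H (sh P)" using Tri_typing[OF t] Dt by (auto simp: Hom_iff)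
  note qt = HomD[OF q] HomD[OF \<delta>]
  have qs: "q \<cdot> s = q" using comp_zero[OF t] Dt Cmp_one_minus[OF s(1) q] unfolding D_def[symmetric] by simp
  obtain p where p: "p \<in> Hom C P X" "\<And>i. p \<cdot> \<iota> i = \<pi> i"
    using coproduct_copair[OF P, of X \<pi>] pi_Hom by auto
  note pt = HomD[OF p(1)]
  have "p \<cdot> s = p"
  proof (rule coproduct_ext[OF P Cmp_in_Hom[OF s(1) p(1)] p(1)])
    show "p \<cdot> s \<cdot> \<iota> i = p \<cdot> \<iota> i" for i
      using pt by (simp add: s(2) Cmp_reassoc[OF p(2)] p(2) pi_phi)
  qed
  then have "p \<cdot> D = Zer C P X" using Cmp_one_minus[OF s(1) p(1)] unfolding D_def by simp
  then obtain \<pi>' where \<pi>': "\<pi>' \<in> Hom C ?H X" "\<pi>' \<cdot> q = p"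
    using tri_ext[OF t, of p X] p(1) Dt by auto
  note pit = HomD[OF \<pi>'(1)]
  show ?thesis
  proof (rule that[OF \<pi>'(1)])
    show "?H \<in> A" if A: "localizing \<Lambda> C A" "range \<Gamma> \<subseteq> A" for A
    proof -
      have "P \<in> A" by (rule localizing_coproduct[OF A(1) small_nat[OF universe] _ P]) (use A(2) in auto)
      then show ?thesis using tri_subD(7)[OF localizingD[OF A(1)] t] Dt by simp
    qed
  next
    fix Y f assume Y: "Y \<in> G" and f: "f \<in> Hom C Y X"
    obtain f' where f': "f' \<in> Hom C Y (\<Gamma> 0)" "\<pi> 0 \<cdot> f' = f" using epi[OF Y f] by blast
    have "\<pi>' \<cdot> (q \<cdot> (\<iota> 0 \<cdot> f')) = f"
      using pit qt pt HomD[OF f'(1)] by (simp add: Cmp_reassoc[OF \<pi>'(2)] Cmp_reassoc[OF p(2)] f'(2))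
    then show "\<exists>f'\<in>Hom C Y ?H. \<pi>' \<cdot> f' = f"
      using Cmp_in_Hom[OF Cmp_in_Hom[OF f'(1) iota_Hom] q] by blast
  next
    \<comment> \<open>The boundary \<open>\<delta> \<cdot> f\<close> is desuspended to a morphism
      \<open>d\<close> from \<open>unsh Y\<close>, again in \<open>G\<close>, which is fixed by
      \<open>s\<close>.\<close>
    fix Y f assume Y: "Y \<in> G" and f: "f \<in> Hom C Y ?H" and z: "\<pi>' \<cdot> f = Zer C Y X"
    note Yo = G_Obj[OF Y] and ft = HomD[OF f]
    have "\<delta> \<cdot> f \<in> Hom C (sh (unsh Y)) (sh P)" using Cmp_in_Hom[OF f \<delta>] Yo by simp
    then obtain d where d: "d \<in> Hom C (unsh Y) P" "shm d = \<delta> \<cdot> f"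
      using shm_surj Yo by (metis tower_typing(3) unsh(1))
    note dt = HomD[OF d(1)]
    have "shm (D \<cdot> d) = (shm D \<cdot> \<delta>) \<cdot> f" using Dt dt qt ft d(2) by simp
    also have "\<dots> = shm (Zer C (unsh Y) P)" using comp_zero3[OF t] Dt ft Yo by simp
    finally have "D \<cdot> d = Zer C (unsh Y) P" by (rule shm_inj[rotated 2]) (use Dt dt in auto)
    then have "s \<cdot> d = d" using one_minus_Cmp[OF s(1) d(1)] unfolding D_def by simp
    then have "d = Zer C (unsh Y) P" by (rule fixed_by_s[OF G_unsh[OF Y] d(1)])
    then have "\<delta> \<cdot> f = Zer C Y (sh P)" using d(2) Yo by auto
    then obtain k where k: "k \<in> Hom C Y P" "q \<cdot> k = f" using tri_lift2[OF t f] Dt by auto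
    note kt = HomD[OF k(1)]
    obtain Q \<kappa> t' \<Phi> where Q: "is_coproduct C (UNIV :: nat set) (\<lambda>_. \<Gamma> 0) Q \<kappa>"
      and t': "t' \<in> Hom C Q Q" "\<And>i. t' \<cdot> \<kappa> i = \<kappa> (Suc i)"
      and \<Phi>: "\<Phi> \<in> Hom C Q P" "\<And>i. \<Phi> \<cdot> \<kappa> i = \<iota> i \<cdot> phi0 i" and s\<Phi>: "s \<cdot> \<Phi> = \<Phi> \<cdot> t'"
      using ex_copower by blast
    note Qd = is_coproductD[OF Q]
    obtain b where b: "b \<in> Hom C Y Q" "s \<cdot> k = \<Phi> \<cdot> (t' \<cdot> b)"
      by (rule factor_copower[OF Q t' \<Phi> Y k(1)])
    obtain fold where fold: "fold \<in> Hom C Q (\<Gamma> 0)" "\<And>i. fold \<cdot> \<kappa> i = Idn C (\<Gamma> 0)"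
      using coproduct_copair[OF Q, of "\<Gamma> 0" "\<lambda>_. Idn C (\<Gamma> 0)"] Idn_in_Hom by auto
    note tt = HomD[OF t'(1)] HomD[OF \<Phi>(1)] HomD[OF b(1)] HomD[OF fold(1)]
    have kt': "\<kappa> i \<in> Arr C" "Dom C (\<kappa> i) = \<Gamma> 0" "Cod C (\<kappa> i) = Q" for i using HomD[OF Qd(3)[of i]] by auto
    have qcf: "q \<cdot> (\<iota> i \<cdot> phi0 i) = q \<cdot> \<iota> 0" for i
    proof (induction i)
      case (Suc i)
      have "q \<cdot> (\<iota> (Suc i) \<cdot> phi0 (Suc i)) = q \<cdot> (s \<cdot> (\<iota> i \<cdot> phi0 i))"
        using qt by (simp add: Cmp_reassoc[OF s(2)])
      also have "\<dots> = q \<cdot> (\<iota> i \<cdot> phi0 i)" using qt by (simp add: Cmp_reassoc[OF qs])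
      finally show ?case using Suc by simp
    qed (use qt in simp)
    \<comment> \<open>After \<open>q\<close> the transition maps become invisible, so the copower
      collapses to \<open>\<Gamma> 0\<close> along the codiagonal \<open>fold\<close>.\<close>
    have q\<Phi>: "q \<cdot> \<Phi> = q \<cdot> (\<iota> 0 \<cdot> fold)"
    proof (rule coproduct_ext[OF Q Cmp_in_Hom[OF \<Phi>(1) q] Cmp_in_Hom[OF Cmp_in_Hom[OF fold(1) iota_Hom] q]])
      show "q \<cdot> \<Phi> \<cdot> \<kappa> i = q \<cdot> (\<iota> 0 \<cdot> fold) \<cdot> \<kappa> i" for i
        using qt tt kt' by (simp add: \<Phi>(2) qcf fold(2))
    qed
    define y where "y = fold \<cdot> (t' \<cdot> b)"
    have y: "y \<in> Hom C Y (\<Gamma> 0)" unfolding y_def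
      by (rule Cmp_in_Hom[OF Cmp_in_Hom[OF b(1) t'(1)] fold(1)])
    note yt = HomD[OF y]
    have "f = q \<cdot> (s \<cdot> k)" using qt kt k(2) by (simp add: Cmp_reassoc[OF qs])
    also have "\<dots> = q \<cdot> (\<iota> 0 \<cdot> y)" unfolding b(2) y_def using qt tt by (simp add: Cmp_reassoc[OF q\<Phi>])
    finally have fy: "f = q \<cdot> (\<iota> 0 \<cdot> y)" .
    have "\<pi> 0 \<cdot> y = \<pi>' \<cdot> f"
      unfolding fy using pit qt pt yt by (simp add: Cmp_reassoc[OF \<pi>'(2)] Cmp_reassoc[OF p(2)])
    then have "\<phi> 0 \<cdot> y = Zer C Y (\<Gamma> (Suc 0))" using kill[OF Y y] z by simp
    moreover have "f = q \<cdot> (\<iota> (Suc 0) \<cdot> (\<phi> 0 \<cdot> y))"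
    proof -
      have "f = (q \<cdot> s) \<cdot> (\<iota> 0 \<cdot> y)" using fy qs by simp
      also have "\<dots> = q \<cdot> (\<iota> (Suc 0) \<cdot> (\<phi> 0 \<cdot> y))" using qt yt by (simp add: Cmp_reassoc[OF s(2)])
      finally show ?thesis .
    qed
    ultimately show "f = Zer C Y ?H" using qt Yo by simp
  qed
qed

end

context coproduct_triangulated_category
begin

section \<open>Construction of the tower\<close>

lemma small_Hom_from:
  assumes "small \<Lambda> G" "G \<subseteq> Obj C" "Z \<in> Obj C"
  shows "small \<Lambda> (SIGMA Y:G. Hom C Y Z)"
  by (rule small_Sigma[OF universe assms(1)])
    (use locally_small assms in \<open>auto simp: locally_small_def\<close>)

text \<open>The two uses differ in \<open>K\<close>: all morphisms from \<open>G\<close> to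
  \<open>X\<close> for the first stage, those killed by the projection for each later one. The last
  clause is uniqueness in the universal property, phrased for vanishing.\<close>

lemma ex_cover:
  assumes N: "localizing \<Lambda> C N" and G: "small \<Lambda> G" "G \<subseteq> N" and Z: "Z \<in> Obj C"
    and K: "K \<subseteq> (SIGMA Y:G. Hom C Y Z)"
  obtains t where "t \<in> Arr C" "Cod C t = Z" "Dom C t \<in> N"
    "\<And>Y f. (Y, f) \<in> K \<Longrightarrow> \<exists>f'\<in>Hom C Y (Dom C t). t \<cdot> f' = f"
    "\<And>W k. k \<in> Hom C Z W \<Longrightarrow> (\<And>Y f. (Y, f) \<in> K \<Longrightarrow> k \<cdot> f = Zer C Y W) \<Longrightarrow>
       k \<cdot> t = Zer C (Dom C t) W"
proof -
  have Go: "G \<subseteq> Obj C" using G(2) tri_subD(1)[OF localizingD[OF N]] by blast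
  have sK: "small \<Lambda> K" by (rule small_subset[OF small_Hom_from[OF G(1) Go Z] K])
  obtain P \<iota> where P: "is_coproduct C K fst P \<iota>"
    by (rule ex_coproduct[OF sK, of fst]) (use K Go in auto)
  note d = is_coproductD[OF P]
  have KH: "snd i \<in> Hom C (fst i) Z" "fst i \<in> G" if "i \<in> K" for i using K that by auto
  obtain t where t: "t \<in> Hom C P Z" "\<And>i. i \<in> K \<Longrightarrow> t \<cdot> \<iota> i = snd i"
    by (rule coproduct_copair[OF P Z, of snd]) (use KH in auto)
  note tt = HomD[OF t(1)]
  show ?thesis
  proof (rule that[of t])
    show "Dom C t \<in> N"
      using localizing_coproduct[OF N sK _ P] KH(2) G(2) tt by auto
    show "\<exists>f'\<in>Hom C Y (Dom C t). t \<cdot> f' = f" if "(Y, f) \<in> K" for Y f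
      using d(3)[OF that] t(2)[OF that] tt by auto
    show "k \<cdot> t = Zer C (Dom C t) W"
      if k: "k \<in> Hom C Z W" and z: "\<And>Y f. (Y, f) \<in> K \<Longrightarrow> k \<cdot> f = Zer C Y W" for W k
    proof -
      have "k \<cdot> t = Zer C P W"
      proof (rule coproduct_ext[OF P Cmp_in_Hom[OF t(1) k]])
        fix i assume i: "i \<in> K"
        show "k \<cdot> t \<cdot> \<iota> i = Zer C P W \<cdot> \<iota> i"
          using HomD[OF k] tt HomD[OF d(3)[OF i]] t(2)[OF i] z[of "fst i" "snd i"] i by simp
      qed (use HomD[OF k] tt in \<open>auto intro: Zer_in_Hom\<close>)
      then show ?thesis using tt by simp
    qed
  qed (use tt in auto)
qed

lemma ex_tower_step:
  assumes N: "localizing \<Lambda> C N" and G: "small \<Lambda> G" "G \<subseteq> N"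
    and p: "p \<in> Arr C" "Dom C p \<in> N"
  shows "\<exists>p' \<phi>. p' \<in> Arr C \<and> Cod C p' = Cod C p \<and> Dom C p' \<in> N \<and> \<phi> \<in> Hom C (Dom C p) (Dom C p') \<and>
    p' \<cdot> \<phi> = p \<and> (\<forall>Y\<in>G. \<forall>f\<in>Hom C Y (Dom C p). p \<cdot> f = Zer C Y (Cod C p) \<longrightarrow> \<phi> \<cdot> f = Zer C Y (Dom C p'))"
proof -
  let ?Z = "Dom C p" and ?X = "Cod C p"
  let ?K = "{(Y, f). Y \<in> G \<and> f \<in> Hom C Y ?Z \<and> p \<cdot> f = Zer C Y ?X}"
  have K: "?K \<subseteq> (SIGMA Y:G. Hom C Y ?Z)" by auto
  obtain t where t: "t \<in> Arr C" "Cod C t = ?Z" "Dom C t \<in> N"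
    and lift: "\<And>Y f. (Y, f) \<in> ?K \<Longrightarrow> \<exists>f'\<in>Hom C Y (Dom C t). t \<cdot> f' = f"
    and zero: "\<And>W k. k \<in> Hom C ?Z W \<Longrightarrow> (\<And>Y f. (Y, f) \<in> ?K \<Longrightarrow> k \<cdot> f = Zer C Y W) \<Longrightarrow>
       k \<cdot> t = Zer C (Dom C t) W"
    by (rule ex_cover[OF N G Obj_typing(1)[OF p(1)] K]) blast
  obtain \<phi> h where tr: "(t, \<phi>, h) \<in> Tri C" using Tri_complete[OF t(1)] by blast
  note tt = Tri_typing[OF tr]
  \<comment> \<open>The members of \<open>K\<close> are chosen to vanish in \<open>X\<close>, so the
    projection extends over the cone of their coproduct.\<close>
  have "p \<cdot> t = Zer C (Dom C t) ?X" by (rule zero) (use p in \<open>auto simp: Hom_iff\<close>)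
  then obtain p' where p': "p' \<in> Hom C (Cod C \<phi>) ?X" "p' \<cdot> \<phi> = p"
    using tri_ext[OF tr, of p ?X] p t by (auto simp: Hom_iff)
  note pt = HomD[OF p'(1)]
  have "\<phi> \<cdot> f = Zer C Y (Dom C p')" if Y: "Y \<in> G" and f: "f \<in> Hom C Y ?Z" "p \<cdot> f = Zer C Y ?X" for Y f
  proof -
    obtain f' where f': "f' \<in> Hom C Y (Dom C t)" "t \<cdot> f' = f" using lift[of Y f] Y f by auto
    have "\<phi> \<cdot> f = (\<phi> \<cdot> t) \<cdot> f'" using tt t HomD[OF f'(1)] f'(2) by simp
    also have "\<dots> = Zer C Y (Dom C p')" unfolding comp_zero[OF tr] using pt tt HomD[OF f'(1)] by simp
    finally show ?thesis .
  qed
  moreover have "Dom C p' \<in> N"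
    using tri_subD(7)[OF localizingD[OF N] tr] t p(2) pt by simp
  moreover have "\<phi> \<in> Hom C ?Z (Dom C p')" using tt t pt by (simp add: Hom_iff)
  ultimately show ?thesis using p' pt by blast
qed

text \<open>The stages lie in \<open>Loc \<Lambda> C G\<close> and hence in \<open>M\<close>, where
  \<open>perfect_for\<close> applies, although \<open>X\<close> itself need not lie in
  \<open>M\<close>.\<close>

lemma ex_approximation:
  assumes M: "localizing \<Lambda> C M" and G: "small \<Lambda> G" "G \<subseteq> M"
    and Gs: "\<And>Y. Y \<in> G \<Longrightarrow> sh Y \<in> G" "\<And>Y. Y \<in> G \<Longrightarrow> unsh Y \<in> G"
    and Gp: "\<And>Y. Y \<in> G \<Longrightarrow> perfect_for M G Y" and X: "X \<in> Obj C"
  obtains p g h where "(p, g, h) \<in> Tri C" "Cod C p = X" "Dom C p \<in> Loc \<Lambda> C G" "Cod C g \<in> orth G"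
proof -
  let ?N = "Loc \<Lambda> C G"
  have Go: "G \<subseteq> Obj C" using G(2) tri_subD(1)[OF localizingD[OF M]] by blast
  note N = Loc_localizing[OF Go] and GN = Loc_superset[of G]
  have NM: "?N \<subseteq> M" by (rule Loc_least[OF M G(2)])
  \<comment> \<open>The stage number enters \<open>?A\<close> only to attach the surjectivity
    requirement to stage \<open>0\<close>; every later stage just has to be compatible with its
    predecessor through \<open>?B\<close>.\<close>
  let ?A = "\<lambda>(n::nat) p. p \<in> Arr C \<and> Cod C p = X \<and> Dom C p \<in> ?N \<and>
    (n = 0 \<longrightarrow> (\<forall>Y\<in>G. \<forall>f\<in>Hom C Y X. \<exists>f'\<in>Hom C Y (Dom C p). p \<cdot> f' = f))"
  let ?B = "\<lambda>(n::nat) p p'. \<exists>\<phi>. \<phi> \<in> Hom C (Dom C p) (Dom C p') \<and> p' \<cdot> \<phi> = p \<and>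
    (\<forall>Y\<in>G. \<forall>f\<in>Hom C Y (Dom C p). p \<cdot> f = Zer C Y X \<longrightarrow> \<phi> \<cdot> f = Zer C Y (Dom C p'))"
  have "\<exists>\<pi>. \<forall>n. ?A n (\<pi> n) \<and> ?B n (\<pi> n) (\<pi> (Suc n))"
  proof (rule dependent_nat_choice)
    obtain t where "t \<in> Arr C" "Cod C t = X" "Dom C t \<in> ?N"
      "\<And>Y f. (Y, f) \<in> (SIGMA Y:G. Hom C Y X) \<Longrightarrow> \<exists>f'\<in>Hom C Y (Dom C t). t \<cdot> f' = f"
      by (rule ex_cover[OF N G(1) GN X subset_refl]) blast
    then show "\<exists>p. ?A 0 p" by blast
  next
    fix p n assume p: "?A n p"
    then show "\<exists>p'. ?A (Suc n) p' \<and> ?B n p p'"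
      using ex_tower_step[OF N G(1) GN, of p] by auto
  qed
  then obtain \<pi> where \<pi>B: "\<forall>n. ?A n (\<pi> n) \<and> ?B n (\<pi> n) (\<pi> (Suc n))" by (rule exE)
  have \<pi>: "?A n (\<pi> n)" and B: "?B n (\<pi> n) (\<pi> (Suc n))" for n using spec[OF \<pi>B, of n] by (rule conjunct1, rule conjunct2)
  obtain \<phi> where \<phi>: "\<And>n. \<phi> n \<in> Hom C (Dom C (\<pi> n)) (Dom C (\<pi> (Suc n)))" "\<And>n. \<pi> (Suc n) \<cdot> \<phi> n = \<pi> n"
    "\<And>n Y f. Y \<in> G \<Longrightarrow> f \<in> Hom C Y (Dom C (\<pi> n)) \<Longrightarrow> \<pi> n \<cdot> f = Zer C Y X \<Longrightarrow>
      \<phi> n \<cdot> f = Zer C Y (Dom C (\<pi> (Suc n)))"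
  proof -
    from B have "\<forall>n. \<exists>\<phi>. \<phi> \<in> Hom C (Dom C (\<pi> n)) (Dom C (\<pi> (Suc n))) \<and> \<pi> (Suc n) \<cdot> \<phi> = \<pi> n \<and>
      (\<forall>Y\<in>G. \<forall>f\<in>Hom C Y (Dom C (\<pi> n)). \<pi> n \<cdot> f = Zer C Y X \<longrightarrow> \<phi> \<cdot> f = Zer C Y (Dom C (\<pi> (Suc n))))"
      by (rule allI)
    from choice[OF this] obtain \<phi> where "\<forall>n. \<phi> n \<in> Hom C (Dom C (\<pi> n)) (Dom C (\<pi> (Suc n))) \<and> \<pi> (Suc n) \<cdot> \<phi> n = \<pi> n \<and>
      (\<forall>Y\<in>G. \<forall>f\<in>Hom C Y (Dom C (\<pi> n)). \<pi> n \<cdot> f = Zer C Y X \<longrightarrow> \<phi> n \<cdot> f = Zer C Y (Dom C (\<pi> (Suc n))))"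
      by (rule exE)
    then show ?thesis by (intro that[of \<phi>]) simp_all
  qed
  let ?\<Gamma> = "\<lambda>n. Dom C (\<pi> n)"
  have GO: "?\<Gamma> n \<in> Obj C" for n using \<pi>[of n] by simp
  obtain P \<iota> where P: "is_coproduct C (UNIV :: nat set) ?\<Gamma> P \<iota>"
    by (rule ex_coproduct[OF small_nat[OF universe], of ?\<Gamma>]) (use GO in auto)
  interpret tower C \<Lambda> M G X ?\<Gamma> \<pi> \<phi> P \<iota>
  proof
    show "?\<Gamma> i \<in> M" for i using \<pi>[of i] NM by blast
    show "\<pi> i \<in> Hom C (?\<Gamma> i) X" for i using \<pi>[of i] by (simp add: Hom_iff)
    show "\<exists>f'\<in>Hom C Y (?\<Gamma> 0). \<pi> 0 \<cdot> f' = f" if "Y \<in> G" "f \<in> Hom C Y X" for Y f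
      using \<pi>[of 0] that by simp
  qed (fact M G(2) Gs Gp \<phi> P)+
  obtain H p where p: "p \<in> Hom C H X" and HN: "\<And>A. localizing \<Lambda> C A \<Longrightarrow> range ?\<Gamma> \<subseteq> A \<Longrightarrow> H \<in> A"
    and surj: "\<And>Y f. Y \<in> G \<Longrightarrow> f \<in> Hom C Y X \<Longrightarrow> \<exists>f'\<in>Hom C Y H. p \<cdot> f' = f"
    and inj: "\<And>Y f. Y \<in> G \<Longrightarrow> f \<in> Hom C Y H \<Longrightarrow> p \<cdot> f = Zer C Y X \<Longrightarrow> f = Zer C Y H"
    by (rule hocolim) blast
  note pt = HomD[OF p]
  obtain g h where t: "(p, g, h) \<in> Tri C" using Tri_complete[OF pt(1)] by blast
  note tt = Tri_typing[OF t]
  have gH: "g \<in> Hom C X (Cod C g)" and hH: "h \<in> Hom C (Cod C g) (sh H)"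
    using tt pt by (auto simp: Hom_iff)
  \<comment> \<open>Long exact sequence: injectivity at \<open>unsh Y\<close> makes the boundary of
    \<open>f\<close> vanish, so \<open>f\<close> comes from \<open>X\<close>; surjectivity at
    \<open>Y\<close> then factors \<open>f\<close> through \<open>g \<cdot> p = 0\<close>.\<close>
  have "Cod C g \<in> orth G"
  proof (rule orthI[OF Go])
    fix Y f assume Y: "Y \<in> G" and f: "f \<in> Hom C Y (Cod C g)"
    note ft = HomD[OF f] and Yo = subsetD[OF Go Y]
    have "h \<cdot> f \<in> Hom C (sh (unsh Y)) (sh H)" using Cmp_in_Hom[OF f hH] Yo by simp
    then obtain d where d: "d \<in> Hom C (unsh Y) H" "shm d = h \<cdot> f"
      using shm_surj Yo pt(4) by (metis unsh(1))
    note dt = HomD[OF d(1)]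
    have "shm (p \<cdot> d) = (shm p \<cdot> h) \<cdot> f" using pt dt tt ft d(2) by simp
    also have "\<dots> = shm (Zer C (unsh Y) X)" unfolding comp_zero3[OF t] using pt ft Yo X by simp
    finally have "p \<cdot> d = Zer C (unsh Y) X" by (rule shm_inj[rotated 2]) (use pt dt X in auto)
    then have "d = Zer C (unsh Y) H" by (rule inj[OF Gs(2)[OF Y] d(1)])
    then have "h \<cdot> f = Zer C Y (sh H)" using d(2) Yo pt by auto
    then obtain k where k: "k \<in> Hom C Y X" "g \<cdot> k = f" using tri_lift2[OF t f] pt by auto
    obtain k' where k': "k' \<in> Hom C Y H" "p \<cdot> k' = k" using surj[OF Y k(1)] by blast
    have "f = (g \<cdot> p) \<cdot> k'" using k(2) k'(2) HomD[OF k'(1)] pt tt by simp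
    then show "f = Zer C Y (Cod C g)" unfolding comp_zero[OF t] using HomD[OF k'(1)] pt tt by simp
  qed (use tt in auto)
  moreover have "H \<in> ?N"
  proof (rule HN[OF N], rule image_subsetI)
    show "?\<Gamma> n \<in> ?N" for n using \<pi>[of n] by (elim conjE)
  qed
  ultimately show ?thesis using that[OF t] pt by simp
qed

section \<open>From well generation to perfect generation\<close>

lemma full_subcategory_coproduct:
  assumes M: "M \<subseteq> Obj C" and P: "is_coproduct C I X P \<iota>" "P \<in> M" and X: "\<And>i. i \<in> I \<Longrightarrow> X i \<in> M"
  shows "is_coproduct (full_subcategory C M) I X P \<iota>"
  using P X M unfolding is_coproduct_def full_subcategory_simps
  by (simp add: full_subcategory_Hom subset_iff)

text \<open>Well generation is given with coproducts of the full subcategory and index sets in the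
  type of \<open>\<Lambda>\<close>; \<open>perfect_for\<close> wants coproducts of \<open>C\<close>
  indexed by the natural numbers. Since \<open>M\<close> is closed under small coproducts of
  \<open>C\<close>, these are coproducts in the subcategory too.\<close>

lemma well_generated_perfect:
  assumes M: "localizing \<Lambda> C M" and wg: "well_generated \<Lambda> (full_subcategory C M)"
  obtains G where "small \<Lambda> G" "G \<subseteq> M" "\<And>X. X \<in> M \<Longrightarrow> X \<in> orth G \<Longrightarrow> is_zero C X"
    "\<And>Y. Y \<in> G \<Longrightarrow> perfect_for M G Y"
proof -
  let ?E = "full_subcategory C M"
  have Mo: "M \<subseteq> Obj C" by (rule tri_subD(1)[OF localizingD[OF M]])
  obtain G where G: "small \<Lambda> G" "G \<subseteq> M"
    and gen: "\<forall>X\<in>M. (\<forall>Y\<in>G. Hom ?E Y X = {Zer C Y X}) \<longrightarrow> is_zero ?E X"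
    and perfect: "\<forall>Y\<in>G. \<forall>(I :: 'u set) X P \<iota> f.
           small \<Lambda> I \<and> is_coproduct ?E I X P \<iota> \<and> f \<in> Hom ?E Y P \<longrightarrow>
           (\<exists>Y' f' P' \<iota>' g h.
              (\<forall>i\<in>I. Y' i \<in> G \<and> f' i \<in> Hom ?E (Y' i) (X i)) \<and> is_coproduct ?E I Y' P' \<iota>' \<and>
              h \<in> Hom ?E P' P \<and> (\<forall>i\<in>I. h \<cdot> \<iota>' i = \<iota> i \<cdot> f' i) \<and>
              g \<in> Hom ?E Y P' \<and> f = h \<cdot> g)"
    using wg unfolding well_generated_def card_well_generated_def full_subcategory_simps by blast
  show ?thesis
  proof (rule that[OF G])
    fix X assume X: "X \<in> M" "X \<in> orth G"
    have "\<forall>Y\<in>G. Hom ?E Y X = {Zer C Y X}"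
      using X G(2) by (auto simp: orth_def full_subcategory_Hom)
    then have z: "is_zero ?E X" using gen X(1) by blast
    \<comment> \<open>A zero object of the subcategory is zero in \<open>C\<close>: its endomorphism
      being unique, the identity equals zero.\<close>
    then have "\<exists>!f. f \<in> Hom C X X" using X(1) by (auto simp: is_zero_def full_subcategory_simps full_subcategory_Hom)
    then show "is_zero C X" using Idn_in_Hom Zer_in_Hom X(1) Mo by (auto simp: is_zero_iff)
  next
    fix Y assume Y: "Y \<in> G"
    have YM: "Y \<in> M" using Y G(2) by blast
    show "perfect_for M G Y"
      unfolding perfect_for_def
    proof (intro allI impI)
      fix X :: "nat \<Rightarrow> 'o" and P \<iota> f
      assume "range X \<subseteq> M \<and> is_coproduct C UNIV X P \<iota> \<and> f \<in> Hom C Y P"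
      then have X: "\<And>i. X i \<in> M" and P: "is_coproduct C UNIV X P \<iota>" and f: "f \<in> Hom C Y P" by auto
      have PM: "P \<in> M" by (rule localizing_coproduct[OF M small_nat[OF universe] X P])
      obtain e :: "nat \<Rightarrow> 'u" where e: "inj_on e UNIV" by (rule small_embedding[OF universe small_nat[OF universe]])
      let ?I = "range e" and ?j = "inv_into UNIV e"
      have je: "?j (e i) = i" for i using e by simp
      have I: "small \<Lambda> ?I" by (rule small_image[OF small_nat[OF universe]])
      have "is_coproduct C ?I (\<lambda>i. X (?j i)) P (\<lambda>i. \<iota> (?j i))"
        by (rule is_coproduct_reindex[OF P]) (simp add: bij_betw_inv_into e inj_on_imp_bij_betw)
      then have PE: "is_coproduct ?E ?I (\<lambda>i. X (?j i)) P (\<lambda>i. \<iota> (?j i))"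
        by (rule full_subcategory_coproduct[OF Mo]) (use PM X in auto)
      have "f \<in> Hom ?E Y P" using f YM PM by (simp add: full_subcategory_Hom)
      with perfect Y I PE obtain Y' f' P' \<iota>' g h where
        1: "\<forall>i\<in>?I. Y' i \<in> G \<and> f' i \<in> Hom ?E (Y' i) (X (?j i))" and P': "is_coproduct ?E ?I Y' P' \<iota>'"
        and h: "h \<in> Hom ?E P' P" "\<forall>i\<in>?I. h \<cdot> \<iota>' i = \<iota> (?j i) \<cdot> f' i"
        and g: "g \<in> Hom ?E Y P'" "f = h \<cdot> g"
        by blast
      have Y'M: "Y' i \<in> M" if "i \<in> ?I" for i using 1 G(2) that by blast
      have P'M: "P' \<in> M" using P' by (simp add: is_coproduct_def full_subcategory_simps)
      have f': "f' i \<in> Hom C (Y' i) (X (?j i))" if "i \<in> ?I" for i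
      proof -
        have "f' i \<in> Hom ?E (Y' i) (X (?j i))" using 1 that by blast
        then show ?thesis by (simp only: full_subcategory_Hom[OF Y'M[OF that] X])
      qed
      have \<iota>': "\<iota>' i \<in> Hom C (Y' i) P'" if "i \<in> ?I" for i
      proof -
        have "\<iota>' i \<in> Hom ?E (Y' i) P'" using P' that unfolding is_coproduct_def by blast
        then show ?thesis by (simp only: full_subcategory_Hom[OF Y'M[OF that] P'M])
      qed
      have hC: "h \<in> Hom C P' P" and gC: "g \<in> Hom C Y P'"
        using h(1) g(1) P'M PM YM by (simp_all add: full_subcategory_Hom)
      \<comment> \<open>The coproduct \<open>P'\<close> is known as such only inside the
        subcategory. It suffices to factor \<open>h\<close> as \<open>b \<cdot> a\<close> through a
        coproduct \<open>R\<close> formed in \<open>C\<close>.\<close>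
      obtain R \<mu> where R: "is_coproduct C ?I Y' R \<mu>"
        by (rule ex_coproduct[OF I, of Y']) (use Y'M Mo in blast)+
      note Rd = is_coproductD[OF R]
      have RM: "R \<in> M" by (rule localizing_coproduct[OF M I _ R]) (rule Y'M)
      have RE: "is_coproduct ?E ?I Y' R \<mu>" by (rule full_subcategory_coproduct[OF Mo R RM Y'M])
      have extE: "\<exists>!k. k \<in> Hom ?E P' Z \<and> (\<forall>i\<in>?I. k \<cdot> \<iota>' i = k' i)"
        if Z: "Z \<in> M" and k': "\<And>i. i \<in> ?I \<Longrightarrow> k' i \<in> Hom C (Y' i) Z" for Z k'
      proof -
        have "\<forall>i\<in>?I. k' i \<in> Hom ?E (Y' i) Z"
        proof
          fix i assume "i \<in> ?I"
          then show "k' i \<in> Hom ?E (Y' i) Z" using k' by (simp only: full_subcategory_Hom[OF Y'M Z])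
        qed
        with P' Z show ?thesis unfolding is_coproduct_def full_subcategory_simps by blast
      qed
      obtain a where a: "a \<in> Hom C P' R" "\<And>i. i \<in> ?I \<Longrightarrow> a \<cdot> \<iota>' i = \<mu> i"
      proof -
        obtain a where "a \<in> Hom ?E P' R" "\<forall>i\<in>?I. a \<cdot> \<iota>' i = \<mu> i"
          using extE[OF RM, of \<mu>] Rd(3) by blast
        then show ?thesis using that by (simp only: full_subcategory_Hom[OF P'M RM])
      qed
      have comp: "\<iota> (?j i) \<cdot> f' i \<in> Hom C (Y' i) P" if "i \<in> ?I" for i
        using Cmp_in_Hom[OF f'[OF that] is_coproductD(3)[OF P UNIV_I]] .
      obtain b where b: "b \<in> Hom C R P" "\<And>i. i \<in> ?I \<Longrightarrow> b \<cdot> \<mu> i = \<iota> (?j i) \<cdot> f' i"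
        by (rule coproduct_copair[OF R is_coproductD(1)[OF P], of "\<lambda>i. \<iota> (?j i) \<cdot> f' i"]) (use comp in auto)
      have ba: "b \<cdot> a = h"
      proof -
        have "(b \<cdot> a) \<cdot> \<iota>' i = \<iota> (?j i) \<cdot> f' i" if "i \<in> ?I" for i
          using HomD[OF a(1)] HomD[OF b(1)] HomD[OF \<iota>'[OF that]] a(2)[OF that] b(2)[OF that] by simp
        moreover have "b \<cdot> a \<in> Hom ?E P' P" using Cmp_in_Hom[OF a(1) b(1)] P'M PM by (simp add: full_subcategory_Hom)
        ultimately show ?thesis using extE[OF PM, of "\<lambda>i. \<iota> (?j i) \<cdot> f' i"] comp h by blast
      qed
      show "\<exists>Y' f' P' \<iota>' g h. (\<forall>i. Y' i \<in> G \<and> f' i \<in> Hom C (Y' i) (X i)) \<and>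
        is_coproduct C UNIV Y' P' \<iota>' \<and> h \<in> Hom C P' P \<and> (\<forall>i. h \<cdot> \<iota>' i = \<iota> i \<cdot> f' i) \<and>
        g \<in> Hom C Y P' \<and> f = h \<cdot> g"
      proof (intro exI conjI allI)
        show "Y' (e i) \<in> G" for i using 1 by blast
        show "f' (e i) \<in> Hom C (Y' (e i)) (X i)" for i using f'[of "e i"] je by simp
        show "is_coproduct C UNIV (\<lambda>i. Y' (e i)) R (\<lambda>i. \<mu> (e i))"
          by (rule is_coproduct_reindex[OF R]) (simp add: e inj_on_imp_bij_betw)
        show "b \<cdot> \<mu> (e i) = \<iota> i \<cdot> f' (e i)" for i using b(2)[of "e i"] je by simp
        show "f = b \<cdot> (a \<cdot> g)"
          using HomD[OF a(1)] HomD[OF b(1)] HomD[OF gC] g(2) by (simp add: Cmp_reassoc[OF ba])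
      qed (fact b(1) Cmp_in_Hom[OF gC a(1)])+
    qed
  qed
qed

lemma small_shifts:
  assumes "small \<Lambda> G"
  shows "small \<Lambda> (shifts G)"
proof -
  \<comment> \<open>Every integer is a difference of two natural numbers, so smallness passes from
    pairs of naturals to the shift exponents.\<close>
  have "small \<Lambda> ((\<lambda>(a, b). int a - int b) ` (UNIV \<times> UNIV))"
    by (intro small_image small_Sigma[OF universe] small_nat[OF universe])
  moreover have "z \<in> (\<lambda>(a, b). int a - int b) ` (UNIV \<times> UNIV)" for z
    by (rule image_eqI[of _ _ "(nat z, nat (- z))"]) auto
  then have "(\<lambda>(a, b). int a - int b) ` (UNIV \<times> UNIV) = UNIV" by blast
  ultimately have "small \<Lambda> (UNIV :: int set)" by simp
  then have "small \<Lambda> (\<Union>n :: int. (shift_power C n) ` G)"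
    by (rule small_UNION[OF universe]) (rule small_image[OF assms])
  moreover have "shifts G = (\<Union>n :: int. (shift_power C n) ` G)" by (auto simp: shifts_def)
  ultimately show ?thesis by simp
qed

lemma well_generated_reflection:
  assumes M: "localizing \<Lambda> C M" and wg: "well_generated \<Lambda> (full_subcategory C M)" and X: "X \<in> Obj C"
  shows "\<exists>e\<in>cone_in C M. Dom C e = X \<and> Cod C e \<in> orth M"
proof -
  obtain G where G: "small \<Lambda> G" "G \<subseteq> M" and gen: "\<And>X. X \<in> M \<Longrightarrow> X \<in> orth G \<Longrightarrow> is_zero C X"
    and perfect: "\<And>Y. Y \<in> G \<Longrightarrow> perfect_for M G Y"
    using well_generated_perfect[OF M wg] by blast
  note Mt = localizingD[OF M]
  have Go: "G \<subseteq> Obj C" using G(2) tri_subD(1)[OF Mt] by blast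
  let ?G = "shifts G"
  note sc = shifts_closed[OF Go]
  have GM: "?G \<subseteq> M" by (rule shifts_subset[OF Mt G(2)])
  have perfect': "perfect_for M ?G Y" if "Y \<in> ?G" for Y by (rule perfect_for_shifts[OF Mt Go perfect that])
  note approx = ex_approximation[OF M small_shifts[OF G(1)] GM sc(3,4) perfect']
  have NM: "Loc \<Lambda> C ?G \<subseteq> M" by (rule Loc_least[OF M GM])
  note N = localizingD[OF Loc_localizing[OF sc(1)]]
  have MN: "M \<subseteq> Loc \<Lambda> C ?G"
  proof
    fix Z assume Z: "Z \<in> M"
    then have Zo: "Z \<in> Obj C" using tri_subD(1)[OF Mt] by blast
    obtain p g h where t: "(p, g, h) \<in> Tri C" "Cod C p = Z" "Dom C p \<in> Loc \<Lambda> C ?G" "Cod C g \<in> orth ?G"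
      using approx[OF _ _ _ Zo] by blast
    \<comment> \<open>For \<open>Z\<close> in \<open>M\<close> the cone stays in \<open>M\<close>,
      so it is subject to the generating property of \<open>G\<close>, which detects zero objects
      only there; orthogonality to \<open>G\<close> then makes it zero.\<close>
    have "Cod C g \<in> M" using tri_subD(7)[OF Mt t(1)] t(2,3) NM Z by auto
    moreover have "Cod C g \<in> orth G" using t(4) sc(2) by (auto simp: orth_def)
    ultimately have "is_zero C (Cod C g)" by (rule gen)
    then have "is_iso C (Dom C p) Z p" using is_iso_if_zero_cone[OF t(1)] t(2) by simp
    then have "isomorphic C (Dom C p) Z" by (auto simp: isomorphic_def)
    then show "Z \<in> Loc \<Lambda> C ?G" by (rule tri_subD(3)[OF N t(3)])
  qed
  \<comment> \<open>\<open>?G\<close> is closed under shifts, so its right orthogonal agrees with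
    that of the localizing subcategory it generates, which contains \<open>M\<close>.\<close>
  have orthM: "orth ?G \<subseteq> orth M"
  proof -
    have "shifts ?G = ?G" using shifts_closed(2)[OF sc(1)]
      by (auto elim!: shifts_induct[OF _ sc(1)] intro: sc(3,4))
    then have "orth ?G = orth (Loc \<Lambda> C ?G)" using orth_Loc[OF sc(1)] by simp
    then show ?thesis using MN by (auto simp: orth_def)
  qed
  obtain p g h where t: "(p, g, h) \<in> Tri C" "Cod C p = X" "Dom C p \<in> Loc \<Lambda> C ?G" "Cod C g \<in> orth ?G"
    using approx[OF _ _ _ X] by blast
  note tt = Tri_typing[OF t(1)]
  \<comment> \<open>By rotation the cone of \<open>g\<close> is the shift of the approximating
    object, hence in \<open>M\<close>; so \<open>g\<close> is the reflection.\<close>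
  have "Cod C h \<in> M" using tri_subD(4)[OF Mt, of "Dom C p"] t(3) NM tt by auto
  then have "g \<in> cone_in C M" using rotate[OF t(1)] by (auto simp: cone_in_def)
  then show ?thesis using t tt orthM by auto
qed

end

text \<open>Any choice of reflections is functorial: the action on \<open>f\<close> is the unique
  extension of \<open>\<eta> (Cod C f) \<cdot> f\<close> along \<open>\<eta> (Dom C f)\<close>, and
  uniqueness yields the functor laws.\<close>

lemma (in triangulated_category) bousfield_if_reflection:
  assumes A: "triangulated_subcategory C A"
    and ex: "\<And>X. X \<in> Obj C \<Longrightarrow> \<exists>e\<in>cone_in C A. Dom C e = X \<and> Cod C e \<in> orth A"
  shows "\<exists>L \<eta>. bousfield C A L \<eta>"
proof -
  obtain \<eta> where \<eta>: "\<And>X. X \<in> Obj C \<Longrightarrow> \<eta> X \<in> cone_in C A \<and> Dom C (\<eta> X) = X \<and> Cod C (\<eta> X) \<in> orth A"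
    using ex by metis
  let ?L = "\<lambda>X. Cod C (\<eta> X)"
  have ty: "\<eta> X \<in> Arr C" "Dom C (\<eta> X) = X" if "X \<in> Obj C" for X using \<eta>[OF that] cone_in_Arr by auto
  have "\<exists>k. k \<in> Hom C (?L (Dom C f)) (?L (Cod C f)) \<and> k \<cdot> \<eta> (Dom C f) = \<eta> (Cod C f) \<cdot> f" if f: "f \<in> Arr C" for f
  proof -
    have o: "Dom C f \<in> Obj C" "Cod C f \<in> Obj C" using f by auto
    have "\<eta> (Cod C f) \<cdot> f \<in> Hom C (Dom C (\<eta> (Dom C f))) (?L (Cod C f))"
      using ty[OF o(1)] ty[OF o(2)] f by (simp add: Hom_iff)
    then obtain k where "k \<in> Hom C (?L (Dom C f)) (?L (Cod C f))" "k \<cdot> \<eta> (Dom C f) = \<eta> (Cod C f) \<cdot> f"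
      using cone_ext[OF A, of "\<eta> (Dom C f)" "?L (Cod C f)"] \<eta>[OF o(1)] \<eta>[OF o(2)] by metis
    then show ?thesis by blast
  qed
  then obtain l where l: "\<And>f. f \<in> Arr C \<Longrightarrow> l f \<in> Hom C (?L (Dom C f)) (?L (Cod C f))"
    "\<And>f. f \<in> Arr C \<Longrightarrow> l f \<cdot> \<eta> (Dom C f) = \<eta> (Cod C f) \<cdot> f" by metis
  have uniq: "k = k'" if "X \<in> Obj C" "Y \<in> Obj C" "k \<in> Hom C (?L X) (?L Y)" "k' \<in> Hom C (?L X) (?L Y)"
    "k \<cdot> \<eta> X = k' \<cdot> \<eta> X" for X Y k k'
    using cone_ext_unique[of "\<eta> X" A "?L Y" k k'] \<eta>[OF that(1)] \<eta>[OF that(2)] that by blast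
  let ?F = "\<lparr>OMap = ?L, AMap = l\<rparr>"
  have F: "is_functor C C ?F"
    unfolding is_functor_def
  proof (intro conjI ballI impI category_axioms, unfold functr.simps)
    fix X assume X: "X \<in> Obj C"
    note t = ty[OF X]
    show "?L X \<in> Obj C" using t by simp
    show "l (Idn C X) = Idn C (?L X)"
      by (rule uniq[OF X X]) (use t X l(1)[of "Idn C X"] l(2)[of "Idn C X"] in \<open>auto intro: Idn_in_Hom\<close>)
  next
    fix f assume "f \<in> Arr C"
    then show "l f \<in> Hom C (?L (Dom C f)) (?L (Cod C f))" by (rule l(1))
  next
    fix f g assume f: "f \<in> Arr C" and g: "g \<in> Arr C" and e: "Cod C f = Dom C g"
    have o: "Dom C f \<in> Obj C" "Dom C g \<in> Obj C" "Cod C g \<in> Obj C" using f g by auto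
    have lf: "l f \<in> Hom C (?L (Dom C f)) (?L (Dom C g))" using l(1)[OF f] e by simp
    have ef: "l f \<cdot> \<eta> (Dom C f) = \<eta> (Dom C g) \<cdot> f" using l(2)[OF f] e by simp
    show "l (g \<cdot> f) = l g \<cdot> l f"
    proof (rule uniq[OF o(1,3)])
      show "l (g \<cdot> f) \<in> Hom C (?L (Dom C f)) (?L (Cod C g))" using l(1)[of "g \<cdot> f"] f g e by simp
      show "l g \<cdot> l f \<in> Hom C (?L (Dom C f)) (?L (Cod C g))" by (rule Cmp_in_Hom[OF lf l(1)[OF g]])
      note tt = ty[OF o(1)] ty[OF o(2)] ty[OF o(3)] HomD[OF lf] HomD[OF l(1)[OF g]]
      have "(l g \<cdot> l f) \<cdot> \<eta> (Dom C f) = (l g \<cdot> \<eta> (Dom C g)) \<cdot> f" using tt f g e by (simp add: ef)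
      also have "\<dots> = \<eta> (Cod C g) \<cdot> (g \<cdot> f)" using tt f g e by (simp add: l(2)[OF g])
      also have "\<dots> = l (g \<cdot> f) \<cdot> \<eta> (Dom C f)" using l(2)[of "g \<cdot> f"] f g e by simp
      finally show "l (g \<cdot> f) \<cdot> \<eta> (Dom C f) = (l g \<cdot> l f) \<cdot> \<eta> (Dom C f)" by simp
    qed
  qed
  have "bousfield C A ?F \<eta>"
  proof unfold_locales
    show "nat_trans C C id_functor ?F \<eta>"
      unfolding nat_trans_def using l(2) ty by (auto simp: id_functor_def Hom_iff)
  qed (use A F \<eta> in auto)
  then show ?thesis by blast
qed

text \<open>Image and equivalence are asserted for every localization functor with this kernel, so
  they depend on no choice. The comparison in the triangle equivalence consists of identities
  because the composite commutes strictly with the shifts.\<close>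

theorem proposition3p6:
  fixes \<Lambda> :: "'u rel" and T :: "('o, 'm) tri_cat" and S :: "'o set"
  assumes "universe \<Lambda>"
    and "locally_well_generated \<Lambda> T"
    and "S \<subseteq> Obj T" and "small \<Lambda> S"
  shows "(\<exists>L. localization_functor T L \<and> Ker T L = Loc \<Lambda> T S) \<and>
    (\<forall>L. localization_functor T L \<and> Ker T L = Loc \<Lambda> T S \<longrightarrow>
       Im T L = {X \<in> Obj T. \<forall>Y\<in>S. \<forall>n :: int. 
         Hom T (shift_power T n Y) X = {Zer T (shift_power T n Y) X}} \<and>
       triangle_equivalence (full_subcategory T (Im T L)) (verdier_quotient T (Loc \<Lambda> T S))
         (comp_functor (verdier_functor T (Loc \<Lambda> T S)) inclusion_functor)
         (\<lambda>X. Idn (verdier_quotient T (Loc \<Lambda> T S)) (OMap (Shift T) X))) \<and>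
    locally_small \<Lambda> (verdier_quotient T (Loc \<Lambda> T S))"
proof -
  have ct: "coproduct_triangulated \<Lambda> T" using assms(2) by (simp add: locally_well_generated_def)
  then interpret coproduct_triangulated_category T \<Lambda>
    by (intro coproduct_triangulated_category.intro coproduct_triangulated_category_axioms.intro)
      (use assms(1) in \<open>auto simp: coproduct_triangulated_def\<close>)
  let ?A = "Loc \<Lambda> T S"
  note A = Loc_localizing[OF assms(3)]
  have wg: "well_generated \<Lambda> (full_subcategory T ?A)"
    using assms(2-4) by (simp add: locally_well_generated_def)
  obtain L \<eta> where "bousfield T ?A L \<eta>"
    using bousfield_if_reflection[OF localizingD[OF A] well_generated_reflection[OF A wg]] by blast
  then interpret L: bousfield T ?A L \<eta> .
  have 1: "localization_functor T L \<and> Ker T L = ?A"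
    using L.L_localization_functor L.Ker_eq by blast
  have orthS: "orth ?A = {X \<in> Obj T. \<forall>Y\<in>S. \<forall>n :: int. 
         Hom T (shift_power T n Y) X = {Zer T (shift_power T n Y) X}}"
    unfolding orth_Loc[OF assms(3)] by (auto simp: orth_def shifts_def)
  have 2: "Im T L' = {X \<in> Obj T. \<forall>Y\<in>S. \<forall>n :: int. 
         Hom T (shift_power T n Y) X = {Zer T (shift_power T n Y) X}} \<and>
       triangle_equivalence (full_subcategory T (Im T L')) (verdier_quotient T ?A)
         (comp_functor (verdier_functor T ?A) inclusion_functor)
         (\<lambda>X. Idn (verdier_quotient T ?A) (OMap (Shift T) X))"
    if L': "localization_functor T L'" "Ker T L' = ?A" for L'
  proof -
    \<comment> \<open>The unit that comes with \<open>L'\<close> is enough to rerun the whole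
      analysis of the quotient with \<open>L'\<close> in place of the constructed functor.\<close>
    obtain \<eta>' where "bousfield T ?A L' \<eta>'"
      using localization_functor_bousfield[OF L'(1)] localizingD[OF A] L'(2) by auto
    then interpret L': bousfield T ?A L' \<eta>' .
    show ?thesis
      unfolding L'.Im_eq orthS[symmetric] using L'.F_triangle_equivalence by blast
  qed
  show ?thesis
    using 1 2 L.V_locally_small[OF locally_small] by blast
qed

end
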